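(* The assignment $(R;x)\mapsto G(R;x)$, where $G(R;x)$ is equipped with its $p$-basis $x_\infty$, is a functor $$G:\mathrm{Ring}^{p\text{-gens}}\to\mathrm{RegRing}^{p\text{-basis}}$$ which is right adjoint to the inclusion $\iota:\mathrm{RegRing}^{p\text{-basis}}\subseteq\mathrm{Ring}^{p\text{-gens}}$. The unit of adjunction $\epsilon:\mathrm{id}\to G\circ\iota$ is an isomorphism and the counit $\delta:\iota\circ G\to\mathrm{id}$ is a surjection. In particular, $G$ is essentially surjective.
   Context: Fix a prime $p$; rings are commutative of characteristic $p$. $R^p\subseteq R$ is the image of Frobenius; $R$ is $F$-finite if Frobenius is finite. A finite tuple $x=(x_1,\dots,x_n)$ in $R$ is a tuple of $p$-generators if $R=R^p[x_1,\dots,x_n]$; it is a $p$-basis if in addition the monomials $x_1^{b_1}\cdots x_n^{b_n}$, $0\le b_i\le p-1$, are linearly independent over $R^p$. $\mathrm{Ring}^{p\text{-gens}}$ is the category of pairs $(R;x)$ with $R$ an $F$-finite Noetherian ring and $x$ a finite tuple of $p$-generators of $R$. A morphism $\phi:(R;x)\to(S;y)$ is a ring map $\phi:R\to S$ together with a map of tuples $\phi':x\to y$ (a map of index sets; entries may be repeated) such that $\phi'(x_i)$ coincides with $\phi(x_i)$ as elements of $S$. $\mathrm{RegRing}^{p\text{-basis}}$ is the full subcategory of pairs $(R;x)$ with $R$ regular and $x$ a $p$-basis of $R$. Gabber's construction: given $(R;x)$, put $R_0=R$, $x^{(0)}=x$, and inductively $R_{i}=R_{i-1}[X_1,\dots,X_n]/(X_j^p-x_j^{(i-1)})_{j}$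 with $x_j^{(i)}$ the class of $X_j$, and $\phi:R_i\to R_{i-1}$ the surjection with $r\mapsto r^p$ for $r\in R_{i-1}$ and $X_j\mapsto x_j^{(i-1)}$. Then $G(R;x):=\varprojlim_\phi R_i$, with the tuple $x_\infty$ given by the compatible system $(x^{(i)})_i$, which is in bijection with $x$. The projection $\phi_0:G(R;x)\to R_0=R$ gives the counit. *)

theory Defs
  imports
    "HOL-Algebra.Indexed_Polynomials"
    "HOL-Algebra.Generated_Rings"
    "HOL-Library.Extended_Nat"
    "HOL-Computational_Algebra.Primes"
begin

section \<open>Categories, functors, adjunctions\<close>

text \<open>Categories are given by their hom-sets. A hom-set need not determine its domain and
  codomain, so composition and functors on morphisms take the objects involved as arguments.\<close>

record ('o, 'm) cat =
  Obj :: "'o set"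
  Hom :: "'o \<Rightarrow> 'o \<Rightarrow> 'm set"
  Ident :: "'o \<Rightarrow> 'm"
  Comp :: "'o \<Rightarrow> 'o \<Rightarrow> 'o \<Rightarrow> 'm \<Rightarrow> 'm \<Rightarrow> 'm"

locale category =
  fixes C :: "('o, 'm) cat"
  assumes ident_hom: "a \<in> Obj C \<Longrightarrow> Ident C a \<in> Hom C a a"
    and comp_hom: "\<lbrakk>a \<in> Obj C; b \<in> Obj C; c \<in> Obj C; f \<in> Hom C a b; g \<in> Hom C b c\<rbrakk>
      \<Longrightarrow> Comp C a b c g f \<in> Hom C a c"
    and comp_ident_right: "\<lbrakk>a \<in> Obj C; b \<in> Obj C; f \<in> Hom C a b\<rbrakk>
      \<Longrightarrow> Comp C a a b f (Ident C a) = f"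
    and comp_ident_left: "\<lbrakk>a \<in> Obj C; b \<in> Obj C; f \<in> Hom C a b\<rbrakk>
      \<Longrightarrow> Comp C a b b (Ident C b) f = f"
    and comp_assoc: "\<lbrakk>a \<in> Obj C; b \<in> Obj C; c \<in> Obj C; d \<in> Obj C;
        f \<in> Hom C a b; g \<in> Hom C b c; h \<in> Hom C c d\<rbrakk>
      \<Longrightarrow> Comp C a b d (Comp C b c d h g) f = Comp C a c d h (Comp C a b c g f)"

definition full_subcat :: "('o, 'm) cat \<Rightarrow> ('o \<Rightarrow> bool) \<Rightarrow> ('o, 'm) cat" where
  "full_subcat C P = C\<lparr>Obj := {a \<in> Obj C. P a}\<rparr>"

definition cat_iso :: "('o, 'm) cat \<Rightarrow> 'o \<Rightarrow> 'o \<Rightarrow> 'm \<Rightarrow> bool" where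
  "cat_iso C a b f \<longleftrightarrow> f \<in> Hom C a b \<and>
     (\<exists>g \<in> Hom C b a. Comp C a b a g f = Ident C a \<and> Comp C b a b f g = Ident C b)"

record ('o, 'm, 'o2, 'm2) functr =
  fobj :: "'o \<Rightarrow> 'o2"
  fmor :: "'o \<Rightarrow> 'o \<Rightarrow> 'm \<Rightarrow> 'm2"

locale cat_functor = dom: category C + cod: category D
  for C :: "('o, 'm) cat" and D :: "('o2, 'm2) cat" +
  fixes F :: "('o, 'm, 'o2, 'm2) functr"
  assumes fobj_obj: "a \<in> Obj C \<Longrightarrow> fobj F a \<in> Obj D"
    and fmor_hom: "\<lbrakk>a \<in> Obj C; b \<in> Obj C; f \<in> Hom C a b\<rbrakk>
      \<Longrightarrow> fmor F a b f \<in> Hom D (fobj F a) (fobj F b)"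
    and fmor_ident: "a \<in> Obj C \<Longrightarrow> fmor F a a (Ident C a) = Ident D (fobj F a)"
    and fmor_comp: "\<lbrakk>a \<in> Obj C; b \<in> Obj C; c \<in> Obj C; f \<in> Hom C a b; g \<in> Hom C b c\<rbrakk>
      \<Longrightarrow> fmor F a c (Comp C a b c g f)
        = Comp D (fobj F a) (fobj F b) (fobj F c) (fmor F b c g) (fmor F a b f)"

definition id_functor :: "('o, 'm, 'o, 'm) functr" where
  "id_functor = \<lparr>fobj = (\<lambda>a. a), fmor = (\<lambda>a b f. f)\<rparr>"

definition comp_functor ::
  "('o2, 'm2, 'o3, 'm3) functr \<Rightarrow> ('o, 'm, 'o2, 'm2) functr \<Rightarrow> ('o, 'm, 'o3, 'm3) functr" where
  "comp_functor G F = \<lparr>fobj = (\<lambda>a. fobj G (fobj F a)),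
     fmor = (\<lambda>a b f. fmor G (fobj F a) (fobj F b) (fmor F a b f))\<rparr>"

locale nat_trans = dom: cat_functor C D F + cod: cat_functor C D G
  for C :: "('o, 'm) cat" and D :: "('o2, 'm2) cat"
    and F G :: "('o, 'm, 'o2, 'm2) functr" +
  fixes \<tau> :: "'o \<Rightarrow> 'm2"
  assumes component_hom: "a \<in> Obj C \<Longrightarrow> \<tau> a \<in> Hom D (fobj F a) (fobj G a)"
    and naturality: "\<lbrakk>a \<in> Obj C; b \<in> Obj C; f \<in> Hom C a b\<rbrakk>
      \<Longrightarrow> Comp D (fobj F a) (fobj F b) (fobj G b) (\<tau> b) (fmor F a b f)
        = Comp D (fobj F a) (fobj G a) (fobj G b) (fmor G a b f) (\<tau> a)"

text \<open>\<open>L : C \<rightarrow> D\<close> is left adjoint to \<open>R : D \<rightarrow> C\<close>, with unit \<open>\<epsilon>\<close> and counit \<open>\<delta>\<close>.\<close>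

locale adjunction =
  left: cat_functor C D L + right: cat_functor D C R +
  unit: nat_trans C C id_functor "comp_functor R L" \<epsilon> +
  counit: nat_trans D D "comp_functor L R" id_functor \<delta>
  for C :: "('o, 'm) cat" and D :: "('o2, 'm2) cat"
    and L :: "('o, 'm, 'o2, 'm2) functr" and R :: "('o2, 'm2, 'o, 'm) functr"
    and \<epsilon> :: "'o \<Rightarrow> 'm" and \<delta> :: "'o2 \<Rightarrow> 'm2" +
  assumes triangle_left: "c \<in> Obj C \<Longrightarrow>
      Comp D (fobj L c) (fobj L (fobj R (fobj L c))) (fobj L c)
        (\<delta> (fobj L c)) (fmor L c (fobj R (fobj L c)) (\<epsilon> c)) = Ident D (fobj L c)"
    and triangle_right: "d \<in> Obj D \<Longrightarrow>
      Comp C (fobj R d) (fobj R (fobj L (fobj R d))) (fobj R d)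
        (fmor R (fobj L (fobj R d)) d (\<delta> d)) (\<epsilon> (fobj R d)) = Ident C (fobj R d)"

definition essentially_surjective ::
  "('o, 'm) cat \<Rightarrow> ('o2, 'm2) cat \<Rightarrow> ('o, 'm, 'o2, 'm2) functr \<Rightarrow> bool" where
  "essentially_surjective C D F \<longleftrightarrow>
     (\<forall>d \<in> Obj D. \<exists>c \<in> Obj C. \<exists>f. cat_iso D (fobj F c) d f)"


section \<open>Regular rings\<close>

definition krull_dim :: "('a, 'r) ring_scheme \<Rightarrow> enat" where
  "krull_dim R = Sup {enat n | n. \<exists>P :: nat \<Rightarrow> 'a set.
     (\<forall>i\<le>n. primeideal (P i) R) \<and> (\<forall>i<n. P i \<subset> P (Suc i))}"

definition min_generators :: "('a, 'r) ring_scheme \<Rightarrow> 'a set \<Rightarrow> nat" where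
  "min_generators R I =
     (LEAST n. \<exists>S. finite S \<and> card S = n \<and> S \<subseteq> carrier R \<and> I = genideal R S)"

definition regular_local_ring :: "('a, 'r) ring_scheme \<Rightarrow> bool" where
  "regular_local_ring R \<longleftrightarrow> cring R \<and> noetherian_ring R \<and>
     (\<exists>M. maximalideal M R \<and> (\<forall>M'. maximalideal M' R \<longrightarrow> M' = M) \<and>
          enat (min_generators R M) = krull_dim R)"

text \<open>The fraction \<open>a/s\<close> as an equivalence class, and the localization at a prime \<open>P\<close>.\<close>

definition fraction :: "('a, 'r) ring_scheme \<Rightarrow> 'a set \<Rightarrow> 'a \<Rightarrow> 'a \<Rightarrow> ('a \<times> 'a) set" where
  "fraction R P a s = {(b, t). b \<in> carrier R \<and> t \<in> carrier R - P \<and>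
     (\<exists>u \<in> carrier R - P. u \<otimes>\<^bsub>R\<^esub> (a \<otimes>\<^bsub>R\<^esub> t \<ominus>\<^bsub>R\<^esub> b \<otimes>\<^bsub>R\<^esub> s) = \<zero>\<^bsub>R\<^esub>)}"

definition localization :: "('a, 'r) ring_scheme \<Rightarrow> 'a set \<Rightarrow> ('a \<times> 'a) set ring" where
  "localization R P =
    \<lparr>carrier = {fraction R P a s | a s. a \<in> carrier R \<and> s \<in> carrier R - P},
     monoid.mult = (\<lambda>A B. \<Union>(a, s)\<in>A. \<Union>(b, t)\<in>B. fraction R P (a \<otimes>\<^bsub>R\<^esub> b) (s \<otimes>\<^bsub>R\<^esub> t)),
     one = fraction R P \<one>\<^bsub>R\<^esub> \<one>\<^bsub>R\<^esub>,
     zero = fraction R P \<zero>\<^bsub>R\<^esub> \<one>\<^bsub>R\<^esub>,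
     add = (\<lambda>A B. \<Union>(a, s)\<in>A. \<Union>(b, t)\<in>B.
              fraction R P (a \<otimes>\<^bsub>R\<^esub> t \<oplus>\<^bsub>R\<^esub> b \<otimes>\<^bsub>R\<^esub> s) (s \<otimes>\<^bsub>R\<^esub> t))\<rparr>"

definition regular_ring :: "('a, 'r) ring_scheme \<Rightarrow> bool" where
  "regular_ring R \<longleftrightarrow> cring R \<and> noetherian_ring R \<and>
     (\<forall>P. primeideal P R \<longrightarrow> regular_local_ring (localization R P))"


section \<open>Rings of characteristic \<open>p\<close>, \<open>p\<close>-generators and \<open>p\<close>-bases\<close>

text \<open>Characteristic \<open>p\<close> means \<open>p \<cdot> 1 = 0\<close> (an \<open>\<F>\<^sub>p\<close>-algebra), so the zero ring is included.\<close>

definition char_p_ring :: "nat \<Rightarrow> ('a, 'r) ring_scheme \<Rightarrow> bool" where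
  "char_p_ring p R \<longleftrightarrow> cring R \<and> [p] \<cdot>\<^bsub>R\<^esub> \<one>\<^bsub>R\<^esub> = \<zero>\<^bsub>R\<^esub>"

definition frob_image :: "nat \<Rightarrow> ('a, 'r) ring_scheme \<Rightarrow> 'a set" where
  "frob_image p R = (\<lambda>r. r [^]\<^bsub>R\<^esub> p) ` carrier R"

text \<open>Frobenius is finite: \<open>R\<close> is a finitely generated module over itself via \<open>r \<mapsto> r\<^sup>p\<close>.\<close>

definition F_finite :: "nat \<Rightarrow> ('a, 'r) ring_scheme \<Rightarrow> bool" where
  "F_finite p R \<longleftrightarrow> (\<exists>B. finite B \<and> B \<subseteq> carrier R \<and>
     (\<forall>r \<in> carrier R. \<exists>a \<in> B \<rightarrow> carrier R. r = (\<Oplus>\<^bsub>R\<^esub>b\<in>B. (a b [^]\<^bsub>R\<^esub> p) \<otimes>\<^bsub>R\<^esub> b)))"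

definition p_generators :: "nat \<Rightarrow> ('a, 'r) ring_scheme \<Rightarrow> 'a list \<Rightarrow> bool" where
  "p_generators p R x \<longleftrightarrow> set x \<subseteq> carrier R \<and>
     generate_ring R (frob_image p R \<union> set x) = carrier R"

definition p_basis :: "nat \<Rightarrow> ('a, 'r) ring_scheme \<Rightarrow> 'a list \<Rightarrow> bool" where
  "p_basis p R x \<longleftrightarrow> p_generators p R x \<and>
     (let E = {..<length x} \<rightarrow>\<^sub>E {..<p} in
      \<forall>c \<in> E \<rightarrow> frob_image p R.
        (\<Oplus>\<^bsub>R\<^esub>b\<in>E. c b \<otimes>\<^bsub>R\<^esub> (\<Otimes>\<^bsub>R\<^esub>j\<in>{..<length x}. (x ! j) [^]\<^bsub>R\<^esub> b j)) = \<zero>\<^bsub>R\<^esub>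
        \<longrightarrow> (\<forall>b\<in>E. c b = \<zero>\<^bsub>R\<^esub>))"


section \<open>A universe of rings\<close>

text \<open>The categories below consist of rings whose carrier is a subset of a fixed type, which has
  to be closed under forming multivariate polynomials (with variables indexed by \<open>nat\<close>) and
  sequences for Gabber's construction to stay inside it. The type \<open>'k runiv\<close> is the free such
  closure of an arbitrary type \<open>'k\<close>. No ring is lost: by \<open>Atom_embedding\<close>, every ring on a type
  \<open>'k\<close> has an isomorphic copy with carrier in \<open>'k runiv\<close>.\<close>

datatype 'k runiv =
    Atom 'k
  | MPoly (un_MPoly: "nat multiset \<Rightarrow> 'k runiv")
  | Seq (un_Seq: "nat \<Rightarrow> 'k runiv")

lemma Atom_embedding:
  assumes "ring R"
  shows "ring (image_ring Atom R)" and "Atom \<in> ring_iso R (image_ring Atom R)"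
proof -
  have "inj_on Atom (carrier R)" by (simp add: inj_on_def)
  then show "ring (image_ring Atom R)" "Atom \<in> ring_iso R (image_ring Atom R)"
    using ring.inj_imp_image_ring_is_ring[OF assms] inj_imp_image_ring_iso
    by auto
qed

text \<open>A ring with a finite tuple. Tuples are lists, so entries may be repeated.\<close>

type_synonym 'k tring = "'k runiv ring \<times> 'k runiv list"

text \<open>A ring map together with a map of index sets.\<close>

type_synonym 'k tmor = "('k runiv \<Rightarrow> 'k runiv) \<times> (nat \<Rightarrow> nat)"

definition tuple_hom :: "'k tring \<Rightarrow> 'k tring \<Rightarrow> 'k tmor set" where
  "tuple_hom T U = {(f, \<sigma>).
     f \<in> ring_hom (fst T) (fst U) \<and> f \<in> extensional (carrier (fst T)) \<and>
     \<sigma> \<in> {..<length (snd T)} \<rightarrow>\<^sub>E {..<length (snd U)} \<and>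
     (\<forall>j<length (snd T). f (snd T ! j) = snd U ! \<sigma> j)}"

definition Ring_pgens :: "nat \<Rightarrow> ('k tring, 'k tmor) cat" where
  "Ring_pgens p =
    \<lparr>Obj = {(R, x). char_p_ring p R \<and> noetherian_ring R \<and> F_finite p R \<and> p_generators p R x},
     Hom = tuple_hom,
     Ident = (\<lambda>T. (restrict (\<lambda>r. r) (carrier (fst T)), restrict (\<lambda>j. j) {..<length (snd T)})),
     Comp = (\<lambda>T U W g f. (compose (carrier (fst T)) (fst g) (fst f),
                          compose {..<length (snd T)} (snd g) (snd f)))\<rparr>"

definition RegRing_pbasis :: "nat \<Rightarrow> ('k tring, 'k tmor) cat" where
  "RegRing_pbasis p =
     full_subcat (Ring_pgens p) (\<lambda>(R, x). regular_ring R \<and> p_basis p R x)"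

definition inclusion_functor :: "('k tring, 'k tmor, 'k tring, 'k tmor) functr" where
  "inclusion_functor = id_functor"


section \<open>Gabber's construction\<close>

text \<open>The polynomial ring \<open>R[X\<^sub>i | i \<in> I]\<close>, on the carrier of the library theory: functions
  from monomials (multisets of indices) to coefficients.\<close>

definition mpoly_ring :: "('a, 'r) ring_scheme \<Rightarrow> 'c set \<Rightarrow> ('c multiset \<Rightarrow> 'a) ring" where
  "mpoly_ring R I =
    \<lparr>carrier = ring.indexed_pset R I (carrier R),
     monoid.mult = (\<lambda>f g m. \<Oplus>\<^bsub>R\<^esub>a\<in>{a. a \<subseteq># m}. f a \<otimes>\<^bsub>R\<^esub> g (m - a)),
     one = ring.indexed_const R \<one>\<^bsub>R\<^esub>,
     zero = ring.indexed_const R \<zero>\<^bsub>R\<^esub>,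
     add = ring.indexed_padd R\<rparr>"

text \<open>Evaluation of a polynomial over \<open>R\<close> in \<open>S\<close>, with \<open>h\<close> applied to the coefficients and \<open>y j\<close>
  substituted for \<open>X\<^sub>j\<close>.\<close>

definition mpoly_eval ::
  "('a, 'r) ring_scheme \<Rightarrow> ('b, 's) ring_scheme \<Rightarrow> ('a \<Rightarrow> 'b) \<Rightarrow> ('c \<Rightarrow> 'b) \<Rightarrow>
   ('c multiset \<Rightarrow> 'a) \<Rightarrow> 'b" where
  "mpoly_eval R S h y f =
     (\<Oplus>\<^bsub>S\<^esub>m\<in>{m. f m \<noteq> \<zero>\<^bsub>R\<^esub>}. h (f m) \<otimes>\<^bsub>S\<^esub> (\<Otimes>\<^bsub>S\<^esub>j\<in>set_mset m. y j [^]\<^bsub>S\<^esub> count m j))"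

definition gabber_poly_ring :: "'k tring \<Rightarrow> (nat multiset \<Rightarrow> 'k runiv) ring" where
  "gabber_poly_ring T = mpoly_ring (fst T) {..<length (snd T)}"

definition gabber_ideal :: "nat \<Rightarrow> 'k tring \<Rightarrow> (nat multiset \<Rightarrow> 'k runiv) set" where
  "gabber_ideal p T = genideal (gabber_poly_ring T)
     {ring.indexed_var (fst T) j [^]\<^bsub>gabber_poly_ring T\<^esub> p
        \<ominus>\<^bsub>gabber_poly_ring T\<^esub> ring.indexed_const (fst T) (snd T ! j) | j. j < length (snd T)}"

text \<open>A coset of polynomials is encoded in \<open>'k runiv\<close> by a chosen member of it. Distinct cosets are
  disjoint, so that \<open>image_ring coset_code\<close> merely transports the quotient ring.\<close>

definition coset_code :: "(nat multiset \<Rightarrow> 'k runiv) set \<Rightarrow> 'k runiv" where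
  "coset_code K = MPoly (SOME f. f \<in> K)"

lemma coset_code_inj_on:
  assumes "ideal I P"
  shows "inj_on coset_code (carrier (P Quot I))"
proof (rule inj_onI)
  interpret ideal I P by fact
  fix K L
  assume KL: "K \<in> carrier (P Quot I)" "L \<in> carrier (P Quot I)" "coset_code K = coset_code L"
  have rep: "(SOME f. f \<in> A) \<in> A" if "A \<in> carrier (P Quot I)" for A
  proof -
    from that obtain a where "a \<in> carrier P" "A = I +>\<^bsub>P\<^esub> a"
      unfolding FactRing_simps by auto
    then have "a \<in> A" using a_rcos_self by blast
    then show ?thesis by (rule someI[of "\<lambda>f. f \<in> A"])
  qed
  have "(SOME f. f \<in> K) \<in> K \<inter> L"
    using rep[OF KL(1)] rep[OF KL(2)] KL(3) by (simp add: coset_code_def)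
  then show "K = L"
    using KL(1,2) a_rcos_disjoint by (auto simp: FactRing_def pairwise_def disjnt_def)
qed

definition gabber_class :: "nat \<Rightarrow> 'k tring \<Rightarrow> (nat multiset \<Rightarrow> 'k runiv) \<Rightarrow> 'k runiv" where
  "gabber_class p T f = coset_code (gabber_ideal p T +>\<^bsub>gabber_poly_ring T\<^esub> f)"

text \<open>One step, from \<open>(R\<^sub>i\<^sub>-\<^sub>1; x\<^sup>(\<^sup>i\<^sup>-\<^sup>1\<^sup>))\<close> to \<open>(R\<^sub>i; x\<^sup>(\<^sup>i\<^sup>))\<close>, and the surjection \<open>\<phi> : R\<^sub>i \<rightarrow> R\<^sub>i\<^sub>-\<^sub>1\<close>.
  The value of \<open>gabber_phi\<close> does not depend on the chosen representative.\<close>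

definition gabber_step :: "nat \<Rightarrow> 'k tring \<Rightarrow> 'k tring" where
  "gabber_step p T =
     (image_ring coset_code (gabber_poly_ring T Quot gabber_ideal p T),
      map (\<lambda>j. gabber_class p T (ring.indexed_var (fst T) j)) [0..<length (snd T)])"

definition gabber_phi :: "nat \<Rightarrow> 'k tring \<Rightarrow> 'k runiv \<Rightarrow> 'k runiv" where
  "gabber_phi p T v =
     mpoly_eval (fst T) (fst T) (\<lambda>r. r [^]\<^bsub>fst T\<^esub> p) (\<lambda>j. snd T ! j) (un_MPoly v)"

definition gabber_tower :: "nat \<Rightarrow> 'k tring \<Rightarrow> nat \<Rightarrow> 'k tring" where
  "gabber_tower p T i = (gabber_step p ^^ i) T"

definition inverse_limit :: "(nat \<Rightarrow> ('a, 'r) ring_scheme) \<Rightarrow> (nat \<Rightarrow> 'a \<Rightarrow> 'a) \<Rightarrow> (nat \<Rightarrow> 'a) ring"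
  where
  "inverse_limit A \<phi> =
    \<lparr>carrier = {s. \<forall>i. s i \<in> carrier (A i) \<and> \<phi> i (s (Suc i)) = s i},
     monoid.mult = (\<lambda>s t i. s i \<otimes>\<^bsub>A i\<^esub> t i),
     one = (\<lambda>i. \<one>\<^bsub>A i\<^esub>),
     zero = (\<lambda>i. \<zero>\<^bsub>A i\<^esub>),
     add = (\<lambda>s t i. s i \<oplus>\<^bsub>A i\<^esub> t i)\<rparr>"

definition gabber_obj :: "nat \<Rightarrow> 'k tring \<Rightarrow> 'k tring" where
  "gabber_obj p T =
     (image_ring Seq (inverse_limit (\<lambda>i. fst (gabber_tower p T i))
                                    (\<lambda>i. gabber_phi p (gabber_tower p T i))),
      map (\<lambda>j. Seq (\<lambda>i. snd (gabber_tower p T i) ! j)) [0..<length (snd T)])"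

text \<open>A morphism \<open>(f, \<sigma>)\<close> induces \<open>R\<^sub>i \<rightarrow> S\<^sub>i\<close> at each level, given on coefficients by the map
  \<open>R\<^sub>i\<^sub>-\<^sub>1 \<rightarrow> S\<^sub>i\<^sub>-\<^sub>1 \<rightarrow> S\<^sub>i\<close> and on variables by the map \<open>\<sigma>\<close> of indices.\<close>

primrec gabber_level_mor ::
  "nat \<Rightarrow> 'k tring \<Rightarrow> 'k tring \<Rightarrow> 'k tmor \<Rightarrow> nat \<Rightarrow> 'k runiv \<Rightarrow> 'k runiv" where
  "gabber_level_mor p T U F 0 = fst F"
| "gabber_level_mor p T U F (Suc i) = (\<lambda>v.
     mpoly_eval (fst (gabber_tower p T i)) (fst (gabber_tower p U (Suc i)))
       (\<lambda>r. gabber_class p (gabber_tower p U i)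
              (ring.indexed_const (fst (gabber_tower p U i)) (gabber_level_mor p T U F i r)))
       (\<lambda>j. snd (gabber_tower p U (Suc i)) ! snd F j)
       (un_MPoly v))"

definition gabber_mor :: "nat \<Rightarrow> 'k tring \<Rightarrow> 'k tring \<Rightarrow> 'k tmor \<Rightarrow> 'k tmor" where
  "gabber_mor p T U F =
     (restrict (\<lambda>v. Seq (\<lambda>i. gabber_level_mor p T U F i (un_Seq v i)))
        (carrier (fst (gabber_obj p T))),
      snd F)"

definition gabber_functor :: "nat \<Rightarrow> ('k tring, 'k tmor, 'k tring, 'k tmor) functr" where
  "gabber_functor p = \<lparr>fobj = gabber_obj p, fmor = gabber_mor p\<rparr>"

definition gabber_counit :: "nat \<Rightarrow> 'k tring \<Rightarrow> 'k tmor" where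
  "gabber_counit p T =
     (restrict (\<lambda>v. un_Seq v 0) (carrier (fst (gabber_obj p T))),
      restrict (\<lambda>j. j) {..<length (snd T)})"

end

theory Submission
  imports Defs
begin

text \<open>Each step of Gabber's tower factors Frobenius: if \<open>R'\<close> is the ring after \<open>R\<close>, then
  \<open>v\<^sup>p = inc (phi v)\<close> for the surjection \<open>phi\<close> and the inclusion \<open>inc : R \<rightarrow> R'\<close>, and \<open>R'\<close> is free
  over \<open>R\<close> on the monomials in the new variables with exponents below \<open>p\<close> (\<open>R'_span\<close>, \<open>R'_indep\<close>).
  So the coordinates of a compatible sequence, taken level by level, are again compatible sequences
  after one application of \<open>phi\<close>, and the limit \<open>G\<close> is free over itself via Frobenius on the monomials
  in the limit tuple (\<open>G_pbasis\<close>).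

  \<open>G\<close> is noetherian (\<open>G_noetherian\<close>). Let \<open>V i\<close> be the kernel of \<open>G \<rightarrow> R\<^sub>i\<close>. Taking coordinates maps
  \<open>V (i + 1)\<close> to \<open>V i\<close>, so if \<open>f\<^sub>1, \<dots>, f\<^sub>r\<close> generate \<open>V 0\<close> modulo \<open>V 1\<close>, which is possible because \<open>R\<^sub>1\<close> is
  finite over the noetherian ring \<open>R\<^sub>0\<close>, then their \<open>p\<^sup>i\<close>-th powers generate \<open>V i\<close> modulo \<open>V (i + 1)\<close>.
  By completeness \<open>V 0 = (f\<^sub>1, \<dots>, f\<^sub>r)\<close>. The \<open>f\<^sub>j\<close> are topologically nilpotent and \<open>G / V 0 = R\<^sub>0\<close> is
  noetherian, hence so is \<open>G\<close> (\<open>noetherianI\<close>).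

  \<open>G\<close> is regular because of its \<open>p\<close>-basis (\<open>imp_regular_ring\<close>); this is the flatness criterion of Kunz
  in the presence of a basis. After localizing, the basis elements can be changed by polynomials in
  the earlier ones so that each lies in the maximal ideal or enlarges the residue field. Those in the
  maximal ideal generate it, and the initial segments of them generate a chain of primes. That there
  is no longer chain follows from the degree of the residue field at a prime over its \<open>p\<close>-th powers:
  it grows at least by the factor \<open>p\<close> in each step down a chain (\<open>rho_adjacent\<close>) and is bounded by
  the number of generators over the ring of \<open>p\<close>-th powers.

  The same degree shows that a regular local ring of this kind is a domain, so that regular rings are
  reduced (\<open>regular_ring_reduced\<close>). In a reduced ring a \<open>p\<close>-basis is a basis for the module structure
  given by Frobenius. Then all maps \<open>phi\<close> of its tower are bijective and the counit is an
  isomorphism, whose inverse is the unit (\<open>unit_props\<close>).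

  Finally, \<open>p\<close>-th powers in \<open>R\<^sub>i\<^sub>+\<^sub>1\<close> are determined in \<open>R\<^sub>i\<close>, so a morphism from a \<open>p\<close>-generated ring to
  \<open>G\<close> is determined by its composite with the counit (\<open>mor_eqI\<close>). Functoriality, naturality of the unit
  and the triangle identities follow by comparing both sides at level \<open>0\<close>.\<close>

section \<open>Lengths over a subring at a prime\<close>

context cring begin

definition submod :: "'a set => 'a set => bool" where
 "submod K U \<longleftrightarrow> U <= carrier R & \<zero> : U & (ALL u:U. ALL v:U. u \<oplus> v : U) & (ALL k:K. ALL u:U. k \<otimes> u : U)"

definition ssum :: "'a set => 'a set => 'a set" where
 "ssum U V = {u \<oplus> v | u v. u : U & v : V}"

definition adj :: "'a set => 'a set => 'a => 'a set" where
 "adj K U u = ssum U ((%k. k \<otimes> u) ` K)"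

primrec adjs :: "'a set => 'a set => 'a list => 'a set" where
 "adjs K U [] = U"
| "adjs K U (u # us) = adjs K (adj K U u) us"

text \<open>The length of \<open>M/L\<close> over \<open>K\<close> localized at \<open>Q\<close>, computed without localizing: a step of a chain
 counts if it contains a vector that no scalar of \<open>K - Q\<close> carries into the smaller module.\<close>

definition strict :: "'a set => 'a set => 'a set => 'a set => bool" where
 "strict K Q L U \<longleftrightarrow> (EX v:U. ALL a:K - Q. a \<otimes> v ~: L)"

primrec chn :: "'a set => 'a set => nat => 'a set => 'a set => bool" where
 "chn K Q 0 L M \<longleftrightarrow> submod K L & submod K M & L <= M"
| "chn K Q (Suc n) L M \<longleftrightarrow> submod K L & (EX U. L <= U & strict K Q L U & chn K Q n U M)"

definition len :: "'a set => 'a set => 'a set => 'a set => enat" where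
 "len K Q L M = Sup {enat n | n. chn K Q n L M}"

lemma submodD:
 assumes "submod K U"
 shows "U <= carrier R" "\<zero> : U" "!!u v. u : U ==> v : U ==> u \<oplus> v : U"
  "!!k u. k : K ==> u : U ==> k \<otimes> u : U" "!!u. u : U ==> u : carrier R"
 using assms by (auto simp: submod_def)

lemma submod_neg:
 assumes K: "subring K R" and U: "submod K U" and u: "u : U"
 shows "\<ominus> u : U"
proof -
 have "\<ominus> \<one> : K" using subringE(3,5)[OF K] by auto
 then have "(\<ominus> \<one>) \<otimes> u : U" using submodD(4)[OF U] u by auto
 then show ?thesis using submodD(5)[OF U u] by (simp add: l_minus)
qed

lemma submod_minus:
 assumes K: "subring K R" and U: "submod K U" and "u : U" "v : U"
 shows "u \<ominus> v : U"
 using submod_neg[OF K U] submodD(3)[OF U] assms by (auto simp: minus_eq)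

lemma submod_diff_iff:
 assumes K: "subring K R" and U: "submod K U" and v: "v : U" and u: "u : carrier R"
 shows "u \<oplus> v : U \<longleftrightarrow> u : U"
proof
 assume "u \<oplus> v : U"
 then have "(u \<oplus> v) \<ominus> v : U" using submod_minus[OF K U] v by auto
 moreover have "(u \<oplus> v) \<ominus> v = u" using u submodD(5)[OF U v] by algebra
 ultimately show "u : U" by simp
qed (use submodD(3)[OF U] v in auto)

lemma submod_carrier: "subring K R ==> submod K (carrier R)"
 using subringE(1) by (fastforce simp: submod_def)

lemma submod_self: "subring K R ==> submod K K"
 using subringE[of K R] by (auto simp: submod_def)

lemma submod_ideal: "ideal I R ==> K <= carrier R ==> submod K I"
 unfolding submod_def
 using ideal.I_l_closed[of I R] additive_subgroup.a_closed[of I R] additive_subgroup.zero_closed[of I R]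
  additive_subgroup.a_subset[of I R] ideal.axioms(1)[of I R] by auto

lemma ideal_submod:
 assumes "submod (carrier R) I" shows "ideal I R"
proof (rule idealI)
 show "ring R" by (rule ring_axioms)
 show "subgroup I (add_monoid R)"
  using submodD[OF assms] submod_neg[OF carrier_is_subring assms]
  by (auto intro!: add.subgroupI)
 show "x \<otimes> a : I" if "a : I" "x : carrier R" for a x using that submodD[OF assms] by auto
 then show "a \<otimes> x : I" if "a : I" "x : carrier R" for a x
  using that submodD(5)[OF assms] by (metis m_comm)
qed

lemma submod_Int: "submod K U ==> submod K V ==> submod K (U \<inter> V)"
 by (auto simp: submod_def)

lemma submod_mono: "submod K U ==> K' <= K ==> submod K' U"
 by (auto simp: submod_def)

lemma ssumI: "u : U ==> v : V ==> u \<oplus> v : ssum U V"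
 by (auto simp: ssum_def)

lemma ssumE: assumes "w : ssum U V" obtains u v where "u : U" "v : V" "w = u \<oplus> v"
 using assms by (auto simp: ssum_def)

lemma submod_ssum:
 assumes K: "K <= carrier R" and U: "submod K U" and V: "submod K V"
 shows "submod K (ssum U V)"
 unfolding submod_def
proof (intro conjI ballI)
 note [simp] = submodD(5)[OF U] submodD(5)[OF V]
 show "ssum U V <= carrier R" by (auto elim!: ssumE)
 show "\<zero> : ssum U V" using ssumI[OF submodD(2)[OF U] submodD(2)[OF V]] by simp
 fix x assume x: "x : ssum U V"
 then obtain u v where uv: "u : U" "v : V" "x = u \<oplus> v" by (rule ssumE)
 { fix y assume "y : ssum U V"
  then obtain u' v' where uv': "u' : U" "v' : V" "y = u' \<oplus> v'" by (rule ssumE)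
  have "x \<oplus> y = (u \<oplus> u') \<oplus> (v \<oplus> v')" using uv uv' by (simp add: a_ac)
  then show "x \<oplus> y : ssum U V"
   using submodD(3)[OF U uv(1) uv'(1)] submodD(3)[OF V uv(2) uv'(2)] by (simp add: ssumI) }
 fix k assume k: "k : K"
 then have "k \<otimes> x = k \<otimes> u \<oplus> k \<otimes> v" using uv K by (auto simp: r_distr)
 then show "k \<otimes> x : ssum U V"
  using submodD(4)[OF U k uv(1)] submodD(4)[OF V k uv(2)] by (simp add: ssumI)
qed

lemma ssum_upper1: "submod K V ==> U <= carrier R ==> U <= ssum U V"
 using submodD(2)[of K V] by (force simp: ssum_def)

lemma ssum_upper2: "submod K U ==> V <= carrier R ==> V <= ssum U V"
 using submodD(2)[of K U] by (force simp: ssum_def)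

lemma ssum_least: "submod K W ==> U <= W ==> V <= W ==> ssum U V <= W"
 using submodD(3)[of K W] by (fastforce elim!: ssumE)

lemma ssum_mono: "U <= U' ==> V <= V' ==> ssum U V <= ssum U' V'"
 by (auto simp: ssum_def)

lemma submod_gimage:
 assumes D: "submod K' D" and g: "!!d. d : D ==> g d : carrier R"
  and add: "!!d e. d : D ==> e : D ==> g (d \<oplus> e) = g d \<oplus> g e"
  and sc: "!!c d. c : K' ==> d : D ==> g (c \<otimes> d) = \<sigma> c \<otimes> g d"
  and K: "K <= \<sigma> ` K'"
 shows "submod K (g ` D)"
proof -
 have "g \<zero> \<oplus> g \<zero> = g \<zero>" using add[of \<zero> \<zero>] submodD(2)[OF D] by simp
 then have z: "g \<zero> = \<zero>" using g[OF submodD(2)[OF D]] by (metis add.r_cancel_one')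
 show ?thesis
  unfolding submod_def
 proof (intro conjI ballI)
  show "\<zero> : g ` D" using z submodD(2)[OF D] by (metis imageI)
  fix u assume "u : g ` D"
  then obtain d where d: "d : D" "u = g d" by auto
  { fix v assume "v : g ` D"
   then obtain e where "e : D" "v = g e" by auto
   then show "u \<oplus> v : g ` D" using d add[of d e] submodD(3)[OF D] by (metis imageI) }
  fix k assume "k : K"
  then obtain c where "c : K'" "k = \<sigma> c" using K by auto
  then show "k \<otimes> u : g ` D" using d sc[of c d] submodD(4)[OF D] by (metis imageI)
 qed (use g in auto)
qed

lemma submod_line:
 assumes K: "subring K R" and u: "u : carrier R"
 shows "submod K ((%k. k \<otimes> u) ` K)"
 by (rule submod_gimage[OF submod_self[OF K], where \<sigma>="%x. x"])
  (use subringE(1)[OF K] u in "auto simp: l_distr m_assoc subset_iff")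

lemma submod_adj: "subring K R ==> submod K U ==> u : carrier R ==> submod K (adj K U u)"
 unfolding adj_def by (intro submod_ssum submod_line) (auto dest: subringE(1))

lemma adj_upper: "subring K R ==> submod K U ==> u : carrier R ==> U <= adj K U u"
 unfolding adj_def by (rule ssum_upper1[OF submod_line]) (auto dest: submodD(1))

lemma adjE:
 assumes "w : adj K U u" obtains v k where "v : U" "k : K" "w = v \<oplus> k \<otimes> u"
 using assms by (auto simp: adj_def ssum_def)

lemma adjI: "v : U ==> k : K ==> v \<oplus> k \<otimes> u : adj K U u"
 by (auto simp: adj_def ssum_def)

lemma adj_mem:
 assumes "subring K R" "submod K U" "u : carrier R" shows "u : adj K U u"
 using adjI[OF submodD(2)[OF assms(2)] subringE(3)[OF assms(1)], of u] assms(3) by simp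

lemma adj_least: "submod K W ==> U <= W ==> u : W ==> adj K U u <= W"
 unfolding adj_def by (rule ssum_least) (auto dest: submodD)

lemma adj_mono: "U <= V ==> adj K U u <= adj K V u"
 unfolding adj_def by (rule ssum_mono) auto

lemma submod_adjs:
 "subring K R ==> submod K U ==> set us <= carrier R ==> submod K (adjs K U us)"
 by (induct us arbitrary: U) (auto simp: submod_adj)

lemma adjs_upper:
 "subring K R ==> submod K U ==> set us <= carrier R ==> U <= adjs K U us"
proof (induct us arbitrary: U)
 case (Cons u us)
 then show ?case using adj_upper[of K U u] submod_adj[of K U u] by fastforce
qed simp

lemma adjs_mem:
 "subring K R ==> submod K U ==> set us <= carrier R ==> set us <= adjs K U us"
proof (induct us arbitrary: U)
 case (Cons u us)
 have s: "submod K (adj K U u)" using Cons by (simp add: submod_adj)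
 have "u : adjs K (adj K U u) us" using adj_mem[of K U u] adjs_upper[OF _ s, of us] Cons(2,3,4) by auto
 then show ?case using Cons(1)[OF Cons(2) s] Cons(4) by auto
qed simp

lemma adjs_least: "submod K W ==> U <= W ==> set us <= W ==> adjs K U us <= W"
 by (induct us arbitrary: U) (auto simp: adj_least)

lemma adjs_mono: "U <= V ==> adjs K U us <= adjs K V us"
 by (induct us arbitrary: U V) (auto simp: adj_mono)

lemma adjs_append: "adjs K U (us @ vs) = adjs K (adjs K U us) vs"
 by (induct us arbitrary: U) auto

lemma strict_mono:
 "strict K Q L U ==> L' <= L ==> U <= U' ==> strict K Q L' U'"
 unfolding strict_def by blast

lemma chn_submod: "chn K Q n L M ==> submod K L & submod K M & L <= M"
 by (induct n arbitrary: L) auto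

lemma chn_SucI:
 "submod K L ==> L <= U ==> strict K Q L U ==> chn K Q n U M ==> chn K Q (Suc n) L M"
 by auto

lemma chn_weaken:
 "chn K Q n L M ==> submod K L' ==> submod K M' ==> L' <= L ==> M <= M' ==> chn K Q n L' M'"
proof (induct n arbitrary: L L')
 case (Suc n)
 then obtain U where U: "L <= U" "strict K Q L U" "chn K Q n U M" by auto
 have "submod K U" using chn_submod[OF U(3)] by simp
 then have "chn K Q n U M'" using Suc(1)[OF U(3)] Suc by auto
 moreover have "strict K Q L' U" using strict_mono[OF U(2) Suc(5) subset_refl] .
 moreover have "L' <= U" using U(1) Suc(5) by blast
 ultimately show ?case using Suc(3) by auto
qed auto

lemma chn_Suc_imp: "chn K Q (Suc n) L M ==> chn K Q n L M"
 using chn_weaken[of K Q n _ M L M] by (auto dest: chn_submod)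

lemma chn_le: "chn K Q n L M ==> m <= n ==> chn K Q m L M"
proof (induct n)
 case (Suc n)
 show ?case
 proof (cases "m = Suc n")
  case False then show ?thesis using Suc(1)[OF chn_Suc_imp[OF Suc(2)]] Suc(3) by simp
 qed (use Suc in blast)
qed simp

lemma chn_concat: "chn K Q n L N ==> chn K Q m N M ==> chn K Q (n + m) L M"
proof (induct n arbitrary: L)
 case 0 then show ?case using chn_weaken[of K Q m N M L M] by (auto dest: chn_submod)
qed auto

lemma strict_split:
 assumes K: "subring K R" and Q: "primeideal Q R" and N: "submod K N"
  and L: "submod K L" and U: "submod K U" and LU: "L <= U" and st: "strict K Q L U"
 shows "strict K Q (L \<inter> N) (U \<inter> N) \<or> strict K Q (ssum L N) (ssum U N)"
proof (rule ccontr)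
 assume neg: "\<not> ?thesis"
 obtain v where v: "v : U" "!!a. a : K - Q ==> a \<otimes> v ~: L" using st by (auto simp: strict_def)
 have Kc: "!!k. k : K ==> k : carrier R" using subringE(1)[OF K] by auto
 have vc: "v : carrier R" using v submodD(5)[OF U] by auto
 have "v : ssum U N" using ssumI[OF v(1) submodD(2)[OF N]] vc by simp
 then obtain a where a: "a : K - Q" "a \<otimes> v : ssum L N" using neg by (auto simp: strict_def)
 then obtain l n where ln: "l : L" "n : N" "a \<otimes> v = l \<oplus> n" by (auto elim: ssumE)
 have c: "l : carrier R" "n : carrier R" using ln submodD(5)[OF L] submodD(5)[OF N] by auto
 have "a \<otimes> v : U" using submodD(4)[OF U] a v by auto
 then have "n \<oplus> l : U" using ln c by (simp add: a_comm)
 then have "n : U" using submod_diff_iff[OF K U, of l n] ln LU c by auto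
 then obtain b where b: "b : K - Q" "b \<otimes> n : L" using neg ln by (auto simp: strict_def)
 have "b \<otimes> a : K - Q"
  using a b subringE(6)[OF K] primeideal.I_prime[OF Q, of b a] Kc by auto
 moreover have "(b \<otimes> a) \<otimes> v = b \<otimes> l \<oplus> b \<otimes> n"
  using a b c vc Kc ln by (simp add: m_assoc r_distr)
 moreover have "b \<otimes> l \<oplus> b \<otimes> n : L" using b ln submodD(3,4)[OF L] by auto
 ultimately show False using v(2)[of "b \<otimes> a"] by auto
qed

text \<open>Additivity of the length rests on this: intersecting a chain with \<open>N\<close> and adding \<open>N\<close> to it keeps
 each strict step strict in at least one of the two resulting chains.\<close>

lemma chn_split:
 assumes K: "subring K R" and Q: "primeideal Q R" and N: "submod K N"
 shows "chn K Q n L M ==> EX i j. n <= i + j & chn K Q i (L \<inter> N) (M \<inter> N) & chn K Q j (ssum L N) (ssum M N)"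
proof (induct n arbitrary: L)
 case 0
 then have "submod K L" "submod K M" "L <= M" by auto
 then have "chn K Q 0 (L \<inter> N) (M \<inter> N) & chn K Q 0 (ssum L N) (ssum M N)"
  using N submod_ssum[OF subringE(1)[OF K]] submod_Int ssum_mono[of L M N N] by auto
 then show ?case by blast
next
 case (Suc n)
 then obtain U where U: "submod K L" "L <= U" "strict K Q L U" "chn K Q n U M" by auto
 obtain i j where ij: "n <= i + j" "chn K Q i (U \<inter> N) (M \<inter> N)" "chn K Q j (ssum U N) (ssum M N)"
  using Suc(1)[OF U(4)] by auto
 have sU: "submod K U" using chn_submod[OF U(4)] by simp
 have s: "submod K (L \<inter> N)" "submod K (ssum L N)" "L \<inter> N <= U \<inter> N" "ssum L N <= ssum U N"
  using U N submod_Int submod_ssum[OF subringE(1)[OF K]] ssum_mono[of L U N N] by auto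
 have m: "submod K (M \<inter> N)" "submod K (ssum M N)" using chn_submod ij by blast+
 have w: "chn K Q i (L \<inter> N) (M \<inter> N)" "chn K Q j (ssum L N) (ssum M N)"
  using chn_weaken[OF ij(2) s(1) m(1) s(3)] chn_weaken[OF ij(3) s(2) m(2) s(4)] by auto
 from strict_split[OF K Q N U(1) sU U(2,3)] show ?case
 proof
  assume "strict K Q (L \<inter> N) (U \<inter> N)"
  then have "chn K Q (Suc i) (L \<inter> N) (M \<inter> N)" by (rule chn_SucI[OF s(1,3) _ ij(2)])
  then show ?thesis using w(2) ij(1) by (metis Suc_le_mono add_Suc)
 next
  assume "strict K Q (ssum L N) (ssum U N)"
  then have "chn K Q (Suc j) (ssum L N) (ssum M N)" by (rule chn_SucI[OF s(2,4) _ ij(3)])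
  then show ?thesis using w(1) ij(1) by (metis Suc_le_mono add_Suc_right)
 qed
qed

lemma len_ge: "chn K Q n L M ==> enat n <= len K Q L M"
 unfolding len_def by (rule Sup_upper) auto

lemma len_le: "(!!n. chn K Q n L M ==> enat n <= b) ==> len K Q L M <= b"
 unfolding len_def by (rule Sup_least) auto

lemma chn_if_le_len:
 assumes "submod K L" "submod K M" "L <= M" "enat n <= len K Q L M"
 shows "chn K Q n L M"
proof (cases n)
 case 0 then show ?thesis using assms by simp
next
 case (Suc m)
 show ?thesis
 proof (rule ccontr)
  assume "\<not> ?thesis"
  then have "len K Q L M <= enat m"
   using chn_le[of K Q _ L M n] Suc by (intro len_le) (metis enat_ord_simps(1) not_less_eq_eq)
  then have "enat n <= enat m" using assms(4) order_trans by blast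
  then show False using Suc by simp
 qed
qed

lemma len_mono:
 assumes "submod K L'" "submod K M'" "L' <= L" "M <= M'"
 shows "len K Q L M <= len K Q L' M'"
 using assms by (intro len_le len_ge) (rule chn_weaken)

lemma len_add:
 assumes K: "subring K R" and Q: "primeideal Q R"
  and s: "submod K L" "submod K N" "submod K M" "L <= N" "N <= M"
 shows "len K Q L M = len K Q L N + len K Q N M"
proof (rule antisym)
 show "len K Q L M <= len K Q L N + len K Q N M"
 proof (rule len_le)
  fix n assume "chn K Q n L M"
  then obtain i j where ij: "n <= i + j" "chn K Q i (L \<inter> N) (M \<inter> N)" "chn K Q j (ssum L N) (ssum M N)"
   using chn_split[OF K Q s(2)] by blast
  have e: "L \<inter> N = L" "M \<inter> N = N" using s by auto
  have "N <= ssum L N" "ssum M N <= M"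
   using ssum_upper2[OF s(1) submodD(1)[OF s(2)]] ssum_least[OF s(3) subset_refl s(5)] by auto
  then have "chn K Q j N M" using chn_weaken[OF ij(3) s(2,3)] by simp
  then have "enat i <= len K Q L N" "enat j <= len K Q N M" using ij(2) e len_ge by auto
  then have "enat i + enat j <= len K Q L N + len K Q N M" by (rule add_mono)
  then show "enat n <= len K Q L N + len K Q N M" using ij(1)
   by (metis enat_ord_simps(1) order_trans plus_enat_simps(1))
 qed
 show "len K Q L N + len K Q N M <= len K Q L M"
 proof (cases "len K Q L N = \<infinity> \<or> len K Q N M = \<infinity>")
  case True
  then show ?thesis using len_mono[OF s(1,3), of L N Q] len_mono[OF s(1,3), of N M Q] s by auto
 next
  case False
  then obtain i j where "len K Q L N = enat i" "len K Q N M = enat j" by auto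
  moreover from this have "chn K Q i L N" "chn K Q j N M"
   using chn_if_le_len[OF s(1,2,4)] chn_if_le_len[OF s(2,3,5)] by auto
  ultimately show ?thesis using len_ge[OF chn_concat, of K Q i L N j M] by simp
 qed
qed

text \<open>This lemma and the next compare lengths along a \<open>\<sigma>\<close>-semilinear map \<open>g\<close>. They are applied to
 multiplication by an element, with \<open>\<sigma> = id\<close>, and to Frobenius followed by a multiplication, with \<open>\<sigma>\<close>
 the \<open>p\<close>-th power.\<close>

lemma len_pull:
 assumes K: "subring K R"
  and s: "submod K L" and M: "M <= ssum L (g ` D)" and D: "submod K' D" and L': "submod K' L'"
  and L'_sub: "!!d. d : L' ==> d : D & g d : L"
  and g: "!!d. d : D ==> g d : carrier R"
  and add: "!!d e. d : D ==> e : D ==> g (d \<oplus> e) = g d \<oplus> g e"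
  and sc: "!!c d. c : K' ==> d : D ==> g (c \<otimes> d) = \<sigma> c \<otimes> g d"
  and sK: "\<sigma> ` K' <= K" and sQ: "!!c. c : K' - Q' ==> \<sigma> c ~: Q"
 shows "len K Q L M <= len K' Q' L' D"
proof -
 have "g \<zero> \<oplus> g \<zero> = g \<zero>" using add[of \<zero> \<zero>] submodD(2)[OF D] by simp
 then have z: "g \<zero> = \<zero>" using g[OF submodD(2)[OF D]] by (metis add.r_cancel_one')
 let ?G = "%U. {d : D. g d : U}"
 have sm: "submod K' (?G U)" if "submod K U" for U
  using submodD(2-4)[OF that] submodD[OF D] z add sc sK unfolding submod_def
  by (auto simp: image_subset_iff)
 have "chn K Q n L0 M0 ==> L <= L0 ==> M0 <= ssum L (g ` D) ==> chn K' Q' n (?G L0) (?G M0)" for n L0 M0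
 proof (induct n arbitrary: L0)
  case 0 then show ?case using sm by auto
 next
  case (Suc n)
  then obtain U where U: "submod K L0" "L0 <= U" "strict K Q L0 U" "chn K Q n U M0" by auto
  have sU: "submod K U" "U <= M0" using chn_submod[OF U(4)] by auto
  obtain v where v: "v : U" "!!a. a : K - Q ==> a \<otimes> v ~: L0" using U by (auto simp: strict_def)
  then obtain l d where ld: "l : L" "d : D" "v = l \<oplus> g d" using sU Suc(4) by (auto elim!: ssumE)
  have c: "l : carrier R" "g d : carrier R" using ld submodD(5)[OF s] g by auto
  have "g d \<oplus> l : U" using v ld c by (simp add: a_comm)
  then have gd: "g d : U" using submod_diff_iff[OF K sU(1), of l "g d"] ld Suc(3) U(2) c by auto
  have "strict K' Q' (?G L0) (?G U)"
   unfolding strict_def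
  proof (intro bexI[of _ d] ballI notI)
   fix a assume a: "a : K' - Q'" "a \<otimes> d : ?G L0"
   have sa: "\<sigma> a : K - Q" using a sK sQ by auto
   have "\<sigma> a \<otimes> g d : L0" using a sc ld by auto
   moreover have "\<sigma> a \<otimes> l : L0" using sa ld submodD(4)[OF s] Suc(3) by auto
   ultimately have "\<sigma> a \<otimes> l \<oplus> \<sigma> a \<otimes> g d : L0" using submodD(3)[OF U(1)] by auto
   moreover have "\<sigma> a : carrier R" using sa subringE(1)[OF K] by auto
   ultimately have "\<sigma> a \<otimes> v : L0" using ld c by (simp add: r_distr)
   then show False using v sa by auto
  qed (use gd ld in auto)
  moreover have "chn K' Q' n (?G U) (?G M0)" using Suc(1)[OF U(4)] U Suc by auto
  moreover have "?G L0 <= ?G U" using U(2) by auto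
  ultimately show ?case using chn_SucI[OF sm[OF U(1)]] by blast
 qed
 from this[OF _ subset_refl M]
 have 1: "chn K' Q' n (?G L) (?G M)" if "chn K Q n L M" for n using that .
 have "chn K' Q' n L' D" if "chn K Q n L M" for n
  by (rule chn_weaken[OF 1[OF that] L' D]) (use L'_sub in auto)
 then show ?thesis by (intro len_le len_ge)
qed

lemma len_push:
 assumes K: "subring K R" and K': "subring K' R"
  and s: "submod K L" and sM: "submod K M" and LM: "L <= M" "g ` D <= M" and D: "submod K' D"
  and L': "!!d. d : D ==> g d : L ==> d : L'"
  and g: "!!d. d : D ==> g d : carrier R"
  and add: "!!d e. d : D ==> e : D ==> g (d \<oplus> e) = g d \<oplus> g e"
  and sc: "!!c d. c : K' ==> d : D ==> g (c \<otimes> d) = \<sigma> c \<otimes> g d"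
  and sK: "K <= \<sigma> ` K'" and sQ: "!!c. c : K' ==> \<sigma> c ~: Q ==> c ~: Q'"
 shows "len K' Q' L' D <= len K Q L M"
proof -
 let ?G = "%U. ssum L (g ` U)"
 have gi: "submod K (g ` U)" if "submod K' U" "U <= D" for U
  by (rule submod_gimage[OF that(1), where \<sigma>=\<sigma>]) (use that g add sc sK in "auto simp: subset_iff")
 have sm: "submod K (?G U)" if "submod K' U" "U <= D" for U
  using submod_ssum[OF subringE(1)[OF K] s gi[OF that]] .
 have "chn K' Q' n L0 M0 ==> L' <= L0 ==> M0 <= D ==> chn K Q n (?G L0) (?G M0)" for n L0 M0
 proof (induct n arbitrary: L0)
  case 0
  then have "submod K' L0" "submod K' M0" "L0 <= D" "L0 <= M0" by auto
  then show ?case using sm[of L0] sm[of M0] 0 ssum_mono[of L L "g ` L0" "g ` M0"] by auto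
 next
  case (Suc n)
  then obtain U where U: "submod K' L0" "L0 <= U" "strict K' Q' L0 U" "chn K' Q' n U M0" by auto
  have sU: "submod K' U" "U <= M0" using chn_submod[OF U(4)] by auto
  obtain v where v: "v : U" "!!a. a : K' - Q' ==> a \<otimes> v ~: L0" using U by (auto simp: strict_def)
  have vD: "v : D" using v sU Suc by auto
  have "strict K Q (?G L0) (?G U)"
   unfolding strict_def
  proof (intro bexI[of _ "g v"] ballI notI)
   fix a assume a: "a : K - Q" "a \<otimes> g v : ?G L0"
   then obtain c where c: "c : K'" "a = \<sigma> c" using sK by auto
   then have cQ: "c : K' - Q'" using a sQ by auto
   obtain l u where lu: "l : L" "u : L0" "\<sigma> c \<otimes> g v = l \<oplus> g u" using a c by (auto elim!: ssumE)
   have uD: "u : D" using lu U sU Suc by auto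
   have cv: "c \<otimes> v : D" using c vD submodD(4)[OF D] by auto
   have ud: "\<ominus> u : D" using submod_neg[OF K' D uD] .
   have cc: "l : carrier R" "g u : carrier R" "g (\<ominus> u) : carrier R" "u : carrier R" "v : carrier R" "c : carrier R"
    using lu submodD(5)[OF s] g uD ud submodD(5)[OF D] vD c subringE(1)[OF K'] by auto
   have "g (u \<oplus> \<ominus> u) = g u \<oplus> g (\<ominus> u)" using add uD ud by auto
   moreover have "g \<zero> \<oplus> g \<zero> = g \<zero>" using add[of \<zero> \<zero>] submodD(2)[OF D] by simp
   then have "g \<zero> = \<zero>" using g[OF submodD(2)[OF D]] by (metis add.r_cancel_one')
   ultimately have gz: "g u \<oplus> g (\<ominus> u) = \<zero>" using cc by (simp add: r_neg)
   have "g (c \<otimes> v \<oplus> \<ominus> u) = (l \<oplus> g u) \<oplus> g (\<ominus> u)" using add cv ud sc c(1) vD lu(3) by simp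
   also have "\<dots> = l" using cc gz by (simp add: a_assoc)
   finally have "c \<otimes> v \<oplus> \<ominus> u : L'" using L' lu submodD(3)[OF D cv ud] by auto
   then have "(c \<otimes> v \<oplus> \<ominus> u) \<oplus> u : L0" using Suc(3) submodD(3)[OF U(1)] lu by blast
   moreover have "(c \<otimes> v \<oplus> \<ominus> u) \<oplus> u = c \<otimes> v" using cc by algebra
   ultimately show False using v cQ by auto
  next
   show "g v : ?G U" using ssumI[OF submodD(2)[OF s], of "g v" "g ` U"] v g vD by auto
  qed
  moreover have "chn K Q n (?G U) (?G M0)" using Suc(1)[OF U(4)] U Suc by auto
  moreover have "?G L0 <= ?G U" using U(2) by (intro ssum_mono image_mono) auto
  moreover have "submod K (?G L0)" using sm[OF U(1)] U(2) sU Suc by auto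
  ultimately show ?case using chn_SucI by blast
 qed
 note 1 = this[OF _ subset_refl subset_refl]
 have 2: "?G D <= M" by (rule ssum_least[OF sM LM])
 have "chn K Q n L M" if c: "chn K' Q' n L' D" for n
 proof -
  have "submod K' L'" "L' <= D" using chn_submod[OF c] by auto
  then have "L <= ?G L'" by (intro ssum_upper1[OF gi submodD(1)[OF s]])
  then show ?thesis by (rule chn_weaken[OF 1[OF c] s sM _ 2])
 qed
 then show ?thesis by (intro len_le len_ge)
qed

end

context cring begin

lemma len_adjs:
 assumes K: "subring K R" and Q: "primeideal Q R"
  and B: "!!L' u. submod K L' ==> L <= L' ==> u : set us ==> len K Q L' (adj K L' u) <= B"
  and L: "submod K L" and us: "set us <= carrier R"
 shows "len K Q L (adjs K L us) <= enat (length us) * B"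
 using B L us
proof (induct us arbitrary: L)
 case Nil
 have "len K Q L L <= 0"
 proof (rule len_le)
  fix n assume "chn K Q n L L"
  then show "enat n <= 0"
  proof (cases n)
   case (Suc m)
   with \<open>chn K Q n L L\<close> obtain U where "strict K Q L U" "chn K Q m U L" by auto
   then obtain v where "v : L" "!!a. a : K - Q ==> a \<otimes> v ~: L"
    using chn_submod[of K Q m U L] by (auto simp: strict_def)
   moreover have "\<one> : K - Q"
    using subringE(3)[OF K] primeideal.I_notcarr[OF Q] ideal.one_imp_carrier[OF primeideal.axioms(1)[OF Q]] by auto
   ultimately show ?thesis using submodD(5)[OF Nil(2)] by force
  qed (simp add: zero_enat_def)
 qed
 then show ?case by (simp add: zero_enat_def[symmetric])
next
 case (Cons u us)
 have u: "u : carrier R" "set us <= carrier R" using Cons by auto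
 have s: "submod K (adj K L u)" "L <= adj K L u"
  using submod_adj[OF K Cons(3) u(1)] adj_upper[OF K Cons(3) u(1)] by auto
 have s2: "submod K (adjs K (adj K L u) us)" "adj K L u <= adjs K (adj K L u) us"
  using submod_adjs[OF K s(1) u(2)] adjs_upper[OF K s(1) u(2)] by auto
 have "len K Q L (adjs K L (u # us)) = len K Q L (adj K L u) + len K Q (adj K L u) (adjs K (adj K L u) us)"
  using len_add[OF K Q Cons(3) s(1) s2(1) s(2) s2(2)] by simp
 also have "\<dots> <= B + enat (length us) * B"
  using Cons(2)[OF Cons(3) subset_refl, of u] Cons(1)[OF _ s(1) u(2)] Cons(2) s(2)
  by (intro add_mono) auto
 also have "\<dots> = enat (length (u # us)) * B"
  by (simp add: eSuc_enat[symmetric] mult_eSuc del: eSuc_enat)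
 finally show ?case .
qed

lemma one_notin_prime: "primeideal Q R ==> \<one> ~: Q"
 using primeideal.I_notcarr ideal.one_imp_carrier[OF primeideal.axioms(1)] by metis

lemma len_line_le_1:
 assumes K: "subring K R" and Q: "primeideal Q R" and L: "submod K L" and u: "u : carrier R"
  and Qu: "!!c. c : K ==> c : Q ==> c \<otimes> u : L"
 shows "len K Q L (adj K L u) <= 1"
proof -
 have Kc: "!!k. k : K ==> k : carrier R" using subringE(1)[OF K] by auto
 have sQ: "submod K (K \<inter> Q)"
  by (intro submod_Int submod_self[OF K] submod_ideal[OF primeideal.axioms(1)[OF Q] subringE(1)[OF K]])
 have "len K Q L (adj K L u) <= len K Q (K \<inter> Q) K"
  by (rule len_pull[OF K L _ submod_self[OF K] sQ, where g="%k. k \<otimes> u" and \<sigma>="%k. k"])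
   (use Kc u Qu in "auto simp: adj_def l_distr m_assoc")
 also have "\<dots> <= 1"
 proof (rule len_le)
  fix n assume c: "chn K Q n (K \<inter> Q) K"
  show "enat n <= 1"
  proof (rule ccontr)
   assume "\<not> enat n <= 1"
   then have "2 <= n" by (simp add: one_enat_def)
   then have "chn K Q (Suc (Suc 0)) (K \<inter> Q) K" using chn_le[OF c, of "Suc (Suc 0)"] by simp
   then obtain U V where U: "strict K Q (K \<inter> Q) U" "strict K Q U V" "submod K U" "submod K V" "V <= K" "U <= V"
    by auto
   obtain a where a: "a : U" "\<one> \<otimes> a ~: K \<inter> Q"
    using U(1) subringE(3)[OF K] one_notin_prime[OF Q] by (auto simp: strict_def)
   then have aK: "a : K - Q" using U Kc by auto
   obtain v where v: "v : V" "a \<otimes> v ~: U" using U(2) aK by (auto simp: strict_def)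
   have "v \<otimes> a : U" using submodD(4)[OF U(3)] v a U by auto
   then show False using v aK U Kc by (metis DiffD1 m_comm subsetD)
  qed
 qed
 finally show ?thesis .
qed

lemma ideal_adj:
 assumes "ideal I R" "u : carrier R" shows "ideal (adj (carrier R) I u) R"
 by (rule ideal_submod[OF submod_adj[OF carrier_is_subring submod_ideal[OF assms(1) subset_refl] assms(2)]])

lemma adj_eq_colon_mem:
 assumes "ideal I R" "u : carrier R" shows "ideal {a : carrier R. a \<otimes> u : I} R"
proof (rule ideal_submod, unfold submod_def, intro conjI ballI)
 note I = submodD[OF submod_ideal[OF assms(1) subset_refl]]
 show "\<zero> : {a : carrier R. a \<otimes> u : I}" using I assms by auto
 show "a \<oplus> b : {a : carrier R. a \<otimes> u : I}" if "a : {a : carrier R. a \<otimes> u : I}" "b : {a : carrier R. a \<otimes> u : I}" for a b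
  using that I assms by (auto simp: l_distr)
 show "a \<otimes> b : {a : carrier R. a \<otimes> u : I}" if "a : carrier R" "b : {a : carrier R. a \<otimes> u : I}" for a b
  using that I assms by (auto simp: m_assoc)
qed auto

end

lemma (in noetherian_ring) ideal_maximal_exists:
 assumes "I : F" and F: "!!I. I : F ==> ideal I R"
 shows "EX M:F. I <= M & (ALL J:F. M <= J --> J = M)"
proof -
 let ?F = "{J : F. I <= J}"
 have "EX M:?F. ALL J:?F. M <= J --> J = M"
 proof (rule subset_Zorn)
  fix C assume C: "subset.chain ?F C"
  show "EX U:?F. ALL S:C. S <= U"
  proof (cases "C = {}")
   case True then show ?thesis using assms(1) by auto
  next
   case False
   have "subset.chain {I. ideal I R} C" using C F unfolding pred_on.chain_def by auto
   then have "\<Union>C : C" using ideal_chain_is_trivial[OF False] by simp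
   then show ?thesis using C by (auto simp: pred_on.chain_def)
  qed
 qed
 then obtain M where M: "M : F" "I <= M" "ALL J:?F. M <= J --> J = M" by auto
 show ?thesis by (intro bexI[OF _ M(1)] conjI M(2) ballI impI) (use M in auto)
qed

locale noeth_cring = cring R + noetherian_ring R for R (structure)

context noeth_cring begin

text \<open>A maximal proper colon ideal \<open>(J : v)\<close> is prime.\<close>

lemma exists_prime_colon:
 assumes J: "ideal J R" and proper: "J ~= carrier R"
 obtains v where "v : carrier R" "v ~: J" "primeideal {a : carrier R. a \<otimes> v : J} R"
proof -
 let ?c = "%v. {a : carrier R. a \<otimes> v : J}"
 note Jm = submodD[OF submod_ideal[OF J subset_refl]]
 have one: "\<one> ~: J" using proper ideal.one_imp_carrier[OF J] by auto
 let ?F = "{?c v | v. v : carrier R & v ~: J}"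
 have "?c \<one> : ?F" using one by auto
 moreover have "ideal I R" if "I : ?F" for I using that adj_eq_colon_mem[OF J] by auto
 ultimately have "EX M:?F. ?c \<one> <= M & (ALL J:?F. M <= J --> J = M)" by (rule ideal_maximal_exists)
 then obtain M where M: "M : ?F" "ALL J:?F. M <= J --> J = M" by (elim bexE conjE)
 then obtain v where v: "v : carrier R" "v ~: J" "M = ?c v" by auto
 have "primeideal (?c v) R"
 proof (rule primeidealI)
  show "ideal (?c v) R" by (rule adj_eq_colon_mem[OF J v(1)])
  show "carrier R ~= ?c v" using v by (metis (mono_tags, lifting) l_one mem_Collect_eq one_closed)
  fix a b assume ab: "a : carrier R" "b : carrier R" "a \<otimes> b : ?c v"
  show "a : ?c v \<or> b : ?c v"
  proof (rule ccontr)
   assume neg: "\<not> ?thesis"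
   then have bv: "b \<otimes> v : carrier R" "b \<otimes> v ~: J" using ab v by auto
   have "?c v <= ?c (b \<otimes> v)"
   proof
    fix x assume "x : ?c v"
    then have x: "x : carrier R" "x \<otimes> v : J" by auto
    have "x \<otimes> (b \<otimes> v) = b \<otimes> (x \<otimes> v)" using x ab v by algebra
    then show "x : ?c (b \<otimes> v)" using x ab Jm(4) by auto
   qed
   then have "?c (b \<otimes> v) = ?c v" using M(2) bv v(3) by blast
   moreover have "a : ?c (b \<otimes> v)" using ab v by (simp add: m_assoc)
   ultimately show False using neg by auto
  qed
 qed (rule cring_axioms)
 then show thesis using that v by blast
qed

text \<open>Finite length at \<open>Q\<close>: a prime filtration has only factors \<open>R/Q\<close> and factors that die at \<open>Q\<close>.\<close>

lemma len_finite:
 assumes K: "subring K R" and Q: "primeideal Q R"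
  and gs: "set gs <= carrier R" "adjs K {\<zero>} gs = carrier R"
  and kill: "!!a. a : carrier R ==> a ~: Q ==> EX b:carrier R. a \<otimes> b : K - Q"
  and J: "ideal J R" and only: "!!P. primeideal P R ==> J <= P ==> P <= Q ==> P = Q"
 shows "len K Q J (carrier R) < \<infinity>"
proof (rule ccontr)
 assume inf: "\<not> ?thesis"
 let ?F = "{I. ideal I R & J <= I & len K Q I (carrier R) = \<infinity>}"
 have Kc: "K <= carrier R" using subringE(1)[OF K] .
 have JF: "J : ?F" using J inf by auto
 have "ideal I R" if "I : ?F" for I using that by auto
 from JF this have "EX M:?F. J <= M & (ALL I:?F. M <= I --> I = M)" by (rule ideal_maximal_exists)
 then obtain M where M: "M : ?F" "J <= M" "!!I. I : ?F ==> M <= I ==> I = M" by (elim bexE conjE) simp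
 have Mi: "ideal M R" using M by auto
 note Mm = submodD[OF submod_ideal[OF Mi subset_refl]]
 have "M ~= carrier R"
 proof
  assume "M = carrier R"
  then have "len K Q M (carrier R) <= enat 0 * 1"
   using len_adjs[OF K Q _ submod_carrier[OF K], of "[]" 1] by simp
  then show False using M by (simp add: zero_enat_def[symmetric])
 qed
 from this obtain v where v: "v : carrier R" "v ~: M" "primeideal {a : carrier R. a \<otimes> v : M} R"
  by (rule exists_prime_colon[OF Mi])
 let ?P = "{a : carrier R. a \<otimes> v : M}"
 let ?M' = "adj (carrier R) M v"
 have MM': "M <= ?M'" using adj_upper[OF carrier_is_subring submod_ideal[OF Mi subset_refl] v(1)] .
 have vM': "v : ?M'" using adj_mem[OF carrier_is_subring submod_ideal[OF Mi subset_refl] v(1)] .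
 have M'i: "ideal ?M' R" by (rule ideal_adj[OF Mi v(1)])
 have sM: "submod K M" "submod K ?M'" using Mi M'i submod_ideal Kc by auto
 have fin': "len K Q ?M' (carrier R) ~= \<infinity>"
 proof
  assume "len K Q ?M' (carrier R) = \<infinity>"
  then have "?M' : ?F" using M'i MM' M(1) by auto
  then show False using M(3)[OF _ MM'] vM' v(2) by simp
 qed
 let ?us = "map (%g. g \<otimes> v) gs"
 have us: "set ?us <= carrier R" using gs v by auto
 have sub: "?M' <= adjs K M ?us"
 proof -
  let ?W = "{a : carrier R. a \<otimes> v : adjs K M ?us}"
  note A = submodD[OF submod_adjs[OF K sM(1) us]]
  have Au: "M <= adjs K M ?us" "set ?us <= adjs K M ?us"
   using adjs_upper[OF K sM(1) us] adjs_mem[OF K sM(1) us] by auto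
  have "submod K ?W"
   unfolding submod_def using A v Kc by (auto simp: l_distr m_assoc subset_iff)
  then have "adjs K {\<zero>} gs <= ?W"
   by (rule adjs_least) (use A v gs Au in auto)
  then have "!!k. k : carrier R ==> k \<otimes> v : adjs K M ?us" using gs by auto
  then show ?thesis using A(3) Au by (auto elim!: adjE)
 qed
 have "len K Q M ?M' ~= \<infinity>"
 proof (cases "?P <= Q")
  case True
  have "x \<otimes> v : M" if "x : M" for x using that Mm(4)[of v x] Mm(5) v(1) by (simp add: m_comm)
  then have "J <= ?P" using M(2) Mm(1) by auto
  then have PQ: "?P = Q" using only[OF v(3) _ True] by simp
  have "len K Q M (adjs K M ?us) <= enat (length ?us) * 1"
  proof (rule len_adjs[OF K Q _ sM(1) us])
   fix L' u assume L': "submod K L'" "M <= L'" "u : set ?us"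
   then obtain g where g: "g : carrier R" "u = g \<otimes> v" using gs by auto
   show "len K Q L' (adj K L' u) <= 1"
   proof (rule len_line_le_1[OF K Q L'(1)])
    show "u : carrier R" using g v by auto
    fix c assume c: "c : K" "c : Q"
    then have "c : ?P" using PQ by simp
    then have "g \<otimes> (c \<otimes> v) : M" using Mm(4) g by auto
    moreover have "c \<otimes> u = g \<otimes> (c \<otimes> v)" using c Kc g v by (auto simp: subset_iff m_lcomm)
    ultimately show "c \<otimes> u : L'" using L' by auto
   qed
  qed
  moreover have "len K Q M ?M' <= len K Q M (adjs K M ?us)"
   using len_mono[OF sM(1) submod_adjs[OF K sM(1) us]] sub by simp
  ultimately show ?thesis by (metis enat_ord_simps(5) mult.right_neutral order_trans enat.distinct(2))
 next
  case False
  then obtain a where a: "a : carrier R" "a \<otimes> v : M" "a ~: Q" by auto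
  then obtain b where b: "b : carrier R" "a \<otimes> b : K - Q" using kill by blast
  have "len K Q M ?M' <= 0"
  proof (rule len_le)
   fix n assume c: "chn K Q n M ?M'"
   show "enat n <= 0"
   proof (cases n)
    case (Suc m)
    with c obtain U where U: "strict K Q M U" "chn K Q m U ?M'" by auto
    then have "U <= ?M'" using chn_submod by blast
    then obtain w where w: "w : ?M'" "(a \<otimes> b) \<otimes> w ~: M" using U(1) b by (auto simp: strict_def)
    then obtain m' k where mk: "m' : M" "k : carrier R" "w = m' \<oplus> k \<otimes> v" by (auto elim: adjE)
    have "(a \<otimes> b) \<otimes> w = (a \<otimes> b) \<otimes> m' \<oplus> (b \<otimes> k) \<otimes> (a \<otimes> v)"
     using a b mk Mm(5) v by algebra
    moreover have "(a \<otimes> b) \<otimes> m' \<oplus> (b \<otimes> k) \<otimes> (a \<otimes> v) : M"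
     using a b mk Mm(3,4) by auto
    ultimately show ?thesis using w by auto
   qed (simp add: zero_enat_def)
  qed
  then show ?thesis by auto
 qed
 moreover have "?M' <= carrier R" using submodD(1)[OF sM(2)] .
 ultimately have "len K Q M (carrier R) ~= \<infinity>"
  using len_add[OF K Q sM submod_carrier[OF K] MM'] fin' by auto
 then show False using M by auto
qed

end

section \<open>Frobenius and the degree of a residue field over its \<open>p\<close>-th powers\<close>

lemma (in cring) binomial_expansion:
 assumes x: "x : carrier R" and y: "y : carrier R"
 shows "(x \<oplus> y) [^] n = (\<Oplus>k\<in>{..n}. [(n choose k)] \<cdot> (x [^] k \<otimes> y [^] (n - k)))"
proof (induct n)
 case 0 show ?case using x y by (simp add: finsum_0)
next
 case (Suc n)
 let ?f = "%k. [(n choose k)] \<cdot> (x [^] k \<otimes> y [^] (n - k))"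
 let ?s = "%k. [(n choose k)] \<cdot> (x [^] Suc k \<otimes> y [^] (n - k))"
 let ?t = "%k. [(n choose k)] \<cdot> (x [^] k \<otimes> y [^] (Suc n - k))"
 have fc: "?f : {..m} \<rightarrow> carrier R" "?s : {..m} \<rightarrow> carrier R" "?t : {..m} \<rightarrow> carrier R" for m using x y by auto
 have "(x \<oplus> y) [^] Suc n = (\<Oplus>k\<in>{..n}. ?f k) \<otimes> x \<oplus> (\<Oplus>k\<in>{..n}. ?f k) \<otimes> y"
  using Suc x y fc(1)[of n] by (simp add: r_distr)
 also have "(\<Oplus>k\<in>{..n}. ?f k) \<otimes> x = (\<Oplus>k\<in>{..n}. ?f k \<otimes> x)"
  by (rule finsum_ldistr) (use x fc in auto)
 also have "\<dots> = (\<Oplus>k\<in>{..n}. ?s k)"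
  by (rule finsum_cong') (use x y in "auto simp: add_pow_ldistr add_pow_rdistr m_ac")
 also have "(\<Oplus>k\<in>{..n}. ?f k) \<otimes> y = (\<Oplus>k\<in>{..n}. ?f k \<otimes> y)"
  by (rule finsum_ldistr) (use y fc in auto)
 also have "\<dots> = (\<Oplus>k\<in>{..n}. ?t k)"
  by (rule finsum_cong') (use x y in "auto simp: add_pow_ldistr add_pow_rdistr m_ac Suc_diff_le")
 also have "(\<Oplus>k\<in>{..n}. ?t k) = (\<Oplus>k\<in>{..Suc n}. ?t k)"
  using finsum_Suc[OF fc(3), of n] x y finsum_closed[OF fc(3)] by (simp add: binomial_eq_0)
 also have "(\<Oplus>k\<in>{..Suc n}. ?t k) = (\<Oplus>k\<in>{..n}. ?t (Suc k)) \<oplus> ?t 0"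
  by (rule finsum_Suc2[OF fc(3)])
 also have "(\<Oplus>k\<in>{..n}. ?s k) \<oplus> ((\<Oplus>k\<in>{..n}. ?t (Suc k)) \<oplus> ?t 0)
   = ((\<Oplus>k\<in>{..n}. ?s k) \<oplus> (\<Oplus>k\<in>{..n}. ?t (Suc k))) \<oplus> ?t 0"
  by (rule a_assoc[symmetric]) (use x y in "auto intro!: finsum_closed")
 also have "(\<Oplus>k\<in>{..n}. ?s k) \<oplus> (\<Oplus>k\<in>{..n}. ?t (Suc k)) = (\<Oplus>k\<in>{..n}. ?s k \<oplus> ?t (Suc k))"
  by (rule finsum_addf[symmetric]) (use x y in auto)
 also have "(\<Oplus>k\<in>{..n}. ?s k \<oplus> ?t (Suc k))
   = (\<Oplus>k\<in>{..n}. [(Suc n choose Suc k)] \<cdot> (x [^] Suc k \<otimes> y [^] (Suc n - Suc k)))"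
  by (rule finsum_cong') (use x y in "auto simp: add.nat_pow_mult")
 also have "\<dots> \<oplus> ?t 0 = (\<Oplus>k\<in>{..Suc n}. [(Suc n choose k)] \<cdot> (x [^] k \<otimes> y [^] (Suc n - k)))"
  by (subst finsum_Suc2) (use x y in auto)
 finally show ?case .
qed

lemma enat_le_cancel: "f ~= \<infinity> ==> (f :: enat) <= g ==> g + t = h + f ==> t <= h"
 by (cases f; cases g; cases t; cases h) auto

locale charp = cring R for R (structure) +
 fixes p :: nat
 assumes prime_p: "Factorial_Ring.prime p" and char_p: "[p] \<cdot> \<one> = \<zero>"
begin

lemma p_pos: "0 < p" "1 < p" "2 <= p"
 using prime_p prime_gt_0_nat prime_gt_1_nat prime_ge_2_nat by auto

lemma p_mult_zero: "x : carrier R ==> [p] \<cdot> x = \<zero>"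
 using add_pow_ldistr[of \<one> x p] char_p by simp

lemma p_dvd_mult_zero: "x : carrier R ==> p dvd k ==> [k] \<cdot> x = \<zero>"
 using p_mult_zero add.nat_pow_pow[of x p] by (auto elim!: dvdE simp: mult.commute)

lemma frob_add:
 assumes x: "x : carrier R" and y: "y : carrier R"
 shows "(x \<oplus> y) [^] p = x [^] p \<oplus> y [^] p"
proof -
 let ?f = "%k. [(p choose k)] \<cdot> (x [^] k \<otimes> y [^] (p - k))"
 have "(x \<oplus> y) [^] p = (\<Oplus>k\<in>{..p}. ?f k)" by (rule binomial_expansion[OF x y])
 also have "\<dots> = (\<Oplus>k\<in>{0,p}. ?f k)"
 proof (rule add.finprod_mono_neutral_cong_right)
  fix k assume k: "k : {..p} - {0,p}"
  then have "p dvd (p choose k)" using prime_p by (intro dvd_choose_prime) auto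
  then show "?f k = \<zero>" using p_dvd_mult_zero x y by auto
 qed (use x y in auto)
 also have "\<dots> = x [^] p \<oplus> y [^] p" using x y p_pos by (simp add: add.finprod_insert a_comm)
 finally show ?thesis .
qed

lemma frob_mult: "x : carrier R ==> y : carrier R ==> (x \<otimes> y) [^] p = x [^] p \<otimes> y [^] p"
 by (rule nat_pow_distrib)

lemma frob_zero: "\<zero> [^] p = \<zero>"
 using p_pos by (simp add: nat_pow_zero)

lemma frob_neg: "x : carrier R ==> (\<ominus> x) [^] p = \<ominus> (x [^] p)"
 using frob_add[of "x" "\<ominus> x"] frob_zero by (simp add: r_neg) (metis a_inv_closed minus_equality nat_pow_closed a_comm)

abbreviation Kp where "Kp \<equiv> frob_image p R"

lemma Kp_subring: "subring Kp R"
proof (rule subringI)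
 show "Kp <= carrier R" by (auto simp: frob_image_def)
 show "\<one> : Kp" unfolding frob_image_def by (rule image_eqI[of _ _ \<one>]) auto
 fix h assume "h : Kp"
 then obtain a where a: "a : carrier R" "h = a [^] p" by (auto simp: frob_image_def)
 show "\<ominus> h : Kp" unfolding frob_image_def by (rule image_eqI[of _ _ "\<ominus> a"]) (use a frob_neg in auto)
 fix k assume "k : Kp"
 then obtain b where b: "b : carrier R" "k = b [^] p" by (auto simp: frob_image_def)
 show "h \<otimes> k : Kp" unfolding frob_image_def by (rule image_eqI[of _ _ "a \<otimes> b"]) (use a b frob_mult in auto)
 show "h \<oplus> k : Kp" unfolding frob_image_def by (rule image_eqI[of _ _ "a \<oplus> b"]) (use a b frob_add in auto)
qed

lemma KpI: "a : carrier R ==> a [^] p : Kp" by (auto simp: frob_image_def)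

lemma KpE: assumes "k : Kp" obtains a where "a : carrier R" "k = a [^] p"
 using assms by (auto simp: frob_image_def)

lemma Kp_carrier: "k : Kp ==> k : carrier R" "Kp <= carrier R"
 using subringE(1)[OF Kp_subring] by auto

lemma prime_pow:
 assumes Q: "primeideal Q R" and a: "a : carrier R" "a [^] (n::nat) : Q" shows "a : Q"
 using a(2)
proof (induct n)
 case 0 then show ?case using one_notin_prime[OF Q] by simp
next
 case (Suc n)
 then have "a [^] n : Q \<or> a : Q" using primeideal.I_prime[OF Q, of "a [^] n" a] a(1) by simp
 then show ?case using Suc by blast
qed

lemma prime_frob: "primeideal Q R ==> a : carrier R ==> a [^] p : Q \<longleftrightarrow> a : Q"
proof
 assume Q: "primeideal Q R" and a: "a : carrier R" "a : Q"
 have "a [^] p = a [^] (p - 1) \<otimes> a" using p_pos a by (metis Suc_diff_1 nat_pow_Suc)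
 then show "a [^] p : Q" using ideal.I_l_closed[OF primeideal.axioms(1)[OF Q]] a by auto
qed (rule prime_pow)

text \<open>\<open>R\<^sup>p / (Q \<inter> R\<^sup>p) = (R/Q)\<^sup>p\<close>, so this is the degree \<open>[k(Q) : k(Q)\<^sup>p]\<close> for the residue field \<open>k(Q)\<close>.\<close>

definition rho :: "'a set => enat" where "rho Q = len Kp Q Q (carrier R)"

lemma Kp_kill: "primeideal Q R ==> a : carrier R ==> a ~: Q ==> EX b:carrier R. a \<otimes> b : Kp - Q"
 using prime_frob[of Q a] KpI[of a] p_pos by (intro bexI[of _ "a [^] (p - 1)"])
  (auto simp: nat_pow_Suc2[symmetric] simp del: nat_pow_Suc)

text \<open>A maximal chain is spanned by the vectors that witness its steps.\<close>

lemma chn_witnesses: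
 assumes K: "subring K R"
 shows "chn K Q n L M ==>
  EX us. length us = n & set us <= M & (ALL L'. submod K L' --> L' <= L --> chn K Q n L' (adjs K L' us))"
proof (induct n arbitrary: L)
 case 0 then show ?case by auto
next
 case (Suc n)
 then obtain U where U: "submod K L" "L <= U" "strict K Q L U" "chn K Q n U M" by auto
 obtain us where us: "length us = n" "set us <= M"
  "!!L'. submod K L' ==> L' <= U ==> chn K Q n L' (adjs K L' us)"
  using Suc(1)[OF U(4)] by auto
 have sU: "submod K U" "U <= M" using chn_submod[OF U(4)] by auto
 obtain v where v: "v : U" "!!a. a : K - Q ==> a \<otimes> v ~: L" using U by (auto simp: strict_def)
 have vc: "v : carrier R" using v submodD(5)[OF sU(1)] by auto
 show ?case
 proof (intro exI[of _ "v # us"] conjI allI impI)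
  fix L' assume L': "submod K L'" "L' <= L"
  show "chn K Q (Suc n) L' (adjs K L' (v # us))"
  proof (rule chn_SucI[OF L'(1) adj_upper[OF K L'(1) vc]])
   show "strict K Q L' (adj K L' v)"
    using v(2) L' adj_mem[OF K L'(1) vc] by (auto simp: strict_def)
   show "chn K Q n (adj K L' v) (adjs K L' (v # us))"
    using us(3)[OF submod_adj[OF K L'(1) vc]] adj_least[OF sU(1) _ v(1)] L' U(2) by auto
  qed
 qed (use us v sU in auto)
qed

end

locale charp_noeth = charp R p + noeth_cring R for R (structure) and p +
 fixes gs :: "'a list"
 assumes gs: "set gs <= carrier R" "adjs Kp {\<zero>} gs = carrier R"
begin

lemma submod_Kp: "ideal I R ==> submod Kp I"
 by (rule submod_ideal) (auto simp: Kp_carrier)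

lemma rho_pos:
 assumes Q: "primeideal Q R" shows "1 <= rho Q"
proof -
 have "chn Kp Q (Suc 0) Q (carrier R)"
 proof (rule chn_SucI)
  show "strict Kp Q Q (carrier R)"
   unfolding strict_def by (rule bexI[of _ \<one>]) (auto simp: Kp_carrier)
 qed (use submod_Kp[OF primeideal.axioms(1)[OF Q]] submodD(1) submod_carrier[OF Kp_subring] in auto)
 then show ?thesis unfolding rho_def using len_ge by (force simp: one_enat_def)
qed

lemma rho_le_gens:
 assumes Q: "primeideal Q R" and us: "set us <= carrier R" "carrier R <= adjs Kp Q us"
 shows "rho Q <= enat (length us)"
proof -
 have Qi: "ideal Q R" using primeideal.axioms(1)[OF Q] .
 have "rho Q <= len Kp Q Q (adjs Kp Q us)"
  unfolding rho_def by (rule len_mono) (use us submod_Kp[OF Qi] submod_adjs[OF Kp_subring] in auto)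
 also have "\<dots> <= enat (length us) * 1"
 proof (rule len_adjs[OF Kp_subring Q _ submod_Kp[OF Qi] us(1)])
  fix L' u assume L': "submod Kp L'" "Q <= L'" "u : set us"
  show "len Kp Q L' (adj Kp L' u) <= 1"
   by (rule len_line_le_1[OF Kp_subring Q L'(1)])
    (use L' us ideal.I_r_closed[OF Qi] subsetD[OF L'(2)] in auto)
 qed
 finally show ?thesis by simp
qed

lemma rho_finite: assumes Q: "primeideal Q R" shows "rho Q <= enat (length gs)"
proof (rule rho_le_gens[OF Q gs(1)])
 have "submod Kp Q" using submod_Kp primeideal.axioms(1)[OF Q] .
 then show "carrier R <= adjs Kp Q gs" using adjs_mono[of "{\<zero>}" Q Kp gs] submodD(2) gs by auto
qed

lemma len_mult_rho:
 assumes Q: "primeideal Q R"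
 shows "chn (carrier R) Q n L M ==> enat n * rho Q <= len Kp Q L M"
proof (induct n arbitrary: L)
 case (Suc n)
 have Qi: "ideal Q R" using primeideal.axioms(1)[OF Q] .
 from Suc(2) obtain U where U: "submod (carrier R) L" "L <= U" "strict (carrier R) Q L U" "chn (carrier R) Q n U M" by auto
 have sU: "submod (carrier R) U" "submod (carrier R) M" "U <= M" using chn_submod[OF U(4)] by auto
 note s = U(1)[THEN submod_mono, OF Kp_carrier(2)] sU(1,2)[THEN submod_mono, OF Kp_carrier(2)]
 obtain v where v: "v : U" "!!a. a : carrier R - Q ==> a \<otimes> v ~: L" using U by (auto simp: strict_def)
 have vc: "v : carrier R" using v submodD(5)[OF sU(1)] by auto
 have "rho Q <= len Kp Q L U"
  unfolding rho_def
  by (rule len_push[OF Kp_subring Kp_subring s(1,2) U(2), where g="%w. w \<otimes> v" and \<sigma>="%c. c"])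
   (use v vc submodD(4)[OF sU(1)] in "auto simp: l_distr m_assoc Kp_carrier submod_carrier[OF Kp_subring]")
 moreover have "enat n * rho Q <= len Kp Q U M" by (rule Suc(1)[OF U(4)])
 ultimately have "rho Q + enat n * rho Q <= len Kp Q L M"
  using len_add[OF Kp_subring Q s(1,2,3) U(2) sU(3)] by (metis add_mono)
 moreover have "enat (Suc n) * rho Q = rho Q + enat n * rho Q"
  by (simp add: eSuc_enat[symmetric] mult_eSuc del: eSuc_enat)
 ultimately show ?case by simp
qed (simp add: zero_enat_def[symmetric])

text \<open>For \<open>y \<in> Q - P\<close> let \<open>D\<close> be the length of \<open>R / (P + yR)\<close> at \<open>Q\<close>, and count the length of
 \<open>R / (P + y\<^sup>pR)\<close> at \<open>Q\<close> over \<open>R\<^sup>p\<close> in two ways. The filtration by powers of \<open>y\<close> gives at least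
 \<open>p \<rho>(Q) D\<close>. On the other hand \<open>\<rho>(P)\<close> elements span \<open>R/P\<close> over \<open>R\<^sup>p\<close> up to torsion, and each of them
 contributes at most \<open>D\<close>.\<close>

lemma rho_adjacent:
 assumes P: "primeideal P R" and Q: "primeideal Q R" and PQ: "P <= Q" "P ~= Q"
  and adjacent: "!!P'. primeideal P' R ==> P <= P' ==> P' <= Q ==> P' ~= P ==> P' = Q"
 shows "enat p * rho Q <= rho P"
proof -
 interpret Pp: primeideal P R by (rule P)
 have Pi: "ideal P R" and Qi: "ideal Q R" using primeideal.axioms(1)[OF P] primeideal.axioms(1)[OF Q] .
 note C = carrier_is_subring and Pm = submodD[OF submod_ideal[OF Pi subset_refl]]
 obtain y where y: "y : Q" "y ~: P" using PQ by auto
 have yc: "y : carrier R" using y Qi by (simp add: ideal.Icarr)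
 define PY where "PY = (%z. adj (carrier R) P z)"
 have PYi: "ideal (PY z) R" if "z : carrier R" for z unfolding PY_def by (rule ideal_adj[OF Pi that])
 have PYm: "submod (carrier R) (PY z)" "submod Kp (PY z)" if "z : carrier R" for z
  using PYi[OF that] submod_ideal submod_Kp by auto
 have PsubPY: "P <= PY z" "z : PY z" if "z : carrier R" for z
  unfolding PY_def using adj_upper[OF C submod_ideal[OF Pi subset_refl] that] adj_mem[OF C submod_ideal[OF Pi subset_refl] that] by auto
 have PYle: "PY z <= I" if "ideal I R" "P <= I" "z : I" for z I
  unfolding PY_def by (rule adj_least[OF submod_ideal[OF that(1) subset_refl] that(2,3)])
 have only: "P' = Q" if "primeideal P' R" "PY z <= P'" "P' <= Q" "z : carrier R" "z ~: P" for P' z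
  using adjacent[OF that(1) _ that(3)] PsubPY[OF that(4)] that by auto
 have pw: "y [^] (i::nat) : carrier R" "y [^] (i::nat) ~: P" for i using yc y prime_pow[OF P yc] by auto
 define D where "D = len (carrier R) Q (PY y) (carrier R)"
 have Dfin: "D < \<infinity>"
  unfolding D_def
 proof (rule len_finite[OF C Q, of "[\<one>]"])
  show "adjs (carrier R) {\<zero>} [\<one>] = carrier R" by (force simp: adj_def ssum_def)
  show "EX b:carrier R. a \<otimes> b : carrier R - Q" if "a : carrier R" "a ~: Q" for a
   using that by (intro bexI[of _ \<one>]) auto
 qed (use PYi[OF yc] only[OF _ _ _ yc y(2)] in auto)
 have D1: "1 <= D"
 proof -
  have "PY y <= Q" by (rule PYle[OF Qi PQ(1) y(1)])
  then have "strict (carrier R) Q (PY y) (carrier R)"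
   unfolding strict_def by (intro bexI[of _ \<one>]) auto
  then have "chn (carrier R) Q (Suc 0) (PY y) (carrier R)"
   by (rule chn_SucI[OF PYm(1)[OF yc], rotated]) (use PYm(1)[OF yc] submodD(1) submod_carrier[OF C] in auto)
  then show ?thesis unfolding D_def using len_ge by (force simp: one_enat_def)
 qed
 obtain d where d: "D = enat d" using Dfin by auto
 let ?l = "len Kp Q"
 \<comment> \<open>the lower bound \<open>p \<rho>(Q) D\<close>\<close>
 have lower1: "D * rho Q <= ?l (PY y) (carrier R)"
 proof -
  have "chn (carrier R) Q d (PY y) (carrier R)"
   by (rule chn_if_le_len[OF PYm(1)[OF yc] submod_carrier[OF C]]) (use PYm(1)[OF yc] submodD(1) d D_def in auto)
  then show ?thesis using len_mult_rho[OF Q] d by simp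
 qed
 have lower2: "enat i * ?l (PY y) (carrier R) <= ?l (PY (y [^] i)) (carrier R)" for i
 proof (induct i)
  case 0 show ?case by (simp add: zero_enat_def[symmetric])
 next
  case (Suc i)
  have sub: "PY (y [^] Suc i) <= PY (y [^] i)"
  proof (rule PYle[OF PYi[OF pw(1)] PsubPY(1)[OF pw(1)]])
   show "y [^] Suc i : PY (y [^] i)"
    using submodD(4)[OF PYm(1)[OF pw(1)] yc PsubPY(2)[OF pw(1)[of i]]] yc by (simp add: m_comm)
  qed
  have "?l (PY y) (carrier R) <= ?l (PY (y [^] Suc i)) (PY (y [^] i))"
  proof (rule len_push[OF Kp_subring Kp_subring PYm(2)[OF pw(1)] PYm(2)[OF pw(1)] sub, where g="%a. a \<otimes> y [^] i" and \<sigma>="%c. c"])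
   show "(%a. a \<otimes> y [^] i) ` carrier R <= PY (y [^] i)"
    using submodD(4)[OF PYm(1)[OF pw(1)] _ PsubPY(2)[OF pw(1)[of i]]] by auto
   fix a assume a: "a : carrier R" "a \<otimes> y [^] i : PY (y [^] Suc i)"
   then obtain q k where qk: "q : P" "k : carrier R" "a \<otimes> y [^] i = q \<oplus> k \<otimes> y [^] Suc i"
    unfolding PY_def by (auto elim: adjE)
   have qc: "q : carrier R" using qk Pm(5) by auto
   have "(a \<ominus> k \<otimes> y) \<otimes> y [^] i = a \<otimes> y [^] i \<ominus> k \<otimes> (y [^] i \<otimes> y)"
    using a qk(2) yc pw(1)[of i] by algebra
   also have "\<dots> = (q \<oplus> k \<otimes> (y [^] i \<otimes> y)) \<ominus> k \<otimes> (y [^] i \<otimes> y)" using qk(3) by simp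
   also have "\<dots> = q" using qc qk(2) yc pw(1)[of i] by algebra
   finally have "(a \<ominus> k \<otimes> y) \<otimes> y [^] i : P" using qk by simp
   then have "a \<ominus> k \<otimes> y : P" using Pp.I_prime[of "a \<ominus> k \<otimes> y" "y [^] i"] a qk(2) yc pw[of i] by auto
   then have "(a \<ominus> k \<otimes> y) \<oplus> k \<otimes> y : PY y" unfolding PY_def by (rule adjI[OF _ qk(2)])
   moreover have "(a \<ominus> k \<otimes> y) \<oplus> k \<otimes> y = a" using a qk(2) yc by algebra
   ultimately show "a : PY y" by simp
  qed (use pw(1) in "auto simp: l_distr m_assoc Kp_carrier submod_carrier[OF Kp_subring]")
  then have "?l (PY y) (carrier R) + enat i * ?l (PY y) (carrier R) <= ?l (PY (y [^] Suc i)) (carrier R)"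
   using Suc len_add[OF Kp_subring Q PYm(2)[OF pw(1)] PYm(2)[OF pw(1)] submod_carrier[OF Kp_subring] sub submodD(1)[OF PYm(1)[OF pw(1)]]]
   by (metis add_mono)
  moreover have "enat (Suc i) * ?l (PY y) (carrier R) = ?l (PY y) (carrier R) + enat i * ?l (PY y) (carrier R)"
   by (simp add: eSuc_enat[symmetric] mult_eSuc del: eSuc_enat)
  ultimately show ?case by simp
 qed
 \<comment> \<open>a submodule \<open>F\<close> spanned by \<open>\<rho>(P)\<close> elements that is everything away from a hypersurface\<close>
 obtain n where n: "rho P = enat n" using rho_finite[OF P] by (metis enat_ile)
 have "chn Kp P n P (carrier R)"
  by (rule chn_if_le_len[OF submod_Kp[OF Pi] submod_carrier[OF Kp_subring] Pm(1)]) (simp add: n[symmetric] rho_def)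
 then obtain us where us: "length us = n" "set us <= carrier R" "chn Kp P n P (adjs Kp P us)"
  using chn_witnesses[OF Kp_subring] submod_Kp[OF Pi] by blast
 define F where "F = adjs Kp P us"
 have sF: "submod Kp F" "P <= F" unfolding F_def
  using submod_adjs[OF Kp_subring submod_Kp[OF Pi] us(2)] adjs_upper[OF Kp_subring submod_Kp[OF Pi] us(2)] by auto
 have c1: "EX c:Kp - P. c \<otimes> a : F" if a: "a : carrier R" for a
 proof (rule ccontr)
  assume neg: "\<not> ?thesis"
  have "chn Kp P (Suc 0) F (adj Kp F a)"
  proof (rule chn_SucI[OF sF(1) adj_upper[OF Kp_subring sF(1) a]])
   show "strict Kp P F (adj Kp F a)" using neg adj_mem[OF Kp_subring sF(1) a] by (auto simp: strict_def)
  qed (use submod_adj[OF Kp_subring sF(1) a] in auto)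
  then have "chn Kp P (n + Suc 0) P (adj Kp F a)" using chn_concat us(3) F_def by blast
  then have "chn Kp P (Suc n) P (carrier R)"
   using chn_weaken[of Kp P "Suc n" P "adj Kp F a" P "carrier R"] submod_Kp[OF Pi] submod_carrier[OF Kp_subring]
    submodD(1)[OF submod_adj[OF Kp_subring sF(1) a]] by simp
  then have "enat (Suc n) <= rho P" unfolding rho_def by (rule len_ge)
  then show False using n by simp
 qed
 have "EX c:Kp - P. ALL a:set as. c \<otimes> a : F" if "set as <= carrier R" for as
  using that
 proof (induct as)
  case Nil
  show ?case using subringE(3)[OF Kp_subring] one_notin_prime[OF P] by auto
 next
  case (Cons a as)
  then obtain c where c: "c : Kp - P" "ALL a:set as. c \<otimes> a : F" by auto
  obtain c' where c': "c' : Kp - P" "c' \<otimes> a : F" using c1[of a] Cons by auto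
  have cc: "c : carrier R" "c' : carrier R" "a : carrier R" using c c' Cons Kp_carrier by auto
  have "c \<otimes> c' : Kp - P" using c c' cc subringE(6)[OF Kp_subring] Pp.I_prime[of c c'] by auto
  moreover have "(c \<otimes> c') \<otimes> b : F" if "b : set (a # as)" for b
  proof -
   have b: "b : carrier R" using that Cons by auto
   have "(c \<otimes> c') \<otimes> b = c \<otimes> (c' \<otimes> b)" "(c \<otimes> c') \<otimes> b = c' \<otimes> (c \<otimes> b)" using cc b by (simp_all add: m_assoc m_lcomm)
   then show ?thesis using that c c' submodD(4)[OF sF(1)] by (metis DiffD1 set_ConsD)
  qed
  ultimately show ?case by blast
 qed
 then obtain c where c: "c : Kp - P" "!!a. a : set gs ==> c \<otimes> a : F" using gs by blast
 have cc: "c : carrier R" using c Kp_carrier by auto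
 have cF: "c \<otimes> a : F" if "a : carrier R" for a
 proof -
  have "submod Kp {a : carrier R. c \<otimes> a : F}"
   unfolding submod_def using submodD[OF sF(1)] cc by (auto simp: r_distr m_lcomm Kp_carrier subset_iff)
  then have "adjs Kp {\<zero>} gs <= {a : carrier R. c \<otimes> a : F}"
   by (rule adjs_least) (use submodD(2)[OF sF(1)] cc c gs in auto)
  then show ?thesis using gs that by auto
 qed
 have Fc: "F <= carrier R" using submodD(1)[OF sF(1)] .
 have PYcF: "PY c <= F" unfolding PY_def adj_def
  by (rule ssum_least[OF sF]) (use cF cc in "auto simp: m_comm")
 have "?l (PY c) (carrier R) < \<infinity>"
  by (rule len_finite[OF Kp_subring Q gs Kp_kill[OF Q] PYi[OF cc]]) (use only[OF _ _ _ cc] c in auto)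
 then have Ffin: "?l F (carrier R) ~= \<infinity>"
  using len_mono[OF PYm(2)[OF cc] submod_carrier[OF Kp_subring] PYcF subset_refl, of Q] by (cases "?l F (carrier R)") auto
 \<comment> \<open>the upper bound \<open>\<rho>(P) D\<close>\<close>
 let ?y = "y [^] p"
 have yK: "?y : Kp" using KpI[OF yc] .
 define G where "G = ssum P ((%f. f \<otimes> ?y) ` F)"
 have sI: "submod Kp ((%f. f \<otimes> ?y) ` F)"
  by (rule submod_gimage[OF sF(1), where \<sigma>="%c. c"]) (use submodD(5)[OF sF(1)] pw Kp_carrier in "auto simp: l_distr m_assoc")
 have sG: "submod Kp G" unfolding G_def by (rule submod_ssum[OF Kp_carrier(2) submod_Kp[OF Pi] sI])
 have PG: "P <= G" unfolding G_def by (rule ssum_upper1[OF sI Pm(1)])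
 have yFG: "f \<otimes> ?y : G" if "f : F" for f
  using ssumI[OF Pm(2), of "f \<otimes> ?y"] that submodD(5)[OF sF(1) that] pw unfolding G_def by auto
 have GF: "G <= F"
  unfolding G_def by (rule ssum_least[OF sF]) (use submodD(4)[OF sF(1) yK] submodD(5)[OF sF(1)] pw in "auto simp: m_comm")
 have GPY: "G <= PY ?y"
  unfolding G_def PY_def adj_def by (rule ssum_mono) (use submodD(5)[OF sF(1)] in auto)
 have "?l F (carrier R) <= ?l G (PY ?y)"
 proof (rule len_push[OF Kp_subring Kp_subring sG PYm(2)[OF pw(1)] GPY, where g="%a. a \<otimes> ?y" and \<sigma>="%c. c"])
  show "(%a. a \<otimes> ?y) ` carrier R <= PY ?y"
   using submodD(4)[OF PYm(1)[OF pw(1)] _ PsubPY(2)[OF pw(1)]] by auto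
  fix a assume a: "a : carrier R" "a \<otimes> ?y : G"
  then obtain q f where qf: "q : P" "f : F" "a \<otimes> ?y = q \<oplus> f \<otimes> ?y"
   unfolding G_def by (auto elim!: ssumE)
  have cs: "q : carrier R" "f : carrier R" using qf Pm(5) Fc by auto
  have "(a \<ominus> f) \<otimes> ?y = a \<otimes> ?y \<ominus> f \<otimes> ?y" using a cs pw(1)[of p] by algebra
  also have "\<dots> = q" unfolding qf(3) using cs pw(1)[of p] by algebra
  finally have "(a \<ominus> f) \<otimes> ?y : P" using qf by simp
  then have "a \<ominus> f : P" using Pp.I_prime[of "a \<ominus> f" ?y] a cs pw[of p] by auto
  then have "(a \<ominus> f) \<oplus> f : F" using qf sF submodD(3)[OF sF(1)] by auto
  moreover have "(a \<ominus> f) \<oplus> f = a" using a cs by algebra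
  ultimately show "a : F" by simp
 qed (use pw(1) in "auto simp: l_distr m_assoc Kp_carrier submod_carrier[OF Kp_subring]")
 moreover have "?l G (PY ?y) + ?l (PY ?y) (carrier R) = ?l G F + ?l F (carrier R)"
  using len_add[OF Kp_subring Q sG PYm(2)[OF pw(1)] submod_carrier[OF Kp_subring] GPY submodD(1)[OF PYm(1)[OF pw(1)]]]
   len_add[OF Kp_subring Q sG sF(1) submod_carrier[OF Kp_subring] GF Fc] by simp
 ultimately have up1: "?l (PY ?y) (carrier R) <= ?l G F"
  using enat_le_cancel[OF Ffin] by simp
 have "?l G F <= ?l G (adjs Kp G us)"
  by (rule len_mono[OF sG submod_adjs[OF Kp_subring sG us(2)] subset_refl]) (simp add: F_def adjs_mono PG)
 also have "\<dots> <= enat (length us) * D"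
 proof (rule len_adjs[OF Kp_subring Q _ sG us(2)])
  fix L' u assume L': "submod Kp L'" "G <= L'" and u: "u : set us"
  have uc: "u : carrier R" using u us by auto
  have uF: "u : F" unfolding F_def using adjs_mem[OF Kp_subring submod_Kp[OF Pi] us(2)] u by auto
  show "?l L' (adj Kp L' u) <= D"
   unfolding D_def
  proof (rule len_pull[OF Kp_subring L'(1) _ submod_carrier[OF C] PYm(1)[OF yc], where g="%a. a [^] p \<otimes> u" and \<sigma>="%c. c [^] p"])
   show "adj Kp L' u <= ssum L' ((%a. a [^] p \<otimes> u) ` carrier R)"
    unfolding adj_def frob_image_def image_image by simp
   fix a assume "a : PY y"
   then obtain q k where qk: "q : P" "k : carrier R" "a = q \<oplus> k \<otimes> y" unfolding PY_def by (auto elim: adjE)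
   have qc: "q : carrier R" using qk Pm(5) by auto
   have "a [^] p \<otimes> u = q [^] p \<otimes> u \<oplus> (k [^] p \<otimes> u) \<otimes> ?y"
    using qk qc yc uc by (simp add: frob_add frob_mult l_distr r_distr m_ac)
   moreover have "q [^] p \<otimes> u : L'"
    using prime_frob[OF P qc] qk ideal.I_r_closed[OF Pi _ uc] PG L' by auto
   moreover have "(k [^] p \<otimes> u) \<otimes> ?y : L'" using yFG submodD(4)[OF sF(1) KpI[OF qk(2)] uF] L' by auto
   ultimately show "a : carrier R & a [^] p \<otimes> u : L'" using submodD(3)[OF L'(1)] qk qc yc by auto
  qed (use uc KpI prime_frob[OF Q] in "auto simp: frob_add frob_mult l_distr m_assoc")
 qed
 finally have up2: "?l G F <= enat n * D" using us by simp
 have "enat p * (D * rho Q) <= enat n * D"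
  using mult_left_mono[OF lower1, of "enat p"] lower2[of p] up1 up2 by (meson order_trans zero_le)
 moreover obtain q where q: "rho Q = enat q" using rho_finite[OF Q] by (metis enat_ile)
 moreover have "1 <= d" using D1 d by (simp add: one_enat_def)
 ultimately have "p * (d * q) <= n * d" "1 <= d" using d by auto
 then have "d * (p * q) <= d * n" by (simp add: algebra_simps)
 then have "p * q <= n" using \<open>1 <= d\<close> by simp
 then show ?thesis using q n by simp
qed

end

section \<open>Nakayama's lemma and generators over the \<open>p\<close>-th powers\<close>

lemma (in cring) genideal_eq_adjs:
 assumes "set ws <= carrier R" shows "genideal R (set ws) = adjs (carrier R) {\<zero>} ws"
proof
 have z: "submod (carrier R) {\<zero>}" by (auto simp: submod_def)
 show "genideal R (set ws) <= adjs (carrier R) {\<zero>} ws"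
  by (rule genideal_minimal[OF ideal_submod[OF submod_adjs[OF carrier_is_subring z assms]] adjs_mem[OF carrier_is_subring z assms]])
 have i: "ideal (genideal R (set ws)) R" by (rule genideal_ideal[OF assms])
 show "adjs (carrier R) {\<zero>} ws <= genideal R (set ws)"
  by (rule adjs_least[OF submod_ideal[OF i subset_refl]])
   (use genideal_self[OF assms] submodD(2)[OF submod_ideal[OF i subset_refl]] in auto)
qed

lemma (in cring) adjs_adj_commute:
 assumes K: "subring K R" and U: "submod K U" and w: "w : carrier R" and ws: "set ws <= carrier R"
 shows "adjs K (adj K U w) ws = adj K (adjs K U ws) w"
proof
 have a: "submod K (adj K (adjs K U ws) w)" by (rule submod_adj[OF K submod_adjs[OF K U ws] w])
 have b: "adjs K U ws <= adj K (adjs K U ws) w" by (rule adj_upper[OF K submod_adjs[OF K U ws] w])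
 show "adjs K (adj K U w) ws <= adj K (adjs K U ws) w"
  by (rule adjs_least[OF a adj_mono[OF adjs_upper[OF K U ws]]])
   (use b adjs_mem[OF K U ws] in auto)
 have c: "submod K (adj K U w)" by (rule submod_adj[OF K U w])
 have "w : adjs K (adj K U w) ws" using adj_mem[OF K U w] adjs_upper[OF K c ws] by auto
 then show "adj K (adjs K U ws) w <= adjs K (adj K U w) ws"
  by (intro adj_least[OF submod_adjs[OF K c ws] adjs_mono[OF adj_upper[OF K U w]]])
qed

lemma (in cring) submod_sub_adj:
 assumes K: "K <= carrier R" and M: "submod K M" "M <= carrier R" and U: "submod K U" and us: "set us <= carrier R"
 shows "submod K (adjs M U us) & U <= adjs M U us & (ALL c:M. ALL u:set us. c \<otimes> u : adjs M U us)"
 using U us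
proof (induct us arbitrary: U)
 case (Cons u us)
 have u: "u : carrier R" using Cons by auto
 have s: "submod K ((%k. k \<otimes> u) ` M)"
  by (rule submod_gimage[OF M(1), where \<sigma>="%c. c"]) (use M(2) K u in "auto simp: l_distr m_assoc subset_iff")
 have a: "submod K (adj M U u)" unfolding adj_def by (rule submod_ssum[OF K Cons(2) s])
 have b: "U <= adj M U u" unfolding adj_def by (rule ssum_upper1[OF s submodD(1)[OF Cons(2)]])
 have c: "k \<otimes> u : adj M U u" if "k : M" for k
 proof -
  have "\<zero> \<oplus> k \<otimes> u : adj M U u" by (rule adjI[OF submodD(2)[OF Cons(2)] that])
  moreover have "k \<otimes> u : carrier R" using that M(2) u by auto
  ultimately show ?thesis by simp
 qed
 have IH: "submod K (adjs M (adj M U u) us) & adj M U u <= adjs M (adj M U u) us \<and>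
   (ALL c:M. ALL u':set us. c \<otimes> u' : adjs M (adj M U u) us)"
  using Cons(1)[OF a] Cons(3) by simp
 then show ?case using b c by auto
qed simp

lemma (in cring) adjs_subset:
 assumes W: "submod K' W" and U: "U <= W" and k: "!!k u. k : K ==> u : set us ==> k \<otimes> u : W"
 shows "adjs K U us <= W"
 using U k
proof (induct us arbitrary: U)
 case (Cons u us)
 have "adj K U u <= W" unfolding adj_def by (rule ssum_least[OF W Cons(2)]) (use Cons(3) in auto)
 then show ?case using Cons by auto
qed simp

locale local_cring = cring R for R (structure) +
 fixes \<mm> :: "'a set"
 assumes mm_ideal: "ideal \<mm> R" and mm_proper: "\<one> ~: \<mm>"
  and mm_unit: "a : carrier R ==> a ~: \<mm> ==> EX b:carrier R. a \<otimes> b = \<one>"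
begin

lemma mm_carrier: "c : \<mm> ==> c : carrier R" using mm_ideal by (simp add: ideal.Icarr)

lemma proper_sub_mm:
 assumes "ideal I R" "\<one> ~: I" shows "I <= \<mm>"
proof
 fix a assume a: "a : I"
 have ac: "a : carrier R" using ideal.Icarr[OF assms(1) a] .
 show "a : \<mm>"
 proof (rule ccontr)
  assume "a ~: \<mm>"
  then obtain b where "b : carrier R" "a \<otimes> b = \<one>" using mm_unit ac by auto
  then show False using ideal.I_r_closed[OF assms(1) a, of b] assms(2) by simp
 qed
qed

lemma mm_prime: "primeideal \<mm> R"
proof (rule primeidealI[OF mm_ideal cring_axioms])
 show "carrier R ~= \<mm>" using mm_proper by auto
 fix a b assume ab: "a : carrier R" "b : carrier R" "a \<otimes> b : \<mm>"
 show "a : \<mm> \<or> b : \<mm>"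
 proof (rule ccontr)
  assume "\<not> ?thesis"
  then obtain c where c: "c : carrier R" "a \<otimes> c = \<one>" and b: "b ~: \<mm>" using mm_unit ab by auto
  have "c \<otimes> (a \<otimes> b) = (a \<otimes> c) \<otimes> b" using ab(1,2) c(1) by algebra
  then have "b = c \<otimes> (a \<otimes> b)" using ab c(2) by simp
  then show False using ideal.I_l_closed[OF mm_ideal ab(3) c(1)] b by simp
 qed
qed

lemma mm_maximal: "maximalideal \<mm> R"
proof (rule maximalidealI[OF mm_ideal])
 show "carrier R ~= \<mm>" using mm_proper by auto
 fix J assume J: "ideal J R" "\<mm> <= J" "J <= carrier R"
 then show "J = \<mm> \<or> J = carrier R" using proper_sub_mm[OF J(1)] ideal.one_imp_carrier[OF J(1)] by auto
qed

lemma maximal_unique: "maximalideal M R ==> M = \<mm>"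
proof -
 assume M: "maximalideal M R"
 then have Mi: "ideal M R" and ne: "carrier R ~= M" by (auto simp: maximalideal_def maximalideal_axioms_def)
 then have "\<one> ~: M" using ideal.one_imp_carrier by blast
 then have "M <= \<mm>" by (rule proper_sub_mm[OF Mi])
 then show ?thesis
  using maximalideal.I_maximal[OF M mm_ideal] mm_proper ideal.Icarr[OF mm_ideal] by auto
qed

text \<open>Nakayama's lemma: \<open>N = U + (\<mm> \<inter> K) N\<close> forces \<open>N = U\<close>.\<close>

lemma nakayama_aux:
 assumes K: "subring K R" and un: "!!a. a : K ==> a ~: \<mm> ==> EX b:K. a \<otimes> b = \<one>"
 shows "submod K U ==> set us <= carrier R ==> set us <= adjs (K \<inter> \<mm>) U us ==> set us <= U"
proof (induct us arbitrary: U)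
 case (Cons u us)
 let ?M = "K \<inter> \<mm>"
 have Kc: "K <= carrier R" using subringE(1)[OF K] .
 have sM: "submod K ?M" by (intro submod_Int submod_self[OF K] submod_ideal[OF mm_ideal Kc])
 have Mc: "?M <= carrier R" using Kc by auto
 have u: "u : carrier R" "set us <= carrier R" using Cons by auto
 have sA: "submod K (adj K U u)" by (rule submod_adj[OF K Cons(2) u(1)])
 have "adj ?M U u <= adj K U u" unfolding adj_def by (rule ssum_mono) auto
 then have "adjs ?M (adj ?M U u) us <= adjs ?M (adj K U u) us" by (rule adjs_mono)
 then have us: "set us <= adj K U u" using Cons(1)[OF sA u(2)] Cons(4) by auto
 have W: "submod K (adj ?M U u)" "U <= adj ?M U u" "!!c. c : ?M ==> c \<otimes> u : adj ?M U u"
  using submod_sub_adj[OF Kc sM Mc Cons(2), of "[u]"] u by auto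
 have "adjs ?M (adj ?M U u) us <= adj ?M U u"
 proof (rule adjs_subset[OF W(1) subset_refl])
  fix c w assume c: "c : ?M" "w : set us"
  then obtain v k where vk: "v : U" "k : K" "w = v \<oplus> k \<otimes> u" using us adjE[of w K U u] by blast
  have "c \<otimes> w = c \<otimes> v \<oplus> (k \<otimes> c) \<otimes> u" using c vk u Kc submodD(5)[OF Cons(2)] by (auto simp: r_distr m_ac subset_iff)
  moreover have "c \<otimes> v : adj ?M U u" using W(2) submodD(4)[OF Cons(2)] c vk by auto
  moreover have "k \<otimes> c : ?M" using submodD(4)[OF sM] c vk by auto
  ultimately show "c \<otimes> w : adj ?M U u" using submodD(3)[OF W(1)] W(3) by auto
 qed
 then have "u : adj ?M U u" using Cons(4) by auto
 then obtain v k where vk: "v : U" "k : ?M" "u = v \<oplus> k \<otimes> u" by (auto elim: adjE)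
 have cc: "v : carrier R" "k : carrier R" using vk submodD(5)[OF Cons(2)] Mc by auto
 have k1: "\<one> \<ominus> k : K" using subringE(3,5,7)[OF K] vk by (auto simp: minus_eq)
 have "\<one> \<ominus> k ~: \<mm>"
 proof
  assume "\<one> \<ominus> k : \<mm>"
  then have "(\<one> \<ominus> k) \<oplus> k : \<mm>" using vk additive_subgroup.a_closed[OF ideal.axioms(1)[OF mm_ideal]] by auto
  moreover have "(\<one> \<ominus> k) \<oplus> k = \<one>" using cc by algebra
  ultimately show False using mm_proper by simp
 qed
 then obtain b where b: "b : K" "(\<one> \<ominus> k) \<otimes> b = \<one>" using un k1 by blast
 have bc: "b : carrier R" using b Kc by auto
 have "(\<one> \<ominus> k) \<otimes> u = u \<ominus> k \<otimes> u" using cc u by algebra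
 also have "\<dots> = (v \<oplus> k \<otimes> u) \<ominus> k \<otimes> u" using vk by simp
 also have "\<dots> = v" using cc u by algebra
 finally have e: "(\<one> \<ominus> k) \<otimes> u = v" .
 have "u = ((\<one> \<ominus> k) \<otimes> b) \<otimes> u" using b u by simp
 also have "\<dots> = b \<otimes> ((\<one> \<ominus> k) \<otimes> u)" using cc bc u by algebra
 finally have "u = b \<otimes> v" using e by simp
 then have uU: "u : U" using submodD(4)[OF Cons(2)] b vk by auto
 have "adj K U u <= U" by (rule adj_least[OF Cons(2) subset_refl uU])
 then show ?case using us uU by auto
qed simp

lemma nakayama:
 assumes K: "subring K R" and un: "!!a. a : K ==> a ~: \<mm> ==> EX b:K. a \<otimes> b = \<one>"
  and U: "submod K U" and us: "set us <= carrier R"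
  and gen: "!!W. submod K W ==> U <= W ==>
   (!!c a. c : K ==> c : \<mm> ==> a : adjs K {\<zero>} us ==> c \<otimes> a : W) ==> adjs K {\<zero>} us <= W"
 shows "adjs K {\<zero>} us <= U"
proof -
 let ?M = "K \<inter> \<mm>"
 have Kc: "K <= carrier R" using subringE(1)[OF K] .
 have sM: "submod K ?M" by (intro submod_Int submod_self[OF K] submod_ideal[OF mm_ideal Kc])
 have Mc: "?M <= carrier R" using Kc by auto
 have z: "submod K {\<zero>}" using Kc by (auto simp: submod_def)
 note W = submod_sub_adj[OF Kc sM Mc U us]
 have Wc: "submod K (adjs ?M U us)" using W by simp
 have "adjs K {\<zero>} us <= adjs ?M U us"
 proof (rule gen)
  fix c a assume c: "c : K" "c : \<mm>" and a: "a : adjs K {\<zero>} us"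
  have "submod K {a : carrier R. c \<otimes> a : adjs ?M U us}"
   unfolding submod_def using submodD[OF Wc] c Kc
   by (auto simp: r_distr m_lcomm subset_iff)
  then have "adjs K {\<zero>} us <= {a : carrier R. c \<otimes> a : adjs ?M U us}"
   by (rule adjs_least) (use submodD(2)[OF Wc] c Kc us W in auto)
  then show "c \<otimes> a : adjs ?M U us" using a by auto
 qed (use W in auto)
 then have "set us <= adjs ?M U us" using adjs_mem[OF K z us] by auto
 then have "set us <= U" using nakayama_aux[OF K un U us] by blast
 then show ?thesis by (intro adjs_least[OF U]) (use submodD(2)[OF U] in auto)
qed

end

lemma (in noeth_cring) ideal_list:
 assumes "ideal N R" obtains us where "set us <= carrier R" "N = adjs (carrier R) {\<zero>} us"
proof -
 obtain A where "A <= carrier R" "finite A" "N = Idl A" using finetely_gen[OF assms] by auto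
 moreover from this obtain us where "set us = A" using finite_list by auto
 ultimately show thesis using genideal_eq_adjs[of us] that by auto
qed

locale charp_local = charp_noeth R p gs + local_cring R \<mm> for R (structure) and p gs \<mm>
begin

lemma nakayama_ideal:
 assumes N: "ideal N R" and I: "ideal I R"
  and gen: "!!J. ideal J R ==> I <= J ==> (!!c a. c : \<mm> ==> a : N ==> c \<otimes> a : J) ==> N <= J"
 shows "N <= I"
proof -
 obtain us where us: "set us <= carrier R" "N = adjs (carrier R) {\<zero>} us" using ideal_list[OF N] .
 have "adjs (carrier R) {\<zero>} us <= I"
 proof (rule nakayama[OF carrier_is_subring mm_unit submod_ideal[OF I subset_refl] us(1)])
  fix W assume W: "submod (carrier R) W" "I <= W"
   "!!c a. c : carrier R ==> c : \<mm> ==> a : adjs (carrier R) {\<zero>} us ==> c \<otimes> a : W"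
  then show "adjs (carrier R) {\<zero>} us <= W"
   using gen[OF ideal_submod[OF W(1)] W(2)] us mm_carrier by simp
 qed auto
 then show ?thesis using us by simp
qed

lemma Kp_unit: "a : Kp ==> a ~: \<mm> ==> EX b:Kp. a \<otimes> b = \<one>"
proof -
 assume a: "a : Kp" "a ~: \<mm>"
 then obtain c where c: "c : carrier R" "a = c [^] p" by (auto elim: KpE)
 then have "c ~: \<mm>" using prime_frob[OF mm_prime] a by auto
 then obtain b where b: "b : carrier R" "c \<otimes> b = \<one>" using mm_unit c by auto
 then have "a \<otimes> b [^] p = \<one>" using c by (simp add: frob_mult[symmetric])
 then show ?thesis using KpI b by blast
qed

lemma len_adj_pow:
 assumes J: "ideal J R" and w: "w : carrier R"
 shows "len Kp \<mm> (adj (carrier R) J (w [^] (i::nat))) (carrier R) <= enat i * len Kp \<mm> (adj (carrier R) J w) (carrier R)"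
proof (induct i)
 case 0
 have "adj (carrier R) J (w [^] (0::nat)) = carrier R"
  using ideal.one_imp_carrier[OF ideal_adj[OF J one_closed]] adj_mem[OF carrier_is_subring submod_ideal[OF J subset_refl] one_closed] by simp
 moreover have "len Kp \<mm> (carrier R) (carrier R) <= enat 0 * 1"
  using len_adjs[OF Kp_subring mm_prime _ submod_carrier[OF Kp_subring], of "[]" 1] by simp
 ultimately show ?case by (simp add: zero_enat_def[symmetric])
next
 case (Suc i)
 let ?A = "%i. adj (carrier R) J (w [^] (i::nat))"
 have Ai: "ideal (?A i) R" for i using ideal_adj[OF J] w by simp
 have wA: "w [^] i : ?A i" "J <= ?A i" for i
  using adj_mem[OF carrier_is_subring submod_ideal[OF J subset_refl], of "w [^] i"]
   adj_upper[OF carrier_is_subring submod_ideal[OF J subset_refl], of "w [^] i"] w by auto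
 have sub: "?A (Suc i) <= ?A i"
  by (rule adj_least[OF submod_ideal[OF Ai subset_refl] wA(2)]) (use ideal.I_r_closed[OF Ai wA(1) w] in simp)
 have "len Kp \<mm> (?A (Suc i)) (?A i) <= len Kp \<mm> (adj (carrier R) J w) (carrier R)"
 proof (rule len_pull[OF Kp_subring submod_Kp[OF Ai] _ submod_carrier[OF Kp_subring] submod_Kp[OF ideal_adj[OF J w]], where g="%a. a \<otimes> w [^] i" and \<sigma>="%c. c"])
  show "?A i <= ssum (?A (Suc i)) ((%a. a \<otimes> w [^] i) ` carrier R)"
   unfolding adj_def[of _ _ "w [^] i"] by (rule ssum_mono[OF wA(2) subset_refl])
  fix d assume "d : adj (carrier R) J w"
  then obtain j k where jk: "j : J" "k : carrier R" "d = j \<oplus> k \<otimes> w" by (auto elim: adjE)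
  have jc: "j : carrier R" using jk ideal.Icarr[OF J] by simp
  have "d \<otimes> w [^] i = j \<otimes> w [^] i \<oplus> k \<otimes> w [^] Suc i" using jk jc w by (simp add: l_distr r_distr m_ac)
  moreover have "j \<otimes> w [^] i : J" using ideal.I_r_closed[OF J jk(1)] w by simp
  ultimately show "d : carrier R & d \<otimes> w [^] i : ?A (Suc i)" using adjI jk jc w by auto
 qed (use w in "auto simp: l_distr m_assoc Kp_carrier")
 then have "len Kp \<mm> (?A (Suc i)) (carrier R) <= len Kp \<mm> (adj (carrier R) J w) (carrier R) + enat i * len Kp \<mm> (adj (carrier R) J w) (carrier R)"
  using Suc len_add[OF Kp_subring mm_prime submod_Kp[OF Ai] submod_Kp[OF Ai] submod_carrier[OF Kp_subring] sub]
   submodD(1)[OF submod_Kp[OF Ai]] by (metis add_mono)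
 also have "\<dots> = enat (Suc i) * len Kp \<mm> (adj (carrier R) J w) (carrier R)"
  by (simp add: eSuc_enat[symmetric] mult_eSuc del: eSuc_enat)
 finally show ?case .
qed

lemma len_adjs_pow:
 "ideal J R ==> set ws <= carrier R ==>
 len Kp \<mm> (adjs (carrier R) J (map (%w. w [^] p) ws)) (carrier R)
  <= enat (p ^ length ws) * len Kp \<mm> (adjs (carrier R) J ws) (carrier R)"
proof (induct ws arbitrary: J)
 case Nil
 have "enat (Suc 0) = 1" by (simp add: one_enat_def)
 then show ?case by simp
next
 case (Cons w ws)
 have w: "w : carrier R" "set ws <= carrier R" using Cons by auto
 let ?C = "carrier R"
 note sJ = submod_ideal[OF Cons(2) subset_refl]
 have i1: "ideal (adj ?C J (w [^] p)) R" using ideal_adj[OF Cons(2)] w by simp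
 have i2: "ideal (adjs ?C J ws) R" by (rule ideal_submod[OF submod_adjs[OF carrier_is_subring sJ w(2)]])
 have "len Kp \<mm> (adjs ?C J (map (%w. w [^] p) (w # ws))) ?C
   <= enat (p ^ length ws) * len Kp \<mm> (adjs ?C (adj ?C J (w [^] p)) ws) ?C"
  using Cons(1)[OF i1 w(2)] by simp
 also have "adjs ?C (adj ?C J (w [^] p)) ws = adj ?C (adjs ?C J ws) (w [^] p)"
  by (rule adjs_adj_commute[OF carrier_is_subring sJ _ w(2)]) (use w in simp)
 also have "enat (p ^ length ws) * len Kp \<mm> (adj ?C (adjs ?C J ws) (w [^] p)) ?C
   <= enat (p ^ length ws) * (enat p * len Kp \<mm> (adj ?C (adjs ?C J ws) w) ?C)"
  by (rule mult_left_mono[OF len_adj_pow[OF i2 w(1)]]) simp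
 also have "adj ?C (adjs ?C J ws) w = adjs ?C J (w # ws)"
  using adjs_adj_commute[OF carrier_is_subring sJ w] by simp
 also have "enat (p ^ length ws) * (enat p * len Kp \<mm> (adjs ?C J (w # ws)) ?C) = enat (p ^ length (w # ws)) * len Kp \<mm> (adjs ?C J (w # ws)) ?C"
  by (simp add: mult.assoc[symmetric] mult.commute)
 finally show ?case .
qed

text \<open>The Frobenius has fibre \<open>R/\<mm>\<^sup>[\<^sup>p\<^sup>]\<close>, so by Nakayama the length of the latter bounds the number
 of generators of \<open>R\<close> over \<open>R\<^sup>p\<close>.\<close>

lemma few_generators:
 assumes ws: "set ws <= carrier R" "\<mm> = adjs (carrier R) {\<zero>} ws"
 obtains us where "set us <= carrier R" "adjs Kp {\<zero>} us = carrier R"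
  "enat (length us) <= enat (p ^ length ws) * rho \<mm>"
proof -
 let ?C = "carrier R"
 define M where "M = adjs ?C {\<zero>} (map (%w. w [^] p) ws)"
 have wsp: "set (map (%w. w [^] p) ws) <= ?C" using ws by auto
 have zi: "ideal {\<zero>} R" by (rule zeroideal)
 have Mi: "ideal M R" unfolding M_def by (rule ideal_submod[OF submod_adjs[OF carrier_is_subring submod_ideal[OF zi subset_refl] wsp]])
 have l: "len Kp \<mm> M ?C <= enat (p ^ length ws) * rho \<mm>"
  using len_adjs_pow[OF zi ws(1)] unfolding M_def rho_def ws(2)[symmetric] .
 obtain r where "rho \<mm> = enat r" using rho_finite[OF mm_prime] by (metis enat_ile)
 then obtain n where n: "len Kp \<mm> M ?C = enat n" using l by (metis enat_ile times_enat_simps(1))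
 note sM = submod_Kp[OF Mi] and sC = submod_carrier[OF Kp_subring]
 have "chn Kp \<mm> n M ?C"
  by (rule chn_if_le_len[OF sM sC submodD(1)[OF sM]]) (simp add: n)
 then obtain us where us: "length us = n" "set us <= ?C" "chn Kp \<mm> n M (adjs Kp M us)"
  using chn_witnesses[OF Kp_subring] sM by blast
 let ?F = "adjs Kp M us"
 have sF: "submod Kp ?F" by (rule submod_adjs[OF Kp_subring sM us(2)])
 have full: "?C <= ?F"
 proof
  fix a assume a: "a : ?C"
  show "a : ?F"
  proof (rule ccontr)
   assume neg: "a ~: ?F"
   have "chn Kp \<mm> (Suc 0) ?F (adj Kp ?F a)"
   proof (rule chn_SucI[OF sF adj_upper[OF Kp_subring sF a]])
    show "strict Kp \<mm> ?F (adj Kp ?F a)"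
     unfolding strict_def
    proof (rule bexI[OF _ adj_mem[OF Kp_subring sF a]], rule ballI, rule notI)
     fix c assume c: "c : Kp - \<mm>" "c \<otimes> a : ?F"
     then obtain b where b: "b : Kp" "c \<otimes> b = \<one>" using Kp_unit by auto
     have "b \<otimes> (c \<otimes> a) = (c \<otimes> b) \<otimes> a" using b c a Kp_carrier(1) by (simp add: m_ac)
     then have "a = b \<otimes> (c \<otimes> a)" using b a by simp
     then show False using submodD(4)[OF sF b(1) c(2)] neg by simp
    qed
   qed (use submod_adj[OF Kp_subring sF a] in auto)
   then have "chn Kp \<mm> (n + Suc 0) M (adj Kp ?F a)" using chn_concat us(3) by blast
   then have "chn Kp \<mm> (Suc n) M ?C"
    using chn_weaken[of Kp \<mm> "Suc n" M "adj Kp ?F a" M ?C] sM sC submodD(1)[OF submod_adj[OF Kp_subring sF a]] by simp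
   then have "enat (Suc n) <= enat n" using len_ge n by metis
   then show False by simp
  qed
 qed
 have z: "submod Kp {\<zero>}" by (rule submod_Kp[OF zi])
 have "adjs Kp {\<zero>} gs <= adjs Kp {\<zero>} us"
 proof (rule nakayama[OF Kp_subring Kp_unit submod_adjs[OF Kp_subring z us(2)] gs(1)])
  fix W assume W: "submod Kp W" "adjs Kp {\<zero>} us <= W"
   "!!c a. c : Kp ==> c : \<mm> ==> a : adjs Kp {\<zero>} gs ==> c \<otimes> a : W"
  have "M <= W" unfolding M_def
  proof (rule adjs_subset[OF W(1)])
   show "{\<zero>} <= W" using submodD(2)[OF W(1)] by simp
   fix k u assume k: "k : ?C" "u : set (map (%w. w [^] p) ws)"
   then obtain w where w: "w : set ws" "u = w [^] p" by auto
   have wm: "w : \<mm>" using adjs_mem[OF carrier_is_subring submod_ideal[OF zi subset_refl] ws(1)] ws(2) w by auto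
   then have "u : Kp" "u : \<mm>" using w KpI prime_frob[OF mm_prime] mm_carrier by auto
   then have "u \<otimes> k : W" using W(3) k gs by simp
   then show "k \<otimes> u : W" using k w wm mm_carrier by (simp add: m_comm)
  qed
  then have "?F <= W" using adjs_least[OF W(1)] adjs_mem[OF Kp_subring z us(2)] W(2) by auto
  then show "adjs Kp {\<zero>} gs <= W" using full gs by auto
 qed auto
 then have "adjs Kp {\<zero>} us = ?C" using gs submodD(1)[OF submod_adjs[OF Kp_subring z us(2)]] by auto
 then show thesis using that us l n by auto
qed

end

text \<open>Along a chain of primes, \<open>\<rho>\<close> drops by a factor of at least \<open>p\<close> in each step; a step can be
 refined to an adjacent pair because \<open>R\<close> is noetherian.\<close>

lemma (in charp_noeth) rho_chain:
 "(!!i. i <= n ==> primeideal (f i) R) ==> (!!i. i < n ==> f i \<subset> f (Suc i)) ==>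
 EX P. primeideal P R & P <= f n & enat (p ^ n) * rho (f n) <= rho P"
proof (induct n arbitrary: f)
 case 0
 have "enat (Suc 0) = 1" by (simp add: one_enat_def)
 then show ?case using 0 by auto
next
 case (Suc n)
 let ?Q = "f (Suc n)"
 let ?F = "{P. primeideal P R & f n <= P & P \<subset> ?Q}"
 have Q: "primeideal ?Q R" using Suc(2) by simp
 have "f n : ?F" using Suc by auto
 moreover have "ideal I R" if "I : ?F" for I using that primeideal.axioms(1) by auto
 ultimately have "EX M:?F. f n <= M & (ALL J:?F. M <= J --> J = M)" by (rule ideal_maximal_exists)
 then obtain P' where P': "P' : ?F" "ALL J:?F. P' <= J --> J = P'" by auto
 have step: "enat p * rho ?Q <= rho P'"
 proof (rule rho_adjacent[OF _ Q])
  fix P'' assume P'': "primeideal P'' R" "P' <= P''" "P'' <= ?Q" "P'' ~= P'"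
  show "P'' = ?Q"
  proof (rule ccontr)
   assume "P'' ~= ?Q"
   then have "P'' : ?F" using P'' P'(1) by auto
   then show False using P'(2) P'' by auto
  qed
 qed (use P' in auto)
 define g where "g = f(n := P')"
 have "EX P. primeideal P R & P <= g n & enat (p ^ n) * rho (g n) <= rho P"
 proof (rule Suc(1))
  show "primeideal (g i) R" if "i <= n" for i using that Suc(2)[of i] P' by (auto simp: g_def)
  show "g i \<subset> g (Suc i)" if "i < n" for i using that Suc(3)[of i] P' by (auto simp: g_def)
 qed
 then obtain P where P: "primeideal P R" "P <= P'" "enat (p ^ n) * rho P' <= rho P" by (auto simp: g_def)
 have "enat (p ^ Suc n) * rho ?Q = enat (p ^ n) * (enat p * rho ?Q)"
  by (simp add: mult.assoc[symmetric] mult.commute)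
 also have "\<dots> <= enat (p ^ n) * rho P'" by (rule mult_left_mono[OF step]) simp
 finally show ?case using P P' by (intro exI[of _ P]) auto
qed

section \<open>Regular local rings that are finite over their \<open>p\<close>-th powers\<close>

lemma (in charp_noeth) len_adjs_le:
 assumes Q: "primeideal Q R" and L: "submod Kp L" "Q <= L" and us: "set us <= carrier R"
 shows "len Kp Q L (adjs Kp L us) <= enat (length us)"
proof -
 have "len Kp Q L (adjs Kp L us) <= enat (length us) * 1"
 proof (rule len_adjs[OF Kp_subring Q _ L(1) us])
  fix L' u assume L': "submod Kp L'" "L <= L'" "u : set us"
  show "len Kp Q L' (adj Kp L' u) <= 1"
   by (rule len_line_le_1[OF Kp_subring Q L'(1)])
    (use L' us ideal.I_r_closed[OF primeideal.axioms(1)[OF Q]] subsetD[OF subset_trans[OF L(2) L'(2)]] in auto)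
 qed
 then show ?thesis by simp
qed

lemma enat_sum_bound:
 "a <= (0 :: enat) ==> b <= enat i ==> c <= enat j ==> t = b + (a + c) ==> r <= t ==> n <= r ==> n <= enat (i + j)"
 using add_mono[of b "enat i" c "enat j"] by auto

text \<open>When \<open>R\<close> is generated over \<open>R\<^sup>p\<close> by \<open>\<rho>(P)\<close> elements, they are independent modulo \<open>P\<close>, since
 otherwise one of them could be dropped locally at \<open>P\<close>.\<close>

lemma (in charp_noeth) coeffs_in_prime:
 assumes P: "primeideal P R" and us: "set us <= carrier R" "adjs Kp {\<zero>} us = carrier R"
  and n: "enat (length us) <= rho P"
 shows "P <= adjs (Kp \<inter> P) {\<zero>} us"
proof -
 have Pi: "ideal P R" using primeideal.axioms(1)[OF P] .
 note sP = submod_Kp[OF Pi] and K = Kp_subring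
 have z: "submod Kp {\<zero>}" by (rule submod_Kp[OF zeroideal])
 have main: "us = us' @ rest ==> v : P ==> v : adjs Kp {\<zero>} us' ==> v : adjs (Kp \<inter> P) {\<zero>} us'" for us' rest v
 proof (induct us' arbitrary: rest v rule: rev_induct)
  case Nil then show ?case by simp
 next
  case (snoc u us')
  have uc: "u : carrier R" "set us' <= carrier R" "set rest <= carrier R" using snoc us by auto
  obtain w k where wk: "w : adjs Kp {\<zero>} us'" "k : Kp" "v = w \<oplus> k \<otimes> u"
   using snoc(4) by (auto simp: adjs_append elim: adjE)
  note sw = submod_adjs[OF K z uc(2)]
  have cc: "w : carrier R" "k : carrier R" "v : carrier R"
   using wk submodD(5)[OF sw] Kp_carrier snoc(3) ideal.Icarr[OF Pi] by auto
  have kP: "k : P"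
  proof (rule ccontr)
   assume kn: "k ~: P"
   let ?A = "adjs Kp P us'" and ?B = "adj Kp (adjs Kp P us') u"
   have sA: "submod Kp ?A" "P <= ?A" using submod_adjs[OF K sP uc(2)] adjs_upper[OF K sP uc(2)] by auto
   have sB: "submod Kp ?B" "?A <= ?B" using submod_adj[OF K sA(1) uc(1)] adj_upper[OF K sA(1) uc(1)] by auto
   have "w : ?A" using wk(1) adjs_mono[of "{\<zero>}" P Kp us'] submodD(2)[OF sP] by auto
   moreover have "k \<otimes> u = v \<ominus> w" unfolding wk(3) using cc(1,2) uc(1) by algebra
   ultimately have ku: "k \<otimes> u : ?A" using submod_minus[OF K sA(1)] snoc(3) sA(2) by auto
   have e1: "len Kp P ?A ?B <= 0"
   proof (rule len_le)
    fix n assume c: "chn Kp P n ?A ?B"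
    show "enat n <= 0"
    proof (cases n)
     case (Suc m)
     with c obtain U where U: "strict Kp P ?A U" "chn Kp P m U ?B" by auto
     then have "U <= ?B" using chn_submod by blast
     then obtain x where x: "x : ?B" "k \<otimes> x ~: ?A" using U(1) wk(2) kn by (auto simp: strict_def)
     obtain a c' where ac: "a : ?A" "c' : Kp" "x = a \<oplus> c' \<otimes> u" using x(1) by (rule adjE)
     have "k \<otimes> x = k \<otimes> a \<oplus> c' \<otimes> (k \<otimes> u)"
      using ac cc(2) uc(1) submodD(5)[OF sA(1)] Kp_carrier(1) by (simp add: r_distr m_ac)
     moreover have "k \<otimes> a \<oplus> c' \<otimes> (k \<otimes> u) : ?A"
      using submodD(3,4)[OF sA(1)] ac ku wk(2) by auto
     ultimately show ?thesis using x by simp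
    qed (simp add: zero_enat_def)
   qed
   have e2: "len Kp P P ?A <= enat (length us')" by (rule len_adjs_le[OF P sP subset_refl uc(2)])
   have e3: "len Kp P ?B (adjs Kp ?B rest) <= enat (length rest)"
    by (rule len_adjs_le[OF P sB(1) _ uc(3)]) (use sA sB in auto)
   have e4: "len Kp P P (adjs Kp ?B rest) = len Kp P P ?A + (len Kp P ?A ?B + len Kp P ?B (adjs Kp ?B rest))"
   proof -
    have r: "submod Kp (adjs Kp ?B rest)" "?B <= adjs Kp ?B rest"
     using submod_adjs[OF K sB(1) uc(3)] adjs_upper[OF K sB(1) uc(3)] by auto
    show ?thesis
     using len_add[OF K P sP sA(1) r(1) sA(2)] len_add[OF K P sA(1) sB(1) r(1) sB(2) r(2)] sB(2) r(2) by auto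
   qed
   have e5: "rho P <= len Kp P P (adjs Kp ?B rest)"
   proof -
    have "carrier R <= adjs Kp P us" using adjs_mono[of "{\<zero>}" P Kp us] submodD(2)[OF sP] us by auto
    then show ?thesis unfolding rho_def
     using len_mono[OF sP submod_adjs[OF K sP us(1)] subset_refl, of "carrier R"] snoc(2) by (simp add: adjs_append)
   qed
   have "enat (length us) <= enat (length us' + length rest)"
    by (rule enat_sum_bound[OF e1 e2 e3 e4 e5 n])
   then show False using snoc(2) by simp
  qed
  have "w = v \<ominus> k \<otimes> u" unfolding wk(3) using cc(1,2) uc(1) by algebra
  then have "w : P" using submod_minus[OF K sP snoc(3)] ideal.I_r_closed[OF Pi kP uc(1)] by auto
  then have "w : adjs (Kp \<inter> P) {\<zero>} us'" using snoc(1)[of "u # rest" w] snoc(2) wk(1) by simp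
  then show ?case using adjI[of w _ k] wk kP by (simp add: adjs_append)
 qed
 show ?thesis using main[of us "[]"] us ideal.Icarr[OF Pi] by auto
qed

context charp_local begin

definition prime_chain :: "nat => (nat => 'a set) => bool" where
 "prime_chain n f \<longleftrightarrow> (\<forall>i\<le>n. primeideal (f i) R) & (\<forall>i<n. f i \<subset> f (Suc i))"

lemma krull_dim_ge: "prime_chain n f ==> enat n <= krull_dim R"
 unfolding krull_dim_def prime_chain_def by (rule Sup_upper) auto

lemma prime_chain_rho:
 assumes "prime_chain n f"
 shows "EX P. primeideal P R & P <= \<mm> & enat (p ^ n) * rho \<mm> <= rho P"
proof -
 have pr: "!!i. i <= n ==> primeideal (f i) R" and st: "!!i. i < n ==> f i \<subset> f (Suc i)"
  using assms by (auto simp: prime_chain_def)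
 have sub: "f n <= \<mm>" using proper_sub_mm[OF primeideal.axioms(1)[OF pr] one_notin_prime[OF pr]] by auto
 show ?thesis
 proof (cases "f n = \<mm>")
  case True then show ?thesis using rho_chain[of n f, OF pr st] by auto
 next
  case False
  define g where "g = f(Suc n := \<mm>)"
  have "EX P. primeideal P R & P <= g (Suc n) & enat (p ^ Suc n) * rho (g (Suc n)) <= rho P"
  proof (rule rho_chain)
   show "primeideal (g i) R" if "i <= Suc n" for i using that pr[of i] mm_prime by (auto simp: g_def)
   show "g i \<subset> g (Suc i)" if "i < Suc n" for i
    using that st[of i] sub False by (cases "i = n") (auto simp: g_def)
  qed
  then obtain P where P: "primeideal P R" "P <= \<mm>" "enat (p ^ Suc n) * rho \<mm> <= rho P" by (auto simp: g_def)
  have "enat (p ^ n) * rho \<mm> <= enat (p ^ Suc n) * rho \<mm>"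
   by (rule mult_right_mono) (use p_pos in auto)
  then show ?thesis using P by (meson order_trans)
 qed
qed

lemma rho_mm_pos: obtains r where "rho \<mm> = enat r" "1 <= r"
 using rho_finite[OF mm_prime] rho_pos[OF mm_prime] by (metis enat_ile enat_ord_simps(1) one_enat_def)

lemma chain_le_generators:
 assumes ws: "set ws <= carrier R" "\<mm> = adjs (carrier R) {\<zero>} ws" and c: "prime_chain n f"
 shows "n <= length ws"
proof -
 obtain us where us: "set us <= carrier R" "adjs Kp {\<zero>} us = carrier R"
  "enat (length us) <= enat (p ^ length ws) * rho \<mm>" using few_generators[OF ws] .
 obtain P where P: "primeideal P R" "enat (p ^ n) * rho \<mm> <= rho P" using prime_chain_rho[OF c] by auto
 have sP: "submod Kp P" using submod_Kp primeideal.axioms(1)[OF P(1)] .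
 have "rho P <= enat (length us)"
  by (rule rho_le_gens[OF P(1) us(1)]) (use us(2) adjs_mono[of "{\<zero>}" P Kp us] submodD(2)[OF sP] in auto)
 obtain r where r: "rho \<mm> = enat r" "1 <= r" by (rule rho_mm_pos)
 have "enat (p ^ n * r) <= enat (p ^ length ws * r)"
  using P(2) \<open>rho P <= enat (length us)\<close> us(3) r by (metis order_trans times_enat_simps(1))
 then have "p ^ n <= p ^ length ws" using r by simp
 then show ?thesis using p_pos by simp
qed

lemma krull_dim_le:
 assumes "set ws <= carrier R" "\<mm> = adjs (carrier R) {\<zero>} ws"
 shows "krull_dim R <= enat (length ws)"
 unfolding krull_dim_def
 by (rule Sup_least) (use chain_le_generators[OF assms] in "auto simp: prime_chain_def")

lemma min_generators_attained:
 obtains ws where "set ws <= carrier R" "\<mm> = adjs (carrier R) {\<zero>} ws" "length ws = min_generators R \<mm>"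
proof -
 let ?P = "%n. EX S. finite S & card S = n & S <= carrier R & \<mm> = genideal R S"
 obtain A where "A <= carrier R" "finite A" "\<mm> = Idl A" using finetely_gen[OF mm_ideal] by auto
 then have "?P (card A)" by auto
 then have "?P (min_generators R \<mm>)" unfolding min_generators_def by (rule LeastI)
 then obtain S where S: "finite S" "card S = min_generators R \<mm>" "S <= carrier R" "\<mm> = genideal R S" by auto
 obtain ws where "set ws = S" "distinct ws" using finite_distinct_list[OF S(1)] by auto
 then show thesis using that[of ws] S genideal_eq_adjs[of ws] distinct_card[of ws] by auto
qed

lemma min_generators_le:
 assumes ws: "set ws <= carrier R" "\<mm> = adjs (carrier R) {\<zero>} ws"
 shows "min_generators R \<mm> <= length ws"
proof -
 have "min_generators R \<mm> <= card (set ws)"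
  unfolding min_generators_def
  by (rule Least_le) (use ws genideal_eq_adjs[of ws] in auto)
 then show ?thesis using card_length order_trans by blast
qed

text \<open>The chain bounds the dimension from below; \<open>krull_dim_le\<close>, applied to a minimal set of generators,
 bounds it from above.\<close>

lemma regular_localI:
 assumes ws: "set ws <= carrier R" "\<mm> = adjs (carrier R) {\<zero>} ws" and c: "prime_chain (length ws) f"
 shows "regular_local_ring R"
proof -
 obtain vs where vs: "set vs <= carrier R" "\<mm> = adjs (carrier R) {\<zero>} vs" "length vs = min_generators R \<mm>"
  by (rule min_generators_attained)
 have "length ws <= length vs" by (rule chain_le_generators[OF vs(1,2) c])
 then have "min_generators R \<mm> = length ws" using min_generators_le[OF ws] vs(3) by simp
 moreover have "krull_dim R = enat (length ws)"
  using krull_dim_le[OF ws] krull_dim_ge[OF c] by (rule antisym)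
 ultimately have "enat (min_generators R \<mm>) = krull_dim R" by simp
 then show ?thesis
  unfolding regular_local_ring_def
  by (intro conjI exI[of _ \<mm>] cring_axioms noetherian_ring_axioms mm_maximal allI impI maximal_unique)
qed

text \<open>A chain of primes of length \<open>dim R\<close> produces a prime \<open>P\<close> for which \<open>\<rho>(P)\<close> reaches the number of
 generators of \<open>R\<close> over \<open>R\<^sup>p\<close>. By \<open>coeffs_in_prime\<close>, \<open>P\<close> is then spanned by \<open>p\<close>-th powers of its own
 elements, so it vanishes by Nakayama's lemma.\<close>

theorem regular_local_imp_domain:
 assumes "regular_local_ring R" shows "domain R"
proof -
 have eq: "enat (min_generators R \<mm>) = krull_dim R"
 proof -
  obtain M where "maximalideal M R" "enat (min_generators R M) = krull_dim R"
   using assms unfolding regular_local_ring_def by blast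
  then show ?thesis using maximal_unique by metis
 qed
 obtain ws where ws: "set ws <= carrier R" "\<mm> = adjs (carrier R) {\<zero>} ws" "length ws = min_generators R \<mm>"
  by (rule min_generators_attained)
 let ?d = "length ws"
 have "EX f. prime_chain ?d f"
 proof (rule ccontr)
  assume neg: "\<not> ?thesis"
  have "prime_chain 0 (%i. \<mm>)" using mm_prime by (simp add: prime_chain_def)
  then have d: "?d ~= 0" using neg by metis
  have "n <= ?d - 1" if c: "prime_chain n f" for n f
  proof -
   have "n ~= ?d" using neg c by auto
   then show ?thesis using chain_le_generators[OF ws(1,2) c] by simp
  qed
  then have "krull_dim R <= enat (?d - 1)"
   unfolding krull_dim_def by (intro Sup_least) (auto simp: prime_chain_def)
  then show False using eq ws(3) d by (metis One_nat_def diff_less enat_ord_simps(1) not_gr_zero not_le zero_less_one)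
 qed
 then obtain P where P: "primeideal P R" "P <= \<mm>" "enat (p ^ ?d) * rho \<mm> <= rho P"
  using prime_chain_rho by blast
 have Pi: "ideal P R" using primeideal.axioms(1)[OF P(1)] .
 obtain us where us: "set us <= carrier R" "adjs Kp {\<zero>} us = carrier R"
  "enat (length us) <= enat (p ^ ?d) * rho \<mm>" using few_generators[OF ws(1,2)] .
 have co: "P <= adjs (Kp \<inter> P) {\<zero>} us"
  by (rule coeffs_in_prime[OF P(1) us(1,2)]) (use us(3) P(3) in auto)
 have "P <= {\<zero>}"
 proof (rule nakayama_ideal[OF Pi zeroideal])
  fix J assume J: "ideal J R" "{\<zero>} <= J" "!!c a. c : \<mm> ==> a : P ==> c \<otimes> a : J"
  have "adjs (Kp \<inter> P) {\<zero>} us <= J"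
  proof (rule adjs_subset[OF submod_ideal[OF J(1) subset_refl] J(2)])
   fix k u assume k: "k : Kp \<inter> P" "u : set us"
   then obtain a where a: "a : carrier R" "k = a [^] p" by (auto elim: KpE)
   then have aP: "a : P" using prime_frob[OF P(1)] k by auto
   have "p = Suc (Suc (p - 2))" using p_pos(3) by simp
   then have "k = a [^] Suc (Suc (p - 2))" using a(2) by simp
   then have "k = a [^] (p - 2) \<otimes> a \<otimes> a" by simp
   moreover have "a [^] (p - 2) \<otimes> a : \<mm>" using ideal.I_l_closed[OF mm_ideal] aP P(2) a by auto
   ultimately have "k : J" using J(3) aP by auto
   then show "k \<otimes> u : J" using ideal.I_r_closed[OF J(1)] k us by auto
  qed
  then show "P <= J" using co by auto
 qed
 then have "P = {\<zero>}" using submodD(2)[OF submod_Kp[OF Pi]] by auto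
 then show ?thesis using P(1) zeroprimeideal_domainI by auto
qed

end

section \<open>Bases over the \<open>p\<close>-th powers\<close>

lemma (in abelian_monoid) finsum_in_submonoid:
 assumes "finite I" "U <= carrier G" "\<zero> : U" "!!u v. u : U ==> v : U ==> u \<oplus> v : U" "!!i. i : I ==> f i : U"
 shows "(\<Oplus>i\<in>I. f i) : U"
 using assms(1,5)
proof (induct I rule: finite_induct)
 case (insert i I)
 then have "(\<Oplus>i\<in>insert i I. f i) = f i \<oplus> (\<Oplus>i\<in>I. f i)"
  by (intro finsum_insert) (use assms(2) insert in auto)
 then show ?case using insert assms(4) by auto
qed (use assms in simp)

context charp begin

definition E :: "nat => (nat => nat) set" where "E n = {..<n} \<rightarrow>\<^sub>E {..<p}"

definition mon :: "(nat => 'a) => nat => (nat => nat) => 'a" where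
 "mon x n b = (\<Otimes>j\<in>{..<n}. x j [^] b j)"

definition pcomb :: "(nat => 'a) => nat => ((nat => nat) => 'a) => 'a" where
 "pcomb x n c = (\<Oplus>b\<in>E n. c b [^] p \<otimes> mon x n b)"

definition pindep :: "(nat => 'a) => nat => bool" where
 "pindep x n \<longleftrightarrow> (ALL c:E n \<rightarrow> carrier R. pcomb x n c = \<zero> --> (ALL b:E n. c b = \<zero>))"

definition pspan :: "(nat => 'a) => nat => 'a set" where
 "pspan x n = pcomb x n ` (E n \<rightarrow> carrier R)"

lemma finite_E: "finite (E n)" unfolding E_def by (intro finite_PiE) auto

lemma E_le: "b : E n ==> j < n ==> b j < p" by (auto simp: E_def)

lemma E_upd: "b : E n ==> j < n ==> k < p ==> b(j := k) : E n"
 by (auto simp: E_def PiE_iff extensional_def)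

lemma mon_closed: "x : {..<n} \<rightarrow> carrier R ==> mon x n b : carrier R"
 unfolding mon_def by (rule finprod_closed) (auto simp: Pi_def)

lemma mon_split:
 assumes x: "x : {..<n} \<rightarrow> carrier R" and j: "j < n"
 shows "mon x n b = x j [^] b j \<otimes> (\<Otimes>k\<in>{..<n} - {j}. x k [^] b k)"
proof -
 have "{..<n} = insert j ({..<n} - {j})" using j by auto
 then have "mon x n b = (\<Otimes>k\<in>insert j ({..<n} - {j}). x k [^] b k)" by (simp add: mon_def)
 also have "\<dots> = x j [^] b j \<otimes> (\<Otimes>k\<in>{..<n} - {j}. x k [^] b k)"
  by (rule finprod_insert) (use x j in auto)
 finally show ?thesis .
qed

lemma mon_split_upd:
 assumes x: "x : {..<n} \<rightarrow> carrier R" and j: "j < n"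
 shows "mon x n (b(j := k)) = x j [^] k \<otimes> (\<Otimes>k\<in>{..<n} - {j}. x k [^] b k)"
proof -
 have "(\<Otimes>l\<in>{..<n} - {j}. x l [^] (b(j := k)) l) = (\<Otimes>k\<in>{..<n} - {j}. x k [^] b k)"
  by (rule finprod_cong') (use x in auto)
 then show ?thesis using mon_split[OF x j, of "b(j := k)"] by simp
qed

lemma rest_closed: "x : {..<n} \<rightarrow> carrier R ==> (\<Otimes>k\<in>{..<n} - {j}. x k [^] (b k :: nat)) : carrier R"
 by (rule finprod_closed) (auto simp: Pi_def)

lemma pcomb_term_closed:
 "x : {..<n} \<rightarrow> carrier R ==> c : E n \<rightarrow> carrier R ==> b : E n ==> c b [^] p \<otimes> mon x n b : carrier R"
 using mon_closed[of x n b] by (auto simp: Pi_def)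

lemma pcomb_closed: "x : {..<n} \<rightarrow> carrier R ==> c : E n \<rightarrow> carrier R ==> pcomb x n c : carrier R"
 unfolding pcomb_def by (rule finsum_closed) (use pcomb_term_closed in auto)

lemma pcomb_cong: "x : {..<n} \<rightarrow> carrier R ==> c' : E n \<rightarrow> carrier R ==> (!!b. b : E n ==> c b = c' b) ==> pcomb x n c = pcomb x n c'"
 unfolding pcomb_def by (rule finsum_cong') (use pcomb_term_closed in auto)

lemma pcomb_add:
 assumes x: "x : {..<n} \<rightarrow> carrier R" and c: "c : E n \<rightarrow> carrier R" "d : E n \<rightarrow> carrier R"
 shows "pcomb x n (%b. c b \<oplus> d b) = pcomb x n c \<oplus> pcomb x n d"
proof -
 have "pcomb x n c \<oplus> pcomb x n d = (\<Oplus>b\<in>E n. c b [^] p \<otimes> mon x n b \<oplus> d b [^] p \<otimes> mon x n b)"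
  unfolding pcomb_def by (rule finsum_addf[symmetric]) (use pcomb_term_closed[OF x] c in auto)
 also have "\<dots> = pcomb x n (%b. c b \<oplus> d b)"
  unfolding pcomb_def
 proof (rule finsum_cong')
  fix b assume "b : E n"
  then have "c b : carrier R" "d b : carrier R" using c by auto
  then show "c b [^] p \<otimes> mon x n b \<oplus> d b [^] p \<otimes> mon x n b = (c b \<oplus> d b) [^] p \<otimes> mon x n b"
   using mon_closed[OF x] by (simp add: frob_add l_distr)
 qed (use c mon_closed[OF x] in "auto simp: Pi_def")
 finally show ?thesis by simp
qed

lemma pcomb_smult:
 assumes x: "x : {..<n} \<rightarrow> carrier R" and c: "c : E n \<rightarrow> carrier R" and k: "k : carrier R"
 shows "pcomb x n (%b. k \<otimes> c b) = k [^] p \<otimes> pcomb x n c"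
proof -
 have "k [^] p \<otimes> pcomb x n c = (\<Oplus>b\<in>E n. k [^] p \<otimes> (c b [^] p \<otimes> mon x n b))"
  unfolding pcomb_def by (rule finsum_rdistr[OF finite_E]) (use pcomb_term_closed[OF x] c k in auto)
 also have "\<dots> = pcomb x n (%b. k \<otimes> c b)"
  unfolding pcomb_def
 proof (rule finsum_cong')
  fix b assume "b : E n"
  then have "c b : carrier R" using c by auto
  then show "k [^] p \<otimes> (c b [^] p \<otimes> mon x n b) = (k \<otimes> c b) [^] p \<otimes> mon x n b"
   using mon_closed[OF x] k by (simp add: frob_mult m_assoc)
 qed (use c k mon_closed[OF x] in "auto simp: Pi_def")
 finally show ?thesis by simp
qed

lemma pcomb_zero: "x : {..<n} \<rightarrow> carrier R ==> pcomb x n (%b. \<zero>) = \<zero>"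
 unfolding pcomb_def by (rule add.finprod_one_eqI) (use mon_closed frob_zero in auto)

lemma pcomb_single:
 assumes x: "x : {..<n} \<rightarrow> carrier R" and b: "b : E n"
 shows "pcomb x n (%b'. if b' = b then \<one> else \<zero>) = mon x n b"
proof -
 have "pcomb x n (%b'. if b' = b then \<one> else \<zero>) = (\<Oplus>b'\<in>E n. if b' = b then mon x n b' else \<zero>)"
  unfolding pcomb_def by (rule finsum_cong') (use mon_closed[OF x] frob_zero in auto)
 also have "\<dots> = mon x n b"
  by (rule add.finprod_singleton_swap[OF b finite_E]) (use mon_closed[OF x] in auto)
 finally show ?thesis .
qed

definition shift :: "(nat => 'a) => nat => ((nat => nat) => 'a) => (nat => nat) => 'a" where
 "shift x j c b = (if b j = 0 then x j \<otimes> c (b(j := p - 1)) else c (b(j := b j - 1)))"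

lemma shift_closed:
 "x : {..<n} \<rightarrow> carrier R ==> c : E n \<rightarrow> carrier R ==> j < n ==> shift x j c : E n \<rightarrow> carrier R"
 using p_pos E_le by (fastforce simp: shift_def E_upd)

text \<open>Multiplication by \<open>x\<^sub>j\<close> permutes the monomials cyclically in the \<open>j\<close>-th exponent, with the
 carry \<open>x\<^sub>j\<^sup>p\<close> absorbed in the coefficient.\<close>

lemma pcomb_shift:
 assumes x: "x : {..<n} \<rightarrow> carrier R" and c: "c : E n \<rightarrow> carrier R" and j: "j < n"
 shows "x j \<otimes> pcomb x n c = pcomb x n (shift x j c)"
proof -
 have xj: "x j : carrier R" using x j by auto
 let ?\<pi> = "%b. b(j := Suc (b j) mod p)"
 have pi: "?\<pi> ` E n <= E n" using E_upd j p_pos by auto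
 have inj: "inj_on ?\<pi> (E n)"
 proof (rule inj_onI)
  fix b b' assume b: "b : E n" "b' : E n" "?\<pi> b = ?\<pi> b'"
  have "Suc (b j) mod p = Suc (b' j) mod p" using b(3) by (metis fun_upd_same)
  moreover have "b j < p" "b' j < p" using b E_le j by auto
  ultimately have "b j = b' j" by (auto simp: mod_Suc split: if_splits)
  moreover have "b k = b' k" if "k ~= j" for k using b(3) that by (metis fun_upd_other)
  ultimately show "b = b'" by (metis ext)
 qed
 have im: "?\<pi> ` E n = E n" by (rule endo_inj_surj[OF finite_E pi inj])
 let ?f = "%b. shift x j c b [^] p \<otimes> mon x n b"
 have fc: "?f : E n \<rightarrow> carrier R" using pcomb_term_closed[OF x shift_closed[OF x c j]] by auto
 have "pcomb x n (shift x j c) = (\<Oplus>b\<in>?\<pi> ` E n. ?f b)" by (simp add: pcomb_def im)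
 also have "\<dots> = (\<Oplus>b\<in>E n. ?f (?\<pi> b))" by (rule finsum_reindex) (use fc im inj in auto)
 also have "\<dots> = (\<Oplus>b\<in>E n. x j \<otimes> (c b [^] p \<otimes> mon x n b))"
 proof (rule finsum_cong')
  fix b assume b: "b : E n"
  have cb: "c b : carrier R" using c b by auto
  let ?r = "\<Otimes>k\<in>{..<n} - {j}. x k [^] b k"
  have r: "?r : carrier R" by (rule rest_closed[OF x])
  have m: "mon x n b = x j [^] b j \<otimes> ?r" by (rule mon_split[OF x j])
  show "?f (?\<pi> b) = x j \<otimes> (c b [^] p \<otimes> mon x n b)"
  proof (cases "Suc (b j) = p")
   case True
   have "shift x j c (?\<pi> b) = x j \<otimes> c b" using True by (auto simp: shift_def intro!: arg_cong[of _ _ c])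
   moreover have "mon x n (?\<pi> b) = ?r" using mon_split_upd[OF x j, of b 0] True r by simp
   moreover have "x j [^] p = x j [^] b j \<otimes> x j" using True nat_pow_Suc by metis
   ultimately show ?thesis using m xj cb r by (simp add: frob_mult m_ac)
  next
   case False
   then have s: "Suc (b j) mod p = Suc (b j)" using E_le[OF b j] by simp
   have "shift x j c (?\<pi> b) = c b" unfolding shift_def s by (auto intro!: arg_cong[of _ _ c])
   moreover have "mon x n (?\<pi> b) = x j [^] Suc (b j) \<otimes> ?r" using mon_split_upd[OF x j] s by simp
   ultimately show ?thesis using m xj cb r by (simp add: m_ac)
  qed
 qed (use c xj mon_closed[OF x] in "auto simp: Pi_def")
 also have "\<dots> = x j \<otimes> pcomb x n c"
  unfolding pcomb_def by (rule finsum_rdistr[OF finite_E, symmetric]) (use pcomb_term_closed[OF x c] xj in auto)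
 finally show ?thesis by simp
qed

lemma pspan_submod: "x : {..<n} \<rightarrow> carrier R ==> submod Kp (pspan x n)"
 unfolding submod_def
proof (intro conjI ballI)
 assume x: "x : {..<n} \<rightarrow> carrier R"
 show "pspan x n <= carrier R" unfolding pspan_def using pcomb_closed[OF x] by auto
 show "\<zero> : pspan x n" unfolding pspan_def by (rule image_eqI[where x="%b. \<zero>"]) (auto simp: pcomb_zero[OF x])
 fix u assume "u : pspan x n"
 then obtain c where c: "c : E n \<rightarrow> carrier R" "u = pcomb x n c" by (auto simp: pspan_def)
 { fix v assume "v : pspan x n"
  then obtain d where d: "d : E n \<rightarrow> carrier R" "v = pcomb x n d" by (auto simp: pspan_def)
  show "u \<oplus> v : pspan x n"
   unfolding pspan_def c d by (rule image_eqI[where x="%b. c b \<oplus> d b"]) (use c d pcomb_add[OF x c(1) d(1)] in auto) }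
 fix k assume "k : Kp"
 then obtain a where a: "a : carrier R" "k = a [^] p" by (rule KpE)
 show "k \<otimes> u : pspan x n"
  unfolding pspan_def c a by (rule image_eqI[where x="%b. a \<otimes> c b"]) (use c a pcomb_smult[OF x c(1) a(1)] in auto)
qed

lemma stabiliser_subring:
 assumes U: "submod Kp U"
 shows "subring {h : carrier R. ALL u:U. h \<otimes> u : U} R"
proof (rule subringI)
 note [simp] = submodD(3,4)[OF U] submodD(5)[OF U]
 show "\<ominus> h : {h : carrier R. ALL u:U. h \<otimes> u : U}" if "h : {h : carrier R. ALL u:U. h \<otimes> u : U}" for h
  using that submod_neg[OF Kp_subring U] by (auto simp: l_minus)
qed (use submodD(3,4,5)[OF U] in "auto simp: m_assoc l_distr")

lemma stabiliser_Kp: "submod Kp U ==> Kp <= {h : carrier R. ALL u:U. h \<otimes> u : U}"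
 using submodD(4) Kp_carrier by auto

lemma generate_stabilises:
 assumes U: "submod Kp U" and x: "!!s u. s : S ==> u : U ==> s \<otimes> u : U" "S <= carrier R"
  and h: "h : generate_ring R (Kp \<union> S)" and u: "u : U"
 shows "h \<otimes> u : U"
proof -
 have "generate_ring R (Kp \<union> S) <= {h : carrier R. ALL u:U. h \<otimes> u : U}"
  by (rule generate_ring_min_subring1[OF _ stabiliser_subring[OF U]])
   (use stabiliser_Kp[OF U] x Kp_carrier in auto)
 then show ?thesis using h u by auto
qed

lemma one_eq_mon: "x : {..<n} \<rightarrow> carrier R ==> \<one> = mon x n (%j. if j < n then 0 else undefined)"
 unfolding mon_def by (subst finprod_one_eqI) auto

lemma zero_exp_E: "(%j. if j < n then 0 else undefined) : E n"
 using p_pos by (auto simp: E_def PiE_iff extensional_def)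

lemma mon_in_pspan: "x : {..<n} \<rightarrow> carrier R ==> b : E n ==> mon x n b : pspan x n"
 unfolding pspan_def by (rule image_eqI[where x="%b'. if b' = b then \<one> else \<zero>"]) (auto simp: pcomb_single)

lemma pspan_eq_generate:
 assumes x: "x : {..<n} \<rightarrow> carrier R"
 shows "pspan x n = generate_ring R (Kp \<union> x ` {..<n})"
proof
 have sub: "Kp \<union> x ` {..<n} <= carrier R" using x Kp_carrier by auto
 note G = generate_ring_is_subring[OF sub]
 have inc: "Kp \<union> x ` {..<n} <= generate_ring R (Kp \<union> x ` {..<n})" by (rule subsetI, rule generate_ring.incl)
 show "pspan x n <= generate_ring R (Kp \<union> x ` {..<n})"
 proof
  fix a assume "a : pspan x n"
  then obtain c where c: "c : E n \<rightarrow> carrier R" "a = pcomb x n c" by (auto simp: pspan_def)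
  have pw: "g [^] (k::nat) : generate_ring R (Kp \<union> x ` {..<n})" if "g : generate_ring R (Kp \<union> x ` {..<n})" for g k
   by (induct k) (use that subringE(3,6)[OF G] in auto)
  have mon: "mon x n b : generate_ring R (Kp \<union> x ` {..<n})" for b
  proof -
   have "(\<Otimes>j\<in>I. x j [^] b j) : generate_ring R (Kp \<union> x ` {..<n})" if "finite I" "I <= {..<n}" for I
    using that
   proof (induct I rule: finite_induct)
    case empty then show ?case using subringE(3)[OF G] by simp
   next
    case (insert i I)
    have "(\<Otimes>j\<in>insert i I. x j [^] b j) = x i [^] b i \<otimes> (\<Otimes>j\<in>I. x j [^] b j)"
     by (rule finprod_insert) (use insert x in auto)
    then show ?case using insert subringE(6)[OF G] pw[of "x i"] inc by auto
   qed
   then show ?thesis by (simp add: mon_def)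
  qed
  have "c b [^] p \<otimes> mon x n b : generate_ring R (Kp \<union> x ` {..<n})" if "b : E n" for b
   by (rule subringE(6)[OF G _ mon], rule subsetD[OF inc]) (use KpI funcset_mem[OF c(1) that] in auto)
  then show "a : generate_ring R (Kp \<union> x ` {..<n})"
   unfolding c pcomb_def
   by (intro finsum_in_submonoid[OF finite_E subringE(1,2,7)[OF G]])
 qed
 show "generate_ring R (Kp \<union> x ` {..<n}) <= pspan x n"
 proof
  fix h assume h: "h : generate_ring R (Kp \<union> x ` {..<n})"
  have "h \<otimes> \<one> : pspan x n"
  proof (rule generate_stabilises[OF pspan_submod[OF x] _ _ h])
   show "\<one> : pspan x n" using mon_in_pspan[OF x zero_exp_E] one_eq_mon[OF x] by simp
   fix s u assume "s : x ` {..<n}" "u : pspan x n"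
   then obtain j c where jc: "j < n" "s = x j" "c : E n \<rightarrow> carrier R" "u = pcomb x n c" by (auto simp: pspan_def)
   then have "s \<otimes> u = pcomb x n (shift x j c)" using pcomb_shift[OF x] by simp
   then show "s \<otimes> u : pspan x n"
    unfolding pspan_def using shift_closed[OF x jc(3,1)] by (rule image_eqI)
  qed (use x in auto)
  then show "h : pspan x n" using h subringE(1)[OF G] by auto
 qed
qed

lemma p_generators_iff:
 "p_generators p R xs \<longleftrightarrow> set xs <= carrier R & pspan ((!) xs) (length xs) = carrier R"
proof -
 have "set xs = (!) xs ` {..<length xs}" by (auto simp: set_conv_nth)
 moreover have "(!) xs : {..<length xs} \<rightarrow> carrier R \<longleftrightarrow> set xs <= carrier R" by (auto simp: set_conv_nth)
 ultimately show ?thesis using pspan_eq_generate[of "(!) xs" "length xs"] by (auto simp: p_generators_def)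
qed

end

lemma hom_pcomb:
 assumes A: "charp A p" and B: "charp B p" and h: "h : ring_hom A B"
  and x: "x : {..<n} \<rightarrow> carrier A" and c: "c : charp.E p n \<rightarrow> carrier A"
  and y: "!!j. j < n ==> h (x j) = y j"
 shows "h (charp.pcomb A p x n c) = charp.pcomb B p y n (%b. h (c b))"
proof -
 interpret A: charp A p by (rule A)
 interpret B: charp B p by (rule B)
 interpret h: ring_hom_cring A B h
  using h by (intro ring_hom_cring.intro ring_hom_cring_axioms.intro A.is_cring B.is_cring)
 have hc: "h a : carrier B" if "a : carrier A" for a using that by simp
 have mon: "h (A.mon x n b) = B.mon y n b" for b
 proof -
  have "h (A.mon x n b) = (\<Otimes>\<^bsub>B\<^esub>j\<in>{..<n}. (h \<circ> (%j. x j [^]\<^bsub>A\<^esub> b j)) j)"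
   unfolding A.mon_def by (subst h.hom_finprod) (use x in "auto simp: Pi_def comp_def")
  also have "\<dots> = B.mon y n b" unfolding B.mon_def
   by (rule B.finprod_cong') (use x y hc funcset_mem[OF x] in "auto simp: y[symmetric]")
  finally show ?thesis .
 qed
 have yc: "y : {..<n} \<rightarrow> carrier B" using hc funcset_mem[OF x] by (auto simp: y[symmetric])
 have "h (A.pcomb x n c) = (\<Oplus>\<^bsub>B\<^esub>b\<in>A.E n. (h \<circ> (%b. c b [^]\<^bsub>A\<^esub> p \<otimes>\<^bsub>A\<^esub> A.mon x n b)) b)"
  unfolding A.pcomb_def by (subst h.hom_finsum) (use A.pcomb_term_closed[OF x c] in "auto simp: comp_def")
 also have "\<dots> = B.pcomb y n (%b. h (c b))" unfolding B.pcomb_def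
 proof (rule B.finsum_cong')
  show "(%b. h (c b) [^]\<^bsub>B\<^esub> p \<otimes>\<^bsub>B\<^esub> B.mon y n b) : A.E n \<rightarrow> carrier B"
   using funcset_mem[OF c] B.mon_closed[OF yc] by auto
  fix b assume "b : A.E n"
  then have "c b : carrier A" using funcset_mem[OF c] by auto
  then show "(h \<circ> (%b. c b [^]\<^bsub>A\<^esub> p \<otimes>\<^bsub>A\<^esub> A.mon x n b)) b = h (c b) [^]\<^bsub>B\<^esub> p \<otimes>\<^bsub>B\<^esub> B.mon y n b"
   using A.mon_closed[OF x] mon by simp
 qed simp
 finally show ?thesis .
qed

text \<open>A \<open>p\<close>-basis in the strong sense: \<open>R\<close> is free over itself via Frobenius on the monomials.\<close>

locale pbasis = charp R p for R (structure) and p +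
 fixes x :: "nat => 'a" and n :: nat
 assumes x: "x : {..<n} \<rightarrow> carrier R" and gen: "pspan x n = carrier R" and indep: "pindep x n"
begin

definition cf :: "'a => (nat => nat) => 'a" where
 "cf a = (SOME c. c : E n \<rightarrow> carrier R & a = pcomb x n c)"

lemma cf_spec: "a : carrier R ==> cf a : E n \<rightarrow> carrier R & a = pcomb x n (cf a)"
proof -
 assume "a : carrier R"
 then have "a : pcomb x n ` (E n \<rightarrow> carrier R)" using gen unfolding pspan_def by simp
 then obtain c where "a = pcomb x n c" "c : E n \<rightarrow> carrier R" by (rule imageE)
 then have "EX c. c : E n \<rightarrow> carrier R & a = pcomb x n c" by (intro exI[of _ c] conjI)
 then show ?thesis unfolding cf_def by (rule someI_ex)
qed

lemma cf_closed: "a : carrier R ==> b : E n ==> cf a b : carrier R"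
 using cf_spec by auto

lemma pcomb_inj:
 assumes c: "c : E n \<rightarrow> carrier R" "d : E n \<rightarrow> carrier R" and eq: "pcomb x n c = pcomb x n d" and b: "b : E n"
 shows "c b = d b"
proof -
 let ?e = "%b. \<ominus> \<one> \<otimes> d b"
 have e: "?e : E n \<rightarrow> carrier R" using c by auto
 have "(\<ominus> \<one>) [^] p = \<ominus> \<one>" by (simp add: frob_neg)
 then have "pcomb x n (%b. c b \<oplus> ?e b) = pcomb x n c \<oplus> \<ominus> \<one> \<otimes> pcomb x n d"
  using pcomb_add[OF x c(1) e] pcomb_smult[OF x c(2), of "\<ominus> \<one>"] by simp
 also have "\<dots> = \<zero>" using eq pcomb_closed[OF x c(2)] by (simp add: l_minus r_neg)
 finally have "pcomb x n (%b. c b \<oplus> ?e b) = \<zero>" .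
 moreover have "(%b. c b \<oplus> ?e b) : E n \<rightarrow> carrier R" using c e by auto
 ultimately have "c b \<oplus> ?e b = \<zero>" using indep b unfolding pindep_def by auto
 moreover have "c b : carrier R" "d b : carrier R" using c b by auto
 ultimately show ?thesis by (simp add: l_minus minus_eq[symmetric])
qed

lemma cf_pcomb: "c : E n \<rightarrow> carrier R ==> b : E n ==> cf (pcomb x n c) b = c b"
 using cf_spec[OF pcomb_closed[OF x]] pcomb_inj by metis

lemma cf_add:
 assumes a: "a : carrier R" "a' : carrier R" and b: "b : E n"
 shows "cf (a \<oplus> a') b = cf a b \<oplus> cf a' b"
proof -
 note s = cf_spec[OF a(1)] cf_spec[OF a(2)]
 have "a \<oplus> a' = pcomb x n (%b. cf a b \<oplus> cf a' b)" using pcomb_add[OF x, of "cf a" "cf a'"] s by metis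
 moreover have "(%b. cf a b \<oplus> cf a' b) : E n \<rightarrow> carrier R" using cf_closed a by auto
 ultimately show ?thesis using cf_pcomb[OF _ b] by metis
qed

lemma cf_smult:
 assumes a: "k : carrier R" "a : carrier R" and b: "b : E n"
 shows "cf (k [^] p \<otimes> a) b = k \<otimes> cf a b"
proof -
 note s = cf_spec[OF a(2)]
 have "k [^] p \<otimes> a = pcomb x n (%b. k \<otimes> cf a b)" using pcomb_smult[OF x, of "cf a" k] s a by metis
 moreover have "(%b. k \<otimes> cf a b) : E n \<rightarrow> carrier R" using cf_closed a by auto
 ultimately show ?thesis using cf_pcomb[OF _ b] by metis
qed

lemma cf_zero: "b : E n ==> cf \<zero> b = \<zero>"
 using cf_pcomb[of "%b. \<zero>" b] pcomb_zero[OF x] by simp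

lemma cf_mon: "b : E n ==> b' : E n ==> cf (mon x n b) b' = (if b' = b then \<one> else \<zero>)"
 using cf_pcomb[of "%b'. if b' = b then \<one> else \<zero>" b'] pcomb_single[OF x, of b] by simp

lemma cf_shift:
 assumes "a : carrier R" "b : E n" "j < n"
 shows "cf (x j \<otimes> a) b = (if b j = 0 then x j \<otimes> cf a (b(j := p - 1)) else cf a (b(j := b j - 1)))"
proof -
 have c: "cf a : E n \<rightarrow> carrier R" and e: "a = pcomb x n (cf a)" using cf_spec[OF assms(1)] by auto
 have "x j \<otimes> a = pcomb x n (shift x j (cf a))"
  using pcomb_shift[OF x c assms(3)] unfolding e[symmetric] .
 then have "cf (x j \<otimes> a) b = shift x j (cf a) b"
  using cf_pcomb[OF shift_closed[OF x c assms(3)] assms(2)] by simp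
 then show ?thesis unfolding shift_def .
qed

lemma cf_eq_zero:
 assumes a: "a : carrier R" and z: "!!b. b : E n ==> cf a b = \<zero>" shows "a = \<zero>"
proof -
 have "pcomb x n (cf a) = pcomb x n (%b. \<zero>)" by (rule pcomb_cong[OF x _ z]) auto
 then show ?thesis using cf_spec[OF a] pcomb_zero[OF x] by simp
qed

lemma cf_in_submod:
 assumes U: "U <= carrier R" "\<zero> : U" "!!u v. u : U ==> v : U ==> u \<oplus> v : U"
  and a: "a : carrier R" and t: "!!b. b : E n ==> cf a b [^] p \<otimes> mon x n b : U"
 shows "a : U"
proof -
 have "pcomb x n (cf a) : U" unfolding pcomb_def by (rule finsum_in_submonoid[OF finite_E U t])
 then show ?thesis using cf_spec[OF a] by simp
qed

lemma submod_cf: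
 assumes "!!b. b : E n ==> submod (carrier R) (I b)"
 shows "submod Kp {a : carrier R. ALL b:E n. P b --> cf a b : I b}"
 unfolding submod_def
proof (intro conjI ballI)
 show "\<zero> : {a : carrier R. ALL b:E n. P b --> cf a b : I b}" using cf_zero submodD(2)[OF assms] by auto
 fix u assume u: "u : {a : carrier R. ALL b:E n. P b --> cf a b : I b}"
 show "u \<oplus> v : {a : carrier R. ALL b:E n. P b --> cf a b : I b}"
  if "v : {a : carrier R. ALL b:E n. P b --> cf a b : I b}" for v
  using u that cf_add submodD(3)[OF assms] by auto
 fix k assume "k : Kp"
 then obtain c where c: "c : carrier R" "k = c [^] p" by (rule KpE)
 then show "k \<otimes> u : {a : carrier R. ALL b:E n. P b --> cf a b : I b}"
  using u cf_smult submodD(4)[OF assms] by auto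
qed auto

end

section \<open>Local rings with a \<open>p\<close>-basis are regular\<close>

context charp begin

definition pows :: "'a => nat => 'a list" where "pows t d = map (%l. t [^] l) [0..<d]"

lemma pows_closed: "t : carrier R ==> set (pows t d) <= carrier R" by (auto simp: pows_def)

lemma pows_span_mult:
 assumes K: "subring K R" and t: "t : carrier R" and tp: "t [^] p : K"
  and u: "u : adjs K {\<zero>} (pows t p)"
 shows "t \<otimes> u : adjs K {\<zero>} (pows t p)"
proof -
 let ?C = "adjs K {\<zero>} (pows t p)"
 have Kc: "K <= carrier R" using subringE(1)[OF K] .
 have z: "submod K {\<zero>}" by (rule submod_ideal[OF zeroideal Kc])
 have sT: "submod K ?C" by (rule submod_adjs[OF K z pows_closed[OF t]])
 have Tmem: "t [^] l : ?C" if "l < p" for l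
  using adjs_mem[OF K z pows_closed[OF t, of p]] that by (auto simp: pows_def)
 have pull: "submod K {a : carrier R. t \<otimes> a : ?C}"
  unfolding submod_def using submodD[OF sT] Kc t by (auto simp: r_distr m_lcomm subset_iff)
 have "?C <= {a : carrier R. t \<otimes> a : ?C}"
 proof (rule adjs_least[OF pull])
  show "{\<zero>} <= {a : carrier R. t \<otimes> a : ?C}" using submodD(2)[OF sT] t by auto
  have "t \<otimes> t [^] l : ?C" if l: "l < p" for l
  proof (cases "Suc l = p")
   case True
   then have "t \<otimes> t [^] l = t [^] p" using t by (metis nat_pow_Suc2)
   moreover have "t [^] p \<otimes> t [^] (0::nat) : ?C" by (rule submodD(4)[OF sT tp Tmem]) (use p_pos in simp)
   ultimately show ?thesis using t by simp
  next
   case False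
   then show ?thesis using Tmem[of "Suc l"] l t by (simp add: m_comm)
  qed
  then show "set (pows t p) <= {a : carrier R. t \<otimes> a : ?C}" using t by (auto simp: pows_def)
 qed
 then show ?thesis using u by auto
qed

end

context local_cring begin

lemma strict_if_mem:
 assumes K: "subring K R" and un: "!!a. a : K ==> a ~: \<mm> ==> EX b:K. a \<otimes> b = \<one>"
  and L: "submod K L" and U: "submod K U" "L <= U" and v: "v : U" "v ~: L"
 shows "1 <= len K \<mm> L U"
proof -
 have vc: "v : carrier R" using submodD(5)[OF U(1) v(1)] .
 have "strict K \<mm> L U"
  unfolding strict_def
 proof (rule bexI[OF _ v(1)], rule ballI, rule notI)
  fix a assume a: "a : K - \<mm>" "a \<otimes> v : L"
  then obtain b where b: "b : K" "a \<otimes> b = \<one>" using un by auto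
  have c: "a : carrier R" "b : carrier R" using a b subringE(1)[OF K] by auto
  have "b \<otimes> (a \<otimes> v) = (a \<otimes> b) \<otimes> v" using c vc by (simp add: m_ac)
  then have "v = b \<otimes> (a \<otimes> v)" using b vc by simp
  then show False using submodD(4)[OF L b(1) a(2)] v by simp
 qed
 then have "chn K \<mm> (Suc 0) L U" by (rule chn_SucI[OF L U(2)]) (use U in simp)
 then have "enat (Suc 0) <= len K \<mm> L U" by (rule len_ge)
 then show ?thesis by (simp add: one_enat_def)
qed

lemma len_self:
 assumes K: "subring K R" and L: "submod K L" shows "len K \<mm> L L = 0"
proof -
 have "len K \<mm> L (adjs K L []) <= enat (length ([] :: 'a list)) * 1"
  by (rule len_adjs[OF K mm_prime _ L]) auto
 then show ?thesis by (simp add: zero_enat_def[symmetric])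
qed

text \<open>Over a local ring \<open>C\<close> all simple modules are copies of the residue field, so lengths over
 \<open>K \<subseteq> C\<close> are multiples of the length of the residue field.\<close>

lemma len_dvd:
 assumes K: "subring K R" and Kun: "!!a. a : K ==> a ~: \<mm> ==> EX b:K. a \<otimes> b = \<one>"
  and C: "subring C R" and Cun: "!!a. a : C ==> a ~: \<mm> ==> EX b:C. a \<otimes> b = \<one>"
  and KC: "K <= C" and e: "len K \<mm> (C \<inter> \<mm>) C = enat e"
 shows "submod C L ==> submod C M ==> L <= M ==> len K \<mm> L M = enat l ==> e dvd l"
proof (induct l arbitrary: L rule: less_induct)
 case (less l)
 have Cc: "C <= carrier R" and Kc: "K <= carrier R" using subringE(1)[OF C] subringE(1)[OF K] by auto
 note L = less(2) and M = less(3) and LM = less(4) and len = less(5)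
 note KM = submod_mono[OF _ KC]
 show ?case
 proof (cases "L = M")
  case True
  then show ?thesis using len len_self[OF K KM[OF M]] by (simp add: zero_enat_def)
 next
  case False
  let ?N = "%v. adj C L v" and ?P = "%v. v : M & v ~: L"
  obtain v0 where v0: "?P v0" using False LM by auto
  obtain v where v: "?P v" "!!w. ?P w ==> the_enat (len K \<mm> L (?N v)) <= the_enat (len K \<mm> L (?N w))"
   using ex_has_least_nat[of ?P v0 "%v. the_enat (len K \<mm> L (?N v))"] v0 by blast
  have N: "submod C (?N w)" "?N w <= M" "L <= ?N w" "w : ?N w" if "w : M" for w
   using submod_adj[OF C L] adj_least[OF M LM that] adj_upper[OF C L] adj_mem[OF C L] submodD(5)[OF M that] by auto
  have fin: "len K \<mm> L (?N w) ~= \<infinity>" if "w : M" for w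
  proof -
   have "len K \<mm> L (?N w) <= len K \<mm> L M"
    by (rule len_mono[OF KM[OF L] KM[OF M] subset_refl N(2)[OF that]])
   then show ?thesis using len by (cases "len K \<mm> L (?N w)") auto
  qed
  have vc: "v : carrier R" "v : M" "v ~: L" using v submodD(5)[OF M] by auto
  have kill: "c \<otimes> v : L" if c: "c : C" "c : \<mm>" for c
  proof (rule ccontr)
   assume neg: "c \<otimes> v ~: L"
   let ?w = "c \<otimes> v"
   have wM: "?w : M" using submodD(4)[OF M c(1)] vc by auto
   have cc: "c : carrier R" using c Cc by auto
   have sub: "?N ?w <= ?N v"
    by (rule adj_least[OF N(1,3)[OF vc(2)] submodD(4)[OF N(1)[OF vc(2)] c(1) N(4)[OF vc(2)]]])
   have "len K \<mm> L (?N v) = len K \<mm> L (?N ?w) + len K \<mm> (?N ?w) (?N v)"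
    by (rule len_add[OF K mm_prime KM[OF L] KM[OF N(1)[OF wM]] KM[OF N(1)[OF vc(2)]] N(3)[OF wM] sub])
   moreover have "the_enat (len K \<mm> L (?N v)) <= the_enat (len K \<mm> L (?N ?w))" using v(2) wM neg by blast
   moreover obtain a b where "len K \<mm> L (?N v) = enat a" "len K \<mm> L (?N ?w) = enat b"
    using fin[OF vc(2)] fin[OF wM] by auto
   ultimately have z: "len K \<mm> (?N ?w) (?N v) = 0"
    by (cases "len K \<mm> (?N ?w) (?N v)") (auto simp: zero_enat_def)
   have "v : ?N ?w"
   proof (rule ccontr)
    assume nv: "v ~: ?N ?w"
    have "1 <= len K \<mm> (?N ?w) (?N v)"
     by (rule strict_if_mem[OF K Kun KM[OF N(1)[OF wM]] KM[OF N(1)[OF vc(2)]] sub N(4)[OF vc(2)] nv])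
    then show False using z by simp
   qed
   then obtain l' k where lk: "l' : L" "k : C" "v = l' \<oplus> k \<otimes> ?w" by (rule adjE)
   have lc: "l' : carrier R" "k : carrier R" using lk submodD(5)[OF L] Cc by auto
   have "(\<one> \<ominus> k \<otimes> c) \<otimes> v = v \<ominus> k \<otimes> ?w" using lc cc vc by algebra
   also have "\<dots> = (l' \<oplus> k \<otimes> ?w) \<ominus> k \<otimes> ?w" using lk(3) by simp
   also have "\<dots> = l'" using lc cc vc by algebra
   finally have e1: "(\<one> \<ominus> k \<otimes> c) \<otimes> v = l'" .
   have "\<one> \<ominus> k \<otimes> c : C" using subringE[OF C] lk c by (auto simp: minus_eq)
   moreover have "\<one> \<ominus> k \<otimes> c ~: \<mm>"
   proof
    assume "\<one> \<ominus> k \<otimes> c : \<mm>"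
    moreover have "k \<otimes> c : \<mm>" using ideal.I_l_closed[OF mm_ideal c(2) lc(2)] .
    ultimately have "(\<one> \<ominus> k \<otimes> c) \<oplus> k \<otimes> c : \<mm>" using additive_subgroup.a_closed[OF ideal.axioms(1)[OF mm_ideal]] by auto
    moreover have "(\<one> \<ominus> k \<otimes> c) \<oplus> k \<otimes> c = \<one>" using lc cc by algebra
    ultimately show False using mm_proper by simp
   qed
   ultimately obtain b where b: "b : C" "(\<one> \<ominus> k \<otimes> c) \<otimes> b = \<one>" using Cun by blast
   have bc: "b : carrier R" using b Cc by auto
   have "b \<otimes> ((\<one> \<ominus> k \<otimes> c) \<otimes> v) = ((\<one> \<ominus> k \<otimes> c) \<otimes> b) \<otimes> v" using bc lc cc vc by (simp add: m_ac)
   then have "v = b \<otimes> l'" using b vc e1 by simp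
   then show False using submodD(4)[OF L b(1) lk(1)] vc by simp
  qed
  have sC: "submod K C" "submod K (C \<inter> \<mm>)"
   using KM[OF submod_self[OF C]] submod_Int[OF _ submod_ideal[OF mm_ideal Kc]] by auto
  have "len K \<mm> L (?N v) <= enat e"
   unfolding e[symmetric]
   by (rule len_pull[OF K KM[OF L] _ sC, where g="%a. a \<otimes> v" and \<sigma>="%c. c"])
    (use kill vc Cc Kc in "auto simp: adj_def l_distr m_assoc subset_iff")
  moreover have "enat e <= len K \<mm> L (?N v)"
   unfolding e[symmetric]
  proof (rule len_push[OF K K KM[OF L] KM[OF N(1)[OF vc(2)]] N(3)[OF vc(2)] _ sC(1), where g="%a. a \<otimes> v" and \<sigma>="%c. c"])
   show "(%a. a \<otimes> v) ` C <= ?N v" using submodD(4)[OF N(1)[OF vc(2)] _ N(4)[OF vc(2)]] by auto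
   fix a assume a: "a : C" "a \<otimes> v : L"
   show "a : C \<inter> \<mm>"
   proof (rule ccontr)
    assume "a ~: C \<inter> \<mm>"
    then obtain b where b: "b : C" "a \<otimes> b = \<one>" using Cun a by auto
    have c: "a : carrier R" "b : carrier R" using a b Cc by auto
    have "b \<otimes> (a \<otimes> v) = (a \<otimes> b) \<otimes> v" using c vc by (simp add: m_ac)
    then have "v = b \<otimes> (a \<otimes> v)" using b vc by simp
    then show False using submodD(4)[OF L b(1) a(2)] vc by simp
   qed
  qed (use vc Cc Kc in "auto simp: l_distr m_assoc subset_iff")
  ultimately have le: "len K \<mm> L (?N v) = enat e" by simp
  have split: "len K \<mm> L M = len K \<mm> L (?N v) + len K \<mm> (?N v) M"
   by (rule len_add[OF K mm_prime KM[OF L] KM[OF N(1)[OF vc(2)]] KM[OF M] N(3,2)[OF vc(2)]])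
  then obtain l' where l': "len K \<mm> (?N v) M = enat l'" "l = e + l'"
   using len le by (cases "len K \<mm> (?N v) M") auto
  have "1 <= len K \<mm> L (?N v)" by (rule strict_if_mem[OF K Kun KM[OF L] KM[OF N(1)[OF vc(2)]] N(3,4)[OF vc(2)] vc(3)])
  then have "l' < l" using le l' by (simp add: one_enat_def)
  then have "e dvd l'" using less(1)[OF _ N(1)[OF vc(2)] M N(2)[OF vc(2)] l'(1)] by simp
  then show ?thesis using l' by simp
 qed
qed

end

context charp_local begin

text \<open>The inverse of \<open>a\<close> is \<open>a\<^sup>p\<^sup>-\<^sup>1 b\<^sup>p\<close>, a product of elements of \<open>C\<close>.\<close>

lemma subring_unit:
 assumes C: "subring C R" and KC: "Kp <= C" and a: "a : C" "a ~: \<mm>"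
 shows "EX b:C. a \<otimes> b = \<one>"
proof -
 have ac: "a : carrier R" using a subringE(1)[OF C] by auto
 obtain b where b: "b : carrier R" "a \<otimes> b = \<one>" using mm_unit ac a by auto
 have pw: "a [^] (k::nat) : C" for k by (induct k) (use a subringE(3,6)[OF C] in auto)
 have "a \<otimes> (a [^] (p - 1) \<otimes> b [^] p) = (a \<otimes> a [^] (p - 1)) \<otimes> b [^] p" using ac b by (simp add: m_assoc)
 also have "a \<otimes> a [^] (p - 1) = a [^] p" using ac p_pos by (metis Suc_diff_1 nat_pow_Suc2)
 also have "a [^] p \<otimes> b [^] p = \<one>" using b ac by (simp add: frob_mult[symmetric])
 finally show ?thesis using subringE(6)[OF C pw[of "p - 1"], of "b [^] p"] KpI[OF b(1)] KC by blast
qed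

text \<open>Adjoining a \<open>p\<close>-th root \<open>t\<close> to a local ring \<open>K\<close> either leaves the residue field alone or
 generates no new elements of the maximal ideal: the length \<open>p\<close> of \<open>K[t]/(\<mm> \<inter> K)K[t]\<close> over \<open>K\<close> is a
 multiple of the degree of the residue field extension, which is therefore \<open>1\<close> or \<open>p\<close>.\<close>

lemma adjoin_root_residue:
 assumes K: "subring K R" and KpK: "Kp <= K" and t: "t : carrier R"
  and free: "!!d k. d < p ==> k : K ==> k \<otimes> t [^] d : adjs K {\<zero>} (pows t d) ==> k = \<zero>"
  and new: "!!k a. k : K ==> a : \<mm> ==> t ~= a \<oplus> k"
 shows "\<mm> \<inter> adjs K {\<zero>} (pows t p) <= adjs (K \<inter> \<mm>) {\<zero>} (pows t p)"
proof -
 let ?T = "%d. adjs K {\<zero>} (pows t d)" and ?B = "%d. adjs (K \<inter> \<mm>) {\<zero>} (pows t d)"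
 have Kc: "K <= carrier R" using subringE(1)[OF K] .
 have z: "submod K {\<zero>}" by (rule submod_ideal[OF zeroideal Kc])
 have pwc: "set (pows t d) <= carrier R" for d using t by (auto simp: pows_def)
 have Kun: "EX b:K. a \<otimes> b = \<one>" if "a : K" "a ~: \<mm>" for a by (rule subring_unit[OF K KpK that])
 have sM: "submod K (K \<inter> \<mm>)" by (intro submod_Int submod_self[OF K] submod_ideal[OF mm_ideal Kc])
 have sT: "submod K (?T d)" for d by (rule submod_adjs[OF K z pwc])
 have B: "submod K (?B d)" "!!c l. c : K ==> c : \<mm> ==> l < d ==> c \<otimes> t [^] l : ?B d" for d
 proof -
  have "K \<inter> \<mm> <= carrier R" using Kc by auto
  note s = submod_sub_adj[OF Kc sM this z pwc[of d]]
  show "submod K (?B d)" using s by simp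
  show "c \<otimes> t [^] l : ?B d" if "c : K" "c : \<mm>" "l < d" for c l
  proof -
   have "t [^] l : set (pows t d)" using that by (auto simp: pows_def)
   then show ?thesis using s that by blast
  qed
 qed
 have TS: "?T (Suc d) = adj K (?T d) (t [^] d)" and BS: "?B (Suc d) = adj (K \<inter> \<mm>) (?B d) (t [^] d)" for d
  by (simp_all add: pows_def adjs_append)
 have Tmem: "t [^] l : ?T d" if "l < d" for l d
  using adjs_mem[OF K z pwc[of d]] that by (auto simp: pows_def)
 have BT: "?B d <= ?T d" for d
  by (rule adjs_subset[OF sT]) (use submodD(2,4)[OF sT[of d]] adjs_mem[OF K z pwc[of d]] in auto)
 let ?C = "?T p"
 have KC: "K <= ?C"
 proof
  fix k assume k: "k : K"
  then have "k \<otimes> t [^] (0::nat) : ?C" using submodD(4)[OF sT k Tmem[of 0 p]] p_pos by simp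
  then show "k : ?C" using k Kc by auto
 qed
 have tp: "t [^] p : K" using KpK KpI[OF t] by auto
 have stab: "submod K {h : carrier R. ALL u:U. h \<otimes> u : U}" if U: "submod K U" for U
  unfolding submod_def using submodD(3,4,5)[OF U] submodD(2)[OF U] Kc by (auto simp: l_distr m_assoc subset_iff)
 have pull: "submod K {a : carrier R. t \<otimes> a : U}" if U: "submod K U" for U
  unfolding submod_def using submodD[OF U] Kc t by (auto simp: r_distr m_lcomm subset_iff)
 have Cstab: "?C <= {h : carrier R. ALL u:U. h \<otimes> u : U}"
  if U: "submod K U" and tU: "!!u. u : U ==> t \<otimes> u : U" for U
 proof (rule adjs_least[OF stab[OF U]])
  show "{\<zero>} <= {h : carrier R. ALL u:U. h \<otimes> u : U}" using submodD(2,5)[OF U] by auto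
  have "t [^] (l::nat) \<otimes> u : U" if "u : U" for l u
  proof (induct l)
   case (Suc l)
   have "t [^] Suc l \<otimes> u = t \<otimes> (t [^] l \<otimes> u)" using t submodD(5)[OF U that] by (simp add: m_ac)
   then show ?case using tU Suc by simp
  qed (use that submodD(5)[OF U that] in simp)
  then show "set (pows t p) <= {h : carrier R. ALL u:U. h \<otimes> u : U}" using t by (auto simp: pows_def)
 qed
 have tC: "t \<otimes> u : ?C" if "u : ?C" for u by (rule pows_span_mult[OF K t tp that])
 have C: "subring ?C R"
 proof (rule subringI[OF submodD(1)[OF sT]])
  show "\<one> : ?C" using KC subringE(3)[OF K] by auto
  show "\<ominus> h : ?C" if "h : ?C" for h by (rule submod_neg[OF K sT that])
  show "h1 \<otimes> h2 : ?C" if "h1 : ?C" "h2 : ?C" for h1 h2 using Cstab[OF sT tC] that by auto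
  show "h1 \<oplus> h2 : ?C" if "h1 : ?C" "h2 : ?C" for h1 h2 by (rule submodD(3)[OF sT that])
 qed
 have Cun: "EX b:?C. a \<otimes> b = \<one>" if "a : ?C" "a ~: \<mm>" for a
  by (rule subring_unit[OF C subset_trans[OF KpK KC] that])
 have tB: "t \<otimes> u : ?B p" if "u : ?B p" for u
 proof -
  have "?B p <= {a : carrier R. t \<otimes> a : ?B p}"
  proof (rule adjs_subset[OF pull[OF B(1)]])
   show "{\<zero>} <= {a : carrier R. t \<otimes> a : ?B p}" using submodD(2)[OF B(1)] t by auto
   fix k u assume k: "k : K \<inter> \<mm>" "u : set (pows t p)"
   then obtain l where l: "l < p" "u = t [^] l" by (auto simp: pows_def)
   have kc: "k : carrier R" using k Kc by auto
   have "t \<otimes> (k \<otimes> t [^] l) : ?B p"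
   proof (cases "Suc l = p")
    case True
    then have "t \<otimes> (k \<otimes> t [^] l) = (t [^] p \<otimes> k) \<otimes> t [^] (0::nat)" using t kc nat_pow_Suc[of t l] by (simp add: m_ac)
    moreover have "t [^] p \<otimes> k : K \<inter> \<mm>" using submodD(4)[OF sM tp k(1)] .
    ultimately show ?thesis using B(2)[of _ 0 p] p_pos by auto
   next
    case False
    have "t \<otimes> (k \<otimes> t [^] l) = k \<otimes> t [^] Suc l" using t kc by (simp add: m_ac)
    then show ?thesis using B(2)[of k "Suc l" p] k l False by simp
   qed
   then show "k \<otimes> u : {a : carrier R. t \<otimes> a : ?B p}" using l kc t by simp
  qed
  then show ?thesis using that by auto
 qed
 have BC: "submod ?C (?B p)"
  unfolding submod_def using submodD[OF B(1)[of p]] Cstab[OF B(1) tB] by auto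
 have low: "d <= p ==> enat d <= len K \<mm> (?B d) (?T d)" for d
 proof (induct d)
  case 0 show ?case by (simp add: zero_enat_def[symmetric])
 next
  case (Suc d)
  have td: "t [^] d : carrier R" using t by simp
  let ?S = "ssum (?B (Suc d)) (?T d)"
  have sS: "submod K ?S" by (rule submod_ssum[OF Kc B(1) sT])
  have TT: "?T d <= ?T (Suc d)" unfolding TS by (rule adj_upper[OF K sT td])
  have S1: "?B (Suc d) <= ?S" "?T d <= ?S"
   using ssum_upper1[OF sT submodD(1)[OF B(1)]] ssum_upper2[OF B(1) submodD(1)[OF sT]] by auto
  have S2: "?S <= ?T (Suc d)" by (rule ssum_least[OF sT BT TT])
  have BdT: "b : ?T d" if "b : ?B d" for b using that BT by auto
  have "len K \<mm> (?B d) (?T d) <= len K \<mm> (?B (Suc d)) ?S"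
  proof (rule len_push[OF K K B(1) sS S1(1) _ sT, where g="%a. a" and \<sigma>="%c. c"])
   fix v assume v: "v : ?T d" "v : ?B (Suc d)"
   then obtain b k where bk: "b : ?B d" "k : K \<inter> \<mm>" "v = b \<oplus> k \<otimes> t [^] d" unfolding BS by (auto elim: adjE)
   have c: "b : carrier R" "k : carrier R" using bk submodD(5)[OF B(1)] Kc by auto
   have "k \<otimes> t [^] d = v \<ominus> b" unfolding bk(3) using c td by algebra
   then have "k \<otimes> t [^] d : ?T d" using submod_minus[OF K sT v(1) BdT[OF bk(1)]] by simp
   then have "k = \<zero>" using free[of d k] bk Suc(2) by simp
   then show "v : ?B d" using bk c td by simp
  qed (use S1(2) submodD(5)[OF sT] in auto)
  moreover have "1 <= len K \<mm> ?S (?T (Suc d))"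
  proof (rule strict_if_mem[OF K Kun sS sT S2 Tmem[of d "Suc d"]])
   show "t [^] d ~: ?S"
   proof
    assume "t [^] d : ?S"
    then obtain b w where bw: "b : ?B (Suc d)" "w : ?T d" "t [^] d = b \<oplus> w" by (rule ssumE)
    then obtain b' k where bk: "b' : ?B d" "k : K \<inter> \<mm>" "b = b' \<oplus> k \<otimes> t [^] d" unfolding BS by (auto elim: adjE)
    have c: "b' : carrier R" "k : carrier R" "w : carrier R"
     using bk bw submodD(5)[OF B(1)] submodD(5)[OF sT] Kc by auto
    have "(\<one> \<ominus> k) \<otimes> t [^] d = t [^] d \<ominus> k \<otimes> t [^] d" using c td by algebra
    also have "\<dots> = (b' \<oplus> k \<otimes> t [^] d \<oplus> w) \<ominus> k \<otimes> t [^] d" using bw(3) bk(3) by simp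
    also have "\<dots> = b' \<oplus> w" using c td by algebra
    finally have "(\<one> \<ominus> k) \<otimes> t [^] d : ?T d" using submodD(3)[OF sT BdT[OF bk(1)] bw(2)] by simp
    moreover have "\<one> \<ominus> k : K" using subringE[OF K] bk by (auto simp: minus_eq)
    ultimately have "\<one> \<ominus> k = \<zero>" using free[of d] Suc(2) by simp
    then have "\<one> = k" using c by simp
    then show False using bk mm_proper by auto
   qed
  qed simp_all
  ultimately have "enat d + 1 <= len K \<mm> (?B (Suc d)) ?S + len K \<mm> ?S (?T (Suc d))"
   using Suc by (intro add_mono) auto
  then show ?case using len_add[OF K mm_prime B(1) sS sT S1(1) S2] by (simp add: one_enat_def)
 qed
 have up: "len K \<mm> (?B p) ?C <= enat p"
 proof -
  have "len K \<mm> (?B p) ?C <= len K \<mm> (?B p) (adjs K (?B p) (pows t p))"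
   by (rule len_mono[OF B(1) submod_adjs[OF K B(1) pwc] subset_refl adjs_mono])
    (use submodD(2)[OF B(1)] in auto)
  also have "\<dots> <= enat (length (pows t p)) * 1"
  proof (rule len_adjs[OF K mm_prime _ B(1) pwc])
   fix L' u assume L': "submod K L'" "?B p <= L'" "u : set (pows t p)"
   then obtain l where l: "l < p" "u = t [^] l" by (auto simp: pows_def)
   show "len K \<mm> L' (adj K L' u) <= 1"
    by (rule len_line_le_1[OF K mm_prime L'(1)]) (use l t B(2)[of _ l p] subsetD[OF L'(2)] in auto)
  qed
  finally show ?thesis by (simp add: pows_def)
 qed
 have lenp: "len K \<mm> (?B p) ?C = enat p" using low[of p] up by simp
 have sN: "submod K (?C \<inter> \<mm>)" by (intro submod_Int sT submod_ideal[OF mm_ideal Kc])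
 have BN: "?B p <= ?C \<inter> \<mm>"
 proof -
  have "?B p <= \<mm>"
   by (rule adjs_subset[OF submod_ideal[OF mm_ideal subset_refl]])
    (use pwc[of p] ideal.I_r_closed[OF mm_ideal] additive_subgroup.zero_closed[OF ideal.axioms(1)[OF mm_ideal]] in auto)
  then show ?thesis using BT by auto
 qed
 have split: "enat p = len K \<mm> (?B p) (?C \<inter> \<mm>) + len K \<mm> (?C \<inter> \<mm>) ?C"
  using len_add[OF K mm_prime B(1) sN sT BN] lenp by simp
 then obtain e where e: "len K \<mm> (?C \<inter> \<mm>) ?C = enat e"
  by (cases "len K \<mm> (?C \<inter> \<mm>) ?C") auto
 have "e dvd p"
  using len_dvd[OF K Kun C Cun KC e BC submod_self[OF C] BT lenp] .
 moreover have "2 <= e"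
 proof -
  let ?V = "adj K (?C \<inter> \<mm>) \<one>"
  have sV: "submod K ?V" "?C \<inter> \<mm> <= ?V" "\<one> : ?V"
   using submod_adj[OF K sN] adj_upper[OF K sN] adj_mem[OF K sN] by auto
  have VC: "?V <= ?C" by (rule adj_least[OF sT]) (use subringE(3)[OF C] in auto)
  have "1 <= len K \<mm> (?C \<inter> \<mm>) ?V" by (rule strict_if_mem[OF K Kun sN sV]) (use mm_proper in auto)
  moreover have "1 <= len K \<mm> ?V ?C"
  proof (rule strict_if_mem[OF K Kun sV(1) sT VC])
   show "t : ?C" using Tmem[of 1 p] p_pos t by simp
   show "t ~: ?V"
   proof
    assume "t : ?V"
    then obtain a k where ak: "a : \<mm>" "k : K" "t = a \<oplus> k \<otimes> \<one>" by (auto elim: adjE)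
    then have "t = a \<oplus> k" using Kc by auto
    then show False using new[OF ak(2,1)] by simp
   qed
  qed
  ultimately have "1 + 1 <= len K \<mm> (?C \<inter> \<mm>) ?V + len K \<mm> ?V ?C" by (rule add_mono)
  then have "1 + 1 <= enat e" using len_add[OF K mm_prime sN sV(1) sT sV(2) VC] unfolding e by simp
  then show ?thesis by (simp add: one_enat_def)
 qed
 ultimately have "e = p" using prime_p by (metis Suc_1 not_less_eq_eq order_refl prime_nat_iff)
 then have z0: "len K \<mm> (?B p) (?C \<inter> \<mm>) = 0"
  using split e by (cases "len K \<mm> (?B p) (?C \<inter> \<mm>)") (auto simp: zero_enat_def)
 show ?thesis
 proof (rule ccontr)
  assume "\<not> ?thesis"
  then obtain v where v: "v : ?C \<inter> \<mm>" "v ~: ?B p" by auto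
  have "1 <= len K \<mm> (?B p) (?C \<inter> \<mm>)" by (rule strict_if_mem[OF K Kun B(1) sN BN v])
  then show False using z0 by simp
 qed
qed

end

definition (in charp) Csub :: "(nat => 'a) => nat => 'a set" where
 "Csub x j = generate_ring R (Kp \<union> x ` {..<j})"

lemma (in charp) Csub_subring:
 "x : {..<n} \<rightarrow> carrier R ==> j <= n ==> subring (Csub x j) R"
 unfolding Csub_def by (rule generate_ring_is_subring) (use Kp_carrier in auto)

lemma (in charp) Csub_incl: "Kp <= Csub x j" "l < j ==> x l : Csub x j"
 unfolding Csub_def by (auto intro: generate_ring.incl)

lemma (in charp) Csub_mono:
 assumes "x : {..<n} \<rightarrow> carrier R" "i <= j" "j <= n" shows "Csub x i <= Csub x j"
 unfolding Csub_def[of x i]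
 by (rule generate_ring_min_subring1[OF _ Csub_subring[OF assms(1,3)]])
  (use assms Csub_incl(1)[of x j] Csub_incl(2)[of _ j x] Kp_carrier in auto)

lemma (in charp) Csub_stab:
 assumes U: "submod Kp U" and x: "x : {..<n} \<rightarrow> carrier R" "j <= n"
  and st: "!!l u. l < j ==> u : U ==> x l \<otimes> u : U" and h: "h : Csub x j" "u : U"
 shows "h \<otimes> u : U"
proof (rule generate_stabilises[OF U _ _ h(1)[unfolded Csub_def] h(2)])
 show "x ` {..<j} <= carrier R" using x by auto
qed (use st in auto)

context pbasis begin

lemma xc: "j < n ==> x j : carrier R" using x by auto

lemma carrier_stab:
 assumes U: "submod Kp U" and st: "!!l u. l < n ==> u : U ==> x l \<otimes> u : U"
 shows "submod (carrier R) U"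
proof -
 have "h \<otimes> u : U" if "h : carrier R" "u : U" for h u
  by (rule Csub_stab[OF U x order_refl st _ that(2)]) (use that gen pspan_eq_generate[OF x] in "auto simp: Csub_def")
 then show ?thesis using submodD[OF U] by (auto simp: submod_def)
qed

lemma cf_one: "b : E n ==> cf \<one> b = (if \<forall>l<n. b l = 0 then \<one> else \<zero>)"
proof -
 assume b: "b : E n"
 let ?z = "%j. if j < n then 0 else undefined"
 have "b = ?z \<longleftrightarrow> (\<forall>l<n. b l = 0)" using b by (auto simp: E_def PiE_iff extensional_def fun_eq_iff)
 then show ?thesis using cf_mon[OF zero_exp_E b] one_eq_mon[OF x] by simp
qed

text \<open>Elements of degree below \<open>d\<close> in \<open>x\<^sub>j\<close>, and elements that involve only variables before \<open>x\<^sub>j\<close>.\<close>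

definition W :: "nat => nat => 'a set" where
 "W j d = {a : carrier R. ALL b:E n. d <= b j --> cf a b : {\<zero>}}"

definition Z :: "nat => 'a set" where
 "Z j = {a : carrier R. ALL b:E n. (EX l. j <= l & l < n & b l ~= 0) --> cf a b : {\<zero>}}"

lemma submod_W: "submod Kp (W j d)"
 unfolding W_def by (rule submod_cf) (simp add: submod_ideal[OF zeroideal])

lemma submod_Z: "submod Kp (Z j)"
 unfolding Z_def by (rule submod_cf) (simp add: submod_ideal[OF zeroideal])

lemma W_mono: "d <= d' ==> W j d <= W j d'" by (auto simp: W_def)

lemma W_stab:
 assumes "l < n" "l ~= j" "a : W j d" shows "x l \<otimes> a : W j d"
 using assms xc[OF assms(1)] p_pos by (auto simp: W_def cf_shift E_upd E_le less_imp_diff_less)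

lemma W_step:
 assumes "j < n" "a : W j d" shows "x j \<otimes> a : W j (Suc d)"
 using assms xc[OF assms(1)] p_pos by (auto simp: W_def cf_shift E_upd E_le less_imp_diff_less)

lemma W_Csub: "j < n ==> h : Csub x j ==> a : W j d ==> h \<otimes> a : W j d"
 by (rule Csub_stab[OF submod_W x, of j]) (use W_stab in auto)

lemma one_W: "j < n ==> \<one> : W j 1"
 by (auto simp: W_def cf_one)

lemma pow_W: "j < n ==> x j [^] d : W j (Suc d)"
proof (induct d)
 case 0 then show ?case using one_W by simp
next
 case (Suc d)
 then have "x j \<otimes> x j [^] d : W j (Suc (Suc d))" by (intro W_step) auto
 then show ?case using xc[OF Suc(2)] by (simp add: m_comm)
qed

lemma Csub_Z: assumes j: "j <= n" and h: "h : Csub x j" shows "h : Z j"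
proof -
 have "x l \<otimes> a : Z j" if l: "l < j" and a: "a : Z j" for l a
 proof -
  have ln: "l < n" "x l : carrier R" and ac: "a : carrier R" using l j xc a by (auto simp: Z_def)
  have "cf (x l \<otimes> a) b = \<zero>" if b: "b : E n" "j <= la" "la < n" "b la ~= 0" for b la
  proof -
   have z: "cf a (b(l := m)) = \<zero>" if "m < p" for m
   proof -
    have "(b(l := m)) la ~= 0" using b l by auto
    then show ?thesis using a E_upd[OF b(1) ln(1) that] b by (auto simp: Z_def)
   qed
   have "b l - 1 < p" using E_le[OF b(1) ln(1)] by simp
   then show ?thesis using cf_shift[OF ac b(1) ln(1)] z p_pos ln(2) by simp
  qed
  then show ?thesis using ln ac by (auto simp: Z_def)
 qed
 moreover have "\<one> : Z j" by (auto simp: Z_def cf_one)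
 ultimately have "h \<otimes> \<one> : Z j" by (intro Csub_stab[OF submod_Z x j _ h]) auto
 moreover have "h : carrier R" using h subringE(1)[OF Csub_subring[OF x j]] by auto
 ultimately show ?thesis by simp
qed

lemma cf_top:
 assumes j: "j < n" and k: "k : carrier R"
 shows "d < p ==> b : E n ==> b j = d ==> cf (x j [^] d \<otimes> k) b = cf k (b(j := 0))"
proof (induct d arbitrary: b)
 case 0 then show ?case using k by (simp add: fun_upd_idem)
next
 case (Suc d)
 have e: "x j [^] Suc d \<otimes> k = x j \<otimes> (x j [^] d \<otimes> k)" using xc[OF j] k by (simp add: m_ac)
 have b': "b(j := d) : E n" using Suc E_upd j by auto
 have "cf (x j \<otimes> (x j [^] d \<otimes> k)) b = cf (x j [^] d \<otimes> k) (b(j := d))"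
  using cf_shift[OF _ Suc(3) j] xc[OF j] k Suc(4) by simp
 also have "\<dots> = cf k ((b(j := d))(j := 0))" by (rule Suc(1)[OF _ b']) (use Suc(2) in simp_all)
 finally show ?case unfolding e fun_upd_upd .
qed

lemma free_over_Csub:
 assumes j: "j < n" and d: "d < p" and k: "k : Csub x j"
  and mem: "k \<otimes> x j [^] d : adjs (Csub x j) {\<zero>} (pows (x j) d)"
 shows "k = \<zero>"
proof -
 have sK: "subring (Csub x j) R" using Csub_subring[OF x] j by simp
 have kc: "k : carrier R" using k subringE(1)[OF sK] by auto
 have "submod (Csub x j) (W j d)"
  using submodD[OF submod_W] W_Csub[OF j] by (auto simp: submod_def)
 moreover have "x j [^] l : W j d" if "l < d" for l using pow_W[OF j, of l] W_mono[of "Suc l" d j] that by auto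
 ultimately have "adjs (Csub x j) {\<zero>} (pows (x j) d) <= W j d"
  by (intro adjs_least) (use submodD(2)[OF submod_W] in "auto simp: pows_def")
 then have w: "x j [^] d \<otimes> k : W j d" using mem kc xc[OF j] by (auto simp: m_comm)
 show ?thesis
 proof (rule cf_eq_zero[OF kc])
  fix b assume b: "b : E n"
  show "cf k b = \<zero>"
  proof (cases "b j = 0")
   case True
   have b': "b(j := d) : E n" using E_upd b j d by auto
   have "cf (x j [^] d \<otimes> k) (b(j := d)) = cf k (b(j := 0))" using cf_top[OF j kc d b'] by simp
   moreover have "cf (x j [^] d \<otimes> k) (b(j := d)) = \<zero>" using w b' by (auto simp: W_def)
   ultimately show ?thesis using True by (simp add: fun_upd_idem)
  next
   case False
   then show ?thesis using Csub_Z[OF _ k] b j by (auto simp: Z_def)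
  qed
 qed
qed

text \<open>Modifying \<open>x\<^sub>i\<close> by a polynomial in the earlier \<open>x\<^sub>j\<close> is a unitriangular change of the monomial
 basis with respect to the exponent of \<open>x\<^sub>i\<close>.\<close>

lemma pbasis_translate:
 assumes i: "i < n" and k: "\<kappa> : Csub x i"
 shows "pbasis R p (x(i := x i \<ominus> \<kappa>)) n"
proof -
 let ?x = "x(i := x i \<ominus> \<kappa>)"
 have sK: "subring (Csub x i) R" using Csub_subring[OF x] i by simp
 have kc: "\<kappa> : carrier R" using k subringE(1)[OF sK] by auto
 have x': "?x : {..<n} \<rightarrow> carrier R" using xc kc i by auto
 have sG: "subring (Csub ?x n) R" by (rule Csub_subring[OF x' order_refl])
 have "Csub ?x i = Csub x i" unfolding Csub_def by (rule arg_cong[of _ _ "%S. generate_ring R (Kp \<union> S)"]) auto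
 then have kG: "\<kappa> : Csub ?x n" using Csub_mono[OF x', of i n] i k by auto
 have "x l : Csub ?x n" if l: "l < n" for l
 proof (cases "l = i")
  case True
  have "?x i \<oplus> \<kappa> : Csub ?x n" using subringE(7)[OF sG Csub_incl(2)[OF i] kG] .
  moreover have "(x i \<ominus> \<kappa>) \<oplus> \<kappa> = x i" using xc[OF i] kc by algebra
  ultimately show ?thesis using True by simp
 next
  case False
  then show ?thesis using Csub_incl(2)[OF l, of ?x] by simp
 qed
 then have "Csub x n <= Csub ?x n"
  unfolding Csub_def[of x n] by (intro generate_ring_min_subring1[OF _ sG]) (use Csub_incl x Kp_carrier in auto)
 moreover have "Csub x n = carrier R" using gen pspan_eq_generate[OF x] by (simp add: Csub_def)
 ultimately have gen': "pspan ?x n = carrier R"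
  using pspan_eq_generate[OF x'] subringE(1)[OF sG] by (auto simp: Csub_def)
 have tri: "(x i \<ominus> \<kappa>) [^] l \<otimes> u \<ominus> x i [^] l \<otimes> u : W i l" if u: "u : W i 1" for l u
 proof (induct l)
  case 0
  have "u : carrier R" using u by (auto simp: W_def)
  then show ?case using submodD(2)[OF submod_W] by (simp add: minus_eq r_neg)
 next
  case (Suc l)
  let ?y = "x i \<ominus> \<kappa>" and ?w = "(x i \<ominus> \<kappa>) [^] l \<otimes> u \<ominus> x i [^] l \<otimes> u"
  have c: "u : carrier R" "x i : carrier R" "x i [^] l : carrier R" "?y [^] l : carrier R"
   using u xc[OF i] kc by (auto simp: W_def)
  have "x i [^] m \<otimes> u : W i (Suc m)" for m
  proof (induct m)
   case 0 then show ?case using u c by simp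
  next
   case (Suc m)
   have "x i \<otimes> (x i [^] m \<otimes> u) : W i (Suc (Suc m))" by (rule W_step[OF i Suc])
   then show ?case using c by (simp add: m_ac)
  qed
  then have 1: "\<kappa> \<otimes> (x i [^] l \<otimes> u) : W i (Suc l)" by (rule W_Csub[OF i k])
  have 2: "x i \<otimes> ?w : W i (Suc l)" by (rule W_step[OF i Suc])
  have 3: "\<kappa> \<otimes> ?w : W i (Suc l)" by (rule W_Csub[OF i k subsetD[OF W_mono Suc]]) simp
  have "?y [^] Suc l \<otimes> u \<ominus> x i [^] Suc l \<otimes> u = (?y [^] l \<otimes> ?y) \<otimes> u \<ominus> (x i [^] l \<otimes> x i) \<otimes> u" by simp
  also have "\<dots> = (x i \<otimes> ?w \<ominus> \<kappa> \<otimes> ?w) \<ominus> \<kappa> \<otimes> (x i [^] l \<otimes> u)"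
   using c kc by algebra
  finally show ?case using submod_minus[OF Kp_subring submod_W submod_minus[OF Kp_subring submod_W 2 3] 1] by simp
 qed
 have mono': "mon ?x n b \<ominus> mon x n b : W i (b i)" if b: "b : E n" for b
 proof -
  let ?r = "\<Otimes>k\<in>{..<n} - {i}. x k [^] b k"
  have "(\<Otimes>k\<in>{..<n} - {i}. ?x k [^] b k) = ?r" by (rule finprod_cong') (use x in auto)
  then have "mon ?x n b = (x i \<ominus> \<kappa>) [^] b i \<otimes> ?r" using mon_split[OF x' i, of b] by simp
  moreover have "mon x n b = x i [^] b i \<otimes> ?r" by (rule mon_split[OF x i])
  moreover have "?r : W i 1"
  proof -
   have "?r = mon x n (b(i := 0))" using mon_split_upd[OF x i, of b 0] rest_closed[OF x] by simp
   then show ?thesis using cf_mon[OF E_upd[OF b i p_pos(1)]] mon_closed[OF x] by (auto simp: W_def)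
  qed
  ultimately show ?thesis using tri by simp
 qed
 have "pindep ?x n"
  unfolding pindep_def
 proof (intro ballI impI)
  fix c b0 assume c: "c : E n \<rightarrow> carrier R" and z: "pcomb ?x n c = \<zero>" and b0: "b0 : E n"
  have "ALL b:E n. d <= b i --> c b = \<zero>" if "d <= p" for d
   using that
  proof (induct rule: inc_induct)
   case base then show ?case using E_le[OF _ i] by (meson not_le)
  next
   case (step d)
   show ?case
   proof (intro ballI impI)
    fix b assume b: "b : E n" "d <= b i"
    show "c b = \<zero>"
    proof (cases "Suc d <= b i")
     case True then show ?thesis using step b by auto
    next
     case False
     then have bd: "b i = d" using b by simp
     have cc: "c b : carrier R" if "b : E n" for b using c that by auto
     have mc: "mon ?x n b : carrier R" "mon x n b : carrier R" for b using mon_closed[OF x'] mon_closed[OF x] by auto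
     let ?w = "\<Oplus>b\<in>E n. c b [^] p \<otimes> (mon ?x n b \<ominus> mon x n b)"
     have w: "?w : W i d"
     proof (rule finsum_in_submonoid[OF finite_E submodD(1-3)[OF submod_W]])
      fix b assume b: "b : E n"
      show "c b [^] p \<otimes> (mon ?x n b \<ominus> mon x n b) : W i d"
      proof (cases "Suc d <= b i")
       case True
       then have "c b = \<zero>" using step b by auto
       then show ?thesis using mc submodD(2)[OF submod_W] by (simp add: frob_zero)
      next
       case False
       then have "mon ?x n b \<ominus> mon x n b : W i d" using mono'[OF b] W_mono[of "b i" d i] by auto
       then show ?thesis using submodD(4)[OF submod_W KpI[OF cc[OF b]]] by auto
      qed
     qed
     have "pcomb ?x n c = (\<Oplus>b\<in>E n. c b [^] p \<otimes> mon x n b \<oplus> c b [^] p \<otimes> (mon ?x n b \<ominus> mon x n b))"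
      unfolding pcomb_def
     proof (rule finsum_cong')
      fix b assume "b : E n"
      then have "c b [^] p : carrier R" using cc by simp
      then show "c b [^] p \<otimes> mon ?x n b = c b [^] p \<otimes> mon x n b \<oplus> c b [^] p \<otimes> (mon ?x n b \<ominus> mon x n b)"
       using mc[of b] by algebra
     qed (use mc cc in auto)
     also have "\<dots> = pcomb x n c \<oplus> ?w"
      unfolding pcomb_def by (rule finsum_addf) (use mc cc in auto)
     finally have "pcomb x n c \<oplus> ?w = \<zero>" using z by simp
     moreover have "cf (pcomb x n c \<oplus> ?w) b = cf (pcomb x n c) b \<oplus> cf ?w b"
      by (rule cf_add[OF pcomb_closed[OF x c] _ b(1)]) (use w in "auto simp: W_def")
     moreover have "cf ?w b = \<zero>" using w b bd by (auto simp: W_def)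
     ultimately show ?thesis using cf_pcomb[OF c b(1)] cf_zero[OF b(1)] cc[OF b(1)] by simp
    qed
   qed
  qed
  from this[of 0] show "c b0 = \<zero>" using b0 by simp
 qed
 then show ?thesis using x' gen' charp_axioms by (intro pbasis.intro pbasis_axioms.intro)
qed

end

context pbasis begin

definition Y :: "'a set => nat => nat set" where "Y M i = {l. l < i & x l : M}"

definition I :: "'a set => nat => 'a set" where "I M i = genideal R (x ` Y M i)"

lemma ideal_I: "i <= n ==> ideal (I M i) R"
 unfolding I_def by (rule genideal_ideal) (use x in "auto simp: Y_def")

lemma I_mem: "i <= n ==> l : Y M i ==> x l : I M i"
proof -
 assume i: "i <= n" and l: "l : Y M i"
 have "x ` Y M i <= carrier R" using x i by (auto simp: Y_def)
 from genideal_self[OF this] l show "x l : I M i" unfolding I_def by blast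
qed

lemma I_least: "ideal J R ==> (!!l. l : Y M i ==> x l : J) ==> I M i <= J"
 unfolding I_def by (rule genideal_minimal) auto

text \<open>Since \<open>R\<close> is free over \<open>R\<^sup>p\<close> on the monomials, membership in the ideal generated by some of
 the \<open>x\<^sub>l\<close> can be read off from the coefficients of the monomials without these variables.\<close>

lemma I_cf:
 assumes i: "i <= n" and a: "a : I M i" and b: "b : E n" "!!l. l : Y M i ==> b l = 0"
 shows "cf a b : I M i"
proof -
 let ?D = "{a : carrier R. ALL b:E n. (ALL l:Y M i. b l = 0) --> cf a b : I M i}"
 note Im = submodD[OF submod_ideal[OF ideal_I[OF i, of M] subset_refl]]
 have sub: "submod Kp ?D" by (rule submod_cf) (rule submod_ideal[OF ideal_I[OF i] subset_refl])
 have inY: "x l \<otimes> u : ?D" if l: "l : Y M i" and u: "u : carrier R" for l u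
 proof -
  have ln: "l < n" using l i by (auto simp: Y_def)
  have "cf (x l \<otimes> u) b : I M i" if b: "b : E n" "ALL l:Y M i. b l = 0" for b
  proof -
   have "cf u (b(l := p - 1)) : carrier R" using cf_closed[OF u E_upd[OF b(1) ln]] p_pos by simp
   then have "x l \<otimes> cf u (b(l := p - 1)) : I M i"
    using ideal.I_r_closed[OF ideal_I[OF i] I_mem[OF i l]] by simp
   then show ?thesis using cf_shift[OF u b(1) ln] b l by simp
  qed
  then show ?thesis using u xc[OF ln] by auto
 qed
 have notY: "x l \<otimes> u : ?D" if l: "l < n" "l ~: Y M i" and u: "u : ?D" for l u
 proof -
  have uc: "u : carrier R" using u by simp
  have "cf (x l \<otimes> u) b : I M i" if b: "b : E n" "ALL l:Y M i. b l = 0" for b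
  proof -
   have z: "cf u (b(l := m)) : I M i" if "m < p" for m
    using u E_upd[OF b(1) l(1) that] b l by (auto dest!: bspec[of "E n" _ "b(l := m)"])
   have "b l - 1 < p" using E_le[OF b(1) l(1)] by simp
   then show ?thesis using cf_shift[OF uc b(1) l(1)] z p_pos Im(4)[OF xc[OF l(1)]] by simp
  qed
  then show ?thesis using xc[OF l(1)] uc by auto
 qed
 have "submod (carrier R) ?D"
  by (rule carrier_stab[OF sub]) (use inY notY in blast)
 then have D: "ideal ?D R" by (rule ideal_submod)
 have "x l : ?D" if l: "l : Y M i" for l
  using inY[OF l one_closed] xc[of l] l i by (auto simp: Y_def)
 then have "I M i <= ?D" by (rule I_least[OF D])
 then show ?thesis using a b by auto
qed

lemma cf_imp_mem:
 assumes J: "ideal J R" and a: "a : carrier R" and xJ: "!!l. l : S ==> l < n & x l : J"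
  and cf: "!!b. b : E n ==> (!!l. l : S ==> b l = 0) ==> cf a b [^] p : J"
 shows "a : J"
proof (rule cf_in_submod[OF _ _ _ a])
 note Jm = submodD[OF submod_ideal[OF J subset_refl]]
 show "J <= carrier R" "\<zero> : J" "!!u v. u : J ==> v : J ==> u \<oplus> v : J" using Jm by auto
 fix b assume b: "b : E n"
 have c: "cf a b [^] p : carrier R" "mon x n b : carrier R" using cf_closed[OF a b] mon_closed[OF x] by auto
 show "cf a b [^] p \<otimes> mon x n b : J"
 proof (cases "ALL l:S. b l = 0")
  case True
  then show ?thesis using ideal.I_r_closed[OF J cf[OF b] c(2)] by auto
 next
  case False
  then obtain l where l: "l : S" "b l ~= 0" by auto
  have ln: "l < n" "x l : J" using xJ[OF l(1)] by auto
  have "x l [^] b l : J"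
  proof -
   have "x l [^] b l = x l [^] (b l - 1) \<otimes> x l" using l xc[OF ln(1)] by (metis Suc_diff_1 nat_pow_Suc not_gr_zero)
   then show ?thesis using Jm(4) ln xc[OF ln(1)] by simp
  qed
  then have "mon x n b : J" unfolding mon_split[OF x ln(1)] by (rule ideal.I_r_closed[OF J _ rest_closed[OF x]])
  then show ?thesis using Jm(4) c by simp
 qed
qed

end

context charp_local begin

text \<open>Each \<open>x\<^sub>j\<close> lies in \<open>\<mm>\<close> or has a residue class that the earlier variables do not generate.\<close>

definition adapted :: "(nat => 'a) => nat => bool" where
 "adapted x i \<longleftrightarrow> (\<forall>j<i. x j : \<mm> \<or> (ALL k:Csub x j. ALL a:\<mm>. x j ~= a \<oplus> k))"

text \<open>If \<open>x\<^sub>j = a + k\<close> with \<open>a \<in> \<mm>\<close> and \<open>k\<close> generated by the earlier variables, \<open>pbasis_translate\<close> makes it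
 possible to replace \<open>x\<^sub>j\<close> by \<open>a\<close>.\<close>

lemma exists_adapted:
 assumes "pbasis R p x n"
 shows "i <= n ==> EX x'. pbasis R p x' n & adapted x' i"
proof (induct i)
 case 0 then show ?case using assms by (auto simp: adapted_def)
next
 case (Suc i)
 then obtain x' where x': "pbasis R p x' n" "adapted x' i" by auto
 interpret X: pbasis R p x' n by (rule x'(1))
 show ?case
 proof (cases "adapted x' (Suc i)")
  case True then show ?thesis using x' by auto
 next
  case False
  then obtain k a where ka: "k : Csub x' i" "a : \<mm>" "x' i = a \<oplus> k"
   using x'(2) by (auto simp: adapted_def less_Suc_eq)
  have kc: "k : carrier R" using ka subringE(1)[OF Csub_subring[OF X.x, of i]] Suc by auto
  let ?x = "x'(i := x' i \<ominus> k)"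
  have xi: "?x i = a" using ka kc mm_carrier[OF ka(2)] by simp algebra
  have C: "Csub ?x j = Csub x' j" if "j <= i" for j
   unfolding Csub_def by (rule arg_cong[of _ _ "%S. generate_ring R (Kp \<union> S)"]) (use that in auto)
  have "adapted ?x (Suc i)"
   unfolding adapted_def
  proof (intro allI impI)
   fix j assume j: "j < Suc i"
   show "?x j : \<mm> \<or> (ALL k:Csub ?x j. ALL a:\<mm>. ?x j ~= a \<oplus> k)"
   proof (cases "j = i")
    case True then show ?thesis using xi ka by simp
   next
    case False
    then have ji: "j < i" using j by simp
    then show ?thesis using x'(2) C[of j] unfolding adapted_def by simp
   qed
  qed
  moreover have "pbasis R p ?x n" by (rule X.pbasis_translate) (use Suc ka in auto)
  ultimately show ?thesis by blast
 qed
qed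

lemma pow_p_mem:
 assumes J: "ideal J R" and c: "c : N" "c : \<mm>" and gen: "!!c a. c : \<mm> ==> a : N ==> c \<otimes> a : J"
 shows "c [^] p : J"
proof -
 have cc: "c : carrier R" using mm_carrier c by auto
 have "p = Suc (Suc (p - 2))" using p_pos(3) by simp
 then have "c [^] p = c [^] Suc (Suc (p - 2))" by simp
 then have "c [^] p = c [^] (p - 2) \<otimes> (c \<otimes> c)" using cc by (simp add: m_assoc)
 then show ?thesis using ideal.I_l_closed[OF J gen[OF c(2,1)], of "c [^] (p - 2)"] cc by simp
qed

lemma prime_chain_Cons:
 assumes "prime_chain k f" "primeideal P R" "P \<subset> f 0"
 shows "prime_chain (Suc k) (case_nat P f)"
 using assms by (auto simp: prime_chain_def split: nat.split)

end

locale charp_local_pbasis = charp_local R p gs \<mm> + pbasis R p x n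
 for R (structure) and p gs \<mm> x n +
 assumes adapted: "adapted x n"
begin

abbreviation II where "II i \<equiv> I \<mm> i"

lemma II_sub_mm: "i <= n ==> II i <= \<mm>"
 by (rule I_least[OF mm_ideal]) (auto simp: Y_def)

lemma mm_Csub:
 assumes J: "ideal J R" "II n <= J" "!!c. c : \<mm> ==> c [^] p : J"
 shows "j <= n ==> \<mm> \<inter> Csub x j <= J"
proof (induct j)
 case 0
 have "Csub x 0 <= Kp" unfolding Csub_def by (rule generate_ring_min_subring1[OF _ Kp_subring]) (auto simp: Kp_carrier)
 then show ?case using J(3) prime_frob[OF mm_prime] by (auto elim!: KpE)
next
 case (Suc j)
 let ?K = "Csub x j"
 have j: "j < n" "j <= n" using Suc by auto
 have K: "subring ?K R" by (rule Csub_subring[OF x j(2)])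
 have Kc: "?K <= carrier R" using subringE(1)[OF K] .
 have z: "submod ?K {\<zero>}" by (rule submod_ideal[OF zeroideal Kc])
 let ?T = "adjs ?K {\<zero>} (pows (x j) p)"
 have sT: "submod ?K ?T" by (rule submod_adjs[OF K z pows_closed[OF xc[OF j(1)]]])
 have tp: "x j [^] p : ?K" using KpI[OF xc[OF j(1)]] Csub_incl(1) by auto
 have "x j [^] (0::nat) : set (pows (x j) p)" unfolding pows_def set_map by (rule imageI) (use p_pos in simp)
 then have one: "\<one> : ?T" using adjs_mem[OF K z pows_closed[OF xc[OF j(1)], of p]] by auto
 have sub: "Csub x (Suc j) <= ?T"
 proof
  fix h assume h: "h : Csub x (Suc j)"
  have "h \<otimes> \<one> : ?T"
  proof (rule Csub_stab[OF submod_mono[OF sT Csub_incl(1)] x Suc(2) _ h one])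
   fix l u assume lu: "l < Suc j" "u : ?T"
   show "x l \<otimes> u : ?T"
   proof (cases "l = j")
    case True then show ?thesis using pows_span_mult[OF K xc[OF j(1)] tp lu(2)] by simp
   next
    case False then show ?thesis using submodD(4)[OF sT Csub_incl(2) lu(2)] lu by simp
   qed
  qed
  moreover have "h : carrier R" using h subringE(1)[OF Csub_subring[OF x Suc(2)]] by auto
  ultimately show "h : ?T" by simp
 qed
 note Jm = submodD[OF submod_ideal[OF J(1) subset_refl]]
 show ?case
 proof (cases "x j : \<mm>")
  case True
  have xJ: "x j : J" using I_mem[of n j \<mm>] True j J(2) by (auto simp: Y_def)
  have sKJ: "submod ?K (ssum ?K J)" by (rule submod_ssum[OF Kc submod_self[OF K] submod_ideal[OF J(1) Kc]])
  have up: "?K <= ssum ?K J" "J <= ssum ?K J"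
   using ssum_upper1[OF submod_ideal[OF J(1) Kc] Kc] ssum_upper2[OF submod_self[OF K] Jm(1)] by auto
  have "x j [^] l : ssum ?K J" for l :: nat
  proof (cases l)
   case 0 then show ?thesis using subringE(3)[OF K] up by auto
  next
   case (Suc m) then show ?thesis using Jm(4)[of "x j [^] m" "x j"] xJ xc[OF j(1)] up by auto
  qed
  then have TKJ: "?T <= ssum ?K J"
   by (intro adjs_least[OF sKJ]) (use submodD(2)[OF sKJ] in "auto simp: pows_def")
  show ?thesis
  proof
   fix a assume a: "a : \<mm> \<inter> Csub x (Suc j)"
   show "a : J"
   proof (cases "\<one> : J")
    case True then show ?thesis using ideal.one_imp_carrier[OF J(1)] a mm_carrier by auto
   next
    case False
    then have Jmm: "J <= \<mm>" by (rule proper_sub_mm[OF J(1)])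
    obtain k w where kw: "k : ?K" "w : J" "a = k \<oplus> w" using a sub TKJ by (auto elim!: ssumE)
    have c: "k : carrier R" "w : carrier R" using kw Kc Jm(5) by auto
    have e: "(k \<oplus> w) \<ominus> w = k" using c by algebra
    have "a \<ominus> w : \<mm>"
     by (rule submod_minus[OF carrier_is_subring submod_ideal[OF mm_ideal subset_refl]]) (use a kw Jmm in auto)
    then have "k : \<mm>" using e kw(3) by simp
    then have "k : J" using Suc kw by auto
    then show ?thesis using kw Jm(3) by auto
   qed
  qed
 next
  case False
  have "\<mm> \<inter> ?T <= adjs (?K \<inter> \<mm>) {\<zero>} (pows (x j) p)"
  proof (rule adjoin_root_residue[OF K Csub_incl(1) xc[OF j(1)]])
   show "k = \<zero>" if "d < p" "k : ?K" "k \<otimes> x j [^] d : adjs ?K {\<zero>} (pows (x j) d)" for d k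
    by (rule free_over_Csub[OF j(1) that])
   show "x j ~= a \<oplus> k" if "k : ?K" "a : \<mm>" for k a
    using adapted False j that unfolding adapted_def by blast
  qed
  also have "adjs (?K \<inter> \<mm>) {\<zero>} (pows (x j) p) <= J"
  proof (rule adjs_subset[OF submod_ideal[OF J(1) subset_refl]])
   show "{\<zero>} <= J" using Jm by auto
   fix k u assume ku: "k : ?K \<inter> \<mm>" "u : set (pows (x j) p)"
   then have "k : J" "u : carrier R" using Suc pows_closed[OF xc[OF j(1)], of p] by auto
   then show "k \<otimes> u : J" by (rule ideal.I_r_closed[OF J(1)])
  qed
  finally show ?thesis using sub by auto
 qed
qed

lemma mm_eq: "\<mm> = II n"
proof
 have Cn: "Csub x n = carrier R" using gen pspan_eq_generate[OF x] by (simp add: Csub_def)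
 show "\<mm> <= II n"
 proof (rule nakayama_ideal[OF mm_ideal ideal_I[OF order_refl]])
  fix J assume J: "ideal J R" "II n <= J" "!!c a. c : \<mm> ==> a : \<mm> ==> c \<otimes> a : J"
  have "\<mm> \<inter> Csub x n <= J"
   by (rule mm_Csub[OF J(1,2) _ order_refl]) (rule pow_p_mem[OF J(1) _ _ J(3)])
  then show "\<mm> <= J" using Cn mm_carrier by auto
 qed
qed (rule II_sub_mm[OF order_refl])

lemma x_notin_II:
 assumes i: "i < n" shows "x i ~: II i"
proof
 assume a: "x i : II i"
 let ?b = "(%j. if j < n then 0 else undefined)(i := 1)"
 have b: "?b : E n" by (rule E_upd[OF zero_exp_E i]) (use p_pos in simp)
 have "cf (x i) ?b : II i" by (rule I_cf[OF _ a b]) (use i in "auto simp: Y_def")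
 moreover have "cf (x i \<otimes> \<one>) ?b = \<one>" using cf_shift[OF one_closed b i] cf_one[OF zero_exp_E] i
  by (simp add: fun_upd_idem)
 ultimately show False using II_sub_mm[of i] i mm_proper xc[OF i] by auto
qed

lemma nonzerodivisor:
 assumes i: "i < n" and a: "a : carrier R" "x i \<otimes> a : II i"
 shows "a : II i"
proof -
 have ile: "i <= n" using i by simp
 note Ii = ideal_I[OF ile, of \<mm>]
 let ?N = "{a : carrier R. a \<otimes> x i : II i}"
 have N: "ideal ?N R" by (rule adj_eq_colon_mem[OF Ii xc[OF i]])
 have "\<one> ~: ?N" using x_notin_II[OF i] xc[OF i] by simp
 then have Nm: "?N <= \<mm>" by (rule proper_sub_mm[OF N])
 have "?N <= II i"
 proof (rule nakayama_ideal[OF N Ii])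
  fix J assume J: "ideal J R" "II i <= J" "!!c a. c : \<mm> ==> a : ?N ==> c \<otimes> a : J"
  show "?N <= J"
  proof
   fix a assume aN: "a : ?N"
   then have a: "a : carrier R" "x i \<otimes> a : II i" using xc[OF i] by (auto simp: m_comm)
   show "a : J"
   proof (rule cf_imp_mem[OF J(1) a(1), of "Y \<mm> i"])
    show "l < n & x l : J" if "l : Y \<mm> i" for l using I_mem[OF ile that] J(2) that i by (auto simp: Y_def)
    fix b assume b: "b : E n" "!!l. l : Y \<mm> i ==> b l = 0"
    have cc: "cf a b : carrier R" by (rule cf_closed[OF a(1) b(1)])
    have iY: "i ~: Y \<mm> i" by (simp add: Y_def)
    show "cf a b [^] p : J"
    proof (cases "Suc (b i) < p")
     case True
     let ?b = "b(i := Suc (b i))"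
     have b': "?b : E n" by (rule E_upd[OF b(1) i True])
     have "cf (x i \<otimes> a) ?b : II i" by (rule I_cf[OF ile a(2) b']) (use b iY in auto)
     moreover have "cf (x i \<otimes> a) ?b = cf a b" using cf_shift[OF a(1) b' i] by (simp add: fun_upd_idem)
     ultimately have "cf a b : J" using J(2) by auto
     moreover have "cf a b [^] p = cf a b [^] (p - 1) \<otimes> cf a b" using p_pos cc by (metis Suc_diff_1 nat_pow_Suc)
     ultimately show ?thesis using ideal.I_l_closed[OF J(1)] cc by simp
    next
     case False
     then have bi: "b i = p - 1" using E_le[OF b(1) i] by simp
     let ?b = "b(i := 0)"
     have b': "?b : E n" by (rule E_upd[OF b(1) i p_pos(1)])
     have "cf (x i \<otimes> a) ?b : II i" by (rule I_cf[OF ile a(2) b']) (use b iY in auto)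
     moreover have "cf (x i \<otimes> a) ?b = x i \<otimes> cf a b" using cf_shift[OF a(1) b' i] bi
      by (simp add: fun_upd_idem)
     ultimately have "cf a b : ?N" using cc xc[OF i] by (simp add: m_comm)
     then show ?thesis using pow_p_mem[OF J(1) _ _ J(3)] Nm by blast
    qed
   qed
  qed
 qed
 then show ?thesis using a xc[OF i] by (auto simp: m_comm)
qed

lemma nonzerodivisor_pow:
 assumes i: "i < n" and a: "a : carrier R" shows "x i [^] (k::nat) \<otimes> a : II i ==> a : II i"
proof (induct k)
 case (Suc k)
 have "x i \<otimes> (x i [^] k \<otimes> a) : II i" using Suc(2) xc[OF i] a by (simp add: m_ac)
 then have "x i [^] k \<otimes> a : II i" by (rule nonzerodivisor[OF i, rotated]) (use xc[OF i] a in simp)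
 then show ?case by (rule Suc(1))
qed (use a in simp)

lemma separated:
 assumes i: "i < n" "x i : \<mm>" and a: "a : carrier R" "!!k. a : adj (carrier R) (II i) (x i [^] (k::nat))"
 shows "a : II i"
proof -
 have ile: "i <= n" using i by simp
 note Ii = ideal_I[OF ile, of \<mm>]
 let ?L = "\<Inter>k. adj (carrier R) (II i) (x i [^] (k::nat))"
 have ai: "ideal (adj (carrier R) (II i) (x i [^] (k::nat))) R" for k by (rule ideal_adj[OF Ii]) (use xc[OF i(1)] in simp)
 have L: "ideal ?L R" by (rule i_Intersect) (use ai in auto)
 have "?L <= II i"
 proof (rule nakayama_ideal[OF L Ii])
  fix J assume J: "ideal J R" "II i <= J" "!!c a. c : \<mm> ==> a : ?L ==> c \<otimes> a : J"
  show "?L <= J"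
  proof
   fix a assume aL: "a : ?L"
   then have ak: "a : adj (carrier R) (II i) (x i [^] k)" for k :: nat by auto
   obtain u c where uc: "u : II i" "c : carrier R" "a = u \<oplus> c \<otimes> x i [^] (1::nat)" using ak[of 1] by (rule adjE)
   have ucc: "u : carrier R" using uc ideal.Icarr[OF Ii] by simp
   have xi: "x i : carrier R" by (rule xc[OF i(1)])
   have "c : adj (carrier R) (II i) (x i [^] k)" for k :: nat
   proof -
    obtain v d where vd: "v : II i" "d : carrier R" "a = v \<oplus> d \<otimes> x i [^] Suc k" using ak[of "Suc k"] by (rule adjE)
    have vc: "v : carrier R" using vd ideal.Icarr[OF Ii] by simp
    have xk: "x i [^] k : carrier R" using xi by simp
    have "u \<oplus> c \<otimes> x i = v \<oplus> d \<otimes> (x i [^] k \<otimes> x i)" using uc(3) vd(3) xi by simp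
    note e = this
    have "x i \<otimes> (c \<ominus> d \<otimes> x i [^] k) = (u \<oplus> c \<otimes> x i) \<ominus> d \<otimes> (x i [^] k \<otimes> x i) \<ominus> u"
     using ucc uc(2) vd(2) xi xk by algebra
    also have "\<dots> = v \<ominus> u" unfolding e using ucc vc vd(2) xi xk by algebra
    finally have "x i \<otimes> (c \<ominus> d \<otimes> x i [^] k) = v \<ominus> u" .
    moreover have "v \<ominus> u : II i"
     by (rule submod_minus[OF carrier_is_subring submod_ideal[OF Ii subset_refl] vd(1) uc(1)])
    ultimately have "c \<ominus> d \<otimes> x i [^] k : II i"
     using nonzerodivisor[OF i(1), of "c \<ominus> d \<otimes> x i [^] k"] uc vd xk by simp
    then have "(c \<ominus> d \<otimes> x i [^] k) \<oplus> d \<otimes> x i [^] k : adj (carrier R) (II i) (x i [^] k)" by (rule adjI[OF _ vd(2)])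
    moreover have "(c \<ominus> d \<otimes> x i [^] k) \<oplus> d \<otimes> x i [^] k = c" using uc(2) vd(2) xk by algebra
    ultimately show ?thesis by simp
   qed
   then have "x i \<otimes> c : J" using J(3)[OF i(2)] by auto
   then have "u \<oplus> x i \<otimes> c : J" using uc J additive_subgroup.a_closed[OF ideal.axioms(1)[OF J(1)]] by auto
   then show "a : J" using uc xi by (simp add: m_comm)
  qed
 qed
 then show ?thesis using a by auto
qed

text \<open>If \<open>x\<close> is a nonzerodivisor of a ring, \<open>\<Inter>\<^sub>k (x\<^sup>k) = 0\<close> and the quotient by \<open>x\<close> is a domain, the ring is
 a domain: nonzero factors of a vanishing product could be divided by powers of \<open>x\<close> until neither of
 them is divisible by \<open>x\<close>. This is applied modulo \<open>II i\<close>.\<close>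

lemma II_prime_step:
 assumes i: "i < n" "x i : \<mm>" and P: "primeideal (II (Suc i)) R"
 shows "primeideal (II i) R"
proof (rule primeidealI)
 have ile: "i <= n" and sile: "Suc i <= n" using i by auto
 note Ii = ideal_I[OF ile, of \<mm>]
 show "ideal (II i) R" by (rule Ii)
 show "cring R" by (rule cring_axioms)
 show "carrier R ~= II i" using II_sub_mm[OF ile] mm_proper by auto
 have xi: "x i : carrier R" by (rule xc[OF i(1)])
 have sub: "II i <= II (Suc i)" by (rule I_least[OF ideal_I[OF sile]]) (use I_mem[OF sile] in "auto simp: Y_def")
 have S: "II (Suc i) <= adj (carrier R) (II i) (x i)"
 proof (rule I_least[OF ideal_adj[OF Ii xi]])
  fix l assume l: "l : Y \<mm> (Suc i)"
  show "x l : adj (carrier R) (II i) (x i)"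
  proof (cases "l = i")
   case True
   then show ?thesis using adj_mem[OF carrier_is_subring submod_ideal[OF Ii subset_refl] xi] by simp
  next
   case False
   then have "x l : II i" using I_mem[OF ile] l by (auto simp: Y_def)
   then show ?thesis using adj_upper[OF carrier_is_subring submod_ideal[OF Ii subset_refl] xi] by auto
  qed
 qed
 have fac: "EX u a' k. u : II i & a' : carrier R & a' ~: II (Suc i) & a = u \<oplus> a' \<otimes> x i [^] (k::nat)"
  if a: "a : carrier R" "a ~: II i" for a
 proof -
  let ?Q = "%k. a ~: adj (carrier R) (II i) (x i [^] (k::nat))"
  have ex: "EX k. ?Q k" using separated[OF i a(1)] a(2) by blast
  define k where "k = (LEAST k. ?Q k)"
  have k: "?Q k" "!!l. l < k ==> \<not> ?Q l" unfolding k_def using LeastI_ex[OF ex] not_less_Least by blast+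
  have "\<not> ?Q 0"
   using ideal.one_imp_carrier[OF ideal_adj[OF Ii one_closed]] adj_mem[OF carrier_is_subring submod_ideal[OF Ii subset_refl] one_closed] a by simp
  then obtain l where l: "k = Suc l" using k(1) by (cases k) auto
  have "a : adj (carrier R) (II i) (x i [^] l)" using k(2)[of l] l by simp
  then obtain u a' where ua: "u : II i" "a' : carrier R" "a = u \<oplus> a' \<otimes> x i [^] l" by (rule adjE)
  have "a' ~: II (Suc i)"
  proof
   assume "a' : II (Suc i)"
   from subsetD[OF S this] obtain v c where vc: "v : II i" "c : carrier R" "a' = v \<oplus> c \<otimes> x i" by (rule adjE)
   have cs: "u : carrier R" "v : carrier R" "x i [^] l : carrier R" using ua vc ideal.Icarr[OF Ii] xi by auto
   have "a = (u \<oplus> v \<otimes> x i [^] l) \<oplus> c \<otimes> x i [^] k"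
    unfolding l ua(3) vc(3) nat_pow_Suc using cs vc(2) xi by algebra
   moreover have "u \<oplus> v \<otimes> x i [^] l : II i"
    using ua(1) ideal.I_r_closed[OF Ii vc(1) cs(3)] additive_subgroup.a_closed[OF ideal.axioms(1)[OF Ii]] by auto
   ultimately show False using k(1) adjI vc by simp
  qed
  then show ?thesis using ua by blast
 qed
 fix a b assume ab: "a : carrier R" "b : carrier R" "a \<otimes> b : II i"
 show "a : II i \<or> b : II i"
 proof (rule ccontr)
  assume "\<not> ?thesis"
  then obtain u a' k v b' l where
   a': "u : II i" "a' : carrier R" "a' ~: II (Suc i)" "a = u \<oplus> a' \<otimes> x i [^] (k::nat)" and
   b': "v : II i" "b' : carrier R" "b' ~: II (Suc i)" "b = v \<oplus> b' \<otimes> x i [^] (l::nat)"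
   using fac[OF ab(1)] fac[OF ab(2)] by blast
  have cs: "u : carrier R" "v : carrier R" "x i [^] l : carrier R" "x i [^] k : carrier R" using a' b' ideal.Icarr[OF Ii] xi by auto
  have "x i [^] k \<otimes> (x i [^] l \<otimes> (a' \<otimes> b')) = a \<otimes> b \<ominus> (u \<otimes> b \<oplus> v \<otimes> (a' \<otimes> x i [^] k))"
   unfolding a'(4) b'(4) using cs a'(2) b'(2) by algebra
  moreover have "u \<otimes> b \<oplus> v \<otimes> (a' \<otimes> x i [^] k) : II i"
   using ideal.I_r_closed[OF Ii a'(1) ab(2)] ideal.I_r_closed[OF Ii b'(1), of "a' \<otimes> x i [^] k"] cs a'(2)
    additive_subgroup.a_closed[OF ideal.axioms(1)[OF Ii]] by auto
  ultimately have "x i [^] k \<otimes> (x i [^] l \<otimes> (a' \<otimes> b')) : II i"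
   using submod_minus[OF carrier_is_subring submod_ideal[OF Ii subset_refl] ab(3)] by simp
  then have "x i [^] l \<otimes> (a' \<otimes> b') : II i" by (rule nonzerodivisor_pow[OF i(1), rotated]) (use cs a'(2) b'(2) in simp)
  then have "a' \<otimes> b' : II i" by (rule nonzerodivisor_pow[OF i(1), rotated]) (use a'(2) b'(2) in simp)
  then show False using primeideal.I_prime[OF P a'(2) b'(2)] sub a'(3) b'(3) by auto
 qed
qed

lemma chain_from:
 "j <= n ==> EX f. prime_chain (card {l. n - j <= l & l < n & x l : \<mm>}) f & f 0 = II (n - j)"
proof (induct j)
 case 0
 have "prime_chain 0 (%_. II n)" using mm_prime mm_eq by (simp add: prime_chain_def)
 moreover have "{l. n - 0 <= l & l < n & x l : \<mm>} = {}" by auto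
 ultimately show ?case by (metis card.empty diff_zero)
next
 case (Suc j)
 let ?S = "%i. {l. i <= l & l < n & x l : \<mm>}"
 define i where "i = n - Suc j"
 have i: "i < n" "n - j = Suc i" using Suc by (auto simp: i_def)
 have ile: "i <= n" and sile: "Suc i <= n" using i by auto
 obtain f where f: "prime_chain (card (?S (Suc i))) f" "f 0 = II (Suc i)" using Suc i by auto
 have fin: "finite (?S k)" for k by (rule finite_subset[of _ "{..<n}"]) auto
 have "EX f. prime_chain (card (?S i)) f & f 0 = II i"
 proof (cases "x i : \<mm>")
  case True
  have "?S i = insert i (?S (Suc i))" using i True by (auto simp: not_less_eq_eq le_less)
  then have c: "card (?S i) = Suc (card (?S (Suc i)))" using fin by simp
  have "primeideal (f 0) R" using f(1) by (auto simp: prime_chain_def)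
  then have P: "primeideal (II i) R" using II_prime_step[OF i(1) True] f(2) by simp
  have "II i <= II (Suc i)" by (rule I_least[OF ideal_I[OF sile]]) (use I_mem[OF sile] in "auto simp: Y_def")
  moreover have "x i : II (Suc i)" using I_mem[OF sile] True by (auto simp: Y_def)
  ultimately have "II i \<subset> f 0" using x_notin_II[OF i(1)] f(2) by auto
  then show ?thesis using prime_chain_Cons[OF f(1) P] c by (intro exI[of _ "case_nat (II i) f"]) simp
 next
  case False
  have "?S i = ?S (Suc i)" using False by (auto simp: not_less_eq_eq le_less)
  moreover have "Y \<mm> (Suc i) = Y \<mm> i" using False by (auto simp: Y_def less_Suc_eq)
  ultimately show ?thesis using f by (auto simp: I_def)
 qed
 then show ?case by (simp add: i_def)
qed

lemma regular: "regular_local_ring R"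
proof -
 let ?ws = "map x (filter (%l. x l : \<mm>) [0..<n])"
 have ws: "set ?ws <= carrier R" using xc by auto
 have "set ?ws = x ` Y \<mm> n" by (auto simp: Y_def)
 then have mm: "\<mm> = adjs (carrier R) {\<zero>} ?ws" using mm_eq genideal_eq_adjs[OF ws] by (simp add: I_def)
 have "length ?ws = card (set (filter (%l. x l : \<mm>) [0..<n]))" using distinct_card[of "filter (%l. x l : \<mm>) [0..<n]"] by simp
 also have "set (filter (%l. x l : \<mm>) [0..<n]) = {l. n - n <= l & l < n & x l : \<mm>}" by auto
 finally obtain f where "prime_chain (length ?ws) f" using chain_from[OF order_refl] by auto
 then show ?thesis by (rule regular_localI[OF ws mm])
qed

end

text \<open>For an adapted \<open>p\<close>-basis the elements in \<open>\<mm>\<close> generate \<open>\<mm>\<close>, and there is a chain of primes with one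
 step for each of them.\<close>

theorem (in charp_local) pbasis_imp_regular_local:
 assumes "pbasis R p x n" shows "regular_local_ring R"
proof -
 obtain x' where x': "pbasis R p x' n" "adapted x' n" using exists_adapted[OF assms order_refl] by auto
 interpret charp_local_pbasis R p gs \<mm> x' n
  using x' charp_local_axioms by (intro charp_local_pbasis.intro charp_local_pbasis_axioms.intro)
 show ?thesis by (rule regular)
qed

section \<open>Localization\<close>

locale localized = primeideal P R for P and R (structure)
begin

abbreviation (input) fr :: "'a => 'a => ('a \<times> 'a) set" where "fr \<equiv> fraction R P"
abbreviation L :: "('a \<times> 'a) set ring" where "L \<equiv> localization R P"

lemma Pi: "ideal P R" by (rule is_ideal)

lemma one_den: "\<one> : carrier R - P"
 using one_notin_prime[OF primeideal_axioms] by simp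

lemma mult_den: "s : carrier R - P ==> t : carrier R - P ==> s \<otimes> t : carrier R - P"
 using I_prime[of s t] by auto

definition eqv :: "'a => 'a => 'a => 'a => bool" where
 "eqv a s b t \<longleftrightarrow> (EX u:carrier R - P. u \<otimes> (a \<otimes> t \<ominus> b \<otimes> s) = \<zero>)"

lemma eqv_refl: "a : carrier R ==> s : carrier R ==> eqv a s a s"
 unfolding eqv_def using one_den by (intro bexI[of _ \<one>]) (auto simp: minus_eq r_neg)

lemma eqv_sym:
 assumes "eqv a s b t" "a : carrier R" "b : carrier R" "s : carrier R" "t : carrier R" shows "eqv b t a s"
proof -
 obtain u where u: "u : carrier R - P" "u \<otimes> (a \<otimes> t \<ominus> b \<otimes> s) = \<zero>" using assms by (auto simp: eqv_def)
 have uc: "u : carrier R" using u by auto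
 have "u \<otimes> (b \<otimes> s \<ominus> a \<otimes> t) = \<ominus> (u \<otimes> (a \<otimes> t \<ominus> b \<otimes> s))" using uc assms(2-) by algebra
 then show ?thesis using u by (auto simp: eqv_def)
qed

lemma eqv_trans:
 assumes 1: "eqv a s b t" and 2: "eqv b t c w"
  and c: "a : carrier R" "b : carrier R" "c : carrier R" "s : carrier R" "t : carrier R - P" "w : carrier R"
 shows "eqv a s c w"
proof -
 obtain u where u: "u : carrier R - P" "u \<otimes> (a \<otimes> t \<ominus> b \<otimes> s) = \<zero>" using 1 by (auto simp: eqv_def)
 obtain v where v: "v : carrier R - P" "v \<otimes> (b \<otimes> w \<ominus> c \<otimes> t) = \<zero>" using 2 by (auto simp: eqv_def)
 have cc: "u : carrier R" "v : carrier R" "t : carrier R" using u v c by auto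
 have "(u \<otimes> v \<otimes> t) \<otimes> (a \<otimes> w \<ominus> c \<otimes> s)
  = (v \<otimes> w) \<otimes> (u \<otimes> (a \<otimes> t \<ominus> b \<otimes> s)) \<oplus> (u \<otimes> s) \<otimes> (v \<otimes> (b \<otimes> w \<ominus> c \<otimes> t))"
  using cc c(1-4,6) by algebra
 also have "\<dots> = \<zero>" using u v cc c by simp
 finally show ?thesis using mult_den[OF mult_den[OF u(1) v(1)] c(5)] by (auto simp: eqv_def)
qed

lemma fr_mem: "(b, t) : fr a s \<longleftrightarrow> b : carrier R & t : carrier R - P & eqv a s b t"
 by (auto simp: fraction_def eqv_def)

lemma fr_eq_iff:
 assumes "a : carrier R" "b : carrier R" "s : carrier R - P" "t : carrier R - P"
 shows "fr a s = fr b t \<longleftrightarrow> eqv a s b t"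
proof
 assume "fr a s = fr b t"
 moreover have "(b, t) : fr b t" using assms eqv_refl by (auto simp: fr_mem)
 ultimately have "(b, t) : fr a s" by simp
 then show "eqv a s b t" by (simp add: fr_mem)
next
 assume e: "eqv a s b t"
 have e': "eqv b t a s" using eqv_sym[OF e] assms by auto
 have "eqv a s c w \<longleftrightarrow> eqv b t c w" if "c : carrier R" "w : carrier R - P" for c w
  using eqv_trans[OF e, of c w] eqv_trans[OF e', of c w] assms that by auto
 then show "fr a s = fr b t" by (auto simp: fr_mem set_eq_iff)
qed

lemma fr_eqI:
 assumes "a : carrier R" "b : carrier R" "s : carrier R - P" "t : carrier R - P" "a \<otimes> t = b \<otimes> s"
 shows "fr a s = fr b t"
proof -
 have "a \<otimes> t \<ominus> b \<otimes> s = \<zero>" using assms by (simp add: minus_eq r_neg)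
 then show ?thesis using fr_eq_iff[OF assms(1-4)] one_den by (auto simp: eqv_def)
qed

lemma fr_self: "a : carrier R ==> s : carrier R - P ==> (a, s) : fr a s"
 using eqv_refl by (auto simp: fr_mem)

lemma carrier_L: "carrier L = {fr a s | a s. a : carrier R & s : carrier R - P}"
 by (simp add: localization_def)

lemma fr_closed: "a : carrier R ==> s : carrier R - P ==> fr a s : carrier L"
 by (auto simp: carrier_L)

lemma L_cases:
 assumes "q : carrier L" obtains a s where "a : carrier R" "s : carrier R - P" "q = fr a s"
 using assms by (auto simp: carrier_L)

lemma UN_const: "A ~= {} ==> (!!q. q : A ==> f q = c) ==> \<Union>(f ` A) = c"
 by auto

lemma fr_rep:
 assumes c: "a : carrier R" "b : carrier R" "s : carrier R - P" "t : carrier R - P"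
  and e: "!!a' s' b' t' u v. [|a' : carrier R; s' : carrier R - P; b' : carrier R; t' : carrier R - P;
   u : carrier R - P; v : carrier R - P; u \<otimes> (a \<otimes> s' \<ominus> a' \<otimes> s) = \<zero>; v \<otimes> (b \<otimes> t' \<ominus> b' \<otimes> t) = \<zero>|]
   ==> f a' s' b' t' = f a s b t"
 shows "(\<Union>(a', s')\<in>fr a s. \<Union>(b', t')\<in>fr b t. f a' s' b' t') = f a s b t"
proof -
 have "f a' s' b' t' = f a s b t" if m: "(a', s') : fr a s" "(b', t') : fr b t" for a' s' b' t'
 proof -
  obtain u v where "u : carrier R - P" "u \<otimes> (a \<otimes> s' \<ominus> a' \<otimes> s) = \<zero>" "v : carrier R - P" "v \<otimes> (b \<otimes> t' \<ominus> b' \<otimes> t) = \<zero>"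
   using m by (auto simp: fr_mem eqv_def)
  then show ?thesis using m by (intro e) (auto simp: fr_mem)
 qed
 then have "(\<Union>(b', t')\<in>fr b t. f a' s' b' t') = f a s b t" if "(a', s') : fr a s" for a' s'
  using that fr_self[OF c(2,4)] by (intro UN_const) auto
 then show ?thesis using fr_self[OF c(1,3)] by (intro UN_const) auto
qed

lemma fr_mult:
 assumes c: "a : carrier R" "b : carrier R" "s : carrier R - P" "t : carrier R - P"
 shows "fr a s \<otimes>\<^bsub>L\<^esub> fr b t = fr (a \<otimes> b) (s \<otimes> t)"
proof -
 have "(\<Union>(a', s')\<in>fr a s. \<Union>(b', t')\<in>fr b t. fr (a' \<otimes> b') (s' \<otimes> t')) = fr (a \<otimes> b) (s \<otimes> t)"
 proof (rule fr_rep[OF c])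
  fix a' s' b' t' u v
  assume c': "a' : carrier R" "s' : carrier R - P" "b' : carrier R" "t' : carrier R - P"
   and u: "u : carrier R - P" and v: "v : carrier R - P"
   and z: "u \<otimes> (a \<otimes> s' \<ominus> a' \<otimes> s) = \<zero>" "v \<otimes> (b \<otimes> t' \<ominus> b' \<otimes> t) = \<zero>"
  have cc: "u : carrier R" "v : carrier R" "s : carrier R" "t : carrier R" "s' : carrier R" "t' : carrier R" using u v c c' by auto
  have "(u \<otimes> v) \<otimes> ((a \<otimes> b) \<otimes> (s' \<otimes> t') \<ominus> (a' \<otimes> b') \<otimes> (s \<otimes> t))
   = (v \<otimes> b \<otimes> t') \<otimes> (u \<otimes> (a \<otimes> s' \<ominus> a' \<otimes> s)) \<oplus> (u \<otimes> a' \<otimes> s) \<otimes> (v \<otimes> (b \<otimes> t' \<ominus> b' \<otimes> t))"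
   using cc c(1,2) c'(1,3) by algebra
  also have "\<dots> = \<zero>" using z cc c c' by simp
  finally have "eqv (a \<otimes> b) (s \<otimes> t) (a' \<otimes> b') (s' \<otimes> t')" using mult_den[OF u v] by (auto simp: eqv_def)
  then show "fr (a' \<otimes> b') (s' \<otimes> t') = fr (a \<otimes> b) (s \<otimes> t)"
   using fr_eq_iff[of "a \<otimes> b" "a' \<otimes> b'" "s \<otimes> t" "s' \<otimes> t'"] c c' mult_den by auto
 qed
 then show ?thesis by (simp add: localization_def)
qed

lemma fr_add:
 assumes c: "a : carrier R" "b : carrier R" "s : carrier R - P" "t : carrier R - P"
 shows "fr a s \<oplus>\<^bsub>L\<^esub> fr b t = fr (a \<otimes> t \<oplus> b \<otimes> s) (s \<otimes> t)"
proof -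
 have "(\<Union>(a', s')\<in>fr a s. \<Union>(b', t')\<in>fr b t. fr (a' \<otimes> t' \<oplus> b' \<otimes> s') (s' \<otimes> t')) = fr (a \<otimes> t \<oplus> b \<otimes> s) (s \<otimes> t)"
 proof (rule fr_rep[OF c])
  fix a' s' b' t' u v
  assume c': "a' : carrier R" "s' : carrier R - P" "b' : carrier R" "t' : carrier R - P"
   and u: "u : carrier R - P" and v: "v : carrier R - P"
   and z: "u \<otimes> (a \<otimes> s' \<ominus> a' \<otimes> s) = \<zero>" "v \<otimes> (b \<otimes> t' \<ominus> b' \<otimes> t) = \<zero>"
  have cc: "u : carrier R" "v : carrier R" "s : carrier R" "t : carrier R" "s' : carrier R" "t' : carrier R" using u v c c' by auto
  have "(u \<otimes> v) \<otimes> ((a \<otimes> t \<oplus> b \<otimes> s) \<otimes> (s' \<otimes> t') \<ominus> (a' \<otimes> t' \<oplus> b' \<otimes> s') \<otimes> (s \<otimes> t))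
   = (v \<otimes> t \<otimes> t') \<otimes> (u \<otimes> (a \<otimes> s' \<ominus> a' \<otimes> s)) \<oplus> (u \<otimes> s \<otimes> s') \<otimes> (v \<otimes> (b \<otimes> t' \<ominus> b' \<otimes> t))"
   using cc c(1,2) c'(1,3) by algebra
  also have "\<dots> = \<zero>" using z cc c c' by simp
  finally have "eqv (a \<otimes> t \<oplus> b \<otimes> s) (s \<otimes> t) (a' \<otimes> t' \<oplus> b' \<otimes> s') (s' \<otimes> t')" using mult_den[OF u v] by (auto simp: eqv_def)
  then show "fr (a' \<otimes> t' \<oplus> b' \<otimes> s') (s' \<otimes> t') = fr (a \<otimes> t \<oplus> b \<otimes> s) (s \<otimes> t)"
   using fr_eq_iff[of "a \<otimes> t \<oplus> b \<otimes> s" "a' \<otimes> t' \<oplus> b' \<otimes> s'" "s \<otimes> t" "s' \<otimes> t'"] c c' cc mult_den by auto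
 qed
 then show ?thesis by (simp add: localization_def)
qed

lemma L_one: "\<one>\<^bsub>L\<^esub> = fr \<one> \<one>" and L_zero: "\<zero>\<^bsub>L\<^esub> = fr \<zero> \<one>"
 by (simp_all add: localization_def)

lemma cring_L: "cring L"
proof (rule cringI)
 note d = one_den mult_den fr_closed
 show "abelian_group L"
 proof (rule abelian_groupI)
  fix q r assume "q : carrier L" "r : carrier L"
  then obtain a s b t where q: "a : carrier R" "s : carrier R - P" "q = fr a s"
   "b : carrier R" "t : carrier R - P" "r = fr b t" by (auto elim!: L_cases)
  show "q \<oplus>\<^bsub>L\<^esub> r : carrier L" using q d by (simp add: fr_add)
  show "q \<oplus>\<^bsub>L\<^esub> r = r \<oplus>\<^bsub>L\<^esub> q"
   using q by (simp add: fr_add) (rule fr_eqI, use q mult_den in "auto simp: m_ac a_ac")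
  fix w assume "w : carrier L"
  then obtain c v where w: "c : carrier R" "v : carrier R - P" "w = fr c v" by (auto elim!: L_cases)
  have cs: "s : carrier R" "t : carrier R" "v : carrier R" using q w by auto
  have "(q \<oplus>\<^bsub>L\<^esub> r) \<oplus>\<^bsub>L\<^esub> w = fr ((a \<otimes> t \<oplus> b \<otimes> s) \<otimes> v \<oplus> c \<otimes> (s \<otimes> t)) (s \<otimes> t \<otimes> v)"
   using q w cs mult_den by (simp add: fr_add)
  also have "\<dots> = fr (a \<otimes> (t \<otimes> v) \<oplus> (b \<otimes> v \<oplus> c \<otimes> t) \<otimes> s) (s \<otimes> (t \<otimes> v))"
  proof (rule fr_eqI)
   show "((a \<otimes> t \<oplus> b \<otimes> s) \<otimes> v \<oplus> c \<otimes> (s \<otimes> t)) \<otimes> (s \<otimes> (t \<otimes> v)) = (a \<otimes> (t \<otimes> v) \<oplus> (b \<otimes> v \<oplus> c \<otimes> t) \<otimes> s) \<otimes> (s \<otimes> t \<otimes> v)"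
    using q(1,4) w(1) cs by algebra
  qed (use q w mult_den in auto)
  also have "\<dots> = q \<oplus>\<^bsub>L\<^esub> (r \<oplus>\<^bsub>L\<^esub> w)" using q w cs mult_den by (simp add: fr_add)
  finally show "(q \<oplus>\<^bsub>L\<^esub> r) \<oplus>\<^bsub>L\<^esub> w = q \<oplus>\<^bsub>L\<^esub> (r \<oplus>\<^bsub>L\<^esub> w)" .
 next
  show "\<zero>\<^bsub>L\<^esub> : carrier L" using d by (simp add: L_zero)
  fix q assume "q : carrier L"
  then obtain a s where q: "a : carrier R" "s : carrier R - P" "q = fr a s" by (auto elim!: L_cases)
  show "\<zero>\<^bsub>L\<^esub> \<oplus>\<^bsub>L\<^esub> q = q" using q one_den by (simp add: L_zero fr_add)
  have "fr (\<ominus> a) s \<oplus>\<^bsub>L\<^esub> q = fr (\<ominus> a \<otimes> s \<oplus> a \<otimes> s) (s \<otimes> s)" using q by (simp add: fr_add)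
  also have "\<dots> = fr \<zero> \<one>" by (rule fr_eqI) (use q one_den mult_den in "auto simp: l_minus l_neg")
  finally show "EX r:carrier L. r \<oplus>\<^bsub>L\<^esub> q = \<zero>\<^bsub>L\<^esub>" using q d by (auto simp: L_zero intro!: bexI[of _ "fr (\<ominus> a) s"])
 qed
 show "comm_monoid L"
 proof (rule comm_monoidI)
  fix q r assume "q : carrier L" "r : carrier L"
  then obtain a s b t where q: "a : carrier R" "s : carrier R - P" "q = fr a s"
   "b : carrier R" "t : carrier R - P" "r = fr b t" by (auto elim!: L_cases)
  show "q \<otimes>\<^bsub>L\<^esub> r : carrier L" using q d by (simp add: fr_mult)
  show "q \<otimes>\<^bsub>L\<^esub> r = r \<otimes>\<^bsub>L\<^esub> q" using q by (simp add: fr_mult m_comm)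
  fix w assume "w : carrier L"
  then obtain c v where w: "c : carrier R" "v : carrier R - P" "w = fr c v" by (auto elim!: L_cases)
  show "(q \<otimes>\<^bsub>L\<^esub> r) \<otimes>\<^bsub>L\<^esub> w = q \<otimes>\<^bsub>L\<^esub> (r \<otimes>\<^bsub>L\<^esub> w)" using q w mult_den by (simp add: fr_mult m_assoc)
 next
  show "\<one>\<^bsub>L\<^esub> : carrier L" using d by (simp add: L_one)
  fix q assume "q : carrier L"
  then show "\<one>\<^bsub>L\<^esub> \<otimes>\<^bsub>L\<^esub> q = q" using one_den by (auto elim!: L_cases simp: L_one fr_mult)
 qed
 fix q r w assume "q : carrier L" "r : carrier L" "w : carrier L"
 then obtain a s b t c v where q: "a : carrier R" "s : carrier R - P" "q = fr a s"
  "b : carrier R" "t : carrier R - P" "r = fr b t" "c : carrier R" "v : carrier R - P" "w = fr c v"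
  by (auto elim!: L_cases)
 have cs: "s : carrier R" "t : carrier R" "v : carrier R" using q by auto
 have "(q \<oplus>\<^bsub>L\<^esub> r) \<otimes>\<^bsub>L\<^esub> w = fr ((a \<otimes> t \<oplus> b \<otimes> s) \<otimes> c) (s \<otimes> t \<otimes> v)"
  using q cs mult_den by (simp add: fr_add fr_mult)
 also have "\<dots> = fr (a \<otimes> c \<otimes> (t \<otimes> v) \<oplus> b \<otimes> c \<otimes> (s \<otimes> v)) (s \<otimes> v \<otimes> (t \<otimes> v))"
 proof (rule fr_eqI)
  show "((a \<otimes> t \<oplus> b \<otimes> s) \<otimes> c) \<otimes> (s \<otimes> v \<otimes> (t \<otimes> v)) = (a \<otimes> c \<otimes> (t \<otimes> v) \<oplus> b \<otimes> c \<otimes> (s \<otimes> v)) \<otimes> (s \<otimes> t \<otimes> v)"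
   using q(1,4,7) cs by algebra
 qed (use q mult_den in auto)
 also have "\<dots> = q \<otimes>\<^bsub>L\<^esub> w \<oplus>\<^bsub>L\<^esub> r \<otimes>\<^bsub>L\<^esub> w" using q cs mult_den by (simp add: fr_add fr_mult)
 finally show "(q \<oplus>\<^bsub>L\<^esub> r) \<otimes>\<^bsub>L\<^esub> w = q \<otimes>\<^bsub>L\<^esub> w \<oplus>\<^bsub>L\<^esub> r \<otimes>\<^bsub>L\<^esub> w" .
qed

sublocale L: cring L by (rule cring_L)

definition \<iota> :: "'a => ('a \<times> 'a) set" where "\<iota> a = fr a \<one>"

lemma iota_hom: "\<iota> : ring_hom R L"
 by (rule ring_hom_memI) (use one_den in "auto simp: \<iota>_def fr_closed fr_mult fr_add L_one")

sublocale iota: ring_hom_cring R L \<iota>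
 by (intro ring_hom_cring.intro ring_hom_cring_axioms.intro cring_axioms cring_L iota_hom)

lemma fr_split:
 assumes "a : carrier R" "s : carrier R - P"
 shows "fr a s = fr \<one> s \<otimes>\<^bsub>L\<^esub> \<iota> a" "\<iota> a = \<iota> s \<otimes>\<^bsub>L\<^esub> fr a s" "\<iota> s \<otimes>\<^bsub>L\<^esub> fr \<one> s = \<one>\<^bsub>L\<^esub>"
proof -
 show "fr a s = fr \<one> s \<otimes>\<^bsub>L\<^esub> \<iota> a" using assms one_den by (simp add: \<iota>_def fr_mult)
 have "\<iota> s \<otimes>\<^bsub>L\<^esub> fr a s = fr (s \<otimes> a) s" using assms one_den by (simp add: \<iota>_def fr_mult)
 also have "\<dots> = fr a \<one>" by (rule fr_eqI) (use assms one_den in "auto simp: m_comm")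
 finally show "\<iota> a = \<iota> s \<otimes>\<^bsub>L\<^esub> fr a s" by (simp add: \<iota>_def)
 have "\<iota> s \<otimes>\<^bsub>L\<^esub> fr \<one> s = fr s s" using assms one_den by (simp add: \<iota>_def fr_mult)
 also have "\<dots> = fr \<one> \<one>" by (rule fr_eqI) (use assms one_den in auto)
 finally show "\<iota> s \<otimes>\<^bsub>L\<^esub> fr \<one> s = \<one>\<^bsub>L\<^esub>" by (simp add: L_one)
qed

lemma iota_zero_iff: "a : carrier R ==> \<iota> a = \<zero>\<^bsub>L\<^esub> \<longleftrightarrow> (EX u:carrier R - P. u \<otimes> a = \<zero>)"
 unfolding \<iota>_def L_zero using one_den by (simp add: fr_eq_iff eqv_def minus_eq)

definition MM :: "('a \<times> 'a) set set" where "MM = {fr a s | a s. a : P & s : carrier R - P}"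

lemma fr_MM: "a : carrier R ==> s : carrier R - P ==> fr a s : MM \<longleftrightarrow> a : P"
proof
 assume a: "a : carrier R" and s: "s : carrier R - P" and m: "fr a s : MM"
 obtain b t where b: "b : P" "t : carrier R - P" "fr a s = fr b t" using m by (auto simp: MM_def)
 have bc: "b : carrier R" using b Icarr by simp
 obtain u where u: "u : carrier R - P" "u \<otimes> (a \<otimes> t \<ominus> b \<otimes> s) = \<zero>"
  using b(3) fr_eq_iff[OF a bc s b(2)] by (auto simp: eqv_def)
 have c: "u : carrier R" "t : carrier R" "s : carrier R" using u b s by auto
 have "(u \<otimes> t) \<otimes> a = u \<otimes> (a \<otimes> t \<ominus> b \<otimes> s) \<oplus> (u \<otimes> s) \<otimes> b" using c a bc by algebra
 also have "\<dots> = (u \<otimes> s) \<otimes> b" using u c bc by simp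
 also have "\<dots> : P" using I_l_closed b c by simp
 finally have "u \<otimes> t : P \<or> a : P" using I_prime[of "u \<otimes> t" a] c a by simp
 then show "a : P" using mult_den[OF u(1) b(2)] by auto
qed (auto simp: MM_def)

lemma MM_ideal: "ideal MM L"
proof (rule L.ideal_submod, unfold L.submod_def, intro conjI ballI)
 show "MM <= carrier L" by (auto simp: MM_def intro!: fr_closed Icarr)
 show "\<zero>\<^bsub>L\<^esub> : MM" unfolding L_zero using one_den zero_closed by (auto simp: fr_MM)
 fix q assume "q : MM"
 then obtain a s where q: "a : P" "s : carrier R - P" "q = fr a s" by (auto simp: MM_def)
 { fix r assume "r : MM"
  then obtain b t where r: "b : P" "t : carrier R - P" "r = fr b t" by (auto simp: MM_def)
  have "q \<oplus>\<^bsub>L\<^esub> r = fr (a \<otimes> t \<oplus> b \<otimes> s) (s \<otimes> t)" using q r Icarr by (simp add: fr_add)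
  moreover have "a \<otimes> t \<oplus> b \<otimes> s : P" using q r I_r_closed by (auto intro!: a_closed)
  ultimately show "q \<oplus>\<^bsub>L\<^esub> r : MM" using mult_den[OF q(2) r(2)] by (auto simp: MM_def) }
 fix r assume "r : carrier L"
 then obtain b t where r: "b : carrier R" "t : carrier R - P" "r = fr b t" by (rule L_cases)
 have "r \<otimes>\<^bsub>L\<^esub> q = fr (b \<otimes> a) (t \<otimes> s)" using q r Icarr by (simp add: fr_mult)
 then show "r \<otimes>\<^bsub>L\<^esub> q : MM" using I_l_closed[OF q(1) r(1)] mult_den[OF r(2) q(2)] by (auto simp: MM_def)
qed

lemma local_L: "local_cring L MM"
proof (intro local_cring.intro local_cring_axioms.intro cring_L MM_ideal)
 show "\<one>\<^bsub>L\<^esub> ~: MM" unfolding L_one using one_den by (auto simp: fr_MM)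
 fix q assume "q : carrier L" "q ~: MM"
 then obtain a s where q: "a : carrier R" "s : carrier R - P" "q = fr a s" "a ~: P" by (auto elim!: L_cases simp: fr_MM)
 have "q \<otimes>\<^bsub>L\<^esub> fr s a = fr (a \<otimes> s) (s \<otimes> a)" using q by (simp add: fr_mult)
 also have "\<dots> = fr \<one> \<one>" by (rule fr_eqI) (use q one_den mult_den[of s a] in "auto simp: m_comm")
 finally have "q \<otimes>\<^bsub>L\<^esub> fr s a = \<one>\<^bsub>L\<^esub>" by (simp add: L_one)
 then show "EX b:carrier L. q \<otimes>\<^bsub>L\<^esub> b = \<one>\<^bsub>L\<^esub>" using q fr_closed[of s a] by auto
qed

lemma noeth_L: assumes "noetherian_ring R" shows "noeth_cring L"
proof -
 interpret N: noeth_cring R using assms cring_axioms by (intro noeth_cring.intro)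
 have "noetherian_ring L"
 proof (rule L.noetherian_ringI)
  fix J assume J: "ideal J L"
  note Jm = L.submodD[OF L.submod_ideal[OF J subset_refl]]
  let ?J = "{a : carrier R. \<iota> a : J}"
  have "submod (carrier R) ?J"
   unfolding submod_def using Jm iota.hom_closed by auto
  then have "ideal ?J R" by (rule ideal_submod)
  then obtain us where us: "set us <= carrier R" "?J = adjs (carrier R) {\<zero>} us" by (rule N.ideal_list)
  have uJ: "set us <= ?J"
   using adjs_mem[OF carrier_is_subring submod_ideal[OF zeroideal subset_refl] us(1)] us(2) by simp
  let ?S = "\<iota> ` set us"
  have S: "?S <= carrier L" "?S <= J" using us uJ iota.hom_closed by auto
  have gi: "ideal (genideal L ?S) L" by (rule L.genideal_ideal[OF S(1)])
  note Gm = L.submodD[OF L.submod_ideal[OF gi subset_refl]]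
  have "submod (carrier R) {a : carrier R. \<iota> a : genideal L ?S}"
   unfolding submod_def using Gm iota.hom_closed by auto
  then have "adjs (carrier R) {\<zero>} us <= {a : carrier R. \<iota> a : genideal L ?S}"
   by (rule adjs_least) (use Gm(2) us(1) L.genideal_self[OF S(1)] in auto)
  then have JS: "!!a. a : carrier R ==> \<iota> a : J ==> \<iota> a : genideal L ?S" using us(2) by auto
  have "J <= genideal L ?S"
  proof
   fix q assume q: "q : J"
   from Jm(5)[OF this] obtain a s where as: "a : carrier R" "s : carrier R - P" "q = fr a s" by (rule L_cases)
   have "\<iota> a : J" using fr_split(2)[OF as(1,2)] Jm(4)[OF _ q] as iota.hom_closed by auto
   then have "\<iota> a : genideal L ?S" using JS as by simp
   then show "q : genideal L ?S" using fr_split(1)[OF as(1,2)] Gm(4)[OF fr_closed[OF one_closed as(2)]] as by simp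
  qed
  moreover have "genideal L ?S <= J" by (rule L.genideal_minimal[OF J S(2)])
  ultimately show "\<exists>A\<subseteq>carrier L. finite A & J = genideal L A" using S(1) by blast
 qed
 then show ?thesis using cring_L by (intro noeth_cring.intro)
qed

end

lemma (in charp) pindepD:
 "pindep x n ==> c : E n \<rightarrow> carrier R ==> pcomb x n c = \<zero> ==> b : E n ==> c b = \<zero>"
 by (simp add: pindep_def)

lemma (in charp) gens_of_pspan:
 assumes x: "x : {..<n} \<rightarrow> carrier R" and gen: "pspan x n = carrier R"
 obtains gs where "set gs <= carrier R" "adjs Kp {\<zero>} gs = carrier R"
proof -
 obtain bs where bs: "set bs = E n" using finite_list[OF finite_E] by auto
 let ?gs = "map (mon x n) bs"
 have gs: "set ?gs <= carrier R" using mon_closed[OF x] by auto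
 have z: "submod Kp {\<zero>}" by (rule submod_ideal[OF zeroideal Kp_carrier(2)])
 note s = submod_adjs[OF Kp_subring z gs]
 have "pspan x n <= adjs Kp {\<zero>} ?gs"
 proof
  fix a assume "a : pspan x n"
  then obtain c where c: "c : E n \<rightarrow> carrier R" "a = pcomb x n c" by (auto simp: pspan_def)
  have "c b [^] p \<otimes> mon x n b : adjs Kp {\<zero>} ?gs" if "b : E n" for b
   by (rule submodD(4)[OF s KpI]) (use funcset_mem[OF c(1) that] adjs_mem[OF Kp_subring z gs] bs that in auto)
  then show "a : adjs Kp {\<zero>} ?gs"
   unfolding c pcomb_def by (intro finsum_in_submonoid[OF finite_E submodD(1-3)[OF s]])
 qed
 then have "adjs Kp {\<zero>} ?gs = carrier R" using gen submodD(1)[OF s] by (intro subset_antisym) simp_all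
 then show thesis by (rule that[OF gs])
qed

locale localized_charp = localized P R + charp R p for P and R (structure) and p
begin

lemma charp_L: "charp L p"
proof (intro charp.intro charp_axioms.intro cring_L prime_p)
 have "[k] \<cdot>\<^bsub>L\<^esub> \<one>\<^bsub>L\<^esub> = \<iota> ([k] \<cdot> \<one>)" for k :: nat
  by (induct k) auto
 then show "[p] \<cdot>\<^bsub>L\<^esub> \<one>\<^bsub>L\<^esub> = \<zero>\<^bsub>L\<^esub>" using char_p by simp
qed

sublocale Lp: charp L p by (rule charp_L)

lemma iota_pcomb:
 assumes x: "x : {..<n} \<rightarrow> carrier R" and c: "c : E n \<rightarrow> carrier R"
 shows "\<iota> (pcomb x n c) = Lp.pcomb (%j. \<iota> (x j)) n (%b. \<iota> (c b))"
 by (rule hom_pcomb[OF charp_axioms charp_L iota_hom x c]) simp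

lemma iota_x: "x : {..<n} \<rightarrow> carrier R ==> (%j. \<iota> (x j)) : {..<n} \<rightarrow> carrier L"
 using iota.hom_closed by auto

text \<open>Denominators are absorbed by \<open>1/s = (1/s)\<^sup>p s\<^sup>p\<^sup>-\<^sup>1\<close>.\<close>

lemma gen_L:
 assumes x: "x : {..<n} \<rightarrow> carrier R" and gen: "pspan x n = carrier R"
 shows "Lp.pspan (%j. \<iota> (x j)) n = carrier L"
proof
 note s = L.submodD[OF Lp.pspan_submod[OF iota_x[OF x]]]
 show "Lp.pspan (%j. \<iota> (x j)) n <= carrier L" by (rule s(1))
 have i: "\<iota> a : Lp.pspan (%j. \<iota> (x j)) n" if a: "a : carrier R" for a
 proof -
  obtain c where c: "c : E n \<rightarrow> carrier R" "a = pcomb x n c" using a gen unfolding pspan_def by blast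
  show ?thesis unfolding Lp.pspan_def c(2) iota_pcomb[OF x c(1)]
   by (rule imageI) (use c iota.hom_closed in auto)
 qed
 show "carrier L <= Lp.pspan (%j. \<iota> (x j)) n"
 proof
  fix q assume "q : carrier L"
  then obtain a s where q: "a : carrier R" "s : carrier R - P" "q = fr a s" by (rule L_cases)
  have sc: "s : carrier R" using q by auto
  have f1: "fr \<one> s : carrier L" using fr_closed q by auto
  have e: "\<iota> s \<otimes>\<^bsub>L\<^esub> fr \<one> s = \<one>\<^bsub>L\<^esub>" by (rule fr_split(3)[OF q(1,2)])
  have "\<iota> (s [^] (p - 1) \<otimes> a) = \<iota> s [^]\<^bsub>L\<^esub> (p - 1) \<otimes>\<^bsub>L\<^esub> \<iota> a" using sc q by simp
  then have "fr \<one> s [^]\<^bsub>L\<^esub> p \<otimes>\<^bsub>L\<^esub> \<iota> (s [^] (p - 1) \<otimes> a) = (fr \<one> s [^]\<^bsub>L\<^esub> p \<otimes>\<^bsub>L\<^esub> \<iota> s [^]\<^bsub>L\<^esub> (p - 1)) \<otimes>\<^bsub>L\<^esub> \<iota> a"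
   using f1 sc q by (simp add: L.m_assoc)
  also have "fr \<one> s [^]\<^bsub>L\<^esub> p \<otimes>\<^bsub>L\<^esub> \<iota> s [^]\<^bsub>L\<^esub> (p - 1) = fr \<one> s"
  proof -
   have "fr \<one> s [^]\<^bsub>L\<^esub> Suc (p - 1) \<otimes>\<^bsub>L\<^esub> \<iota> s [^]\<^bsub>L\<^esub> (p - 1)
     = fr \<one> s \<otimes>\<^bsub>L\<^esub> (fr \<one> s [^]\<^bsub>L\<^esub> (p - 1) \<otimes>\<^bsub>L\<^esub> \<iota> s [^]\<^bsub>L\<^esub> (p - 1))"
    unfolding L.nat_pow_Suc using f1 sc by (simp add: L.m_ac)
   also have "fr \<one> s [^]\<^bsub>L\<^esub> (p - 1) \<otimes>\<^bsub>L\<^esub> \<iota> s [^]\<^bsub>L\<^esub> (p - 1) = (fr \<one> s \<otimes>\<^bsub>L\<^esub> \<iota> s) [^]\<^bsub>L\<^esub> (p - 1)"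
    by (rule L.nat_pow_distrib[symmetric]) (use f1 sc in simp_all)
   also have "fr \<one> s \<otimes>\<^bsub>L\<^esub> \<iota> s = \<one>\<^bsub>L\<^esub>" using e f1 sc by (simp add: L.m_comm)
   finally show ?thesis using f1 p_pos by simp
  qed
  finally have "fr \<one> s [^]\<^bsub>L\<^esub> p \<otimes>\<^bsub>L\<^esub> \<iota> (s [^] (p - 1) \<otimes> a) = q"
   unfolding q(3) fr_split(1)[OF q(1,2)] .
  moreover have "fr \<one> s [^]\<^bsub>L\<^esub> p \<otimes>\<^bsub>L\<^esub> \<iota> (s [^] (p - 1) \<otimes> a) : Lp.pspan (%j. \<iota> (x j)) n"
   by (rule s(4)[OF Lp.KpI[OF f1] i]) (use sc q in simp)
  ultimately show "q : Lp.pspan (%j. \<iota> (x j)) n" by simp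
 qed
qed

lemma common_denominator:
 assumes "finite F" "F <= carrier L"
 shows "EX s:carrier R - P. ALL q:F. EX a:carrier R. q = fr a s"
 using assms
proof (induct F rule: finite_induct)
 case empty then show ?case using one_den by auto
next
 case (insert q F)
 then obtain s where s: "s : carrier R - P" "!!r. r : F ==> EX a:carrier R. r = fr a s" by auto
 obtain b t where b: "b : carrier R" "t : carrier R - P" "q = fr b t" using insert by (auto elim: L_cases)
 have c: "s : carrier R" "t : carrier R" using s b by auto
 have "q = fr (b \<otimes> s) (s \<otimes> t)" unfolding b(3) by (rule fr_eqI) (use b s c mult_den in "auto simp: m_ac")
 moreover have "fr a s = fr (a \<otimes> t) (s \<otimes> t)" if "a : carrier R" for a
  by (rule fr_eqI) (use that b s c mult_den in "auto simp: m_ac")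
 ultimately have "ALL r:insert q F. EX a:carrier R. r = fr a (s \<otimes> t)"
  using s(2) b(1) c by (metis insert_iff m_closed)
 then show ?case using mult_den[OF s(1) b(2)] by blast
qed

text \<open>A relation over the localization becomes one over \<open>R\<close> after multiplication by the \<open>p\<close>-th power of a
 common denominator and by an element that annihilates its value.\<close>

lemma pbasis_L:
 assumes "pbasis R p x n" shows "pbasis L p (%j. \<iota> (x j)) n"
proof -
 interpret X: pbasis R p x n by (rule assms)
 note ix = iota_x[OF X.x]
 have "Lp.pindep (%j. \<iota> (x j)) n"
  unfolding Lp.pindep_def
 proof (intro ballI impI)
  fix c b assume c: "c : E n \<rightarrow> carrier L" and z: "Lp.pcomb (%j. \<iota> (x j)) n c = \<zero>\<^bsub>L\<^esub>" and b: "b : E n"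
  have "c ` E n <= carrier L" using c by auto
  from common_denominator[OF finite_imageI[OF finite_E] this]
  obtain s where s: "s : carrier R - P" "ALL q:c ` E n. EX a:carrier R. q = fr a s" by (elim bexE)
  have "ALL b:E n. EX a. a : carrier R & c b = fr a s" using s(2) by blast
  then obtain d where d: "!!b. b : E n ==> d b : carrier R & c b = fr (d b) s" by metis
  have dc: "d : E n \<rightarrow> carrier R" using d by auto
  have sc: "s : carrier R" using s by auto
  have cc: "c b : carrier L" if "b : E n" for b using c that by auto
  have "\<iota> (pcomb x n d) = Lp.pcomb (%j. \<iota> (x j)) n (%b. \<iota> (d b))" by (rule iota_pcomb[OF X.x dc])
  also have "\<dots> = Lp.pcomb (%j. \<iota> (x j)) n (%b. \<iota> s \<otimes>\<^bsub>L\<^esub> c b)"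
  proof (rule Lp.pcomb_cong[OF ix])
   show "(%b. \<iota> s \<otimes>\<^bsub>L\<^esub> c b) : E n \<rightarrow> carrier L" using cc sc by auto
   fix b assume b: "b : E n"
   have e: "c b = fr (d b) s" and db: "d b : carrier R" using d[OF b] by blast+
   show "\<iota> (d b) = \<iota> s \<otimes>\<^bsub>L\<^esub> c b" unfolding e by (rule fr_split(2)[OF db s(1)])
  qed
  also have "\<dots> = \<iota> s [^]\<^bsub>L\<^esub> p \<otimes>\<^bsub>L\<^esub> \<zero>\<^bsub>L\<^esub>" using Lp.pcomb_smult[OF ix c, of "\<iota> s"] sc z by simp
  finally have "\<iota> (pcomb x n d) = \<zero>\<^bsub>L\<^esub>" using sc by simp
  then obtain u where u: "u : carrier R - P" "u \<otimes> pcomb x n d = \<zero>"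
   using iota_zero_iff[OF pcomb_closed[OF X.x dc]] by auto
  have uc: "u : carrier R" using u by auto
  have "pcomb x n (%b. u \<otimes> d b) = u [^] p \<otimes> pcomb x n d" by (rule pcomb_smult[OF X.x dc uc])
  also have "u [^] p = u [^] (p - 1) \<otimes> u" using uc p_pos by (metis Suc_diff_1 nat_pow_Suc)
  also have "u [^] (p - 1) \<otimes> u \<otimes> pcomb x n d = \<zero>" using u uc pcomb_closed[OF X.x dc] by (simp add: m_assoc)
  finally have pz: "pcomb x n (%b. u \<otimes> d b) = \<zero>" .
  have "(%b. u \<otimes> d b) : E n \<rightarrow> carrier R" using d uc by auto
  then have "u \<otimes> d b = \<zero>" by (rule pindepD[OF X.indep _ pz b])
  then have "\<iota> (d b) = \<zero>\<^bsub>L\<^esub>" using iota_zero_iff[of "d b"] d[OF b] u(1) by blast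
  have e: "c b = fr (d b) s" and db: "d b : carrier R" using d[OF b] by blast+
  have "c b = fr \<one> s \<otimes>\<^bsub>L\<^esub> \<iota> (d b)" unfolding e by (rule fr_split(1)[OF db s(1)])
  then show "c b = \<zero>\<^bsub>L\<^esub>" using \<open>\<iota> (d b) = \<zero>\<^bsub>L\<^esub>\<close> fr_closed[OF one_closed s(1)] by simp
 qed
 then show ?thesis using ix gen_L[OF X.x X.gen] charp_L by (intro pbasis.intro pbasis_axioms.intro)
qed

lemma charp_local_L:
 assumes N: "noetherian_ring R" and x: "x : {..<n} \<rightarrow> carrier R" and gen: "pspan x n = carrier R"
 obtains gs where "charp_local L p gs MM"
proof -
 obtain gs where gs: "set gs <= carrier L" "L.adjs Lp.Kp {\<zero>\<^bsub>L\<^esub>} gs = carrier L"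
  by (rule Lp.gens_of_pspan[OF iota_x[OF x] gen_L[OF x gen]])
 have "charp_local L p gs MM"
  using charp_L noeth_L[OF N] local_L gs
  by (intro charp_local.intro charp_noeth.intro charp_noeth_axioms.intro)
 then show thesis by (rule that)
qed

end

theorem (in pbasis) imp_regular_ring:
 assumes N: "noetherian_ring R" shows "regular_ring R"
 unfolding regular_ring_def
proof (intro conjI allI impI cring_axioms N)
 fix P assume P: "primeideal P R"
 interpret localized_charp P R p using P charp_axioms by (intro localized_charp.intro localized.intro)
 obtain gs where gs: "charp_local L p gs MM" by (rule charp_local_L[OF N x gen])
 show "regular_local_ring (localization R P)"
  by (rule charp_local.pbasis_imp_regular_local[OF gs pbasis_L[OF pbasis_axioms]])
qed

text \<open>For \<open>a \<noteq> 0\<close> nilpotent some multiple \<open>va\<close> has a prime annihilator \<open>P\<close>. The image of \<open>va\<close> in the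
 localization at \<open>P\<close> is nonzero and nilpotent, but this localization is a domain.\<close>

theorem (in charp) regular_ring_reduced:
 assumes reg: "regular_ring R" and x: "x : {..<n} \<rightarrow> carrier R" and gen: "pspan x n = carrier R"
  and a: "a : carrier R" "a [^] (k::nat) = \<zero>"
 shows "a = \<zero>"
proof (rule ccontr)
 assume an: "a ~= \<zero>"
 have N: "noetherian_ring R" using reg by (simp add: regular_ring_def)
 interpret N: noeth_cring R using N cring_axioms by (intro noeth_cring.intro)
 let ?A = "{b : carrier R. b \<otimes> a : {\<zero>}}"
 have A: "ideal ?A R" by (rule adj_eq_colon_mem[OF zeroideal a(1)])
 have "\<one> ~: ?A" using an a by simp
 then have "?A ~= carrier R" by auto
 then obtain v where v: "v : carrier R" "v ~: ?A" "primeideal {b : carrier R. b \<otimes> v : ?A} R"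
  by (rule N.exists_prime_colon[OF A])
 define P where "P = {b : carrier R. b \<otimes> v : ?A}"
 have P: "primeideal P R" unfolding P_def by (rule v(3))
 interpret localized_charp P R p using P charp_axioms by (intro localized_charp.intro localized.intro)
 obtain gs where gs: "charp_local L p gs MM" by (rule charp_local_L[OF N x gen])
 have "regular_local_ring L" using reg P unfolding regular_ring_def by blast
 then have "domain L" by (rule charp_local.regular_local_imp_domain[OF gs])
 then interpret D: domain L .
 have "\<iota> (v \<otimes> a) [^]\<^bsub>L\<^esub> Suc k = \<iota> ((v \<otimes> a) [^] Suc k)" using v(1) a(1) by (simp del: nat_pow_Suc L.nat_pow_Suc)
 also have "(v \<otimes> a) [^] Suc k = \<zero>" using v(1) a by (simp add: nat_pow_distrib)
 finally have z: "\<iota> (v \<otimes> a) [^]\<^bsub>L\<^esub> Suc k = \<zero>\<^bsub>L\<^esub>" by simp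
 have "q [^]\<^bsub>L\<^esub> m = \<zero>\<^bsub>L\<^esub> ==> q : carrier L ==> q = \<zero>\<^bsub>L\<^esub>" for q and m :: nat
  by (induct m) (auto simp: D.integral_iff)
 from this[OF z] have "\<iota> (v \<otimes> a) = \<zero>\<^bsub>L\<^esub>" using v(1) a(1) by simp
 then obtain u where u: "u : carrier R - P" "u \<otimes> (v \<otimes> a) = \<zero>"
  using iota_zero_iff[of "v \<otimes> a"] v(1) a(1) by blast
 have uc: "u : carrier R" using u(1) by simp
 have "u : P" unfolding P_def using u(2) uc v(1) a(1) by (simp add: m_assoc)
 then show False using u(1) by blast
qed

section \<open>Noetherian rings\<close>

lemma (in cring) zero_submod: "K <= carrier R ==> submod K {\<zero>}"
 by (rule submod_ideal[OF zeroideal])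

text \<open>The coefficients of \<open>u\<close> that occur in \<open>N\<close> modulo \<open>A\<close>, as with leading coefficients in the basis theorem.\<close>

lemma leading_submod:
 assumes R: "cring R" and S: "cring S" and h: "h : ring_hom R S" and u: "u : carrier S"
  and A: "cring.submod S (h ` carrier R) A" and N: "cring.submod S (h ` carrier R) N"
 shows "cring.submod R (carrier R) {r : carrier R. EX w:A. w \<oplus>\<^bsub>S\<^esub> h r \<otimes>\<^bsub>S\<^esub> u : N}" (is "cring.submod R _ ?J")
proof -
 interpret h: ring_hom_cring R S h by (intro ring_hom_cring.intro ring_hom_cring_axioms.intro R S h)
 note Nm = h.S.submodD[OF N] and Am = h.S.submodD[OF A]
 show ?thesis unfolding h.R.submod_def
 proof (intro conjI ballI)
  show "\<zero>\<^bsub>R\<^esub> : ?J" using Am(2) Nm(2) u by (auto intro!: bexI[of _ "\<zero>\<^bsub>S\<^esub>"])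
  fix r assume "r : ?J"
  then obtain w where r: "r : carrier R" "w : A" "w \<oplus>\<^bsub>S\<^esub> h r \<otimes>\<^bsub>S\<^esub> u : N" by auto
  { fix r' assume "r' : ?J"
   then obtain w' where r': "r' : carrier R" "w' : A" "w' \<oplus>\<^bsub>S\<^esub> h r' \<otimes>\<^bsub>S\<^esub> u : N" by auto
   have c: "w : carrier S" "w' : carrier S" "h r : carrier S" "h r' : carrier S" using r r' Am(5) by auto
   have "(w \<oplus>\<^bsub>S\<^esub> w') \<oplus>\<^bsub>S\<^esub> (h r \<oplus>\<^bsub>S\<^esub> h r') \<otimes>\<^bsub>S\<^esub> u = (w \<oplus>\<^bsub>S\<^esub> h r \<otimes>\<^bsub>S\<^esub> u) \<oplus>\<^bsub>S\<^esub> (w' \<oplus>\<^bsub>S\<^esub> h r' \<otimes>\<^bsub>S\<^esub> u)"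
    using c u by algebra
   then have "(w \<oplus>\<^bsub>S\<^esub> w') \<oplus>\<^bsub>S\<^esub> h (r \<oplus>\<^bsub>R\<^esub> r') \<otimes>\<^bsub>S\<^esub> u : N" using Nm(3)[OF r(3) r'(3)] r(1) r'(1) by simp
   then show "r \<oplus>\<^bsub>R\<^esub> r' : ?J" using Am(3)[OF r(2) r'(2)] h.R.a_closed[OF r(1) r'(1)] by blast }
  fix k assume k: "k : carrier R"
  have c: "w : carrier S" "h r : carrier S" "h k : carrier S" using r Am(5) k by auto
  have "h k \<otimes>\<^bsub>S\<^esub> w \<oplus>\<^bsub>S\<^esub> (h k \<otimes>\<^bsub>S\<^esub> h r) \<otimes>\<^bsub>S\<^esub> u = h k \<otimes>\<^bsub>S\<^esub> (w \<oplus>\<^bsub>S\<^esub> h r \<otimes>\<^bsub>S\<^esub> u)"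
   using c u by algebra
  then have "h k \<otimes>\<^bsub>S\<^esub> w \<oplus>\<^bsub>S\<^esub> h (k \<otimes>\<^bsub>R\<^esub> r) \<otimes>\<^bsub>S\<^esub> u : N" using Nm(4)[OF imageI[OF k] r(3)] r(1) k by simp
  then show "k \<otimes>\<^bsub>R\<^esub> r : ?J" using Am(4)[OF imageI[OF k] r(2)] h.R.m_closed[OF k r(1)] by blast
 qed auto
qed

text \<open>Induction on the generators: a submodule is generated by its intersection with the span of the earlier
 generators together with lifts of generators of its ideal of coefficients of the last one.\<close>

lemma finite_module_noetherian_aux:
 assumes N: "noeth_cring R" and S: "cring S" and h: "h : ring_hom R S"
 defines "K \<equiv> h ` carrier R"
 shows "set us <= carrier S ==> cring.submod S K M ==> M <= cring.adjs S K {\<zero>\<^bsub>S\<^esub>} us ==>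
  EX vs. set vs <= M & M = cring.adjs S K {\<zero>\<^bsub>S\<^esub>} vs"
proof (induct us arbitrary: M rule: rev_induct)
 interpret R: noeth_cring R by (rule N)
 interpret S: cring S by (rule S)
 case Nil
 then show ?case using S.submodD(2)[OF Nil(2)] by (intro exI[of _ "[]"]) auto
next
 interpret R: noeth_cring R by (rule N)
 interpret S: cring S by (rule S)
 interpret h: ring_hom_cring R S h using h by (intro ring_hom_cring.intro ring_hom_cring_axioms.intro N[THEN noeth_cring.axioms(1)] S)
 case (snoc u us)
 have K: "subring K S" unfolding K_def
  by (rule ring_hom_ring.img_is_subring[OF ring_hom_ringI2[OF R.ring_axioms S.ring_axioms h] R.carrier_is_subring])
 have Kc: "K <= carrier S" using subringE(1)[OF K] .
 have uc: "u : carrier S" "set us <= carrier S" using snoc(2) by auto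
 note z = S.zero_submod[OF Kc]
 let ?A = "S.adjs K {\<zero>\<^bsub>S\<^esub>} us"
 have sA: "S.submod K ?A" by (rule S.submod_adjs[OF K z uc(2)])
 note Mm = S.submodD[OF snoc(3)] and Am = S.submodD[OF sA]
 have hK: "h r : K" if "r : carrier R" for r using that by (simp add: K_def)
 have MA: "M <= S.adj K ?A u" using snoc(4) by (simp add: S.adjs_append)
 let ?J = "{r : carrier R. EX w:?A. w \<oplus>\<^bsub>S\<^esub> h r \<otimes>\<^bsub>S\<^esub> u : M}"
 have "R.submod (carrier R) ?J"
  unfolding K_def by (rule leading_submod[OF R.is_cring S h uc(1) sA[unfolded K_def] snoc(3)[unfolded K_def]])
 then have "ideal ?J R" by (rule R.ideal_submod)
 then obtain rs where rs: "set rs <= carrier R" "?J = R.adjs (carrier R) {\<zero>\<^bsub>R\<^esub>} rs" by (rule R.ideal_list)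
 have "set rs <= ?J"
  using R.adjs_mem[OF R.carrier_is_subring R.zero_submod[OF subset_refl] rs(1)] rs(2) by simp
 then have "ALL r:set rs. EX m:M. EX w:?A. m = w \<oplus>\<^bsub>S\<^esub> h r \<otimes>\<^bsub>S\<^esub> u" by blast
 then obtain m where m: "!!r. r : set rs ==> m r : M & (EX w:?A. m r = w \<oplus>\<^bsub>S\<^esub> h r \<otimes>\<^bsub>S\<^esub> u)" by metis
 let ?ms = "map m rs"
 have ms: "set ?ms <= M" "set ?ms <= carrier S" using m Mm(1) by auto
 obtain vs where vs: "set vs <= M \<inter> ?A" "M \<inter> ?A = S.adjs K {\<zero>\<^bsub>S\<^esub>} vs"
  using snoc(1)[OF uc(2) S.submod_Int[OF snoc(3) sA]] by auto
 have vc: "set vs <= carrier S" using vs(1) Mm(1) by auto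
 let ?T = "S.adjs K {\<zero>\<^bsub>S\<^esub>} (vs @ ?ms)"
 have Tc: "set (vs @ ?ms) <= carrier S" using vc ms by simp
 have sT: "S.submod K ?T" by (rule S.submod_adjs[OF K z Tc])
 note Tm = S.submodD[OF sT]
 have mem: "set (vs @ ?ms) <= ?T" by (rule S.adjs_mem[OF K z Tc])
 have vT: "S.adjs K {\<zero>\<^bsub>S\<^esub>} vs <= ?T" by (rule S.adjs_least[OF sT]) (use Tm(2) mem in auto)
 have TM: "?T <= M" by (rule S.adjs_least[OF snoc(3)]) (use Mm(2) vs(1) ms(1) in auto)
 let ?H = "{r : carrier R. EX w:?A. w \<oplus>\<^bsub>S\<^esub> h r \<otimes>\<^bsub>S\<^esub> u : ?T}"
 have sH: "R.submod (carrier R) ?H"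
  unfolding K_def by (rule leading_submod[OF R.is_cring S h uc(1) sA[unfolded K_def] sT[unfolded K_def]])
 have "R.adjs (carrier R) {\<zero>\<^bsub>R\<^esub>} rs <= ?H"
 proof (rule R.adjs_least[OF sH])
  show "{\<zero>\<^bsub>R\<^esub>} <= ?H" using R.submodD(2)[OF sH] by simp
  show "set rs <= ?H"
  proof
   fix r assume r: "r : set rs"
   have "m r : ?T" using mem r by auto
   then show "r : ?H" using m[OF r] rs(1) r by auto
  qed
 qed
 then have JH: "?J <= ?H" using rs(2) by simp
 have "M <= ?T"
 proof
  fix a assume a: "a : M"
  from subsetD[OF MA a] obtain w k where wk: "w : ?A" "k : K" "a = w \<oplus>\<^bsub>S\<^esub> k \<otimes>\<^bsub>S\<^esub> u" by (rule S.adjE)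
  obtain r where r: "r : carrier R" "k = h r" using wk(2) by (auto simp: K_def)
  have "r : ?J" using r wk a by auto
  then obtain t w' where t: "t : ?T" "w' : ?A" "t = w' \<oplus>\<^bsub>S\<^esub> h r \<otimes>\<^bsub>S\<^esub> u" using JH by blast
  have c: "w : carrier S" "w' : carrier S" "h r : carrier S" using wk t Am(5) r by auto
  have e: "a \<ominus>\<^bsub>S\<^esub> t = w \<ominus>\<^bsub>S\<^esub> w'" unfolding wk(3) t(3) r(2) using c uc(1) by algebra
  have "a \<ominus>\<^bsub>S\<^esub> t : M" using S.submod_minus[OF K snoc(3) a] t(1) TM by auto
  moreover have "a \<ominus>\<^bsub>S\<^esub> t : ?A" unfolding e by (rule S.submod_minus[OF K sA wk(1) t(2)])
  ultimately have "a \<ominus>\<^bsub>S\<^esub> t : ?T" using vs(2) vT by blast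
  then have "(a \<ominus>\<^bsub>S\<^esub> t) \<oplus>\<^bsub>S\<^esub> t : ?T" using Tm(3) t(1) by blast
  moreover have "(a \<ominus>\<^bsub>S\<^esub> t) \<oplus>\<^bsub>S\<^esub> t = a" using Mm(5)[OF a] Tm(5)[OF t(1)] by algebra
  ultimately show "a : ?T" by simp
 qed
 then have "M = ?T" using TM by blast
 moreover have "set (vs @ ?ms) <= M" using vs(1) ms(1) by simp
 ultimately show ?case by blast
qed

lemma finite_module_noetherian:
 assumes N: "noeth_cring R" and S: "cring S" and h: "h : ring_hom R S"
  and us: "set us <= carrier S" "cring.adjs S (h ` carrier R) {\<zero>\<^bsub>S\<^esub>} us = carrier S"
 shows "noeth_cring S"
proof -
 interpret S: cring S by (rule S)
 have hc: "h ` carrier R <= carrier S" using ring_hom_closed[OF h] by auto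
 have "noetherian_ring S"
 proof (rule S.noetherian_ringI)
  fix J assume J: "ideal J S"
  note sJ = S.submod_ideal[OF J hc]
  obtain vs where vs: "set vs <= J" "J = S.adjs (h ` carrier R) {\<zero>\<^bsub>S\<^esub>} vs"
   using finite_module_noetherian_aux[OF N S h us(1) sJ] us(2) S.submodD(1)[OF sJ] by auto
  have vc: "set vs <= carrier S" using vs(1) S.submodD(1)[OF sJ] by auto
  have "genideal S (set vs) <= J" by (rule S.genideal_minimal[OF J vs(1)])
  moreover have "J <= genideal S (set vs)"
  proof -
   have gi: "ideal (genideal S (set vs)) S" by (rule S.genideal_ideal[OF vc])
   have "S.adjs (h ` carrier R) {\<zero>\<^bsub>S\<^esub>} vs <= genideal S (set vs)"
    by (rule S.adjs_least[OF S.submod_ideal[OF gi hc]])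
     (use S.genideal_self[OF vc] S.submodD(2)[OF S.submod_ideal[OF gi hc]] in auto)
   then show ?thesis using vs(2) by simp
  qed
  ultimately show "\<exists>A\<subseteq>carrier S. finite A & J = genideal S A" using vc by (intro exI[of _ "set vs"]) auto
 qed
 then show ?thesis using S by (intro noeth_cring.intro)
qed

context cring begin

definition fg :: "'a set => bool" where
 "fg J \<longleftrightarrow> (EX us. set us <= carrier R & J = adjs (carrier R) {\<zero>} us)"

primrec psum :: "(nat => 'a) => nat => 'a" where
 "psum a 0 = \<zero>"
| "psum a (Suc n) = psum a n \<oplus> a n"

lemma psum_closed: "(!!k. a k : carrier R) ==> psum a n : carrier R"
 by (induct n) auto

lemma diff_linear:
 "[|s : carrier R; t : carrier R; a : carrier R; b : carrier R; g : carrier R|] ==>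
  (s \<oplus> t \<otimes> g) \<ominus> (a \<oplus> b \<otimes> g) = (s \<ominus> a) \<oplus> (t \<ominus> b) \<otimes> g"
 by algebra

lemma diff_tail:
 "s : carrier R ==> a : carrier R ==> b : carrier R ==> (a \<oplus> b) \<ominus> s = b \<ominus> (s \<ominus> a)"
 by algebra

lemma sum_linear:
 "[|s : carrier R; t : carrier R; a : carrier R; b : carrier R; g : carrier R|] ==>
  (s \<oplus> t \<otimes> g) \<oplus> (a \<oplus> b \<otimes> g) = (s \<oplus> a) \<oplus> (t \<oplus> b) \<otimes> g"
 by algebra

end

locale complete_filtered = cring R for R (structure) +
 fixes V :: "nat => 'a set"
 assumes V_ideal: "ideal (V i) R"
  and complete: "(!!i. S i : carrier R) ==> (!!i. S (Suc i) \<ominus> S i : V i) ==> EX s:carrier R. ALL i. s \<ominus> S i : V i"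
  and separated: "a : carrier R ==> (!!i. a : V i) ==> a = \<zero>"
begin

definition tnil :: "'a => bool" where "tnil f \<longleftrightarrow> (ALL i. \<exists>m::nat. f [^] m : V i)"

lemmas Vm = submodD[OF submod_ideal[OF V_ideal subset_refl]]

lemma V_minus: "u : V i ==> v : V i ==> u \<ominus> v : V i"
 by (rule submod_minus[OF carrier_is_subring submod_ideal[OF V_ideal subset_refl]])

lemma pow_V: assumes "f : carrier R" "f [^] (m::nat) : V i" "m <= k" shows "f [^] k : V i"
proof -
 have "f [^] k = f [^] (k - m) \<otimes> f [^] m" using assms by (simp add: nat_pow_mult)
 then show ?thesis using Vm(4) assms by simp
qed

lemma span_carrier: "set fs <= carrier R ==> adjs (V k) {\<zero>} fs <= carrier R"
proof (induct fs rule: rev_induct)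
 case (snoc g gs)
 then show ?case using Vm(5) by (auto simp: adjs_append elim!: adjE)
qed simp

lemma scale_span:
 assumes t: "t : V k"
 shows "set gs <= carrier R ==> e : adjs (carrier R) {\<zero>} gs ==> t \<otimes> e : adjs (V k) {\<zero>} gs"
proof (induct gs arbitrary: e rule: rev_induct)
 case Nil then show ?case using Vm(5)[OF t] by simp
next
 case (snoc g gs)
 have g: "g : carrier R" "set gs <= carrier R" using snoc(2) by auto
 have "e : adj (carrier R) (adjs (carrier R) {\<zero>} gs) g" using snoc(3) by (simp add: adjs_append)
 then obtain w c where w: "w : adjs (carrier R) {\<zero>} gs" "c : carrier R" "e = w \<oplus> c \<otimes> g" by (rule adjE)
 have wc: "w : carrier R" by (rule submodD(5)[OF submod_adjs[OF carrier_is_subring zero_submod[OF subset_refl] g(2)] w(1)])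
 have "t \<otimes> e = t \<otimes> w \<oplus> (t \<otimes> c) \<otimes> g" unfolding w(3) using Vm(5)[OF t] wc w(2) g(1) by algebra
 then show ?case using adjI[OF snoc(1)[OF g(2) w(1)] ideal.I_r_closed[OF V_ideal t w(2)], of g] by (simp add: adjs_append)
qed

text \<open>For each of the \<open>fs\<close> separately, its coefficients form a convergent series.\<close>

lemma series_in_span:
 "set fs <= carrier R ==> (!!k. u k : adjs (V k) {\<zero>} fs) ==>
  EX s:adjs (carrier R) {\<zero>} fs. ALL i. s \<ominus> psum u i : V i"
proof (induct fs arbitrary: u rule: rev_induct)
 case Nil
 have "psum u i = \<zero>" for i using Nil by (induct i) auto
 then show ?case using Vm(2) by (simp add: minus_eq)
next
 case (snoc f fs)
 have fc: "f : carrier R" "set fs <= carrier R" using snoc(2) by auto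
 have "ALL k. EX u' t. u' : adjs (V k) {\<zero>} fs & t : V k & u k = u' \<oplus> t \<otimes> f"
  using snoc(3) by (auto simp: adjs_append elim!: adjE)
 then obtain u' t where ut: "!!k. u' k : adjs (V k) {\<zero>} fs" "!!k. t k : V k" "!!k. u k = u' k \<oplus> t k \<otimes> f" by metis
 have u'c: "u' k : carrier R" for k using ut(1) span_carrier[OF fc(2)] by blast
 have tc: "t k : carrier R" for k using ut(2) Vm(5) by blast
 obtain s where s: "s : adjs (carrier R) {\<zero>} fs" "!!i. s \<ominus> psum u' i : V i" using snoc(1)[OF fc(2) ut(1)] by blast
 have sc: "s : carrier R" by (rule submodD(5)[OF submod_adjs[OF carrier_is_subring zero_submod[OF subset_refl] fc(2)] s(1)])
 have "EX r:carrier R. ALL i. r \<ominus> psum t i : V i"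
 proof (rule complete)
  show "psum t i : carrier R" for i by (rule psum_closed[OF tc])
  fix i
  have "psum t (Suc i) \<ominus> psum t i = t i" unfolding psum.simps using psum_closed[of t i, OF tc] tc[of i] by algebra
  then show "psum t (Suc i) \<ominus> psum t i : V i" using ut(2) by simp
 qed
 then obtain r where r: "r : carrier R" "!!i. r \<ominus> psum t i : V i" by blast
 have ps: "psum u i = psum u' i \<oplus> psum t i \<otimes> f" for i
  by (induct i) (use fc(1) in "simp_all add: ut(3) sum_linear psum_closed u'c tc")
 have "(s \<oplus> r \<otimes> f) \<ominus> psum u i : V i" for i
 proof -
  have "(s \<oplus> r \<otimes> f) \<ominus> psum u i = (s \<ominus> psum u' i) \<oplus> (r \<ominus> psum t i) \<otimes> f"
   unfolding ps by (rule diff_linear[OF sc r(1) psum_closed[OF u'c] psum_closed[OF tc] fc(1)])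
  then show ?thesis using Vm(3)[OF s(2)] ideal.I_r_closed[OF V_ideal r(2) fc(1)] by simp
 qed
 moreover have "s \<oplus> r \<otimes> f : adjs (carrier R) {\<zero>} (fs @ [f])" using adjI[OF s(1) r(1)] by (simp add: adjs_append)
 ultimately show ?case by blast
qed

text \<open>Elements of \<open>D 0\<close> can be reduced to smaller and smaller ones by combinations of the \<open>gs\<close> with smaller and
 smaller coefficients; the sum of these combinations converges.\<close>

lemma approx_span:
 assumes gs: "set gs <= carrier R" and D: "!!k. D k <= V k"
  and step: "!!k v. v : D k ==> EX w:D (Suc k). EX u:adjs (V k) {\<zero>} gs. v = w \<oplus> u"
 shows "D 0 <= adjs (carrier R) {\<zero>} gs"
proof
 fix g assume g: "g : D 0"
 have "EX v. ALL k. (v k : D k & (k = 0 --> v k = g)) & (EX u:adjs (V k) {\<zero>} gs. v k = v (Suc k) \<oplus> u)"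
 proof (rule dependent_nat_choice)
  show "EX v. v : D 0 & ((0::nat) = 0 --> v = g)" using g by auto
  fix v k assume "v : D k & (k = 0 --> v = g)"
  then show "EX w. (w : D (Suc k) & (Suc k = 0 --> w = g)) & (EX u:adjs (V k) {\<zero>} gs. v = w \<oplus> u)" using step by auto
 qed
 then obtain v where v: "!!k. v k : D k" "v 0 = g" "!!k. EX u:adjs (V k) {\<zero>} gs. v k = v (Suc k) \<oplus> u" by blast
 then obtain u where u: "!!k. u k : adjs (V k) {\<zero>} gs" "!!k. v k = v (Suc k) \<oplus> u k" by metis
 have vV: "v k : V k" for k using v(1) D by blast
 have c: "v k : carrier R" "u k : carrier R" for k using Vm(5)[OF vV] u(1) span_carrier[OF gs] by blast+
 have "EX s:adjs (carrier R) {\<zero>} gs. ALL i. s \<ominus> psum u i : V i" by (rule series_in_span[OF gs]) (rule u(1))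
 then obtain s where s: "s : adjs (carrier R) {\<zero>} gs" "!!i. s \<ominus> psum u i : V i" by blast
 have sc: "s : carrier R" by (rule submodD(5)[OF submod_adjs[OF carrier_is_subring zero_submod[OF subset_refl] gs] s(1)])
 have pc: "psum u i : carrier R" for i by (rule psum_closed[OF c(2)])
 have ps: "g = psum u i \<oplus> v i" for i
 proof (induct i)
  case 0 show ?case using v(2) c(1)[of 0] by simp
 next
  case (Suc i)
  have "psum u i \<oplus> v i = psum u (Suc i) \<oplus> v (Suc i)" unfolding u(2)[of i] using pc[of i] c(1)[of "Suc i"] c(2)[of i] by (simp add: a_ac)
  then show ?case using Suc by simp
 qed
 have gc: "g : carrier R" using c(1)[of 0] v(2) by simp
 have "g \<ominus> s = \<zero>"
 proof (rule separated)
  fix i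
  have "g \<ominus> s = v i \<ominus> (s \<ominus> psum u i)" unfolding ps[of i] by (rule diff_tail[OF sc pc c(1)])
  then show "g \<ominus> s : V i" using V_minus[OF vV s(2)] by simp
 qed (use gc sc in simp)
 then show "g : adjs (carrier R) {\<zero>} gs" using gc sc s(1) by simp
qed

end

lemma (in cring) maximal_non_fg:
 assumes J: "ideal J R" "\<not> fg J"
 shows "EX P. ideal P R & J <= P & \<not> fg P & (ALL Q. ideal Q R --> P \<subset> Q --> fg Q)"
proof -
 let ?C = "carrier R" and ?A = "{P. ideal P R & J <= P & \<not> fg P}"
 have "EX P:?A. ALL Q:?A. P <= Q --> Q = P"
 proof (rule subset_Zorn_nonempty)
  show "?A ~= {}" using J by blast
  fix \<C> assume ne: "\<C> ~= {}" and ch: "subset.chain ?A \<C>"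
  have sub: "submod ?C P" "J <= P" "\<not> fg P" if "P : \<C>" for P
   using ch that by (auto simp: subset.chain_def intro: submod_ideal)
  have lin: "P <= Q \<or> Q <= P" if "P : \<C>" "Q : \<C>" for P Q
   using ch that unfolding subset_chain_def by blast
  have sU: "submod ?C (\<Union>\<C>)"
   unfolding submod_def
  proof (intro conjI ballI)
   show "\<zero> : \<Union>\<C>" using ne submodD(2)[OF sub(1)] by blast
   fix u assume "u : \<Union>\<C>"
   then obtain P where P: "P : \<C>" "u : P" by blast
   show "k \<otimes> u : \<Union>\<C>" if "k : ?C" for k using submodD(4)[OF sub(1)[OF P(1)] that P(2)] P(1) by blast
   fix v assume "v : \<Union>\<C>"
   then obtain Q where Q: "Q : \<C>" "v : Q" by blast
   show "u \<oplus> v : \<Union>\<C>"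
    using lin[OF P(1) Q(1)] submodD(3)[OF sub(1)[OF P(1)]] submodD(3)[OF sub(1)[OF Q(1)]] P Q by blast
  qed (use submodD(1)[OF sub(1)] in blast)
  have "\<not> fg (\<Union>\<C>)"
  proof
   assume "fg (\<Union>\<C>)"
   then obtain us where us: "set us <= ?C" "\<Union>\<C> = adjs ?C {\<zero>} us" by (auto simp: fg_def)
   have "EX P:\<C>. set vs <= P" if "set vs <= \<Union>\<C>" for vs
    using that
   proof (induct vs)
    case (Cons v vs)
    then obtain P Q where "P : \<C>" "set vs <= P" "Q : \<C>" "v : Q" by auto
    then show ?case using lin[of P Q] by (metis insert_subset list.simps(15) subset_iff)
   qed (use ne in auto)
   moreover have "set us <= \<Union>\<C>" using adjs_mem[OF carrier_is_subring zero_submod[OF subset_refl] us(1)] us(2) by simp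
   ultimately obtain P where P: "P : \<C>" "set us <= P" by blast
   have "adjs ?C {\<zero>} us <= P" by (rule adjs_least[OF sub(1)[OF P(1)] _ P(2)]) (use submodD(2)[OF sub(1)[OF P(1)]] in simp)
   then have "P = adjs ?C {\<zero>} us" using us(2) P(1) by blast
   then show False using sub(3)[OF P(1)] us(1) by (auto simp: fg_def)
  qed
  moreover have "J <= \<Union>\<C>" using ne sub(2) by blast
  ultimately show "\<Union>\<C> : ?A" using ideal_submod[OF sU] by blast
 qed
 then obtain P where P: "P : ?A" "ALL Q:?A. P <= Q --> Q = P" by (rule bexE)
 have "fg Q" if "ideal Q R" "P \<subset> Q" for Q
 proof (rule ccontr)
  assume "\<not> fg Q"
  then have "Q : ?A" using that P(1) by auto
  then show False using P(2) that(2) by blast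
 qed
 then show ?thesis using P(1) by (intro exI[of _ P]) simp
qed

context complete_filtered begin

text \<open>Suppose \<open>P\<close> is maximal among the ideals that are not finitely generated, and \<open>f \<notin> P\<close>. Then \<open>P + (f)\<close> is
 generated by \<open>f\<close> and finitely many \<open>gs\<close> in \<open>P\<close>. If \<open>(P : f)\<close> were larger than \<open>P\<close>, generators of it times
 \<open>f\<close> would generate \<open>P\<close> together with the \<open>gs\<close>. So \<open>(P : f) = P\<close>, and \<open>P = (gs) + f P = (gs) + f\<^sup>m P\<close> for
 all \<open>m\<close>. As \<open>f\<close> is topologically nilpotent, \<open>approx_span\<close> yields \<open>P = (gs)\<close>.\<close>

lemma fg_step:
 assumes f: "f : carrier R" "tnil f"
  and fgf: "!!J. ideal J R ==> I <= J ==> f : J ==> fg J"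
  and J: "ideal J R" "I <= J"
 shows "fg J"
proof (rule ccontr)
 let ?C = "carrier R"
 note z = zero_submod[OF subset_refl] and Csub = carrier_is_subring
 assume "\<not> fg J"
 then obtain P where P: "ideal P R" "J <= P" "\<not> fg P" "!!Q. ideal Q R ==> P \<subset> Q ==> fg Q"
  using maximal_non_fg[OF J(1)] by blast
 note sP = submod_ideal[OF P(1) subset_refl]
 note Pm = submodD[OF sP]
 have fP: "f ~: P" using fgf[OF P(1)] J(2) P(2,3) by blast
 have "fg (adj ?C P f)"
  using P(4)[OF ideal_submod[OF submod_adj[OF Csub sP f(1)]]] adj_upper[OF Csub sP f(1)] adj_mem[OF Csub sP f(1)] fP by blast
 then obtain us where us: "set us <= ?C" "adj ?C P f = adjs ?C {\<zero>} us" by (auto simp: fg_def)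
 have "set us <= adj ?C P f" using adjs_mem[OF Csub z us(1)] us(2) by simp
 then have "ALL u:set us. EX g:P. EX k:?C. u = g \<oplus> k \<otimes> f" by (meson adjE subsetD)
 then obtain \<gamma> where ga: "!!u. u : set us ==> \<gamma> u : P & (EX k:?C. u = \<gamma> u \<oplus> k \<otimes> f)" by metis
 define gs where "gs = map \<gamma> us"
 have gs: "set gs <= P" "set gs <= ?C" using ga Pm(1) by (auto simp: gs_def)
 let ?N = "adjs ?C {\<zero>} gs"
 have sN: "submod ?C ?N" by (rule submod_adjs[OF Csub z gs(2)])
 note Nm = submodD[OF sN]
 have NP: "?N <= P" by (rule adjs_least[OF sP]) (use Pm(2) gs in auto)
 have sNf: "submod ?C (adj ?C ?N f)" by (rule submod_adj[OF Csub sN f(1)])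
 have "adjs ?C {\<zero>} us <= adj ?C ?N f"
 proof (rule adjs_least[OF sNf])
  show "set us <= adj ?C ?N f"
  proof
   fix u assume u: "u : set us"
   then have "\<gamma> u : ?N" using adjs_mem[OF Csub z gs(2)] by (auto simp: gs_def)
   then show "u : adj ?C ?N f" using ga[OF u] adjI by metis
  qed
 qed (use submodD(2)[OF sNf] in simp)
 then have PN: "P <= adj ?C ?N f" using us(2) adj_upper[OF Csub sP f(1)] by blast
 have split: "EX e:?N. EX k:?C. q = e \<oplus> k \<otimes> f & k \<otimes> f : P" if q: "q : P" for q
 proof -
  obtain e k where ek: "e : ?N" "k : ?C" "q = e \<oplus> k \<otimes> f" using subsetD[OF PN q] by (rule adjE)
  have "k \<otimes> f = q \<ominus> e" unfolding ek(3) using Nm(5)[OF ek(1)] ek(2) f(1) by algebra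
  then have "k \<otimes> f : P" using submod_minus[OF Csub sP q] ek(1) NP by auto
  then show ?thesis using ek by blast
 qed
 have colon: "k : P" if k: "k : ?C" "k \<otimes> f : P" for k
 proof (rule ccontr)
  assume kP: "k ~: P"
  let ?K = "{k : ?C. k \<otimes> f : P}"
  have "submod ?C ?K" unfolding submod_def using Pm f(1) by (auto simp: l_distr m_assoc)
  moreover have "P \<subset> ?K" using k kP Pm(5) ideal.I_r_closed[OF P(1) _ f(1)] by auto
  ultimately have "fg ?K" using P(4) ideal_submod by blast
  then obtain ws where ws: "set ws <= ?C" "?K = adjs ?C {\<zero>} ws" by (auto simp: fg_def)
  have wK: "set ws <= ?K" using adjs_mem[OF Csub z ws(1)] ws(2) by simp
  let ?L = "gs @ map (%w. w \<otimes> f) ws"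
  have L: "set ?L <= P" "set ?L <= ?C" using gs(1) wK Pm(1) by auto
  have sL: "submod ?C (adjs ?C {\<zero>} ?L)" by (rule submod_adjs[OF Csub z L(2)])
  note Lm = submodD[OF sL] and Lmem = adjs_mem[OF Csub z L(2)]
  have NL: "?N <= adjs ?C {\<zero>} ?L" by (rule adjs_least[OF sL]) (use Lm(2) Lmem in auto)
  have "adjs ?C {\<zero>} ws <= {k : ?C. k \<otimes> f : adjs ?C {\<zero>} ?L}"
  proof (rule adjs_least)
   show "submod ?C {k : ?C. k \<otimes> f : adjs ?C {\<zero>} ?L}"
    unfolding submod_def using Lm f(1) by (auto simp: l_distr m_assoc)
  qed (use Lm(2) Lmem ws(1) f(1) in auto)
  then have KL: "k \<otimes> f : adjs ?C {\<zero>} ?L" if "k : ?K" for k using ws(2) that by blast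
  have "P <= adjs ?C {\<zero>} ?L"
  proof
   fix q assume "q : P"
   then obtain e k where "e : ?N" "k : ?C" "q = e \<oplus> k \<otimes> f" "k \<otimes> f : P" using split by blast
   then show "q : adjs ?C {\<zero>} ?L" using Lm(3) NL KL by blast
  qed
  moreover have "adjs ?C {\<zero>} ?L <= P" by (rule adjs_least[OF sP]) (use Pm(2) L(1) in auto)
  ultimately show False using P(3) L(2) unfolding fg_def by blast
 qed
 have iter: "EX e:?N. EX q':P. q = e \<oplus> f [^] m \<otimes> q'" if "q : P" for q and m :: nat
 proof (induct m)
  case 0 show ?case using that Nm(2) Pm(5) by (intro bexI[of _ \<zero>] bexI[of _ q]) auto
 next
  case (Suc m)
  then obtain e q' where e: "e : ?N" "q' : P" "q = e \<oplus> f [^] m \<otimes> q'" by blast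
  obtain e' k where k: "e' : ?N" "k : ?C" "q' = e' \<oplus> k \<otimes> f" "k \<otimes> f : P" using split[OF e(2)] by blast
  have fm: "f [^] m : ?C" using f(1) by simp
  have "q = (e \<oplus> f [^] m \<otimes> e') \<oplus> f [^] m \<otimes> f \<otimes> k"
   unfolding e(3) k(3) using Nm(5)[OF e(1)] Nm(5)[OF k(1)] fm f(1) k(2) by algebra
  then show ?case using Nm(3)[OF e(1) Nm(4)[OF fm k(1)]] colon[OF k(2,4)] by auto
 qed
 obtain m0 :: "nat => nat" where m0: "!!i. f [^] m0 i : V i" using f(2) unfolding tnil_def by metis
 define m where "m i = (\<Sum>j\<le>i. m0 j)" for i
 have mV: "f [^] m k : V k" for k
  by (rule pow_V[OF f(1) m0]) (simp add: m_def member_le_sum)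
 have "(%q. f [^] m 0 \<otimes> q) ` P <= ?N"
 proof (rule approx_span[OF gs(2), of "%k. (%q. f [^] m k \<otimes> q) ` P"])
  show "(%q. f [^] m k \<otimes> q) ` P <= V k" for k using ideal.I_r_closed[OF V_ideal mV Pm(5)] by blast
  fix k v assume "v : (%q. f [^] m k \<otimes> q) ` P"
  then obtain q where q: "q : P" "v = f [^] m k \<otimes> q" by blast
  obtain e q' where e: "e : ?N" "q' : P" "q = e \<oplus> f [^] m0 (Suc k) \<otimes> q'" using iter[OF q(1)] by blast
  have fm: "f [^] m (Suc k) = f [^] m k \<otimes> f [^] m0 (Suc k)" "f [^] m k : ?C" "f [^] m0 (Suc k) : ?C"
   using f(1) by (simp_all add: m_def nat_pow_mult)
  have "v = f [^] m (Suc k) \<otimes> q' \<oplus> f [^] m k \<otimes> e"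
   unfolding q(2) e(3) fm(1) using Nm(5)[OF e(1)] Pm(5)[OF e(2)] fm(2,3) by algebra
  then show "EX w:(%q. f [^] m (Suc k) \<otimes> q) ` P. EX u:adjs (V k) {\<zero>} gs. v = w \<oplus> u"
   using scale_span[OF mV gs(2) e(1)] e(2) by blast
 qed
 then have "P <= ?N" using iter[of _ "m 0"] Nm(3) by blast
 then show False using NP P(3) gs(2) unfolding fg_def by blast
qed

theorem noetherianI:
 assumes fs: "set fs <= carrier R" "!!f. f : set fs ==> tnil f"
  and base: "!!J. ideal J R ==> set fs <= J ==> fg J"
 shows "noetherian_ring R"
proof -
 have "(!!J. ideal J R ==> set fs <= J ==> fg J) ==> ideal J R ==> fg J" for J
  using fs
 proof (induct fs arbitrary: J rule: rev_induct)
  case Nil then show ?case by simp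
 next
  case (snoc f fs)
  have fsc: "set fs <= carrier R" "f : carrier R" using snoc(4) by auto
  have gi: "ideal (genideal R (set fs)) R" by (rule genideal_ideal[OF fsc(1)])
  show ?case
  proof (rule snoc(1))
   fix J assume J: "ideal J R" "set fs <= J"
   show "fg J"
   proof (rule fg_step[OF fsc(2) _ _ J(1) genideal_minimal[OF J]])
    show "tnil f" using snoc(5) by simp
    fix J' assume J': "ideal J' R" "genideal R (set fs) <= J'" "f : J'"
    show "fg J'" by (rule snoc(2)[OF J'(1)]) (use J' genideal_self[OF fsc(1)] in auto)
   qed
  qed (use snoc in auto)
 qed
 then have "fg J" if "ideal J R" for J using base that by blast
 then show ?thesis
  by (intro noetherian_ringI) (metis fg_def genideal_eq_adjs finite_set)
qed

end

section \<open>Polynomial rings and their evaluation maps\<close>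

context cring begin

text \<open>Closure and associativity, and later the multiplicativity of evaluation, are shown by induction on
 the generation of a polynomial, so that only products with constants and variables are computed.\<close>

definition pprod :: "('c multiset => 'a) => ('c multiset => 'a) => 'c multiset => 'a" where
 "pprod f g = (%m. \<Oplus>a\<in>{a. a \<subseteq># m}. f a \<otimes> g (m - a))"

lemma cc: "carrier_coeff f ==> f m : carrier R"
 by (rule carrier_coeffE)

lemma finite_submultisets: "finite {a. a \<subseteq># (m :: 'c multiset)}"
proof (induct m)
 case (add i m)
 have "{a. a \<subseteq># add_mset i m} <= {a. a \<subseteq># m} \<union> add_mset i ` {a. a \<subseteq># m}"
 proof
  fix a assume a: "a : {a. a \<subseteq># add_mset i m}"
  show "a : {a. a \<subseteq># m} \<union> add_mset i ` {a. a \<subseteq># m}"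
  proof (cases "i \<in># a")
   case True
   then obtain b where "a = add_mset i b" by (metis insert_DiffM)
   then show ?thesis using a by auto
  next
   case False
   have "count a j <= count m j" for j
   proof (cases "j = i")
    case True then show ?thesis using \<open>i \<notin># a\<close> by (simp add: not_in_iff)
   next
    case False
    have "count a j <= count (add_mset i m) j" using a mset_subset_eq_count[of a "add_mset i m" j] by simp
    then show ?thesis using False by simp
   qed
   then show ?thesis by (simp add: subseteq_mset_def)
  qed
 qed
 then show ?case using add finite_subset by blast
qed simp

lemma multiset_diff_diff: "a \<subseteq># m ==> m - (m - a) = (a :: 'c multiset)"
 by (auto simp: mset_subset_eq_exists_conv)

lemma pprod_closed: "carrier_coeff f ==> carrier_coeff g ==> carrier_coeff (pprod f g)"
 unfolding carrier_coeff_def pprod_def by (auto intro!: finsum_closed)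

lemma pprod_comm:
 assumes f: "carrier_coeff f" and g: "carrier_coeff g"
 shows "pprod f g = pprod g f"
proof
 fix m :: "'c multiset"
 have inj: "inj_on (%a. m - a) {a. a \<subseteq># m}"
  by (rule inj_onI) (metis mem_Collect_eq multiset_diff_diff)
 have img: "(%a. m - a) ` {a. a \<subseteq># m} = {a. a \<subseteq># m}"
 proof
  show "{a. a \<subseteq># m} <= (%a. m - a) ` {a. a \<subseteq># m}"
  proof
   fix a assume "a : {a. a \<subseteq># m}"
   then have "a = m - (m - a)" "m - a \<subseteq># m" by (auto simp: multiset_diff_diff)
   then show "a : (%a. m - a) ` {a. a \<subseteq># m}" by blast
  qed
 qed auto
 have "pprod g f m = (\<Oplus>a\<in>(%a. m - a) ` {a. a \<subseteq># m}. g a \<otimes> f (m - a))" unfolding pprod_def img ..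
 also have "\<dots> = (\<Oplus>a\<in>{a. a \<subseteq># m}. g (m - a) \<otimes> f (m - (m - a)))"
  by (rule finsum_reindex[OF _ inj]) (use cc[OF f] cc[OF g] in auto)
 also have "\<dots> = (\<Oplus>a\<in>{a. a \<subseteq># m}. f a \<otimes> g (m - a))"
  by (rule finsum_cong') (use cc[OF f] cc[OF g] in "auto simp: m_comm multiset_diff_diff")
 finally show "pprod f g m = pprod g f m" by (simp add: pprod_def)
qed

lemma pprod_const:
 assumes f: "carrier_coeff f" and r: "r : carrier R"
 shows "pprod (indexed_const r) f = (%m. r \<otimes> f m)"
proof
 fix m :: "'c multiset"
 have "(\<Oplus>a\<in>{{#} :: 'c multiset}. r \<otimes> f m) = pprod (indexed_const r) f m"
  unfolding pprod_def
  by (rule add.finprod_mono_neutral_cong_left[OF finite_submultisets])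
   (use cc[OF f] r in "auto simp: indexed_const_def")
 then show "pprod (indexed_const r) f m = r \<otimes> f m" using cc[OF f, of m] r by simp
qed

lemma pprod_padd:
 assumes "carrier_coeff f" "carrier_coeff g" "carrier_coeff h"
 shows "pprod (indexed_padd f g) h = indexed_padd (pprod f h) (pprod g h)"
proof
 fix m :: "'c multiset"
 have "pprod (indexed_padd f g) h m = (\<Oplus>a\<in>{a. a \<subseteq># m}. f a \<otimes> h (m - a) \<oplus> g a \<otimes> h (m - a))"
  unfolding pprod_def indexed_padd_def
  by (rule finsum_cong') (use cc[OF assms(1)] cc[OF assms(2)] cc[OF assms(3)] in "auto simp: l_distr")
 also have "\<dots> = indexed_padd (pprod f h) (pprod g h) m"
  unfolding indexed_padd_def pprod_def by (rule finsum_addf) (use cc[OF assms(1)] cc[OF assms(2)] cc[OF assms(3)] in auto)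
 finally show "pprod (indexed_padd f g) h m = indexed_padd (pprod f h) (pprod g h) m" .
qed

lemma pprod_pmult:
 assumes f: "carrier_coeff f" and g: "carrier_coeff g"
 shows "pprod (indexed_pmult f i) g = indexed_pmult (pprod f g) i"
proof
 fix m :: "'c multiset"
 let ?t = "%a. indexed_pmult f i a \<otimes> g (m - a)"
 have tc: "?t a : carrier R" for a using cc[OF indexed_pmult_in_carrier[OF f]] cc[OF g] by blast
 show "pprod (indexed_pmult f i) g m = indexed_pmult (pprod f g) i m"
 proof (cases "i \<in># m")
  case False
  have "pprod (indexed_pmult f i) g m = (\<Oplus>a\<in>{a. a \<subseteq># m}. \<zero>)"
   unfolding pprod_def
   by (rule finsum_cong') (use cc[OF g] False mset_subset_eqD in "fastforce simp: indexed_pmult_def")+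
  then show ?thesis using False by (simp add: indexed_pmult_def add.finprod_one_eqI)
 next
  case True
  then obtain k where k: "m = add_mset i k" by (metis insert_DiffM)
  have "(\<Oplus>a\<in>add_mset i ` {a. a \<subseteq># k}. ?t a) = (\<Oplus>a\<in>{a. a \<subseteq># m}. ?t a)"
  proof (rule add.finprod_mono_neutral_cong_left[OF finite_submultisets])
   show "add_mset i ` {a. a \<subseteq># k} <= {a. a \<subseteq># m}" by (auto simp: k)
   fix a assume a: "a : {a. a \<subseteq># m} - add_mset i ` {a. a \<subseteq># k}"
   have "i \<notin># a"
   proof
    assume "i \<in># a"
    then obtain b where "a = add_mset i b" by (metis insert_DiffM)
    then show False using a by (auto simp: k)
   qed
   then show "?t a = \<zero>" using cc[OF g] by (simp add: indexed_pmult_def)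
  qed (use tc in auto)
  moreover have "(\<Oplus>a\<in>add_mset i ` {a. a \<subseteq># k}. ?t a) = (\<Oplus>a\<in>{a. a \<subseteq># k}. ?t (add_mset i a))"
   by (rule finsum_reindex) (use tc in "auto simp: inj_on_def")
  ultimately show ?thesis by (simp add: pprod_def indexed_pmult_def k)
 qed
qed

lemma pprod_consts:
 assumes "r : carrier R" "s : carrier R"
 shows "pprod (indexed_const r) (indexed_const s) = indexed_const (r \<otimes> s)"
proof -
 have c: "carrier_coeff (indexed_const s)" using assms by (simp add: carrier_coeff_def indexed_const_def)
 show ?thesis unfolding pprod_const[OF c assms(1)] using assms by (auto simp: indexed_const_def)
qed

lemma pset_cc: "f : indexed_pset I (carrier R) ==> carrier_coeff f"
 by (rule indexed_pset_in_carrier[OF subset_refl])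

lemma pset_finite: "f : indexed_pset I (carrier R) ==> finite {m. f m ~= \<zero>}"
proof (induct rule: indexed_pset.induct)
 case (indexed_const k)
 have "{m. indexed_const k m ~= \<zero>} <= {{#}}" by (auto simp: indexed_const_def)
 then show ?case using finite_subset by blast
next
 case (indexed_padd P Q)
 have "{m. indexed_padd P Q m ~= \<zero>} <= {m. P m ~= \<zero>} \<union> {m. Q m ~= \<zero>}" by (auto simp: indexed_padd_def)
 then show ?case using indexed_padd finite_subset by blast
next
 case (indexed_pmult P i)
 have "{m. indexed_pmult P i m ~= \<zero>} <= add_mset i ` {m. P m ~= \<zero>}"
 proof
  fix m assume "m : {m. indexed_pmult P i m ~= \<zero>}"
  then have "i \<in># m" "P (m - {#i#}) ~= \<zero>" by (auto simp: indexed_pmult_def split: if_splits)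
  then show "m : add_mset i ` {m. P m ~= \<zero>}" by (intro image_eqI[of _ _ "m - {#i#}"]) auto
 qed
 then show ?case using indexed_pmult finite_subset by blast
qed

lemma pset_support: "f : indexed_pset I (carrier R) ==> f m ~= \<zero> ==> set_mset m <= I"
proof (induct arbitrary: m rule: indexed_pset.induct)
 case (indexed_const k) then show ?case by (auto simp: indexed_const_def split: if_splits)
next
 case (indexed_padd P Q)
 have "P m ~= \<zero> \<or> Q m ~= \<zero>" using indexed_padd(5) by (auto simp: indexed_padd_def)
 then show ?case using indexed_padd by blast
next
 case (indexed_pmult P i)
 have "i \<in># m" "P (m - {#i#}) ~= \<zero>" using indexed_pmult(4) by (auto simp: indexed_pmult_def split: if_splits)
 then have "set_mset (m - {#i#}) <= I" "m = add_mset i (m - {#i#})" using indexed_pmult by auto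
 then show ?case using indexed_pmult(3) by (metis insert_subset set_mset_add_mset_insert)
qed

lemma pset_pprod:
 assumes g: "g : indexed_pset I (carrier R)"
 shows "f : indexed_pset I (carrier R) ==> pprod f g : indexed_pset I (carrier R)"
proof (induct rule: indexed_pset.induct)
 case (indexed_const r)
 show ?case using g
 proof (induct rule: indexed_pset.induct)
  case (indexed_const k)
  then show ?case using \<open>r : carrier R\<close> by (simp add: pprod_consts indexed_pset.indexed_const)
 next
  case (indexed_padd P Q)
  note c1 = pset_cc[OF indexed_padd(1)] pset_cc[OF indexed_padd(3)]
  note c = c1 indexed_padd_in_carrier[OF c1]
  have "pprod (indexed_const r) (indexed_padd P Q) = indexed_padd (pprod (indexed_const r) P) (pprod (indexed_const r) Q)"
   unfolding pprod_const[OF c(1) \<open>r : carrier R\<close>] pprod_const[OF c(2) \<open>r : carrier R\<close>] pprod_const[OF c(3) \<open>r : carrier R\<close>]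
   using cc[OF c(1)] cc[OF c(2)] \<open>r : carrier R\<close> by (simp add: indexed_padd_def r_distr)
  then show ?case using indexed_pset.indexed_padd[OF indexed_padd(2,4)] by simp
 next
  case (indexed_pmult P i)
  note c1 = pset_cc[OF indexed_pmult(1)]
  note c = c1 indexed_pmult_in_carrier[OF c1]
  have "pprod (indexed_const r) (indexed_pmult P i) = indexed_pmult (pprod (indexed_const r) P) i"
   unfolding pprod_const[OF c(1) \<open>r : carrier R\<close>] pprod_const[OF c(2) \<open>r : carrier R\<close>]
   using \<open>r : carrier R\<close> by (auto simp: indexed_pmult_def fun_eq_iff)
  then show ?case using indexed_pset.indexed_pmult[OF indexed_pmult(2,3)] by simp
 qed
next
 case (indexed_padd P Q)
 note c = pset_cc[OF indexed_padd(1)] pset_cc[OF indexed_padd(3)] pset_cc[OF g]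
 show ?case unfolding pprod_padd[OF c] by (rule indexed_pset.indexed_padd[OF indexed_padd(2,4)])
next
 case (indexed_pmult P i)
 show ?case unfolding pprod_pmult[OF pset_cc[OF indexed_pmult(1)] pset_cc[OF g]]
  by (rule indexed_pset.indexed_pmult[OF indexed_pmult(2,3)])
qed

lemma pprod_assoc:
 assumes g: "g : indexed_pset I (carrier R)" and h: "h : indexed_pset I (carrier R)"
 shows "f : indexed_pset I (carrier R) ==> pprod (pprod f g) h = pprod f (pprod g h)"
proof (induct rule: indexed_pset.induct)
 case (indexed_const r)
 have c: "carrier_coeff (pprod g h)" using pprod_closed pset_cc g h by blast
 have "pprod (pprod (indexed_const r) g) h = (%m. r \<otimes> pprod g h m)"
  unfolding pprod_const[OF pset_cc[OF g] indexed_const]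
 proof
  fix m
  have "(\<Oplus>a\<in>{a. a \<subseteq># m}. r \<otimes> (g a \<otimes> h (m - a))) = r \<otimes> pprod g h m"
   unfolding pprod_def by (rule finsum_rdistr[symmetric])
    (use indexed_const finite_submultisets cc[OF pset_cc[OF g]] cc[OF pset_cc[OF h]] in auto)
  moreover have "pprod (%m. r \<otimes> g m) h m = (\<Oplus>a\<in>{a. a \<subseteq># m}. r \<otimes> (g a \<otimes> h (m - a)))"
   unfolding pprod_def by (rule finsum_cong')
    (use indexed_const cc[OF pset_cc[OF g]] cc[OF pset_cc[OF h]] in "auto simp: m_assoc")
  ultimately show "pprod (%m. r \<otimes> g m) h m = r \<otimes> pprod g h m" by simp
 qed
 then show ?case using pprod_const[OF c indexed_const] by simp
next
 case (indexed_padd P Q)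
 note c = pset_cc[OF indexed_padd(1)] pset_cc[OF indexed_padd(3)] pset_cc[OF g] pset_cc[OF h]
 show ?case using pprod_padd[OF c(1,2,3)] pprod_padd[OF pprod_closed[OF c(1,3)] pprod_closed[OF c(2,3)] c(4)]
   pprod_padd[OF c(1,2) pprod_closed[OF c(3,4)]] indexed_padd by simp
next
 case (indexed_pmult P i)
 note c = pset_cc[OF indexed_pmult(1)] pset_cc[OF g] pset_cc[OF h]
 show ?case using pprod_pmult[OF c(1,2)] pprod_pmult[OF pprod_closed[OF c(1,2)] c(3)]
  pprod_pmult[OF c(1) pprod_closed[OF c(2,3)]] indexed_pmult by simp
qed

lemma mpoly_simps:
 "carrier (mpoly_ring R I) = indexed_pset I (carrier R)"
 "f \<otimes>\<^bsub>mpoly_ring R I\<^esub> g = pprod f g"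
 "f \<oplus>\<^bsub>mpoly_ring R I\<^esub> g = indexed_padd f g"
 "\<one>\<^bsub>mpoly_ring R I\<^esub> = indexed_const \<one>"
 "\<zero>\<^bsub>mpoly_ring R I\<^esub> = indexed_const \<zero>"
 by (simp_all add: mpoly_ring_def pprod_def)

lemma mpoly_cring: "cring (mpoly_ring R I)"
proof (rule cringI)
 note P = pset_cc
 have z: "indexed_const \<zero> : indexed_pset I (carrier R)" by (rule indexed_pset.indexed_const) simp
 show "abelian_group (mpoly_ring R I)"
 proof (rule abelian_groupI; unfold mpoly_simps)
  show "indexed_const \<zero> : indexed_pset I (carrier R)" by (rule z)
  fix f assume f: "f : indexed_pset I (carrier R)"
  show "indexed_padd (indexed_const \<zero>) f = f" by (rule indexed_padd_zero(2)[OF P[OF f]])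
  have "pprod (indexed_const (\<ominus> \<one>)) f : indexed_pset I (carrier R)"
   by (rule pset_pprod[OF f]) (rule indexed_pset.indexed_const, simp)
  moreover have "indexed_padd (pprod (indexed_const (\<ominus> \<one>)) f) f = indexed_const \<zero>"
  proof
   fix m
   have "\<ominus> \<one> \<otimes> f m \<oplus> f m = \<zero>" using cc[OF P[OF f], of m] by algebra
   then show "indexed_padd (pprod (indexed_const (\<ominus> \<one>)) f) f m = indexed_const \<zero> m"
    using pprod_const[OF P[OF f], of "\<ominus> \<one>"] by (simp add: indexed_padd_def indexed_zero_def)
  qed
  ultimately show "EX g:indexed_pset I (carrier R). indexed_padd g f = indexed_const \<zero>" by blast
  fix g assume g: "g : indexed_pset I (carrier R)"
  show "indexed_padd f g : indexed_pset I (carrier R)" by (rule indexed_pset.indexed_padd[OF f g])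
  show "indexed_padd f g = indexed_padd g f"
   using cc[OF P[OF f]] cc[OF P[OF g]] by (simp add: indexed_padd_def a_comm)
  fix h assume h: "h : indexed_pset I (carrier R)"
  show "indexed_padd (indexed_padd f g) h = indexed_padd f (indexed_padd g h)"
   using cc[OF P[OF f]] cc[OF P[OF g]] cc[OF P[OF h]] by (simp add: indexed_padd_def a_assoc)
 qed
 show "comm_monoid (mpoly_ring R I)"
 proof (rule comm_monoidI; unfold mpoly_simps)
  show "indexed_const \<one> : indexed_pset I (carrier R)" by (rule indexed_pset.indexed_const) simp
  fix f assume f: "f : indexed_pset I (carrier R)"
  show "pprod (indexed_const \<one>) f = f" using pprod_const[OF P[OF f] one_closed] cc[OF P[OF f]] by simp
  fix g assume g: "g : indexed_pset I (carrier R)"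
  show "pprod f g : indexed_pset I (carrier R)" by (rule pset_pprod[OF g f])
  show "pprod f g = pprod g f" by (rule pprod_comm[OF P[OF f] P[OF g]])
  fix h assume h: "h : indexed_pset I (carrier R)"
  show "pprod (pprod f g) h = pprod f (pprod g h)" by (rule pprod_assoc[OF g h f])
 qed
next
 fix f g h assume fgh: "f : carrier (mpoly_ring R I)" "g : carrier (mpoly_ring R I)" "h : carrier (mpoly_ring R I)"
 show "(f \<oplus>\<^bsub>mpoly_ring R I\<^esub> g) \<otimes>\<^bsub>mpoly_ring R I\<^esub> h = f \<otimes>\<^bsub>mpoly_ring R I\<^esub> h \<oplus>\<^bsub>mpoly_ring R I\<^esub> g \<otimes>\<^bsub>mpoly_ring R I\<^esub> h"
  unfolding mpoly_simps by (rule pprod_padd) (use fgh pset_cc in "simp_all add: mpoly_simps")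
qed

lemma mpoly_const_hom: "indexed_const : ring_hom R (mpoly_ring R I)"
proof (rule ring_hom_memI; unfold mpoly_simps)
 fix r s assume rs: "r : carrier R" "s : carrier R"
 show "indexed_const (r \<otimes> s) = pprod (indexed_const r) (indexed_const s)" by (rule pprod_consts[OF rs, symmetric])
qed (auto intro: indexed_pset.indexed_const simp: indexed_padd_const)

lemma mpoly_var_closed: "j : I ==> indexed_var j : carrier (mpoly_ring R I)"
 unfolding mpoly_simps indexed_var_def by (intro indexed_pset.intros) auto

lemma mpoly_mult_var:
 assumes "f : carrier (mpoly_ring R I)" "j : I"
 shows "f \<otimes>\<^bsub>mpoly_ring R I\<^esub> indexed_var j = indexed_pmult f j"
proof -
 interpret P: cring "mpoly_ring R I" by (rule mpoly_cring)
 have f: "f : indexed_pset I (carrier R)" using assms by (simp add: mpoly_simps)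
 have "f \<otimes>\<^bsub>mpoly_ring R I\<^esub> indexed_var j = pprod (indexed_var j) f"
  using P.m_comm[OF assms(1) mpoly_var_closed[OF assms(2)]] by (simp add: mpoly_simps)
 also have "\<dots> = indexed_pmult (pprod (indexed_const \<one>) f) j" unfolding indexed_var_def
  by (rule pprod_pmult[OF _ pset_cc[OF f]]) (simp add: carrier_coeff_def indexed_const_def)
 also have "\<dots> = indexed_pmult f j" using pprod_const[OF pset_cc[OF f] one_closed] cc[OF pset_cc[OF f]] by simp
 finally show ?thesis .
qed

lemma mpoly_induct [consumes 1, case_names const add var]:
 assumes "f : carrier (mpoly_ring R I)"
  and "!!r. r : carrier R ==> Q (indexed_const r)"
  and "!!f g. f : carrier (mpoly_ring R I) ==> g : carrier (mpoly_ring R I) ==> Q f ==> Q g ==> Q (f \<oplus>\<^bsub>mpoly_ring R I\<^esub> g)"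
  and "!!f j. f : carrier (mpoly_ring R I) ==> j : I ==> Q f ==> Q (f \<otimes>\<^bsub>mpoly_ring R I\<^esub> indexed_var j)"
 shows "Q f"
 using assms(1) unfolding mpoly_simps(1)
proof (induct rule: indexed_pset.induct)
 case (indexed_padd P Q) then show ?case using assms(3) by (simp add: mpoly_simps)
next
 case (indexed_pmult P i) then show ?case using assms(4)[of P i] mpoly_mult_var[of P I i] by (simp add: mpoly_simps)
qed (rule assms(2))

end

text \<open>The additive maps \<open>R[X\<^sub>i] \<rightarrow> S\<close> that send \<open>r X\<^sup>m\<close> to \<open>h r \<cdot> w m\<close>.\<close>

definition mlin :: "('a, 'r) ring_scheme => ('b, 's) ring_scheme => ('a => 'b) => ('c multiset => 'b) => ('c multiset => 'a) => 'b" where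
 "mlin R S h w f = (\<Oplus>\<^bsub>S\<^esub>m\<in>{m. f m ~= \<zero>\<^bsub>R\<^esub>}. h (f m) \<otimes>\<^bsub>S\<^esub> w m)"

context ring_hom_cring begin

lemma mlin_superset:
 assumes F: "finite F" "{m. f m ~= \<zero>} <= F" and f: "R.carrier_coeff f" and w: "!!m. w m : carrier S"
 shows "mlin R S h w f = (\<Oplus>\<^bsub>S\<^esub>m\<in>F. h (f m) \<otimes>\<^bsub>S\<^esub> w m)"
 unfolding mlin_def
 by (rule S.add.finprod_mono_neutral_cong_left[OF F]) (use R.cc[OF f] w in auto)

lemma mlin_closed:
 assumes f: "R.carrier_coeff f" and w: "!!m. w m : carrier S"
 shows "mlin R S h w f : carrier S"
 unfolding mlin_def by (rule S.finsum_closed) (use R.cc[OF f] w in auto)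

lemma mlin_closed':
 assumes f: "f : carrier (mpoly_ring R I)" and w: "!!m. w m : carrier S"
 shows "mlin R S h w f : carrier S"
 by (rule mlin_closed[OF R.pset_cc w]) (use f in "simp add: R.mpoly_simps")

lemma mlin_const:
 assumes r: "r : carrier R" and w: "!!m. w m : carrier S"
 shows "mlin R S h w (R.indexed_const r) = h r \<otimes>\<^bsub>S\<^esub> w {#}"
proof -
 have "mlin R S h w (R.indexed_const r) = (\<Oplus>\<^bsub>S\<^esub>m\<in>{{#}}. h (R.indexed_const r m) \<otimes>\<^bsub>S\<^esub> w m)"
  by (rule mlin_superset) (use r w in "auto simp: R.indexed_const_def R.carrier_coeff_def")
 then show ?thesis using r w by (simp add: R.indexed_const_def)
qed

lemma mlin_add:
 assumes fg: "f : carrier (mpoly_ring R I)" "g : carrier (mpoly_ring R I)" and w: "!!m. w m : carrier S"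
 shows "mlin R S h w (f \<oplus>\<^bsub>mpoly_ring R I\<^esub> g) = mlin R S h w f \<oplus>\<^bsub>S\<^esub> mlin R S h w g"
proof -
 note fg' = fg[unfolded R.mpoly_simps]
 note c = R.pset_cc[OF fg'(1)] R.pset_cc[OF fg'(2)]
 let ?F = "{m. f m ~= \<zero>} \<union> {m. g m ~= \<zero>}"
 have F: "finite ?F" using R.pset_finite fg' by blast
 have "mlin R S h w (R.indexed_padd f g) = (\<Oplus>\<^bsub>S\<^esub>m\<in>?F. h (R.indexed_padd f g m) \<otimes>\<^bsub>S\<^esub> w m)"
  by (rule mlin_superset[OF F _ R.indexed_padd_in_carrier[OF c] w]) (auto simp: R.indexed_padd_def)
 also have "\<dots> = (\<Oplus>\<^bsub>S\<^esub>m\<in>?F. h (f m) \<otimes>\<^bsub>S\<^esub> w m \<oplus>\<^bsub>S\<^esub> h (g m) \<otimes>\<^bsub>S\<^esub> w m)"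
  by (rule S.finsum_cong') (use R.cc[OF c(1)] R.cc[OF c(2)] w in "auto simp: R.indexed_padd_def S.l_distr")
 also have "\<dots> = (\<Oplus>\<^bsub>S\<^esub>m\<in>?F. h (f m) \<otimes>\<^bsub>S\<^esub> w m) \<oplus>\<^bsub>S\<^esub> (\<Oplus>\<^bsub>S\<^esub>m\<in>?F. h (g m) \<otimes>\<^bsub>S\<^esub> w m)"
  by (rule S.finsum_addf) (use R.cc[OF c(1)] R.cc[OF c(2)] w in auto)
 also have "\<dots> = mlin R S h w f \<oplus>\<^bsub>S\<^esub> mlin R S h w g"
  using mlin_superset[OF F _ c(1) w] mlin_superset[OF F _ c(2) w] by simp
 finally show ?thesis by (simp add: R.mpoly_simps)
qed

lemma mlin_var:
 assumes f: "f : carrier (mpoly_ring R I)" and j: "j : I" and w: "!!m. w m : carrier S"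
 shows "mlin R S h w (f \<otimes>\<^bsub>mpoly_ring R I\<^esub> R.indexed_var j) = mlin R S h (%m. w (add_mset j m)) f"
proof -
 note f' = f[unfolded R.mpoly_simps]
 note c = R.pset_cc[OF f']
 let ?F = "{m. f m ~= \<zero>}"
 have F: "finite ?F" by (rule R.pset_finite[OF f'])
 have "mlin R S h w (R.indexed_pmult f j) = (\<Oplus>\<^bsub>S\<^esub>m\<in>add_mset j ` ?F. h (R.indexed_pmult f j m) \<otimes>\<^bsub>S\<^esub> w m)"
 proof (rule mlin_superset[OF _ _ R.indexed_pmult_in_carrier[OF c] w])
  show "{m. R.indexed_pmult f j m ~= \<zero>} <= add_mset j ` ?F"
  proof
   fix m assume "m : {m. R.indexed_pmult f j m ~= \<zero>}"
   then have "j \<in># m" "f (m - {#j#}) ~= \<zero>" by (auto simp: R.indexed_pmult_def split: if_splits)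
   then show "m : add_mset j ` ?F" by (intro image_eqI[of _ _ "m - {#j#}"]) auto
  qed
 qed (use F in simp)
 also have "\<dots> = (\<Oplus>\<^bsub>S\<^esub>m\<in>?F. h (R.indexed_pmult f j (add_mset j m)) \<otimes>\<^bsub>S\<^esub> w (add_mset j m))"
  by (rule S.finsum_reindex) (use R.cc[OF R.indexed_pmult_in_carrier[OF c]] w in "auto simp: inj_on_def")
 also have "\<dots> = mlin R S h (%m. w (add_mset j m)) f"
  unfolding mlin_def by (simp add: R.indexed_pmult_def)
 finally show ?thesis using R.mpoly_mult_var[OF f j] by simp
qed

lemma mlin_wscale:
 assumes f: "f : carrier (mpoly_ring R I)" and s: "s : carrier S"
 shows "(!!m. w m : carrier S) ==> mlin R S h (%m. s \<otimes>\<^bsub>S\<^esub> w m) f = s \<otimes>\<^bsub>S\<^esub> mlin R S h w f"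
 using f
proof (induct arbitrary: w rule: R.mpoly_induct)
 case (const r)
 show ?case using const s by (simp add: mlin_const S.m_lcomm)
next
 case (add f g)
 have "mlin R S h w f : carrier S" "mlin R S h w g : carrier S"
  by (rule mlin_closed'[OF add(1) add(5)], rule mlin_closed'[OF add(2) add(5)])
 then show ?case using add s mlin_add[OF add(1,2)] by (simp add: S.r_distr)
next
 case (var f j)
 show ?case using var s by (simp add: mlin_var[OF var(1,2)])
qed

lemma mlin_scale:
 assumes f: "f : carrier (mpoly_ring R I)" and r: "r : carrier R" and w: "!!m. w m : carrier S"
 shows "mlin R S h w (R.indexed_const r \<otimes>\<^bsub>mpoly_ring R I\<^esub> f) = h r \<otimes>\<^bsub>S\<^esub> mlin R S h w f"
proof -
 interpret P: cring "mpoly_ring R I" by (rule R.mpoly_cring)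
 have rc: "R.indexed_const r : carrier (mpoly_ring R I)" by (rule ring_hom_closed[OF R.mpoly_const_hom r])
 show ?thesis using f w
 proof (induct arbitrary: w rule: R.mpoly_induct)
  case (const s)
  have "R.indexed_const r \<otimes>\<^bsub>mpoly_ring R I\<^esub> R.indexed_const s = R.indexed_const (r \<otimes> s)"
   using ring_hom_mult[OF R.mpoly_const_hom[of I] r const(1)] by simp
  then show ?case using const r by (simp add: mlin_const S.m_assoc)
 next
  case (add f g)
  have "mlin R S h w f : carrier S" "mlin R S h w g : carrier S"
   by (rule mlin_closed'[OF add(1) add(5)], rule mlin_closed'[OF add(2) add(5)])
  then show ?case using add r rc mlin_add[of _ I] by (simp add: S.r_distr P.r_distr)
 next
  case (var f j)
  have "R.indexed_const r \<otimes>\<^bsub>mpoly_ring R I\<^esub> (f \<otimes>\<^bsub>mpoly_ring R I\<^esub> R.indexed_var j)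
    = (R.indexed_const r \<otimes>\<^bsub>mpoly_ring R I\<^esub> f) \<otimes>\<^bsub>mpoly_ring R I\<^esub> R.indexed_var j"
   using P.m_assoc rc var(1) R.mpoly_var_closed[OF var(2)] by simp
  then show ?case using var rc by (simp add: mlin_var[OF _ var(2)])
 qed
qed

lemma mlin_var_pow:
 assumes j: "j : I"
 shows "f : carrier (mpoly_ring R I) ==> (!!m. w m : carrier S) ==>
  mlin R S h w (f \<otimes>\<^bsub>mpoly_ring R I\<^esub> R.indexed_var j [^]\<^bsub>mpoly_ring R I\<^esub> (k::nat))
   = mlin R S h (%m. w (m + replicate_mset k j)) f"
proof (induct k arbitrary: f w)
 case 0
 interpret P: cring "mpoly_ring R I" by (rule R.mpoly_cring)
 show ?case using 0 by simp
next
 case (Suc k)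
 interpret P: cring "mpoly_ring R I" by (rule R.mpoly_cring)
 note v = R.mpoly_var_closed[OF j]
 have "f \<otimes>\<^bsub>mpoly_ring R I\<^esub> R.indexed_var j [^]\<^bsub>mpoly_ring R I\<^esub> (Suc k)
  = (f \<otimes>\<^bsub>mpoly_ring R I\<^esub> R.indexed_var j [^]\<^bsub>mpoly_ring R I\<^esub> k) \<otimes>\<^bsub>mpoly_ring R I\<^esub> R.indexed_var j"
  using Suc(2) v by (simp add: P.m_assoc)
 then have "mlin R S h w (f \<otimes>\<^bsub>mpoly_ring R I\<^esub> R.indexed_var j [^]\<^bsub>mpoly_ring R I\<^esub> (Suc k))
  = mlin R S h (%m. w (add_mset j m)) (f \<otimes>\<^bsub>mpoly_ring R I\<^esub> R.indexed_var j [^]\<^bsub>mpoly_ring R I\<^esub> k)"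
  using mlin_var[OF _ j Suc(3)] Suc(2) v by simp
 also have "\<dots> = mlin R S h (%m. w (add_mset j (m + replicate_mset k j))) f"
  by (rule Suc(1)[OF Suc(2)]) (rule Suc(3))
 finally show ?case by simp
qed

definition mval :: "('i => 'c) => 'i multiset => 'c" where
 "mval y m = (\<Otimes>\<^bsub>S\<^esub>j\<in>set_mset m. y j [^]\<^bsub>S\<^esub> count m j)"

lemma mval_closed: "(!!j. y j : carrier S) ==> mval y m : carrier S"
 unfolding mval_def by (rule S.finprod_closed) auto

lemma mval_add:
 assumes y: "!!j. y j : carrier S"
 shows "mval y (add_mset i m) = y i \<otimes>\<^bsub>S\<^esub> mval y m"
proof -
 let ?A = "set_mset m - {i}"
 have s: "set_mset (add_mset i m) = insert i ?A" by auto
 have fi: "finite ?A" "i ~: ?A" by auto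
 have yc: "y j [^]\<^bsub>S\<^esub> count k j : carrier S" for j k using y by simp
 have B: "(\<Otimes>\<^bsub>S\<^esub>j\<in>?A. y j [^]\<^bsub>S\<^esub> count m j) : carrier S" (is "?B : _") by (rule S.finprod_closed) (use yc in auto)
 have "mval y (add_mset i m) = y i [^]\<^bsub>S\<^esub> Suc (count m i) \<otimes>\<^bsub>S\<^esub> (\<Otimes>\<^bsub>S\<^esub>j\<in>?A. y j [^]\<^bsub>S\<^esub> count (add_mset i m) j)"
  unfolding mval_def s by (subst S.finprod_insert[OF fi]) (use y in auto)
 also have "(\<Otimes>\<^bsub>S\<^esub>j\<in>?A. y j [^]\<^bsub>S\<^esub> count (add_mset i m) j) = ?B" by (rule S.finprod_cong') (use y in auto)
 also have "y i [^]\<^bsub>S\<^esub> Suc (count m i) \<otimes>\<^bsub>S\<^esub> ?B = y i \<otimes>\<^bsub>S\<^esub> (y i [^]\<^bsub>S\<^esub> count m i \<otimes>\<^bsub>S\<^esub> ?B)"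
  unfolding S.nat_pow_Suc2[OF y] by (rule S.m_assoc[OF y yc B])
 also have "y i [^]\<^bsub>S\<^esub> count m i \<otimes>\<^bsub>S\<^esub> ?B = mval y m"
 proof (cases "i \<in># m")
  case True
  then have e: "set_mset m = insert i ?A" by auto
  show ?thesis unfolding mval_def by (subst (2) e, subst S.finprod_insert[OF fi]) (use y in auto)
 next
  case False
  then have "?A = set_mset m" "count m i = 0" by (auto simp: not_in_iff)
  then show ?thesis using B unfolding mval_def by simp
 qed
 finally show ?thesis .
qed

lemma mpoly_eval_eq_mlin:
 assumes f: "f : carrier (mpoly_ring R I)" and y: "y : I \<rightarrow> carrier S"
 shows "mpoly_eval R S h y f = mlin R S h (mval (%j. if j : I then y j else \<zero>\<^bsub>S\<^esub>)) f"
 unfolding mpoly_eval_def mlin_def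
proof (rule S.finsum_cong')
 note f' = f[unfolded R.mpoly_simps]
 fix m assume m: "m : {m. f m ~= \<zero>}"
 have s: "set_mset m <= I" using R.pset_support[OF f'] m by simp
 have "(\<Otimes>\<^bsub>S\<^esub>j\<in>set_mset m. y j [^]\<^bsub>S\<^esub> count m j) = mval (%j. if j : I then y j else \<zero>\<^bsub>S\<^esub>) m"
  unfolding mval_def by (rule S.finprod_cong') (use s funcset_mem[OF y] in auto)
 then show "h (f m) \<otimes>\<^bsub>S\<^esub> (\<Otimes>\<^bsub>S\<^esub>j\<in>set_mset m. y j [^]\<^bsub>S\<^esub> count m j) = h (f m) \<otimes>\<^bsub>S\<^esub> mval (%j. if j : I then y j else \<zero>\<^bsub>S\<^esub>) m"
  by simp
next
 note f' = f[unfolded R.mpoly_simps]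
 show "(%m. h (f m) \<otimes>\<^bsub>S\<^esub> mval (%j. if j : I then y j else \<zero>\<^bsub>S\<^esub>) m) : {m. f m ~= \<zero>} \<rightarrow> carrier S"
  using R.cc[OF R.pset_cc[OF f']] y by (auto intro!: S.m_closed mval_closed)
qed simp

lemma mpoly_eval_props:
 assumes y: "y : I \<rightarrow> carrier S"
 shows mpoly_eval_hom: "mpoly_eval R S h y : ring_hom (mpoly_ring R I) S"
  and mpoly_eval_const: "r : carrier R ==> mpoly_eval R S h y (R.indexed_const r) = h r"
  and mpoly_eval_var: "j : I ==> mpoly_eval R S h y (R.indexed_var j) = y j"
proof -
 interpret P: cring "mpoly_ring R I" by (rule R.mpoly_cring)
 define y' where "y' j = (if j : I then y j else \<zero>\<^bsub>S\<^esub>)" for j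
 have y': "y' j : carrier S" for j using y by (auto simp: y'_def)
 let ?e = "mlin R S h (mval y')"
 note w = mval_closed[of y', OF y']
 have e: "mpoly_eval R S h y f = ?e f" if "f : carrier (mpoly_ring R I)" for f
  using mpoly_eval_eq_mlin[OF that y] unfolding y'_def .
 have ec: "?e f : carrier S" if "f : carrier (mpoly_ring R I)" for f
  by (rule mlin_closed[OF R.pset_cc w]) (use that in "simp add: R.mpoly_simps")
 have cc: "R.indexed_const r : carrier (mpoly_ring R I)" if "r : carrier R" for r
  by (rule ring_hom_closed[OF R.mpoly_const_hom that])
 have mv0: "mval y' {#} = \<one>\<^bsub>S\<^esub>" by (simp add: mval_def)
 have const: "?e (R.indexed_const r) = h r" if "r : carrier R" for r
  using mlin_const[OF that, of "mval y'", OF w] that mv0 by simp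
 have var: "?e (f \<otimes>\<^bsub>mpoly_ring R I\<^esub> R.indexed_var j) = y' j \<otimes>\<^bsub>S\<^esub> ?e f" if "f : carrier (mpoly_ring R I)" "j : I" for f j
  using mlin_var[OF that, of "mval y'", OF w] mlin_wscale[OF that(1) y', of "mval y'", OF w] mval_add[of y', OF y'] by simp
 have mult: "?e (f \<otimes>\<^bsub>mpoly_ring R I\<^esub> g) = ?e f \<otimes>\<^bsub>S\<^esub> ?e g" if f: "f : carrier (mpoly_ring R I)" and g: "g : carrier (mpoly_ring R I)" for f g
  using f
 proof (induct rule: R.mpoly_induct)
  case (const r)
  then show ?case using mlin_scale[OF g const, of "mval y'", OF w] \<open>!!r. r : carrier R ==> ?e (R.indexed_const r) = h r\<close> by simp
 next
  case (add f f')
  then show ?case using g ec by (simp add: P.l_distr S.l_distr mlin_add[of _ I _ "mval y'", OF _ _ w])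
 next
  case (var f j)
  note vj = R.mpoly_var_closed[OF var(2)]
  have "f \<otimes>\<^bsub>mpoly_ring R I\<^esub> R.indexed_var j \<otimes>\<^bsub>mpoly_ring R I\<^esub> g = (f \<otimes>\<^bsub>mpoly_ring R I\<^esub> g) \<otimes>\<^bsub>mpoly_ring R I\<^esub> R.indexed_var j"
   using var(1) vj g by algebra
  then show ?case using var g ec y' \<open>!!f j. f : carrier (mpoly_ring R I) ==> j : I ==> ?e (f \<otimes>\<^bsub>mpoly_ring R I\<^esub> R.indexed_var j) = y' j \<otimes>\<^bsub>S\<^esub> ?e f\<close>
   by (simp add: S.m_assoc)
 qed
 show "mpoly_eval R S h y : ring_hom (mpoly_ring R I) S"
 proof (rule ring_hom_memI)
  show "mpoly_eval R S h y \<one>\<^bsub>mpoly_ring R I\<^esub> = \<one>\<^bsub>S\<^esub>"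
   using e[OF P.one_closed] const[OF R.one_closed] by (simp add: R.mpoly_simps)
 qed (use e ec mult mlin_add[of _ I _ "mval y'", OF _ _ w] in simp_all)
 show "mpoly_eval R S h y (R.indexed_const r) = h r" if "r : carrier R"
  using e[OF cc[OF that]] const[OF that] by simp
 show "mpoly_eval R S h y (R.indexed_var j) = y j" if "j : I"
 proof -
  note v = R.mpoly_var_closed[OF that]
  have "?e (R.indexed_var j) = y' j \<otimes>\<^bsub>S\<^esub> ?e \<one>\<^bsub>mpoly_ring R I\<^esub>" using var[OF P.one_closed that] unfolding P.l_one[OF v] .
  also have "?e \<one>\<^bsub>mpoly_ring R I\<^esub> = \<one>\<^bsub>S\<^esub>" using const[OF R.one_closed] by (simp add: R.mpoly_simps)
  finally show ?thesis unfolding e[OF v] using y'[of j] that y'_def[of j] by simp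
 qed
qed

end

section \<open>One step of the tower\<close>

lemma image_ring_cring:
 assumes A: "cring A" and f: "inj_on f (carrier A)"
 shows "cring (image_ring f A)"
proof -
 interpret A: cring A by (rule A)
 interpret I: ring "image_ring f A" by (rule A.inj_imp_image_ring_is_ring[OF f])
 have h: "f : ring_hom A (image_ring f A)" using inj_imp_image_ring_iso[OF f] by (simp add: ring_iso_def)
 show ?thesis
 proof (rule cring.intro[OF I.ring_axioms I.monoid_comm_monoidI])
  fix a b assume "a : carrier (image_ring f A)" "b : carrier (image_ring f A)"
  then obtain u v where "u : carrier A" "v : carrier A" "a = f u" "b = f v" by (auto simp: image_ring_carrier)
  then show "a \<otimes>\<^bsub>image_ring f A\<^esub> b = b \<otimes>\<^bsub>image_ring f A\<^esub> a"
   using ring_hom_mult[OF h] A.m_comm by metis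
 qed
qed

lemma (in charp) frob_hom: "(%r. r [^] p) : ring_hom R R"
 by (rule ring_hom_memI) (auto simp: frob_mult frob_add)

locale gens = R: charp "fst T" p for T :: "'k tring" and p :: nat +
 assumes pg: "p_generators p (fst T) (snd T)"
begin

abbreviation "R \<equiv> fst T"
abbreviation "n \<equiv> length (snd T)"
abbreviation "x \<equiv> (!) (snd T)"
abbreviation "P \<equiv> gabber_poly_ring T"
abbreviation "J \<equiv> gabber_ideal p T"
abbreviation "cls \<equiv> gabber_class p T"
abbreviation "R' \<equiv> fst (gabber_step p T)"
abbreviation "x' \<equiv> (!) (snd (gabber_step p T))"
abbreviation "pconst \<equiv> R.indexed_const :: _ => nat multiset => _"
abbreviation "pvar \<equiv> R.indexed_var :: nat => _"
abbreviation "inc \<equiv> %r. cls (pconst r)"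
abbreviation "phi \<equiv> gabber_phi p T"

lemma xc: "j < n ==> x j : carrier R" "x : {..<n} \<rightarrow> carrier R" "set (snd T) <= carrier R"
 using pg by (auto simp: p_generators_def)

lemma P_def: "P = mpoly_ring R {..<n}" by (simp add: gabber_poly_ring_def)

sublocale P: cring P unfolding P_def by (rule R.mpoly_cring)

lemma const_hom: "pconst : ring_hom R P" unfolding P_def by (rule R.mpoly_const_hom)

lemma const_closed: "r : carrier R ==> pconst r : carrier P" by (rule ring_hom_closed[OF const_hom])

lemma var_closed: "j < n ==> pvar j : carrier P" unfolding P_def by (rule R.mpoly_var_closed) simp

definition rel :: "nat => _" where "rel j = pvar j [^]\<^bsub>P\<^esub> p \<ominus>\<^bsub>P\<^esub> pconst (x j)"

lemma rel_closed: "j < n ==> rel j : carrier P"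
 unfolding rel_def using var_closed const_closed xc by simp

lemma J_def: "J = genideal P (rel ` {..<n})"
 unfolding gabber_ideal_def rel_def by (rule arg_cong[of _ _ "genideal P"]) auto

lemma J_ideal: "ideal J P" unfolding J_def by (rule P.genideal_ideal) (use rel_closed in auto)

sublocale J: ideal J P by (rule J_ideal)

lemma J_least: "ideal H P ==> (!!j. j < n ==> rel j : H) ==> J <= H"
 unfolding J_def by (rule P.genideal_minimal) auto

lemma rel_J: "j < n ==> rel j : J"
 unfolding J_def using P.genideal_self[of "rel ` {..<n}"] rel_closed by auto

lemma R'_def: "R' = image_ring coset_code (P Quot J)" by (simp add: gabber_step_def)

lemma code_inj: "inj_on coset_code (carrier (P Quot J))" by (rule coset_code_inj_on[OF J_ideal])

lemma R'_cring: "cring R'"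
 unfolding R'_def by (rule image_ring_cring[OF J.quotient_is_cring[OF P.is_cring] code_inj])

lemma cls_comp: "cls = coset_code \<circ> (+>\<^bsub>P\<^esub>) J" by (auto simp: gabber_class_def)

lemma cls_hom: "cls : ring_hom P R'"
proof -
 have "coset_code : ring_hom (P Quot J) R'"
  unfolding R'_def using inj_imp_image_ring_iso[OF code_inj] by (simp add: ring_iso_def)
 then show ?thesis unfolding cls_comp by (rule ring_hom_trans[OF J.rcos_ring_hom])
qed

lemma cls_surj: "carrier R' = cls ` carrier P"
 unfolding R'_def image_ring_carrier cls_comp by (auto simp: FactRing_def A_RCOSETS_def')

lemma cls_kernel:
 assumes f: "f : carrier P" and z: "cls f = \<zero>\<^bsub>R'\<^esub>"
 shows "f : J"
proof -
 have "J +>\<^bsub>P\<^esub> f = \<zero>\<^bsub>P Quot J\<^esub>"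
 proof (rule inj_onD[OF code_inj])
  show "coset_code (J +>\<^bsub>P\<^esub> f) = coset_code \<zero>\<^bsub>P Quot J\<^esub>"
   using z by (simp add: gabber_class_def R'_def image_ring_zero)
  show "J +>\<^bsub>P\<^esub> f : carrier (P Quot J)" using f by (auto simp: FactRing_def A_RCOSETS_def')
  show "\<zero>\<^bsub>P Quot J\<^esub> : carrier (P Quot J)"
   using ring.ring_simprules(2)[OF J.quotient_is_ring] by blast
 qed
 then have "J +>\<^bsub>P\<^esub> f = J" by (simp add: FactRing_def)
 then show ?thesis using J.a_rcos_self[OF f] by simp
qed

lemma cls_J: "f : J ==> cls f = \<zero>\<^bsub>R'\<^esub>"
 using J.a_rcos_const[of f] by (simp add: gabber_class_def R'_def image_ring_zero FactRing_def)

lemma cls_rep: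
 assumes f: "f : carrier P"
 obtains g where "g : J" "un_MPoly (cls f) = g \<oplus>\<^bsub>P\<^esub> f"
proof -
 have "(SOME g. g : J +>\<^bsub>P\<^esub> f) : J +>\<^bsub>P\<^esub> f" by (rule someI[of "%g. g : J +>\<^bsub>P\<^esub> f", OF J.a_rcos_self[OF f]])
 then show thesis using that by (auto simp: gabber_class_def coset_code_def a_r_coset_def')
qed

sublocale R': cring R' by (rule R'_cring)

lemma inc_hom: "inc : ring_hom R R'"
 using ring_hom_trans[OF const_hom cls_hom] by (simp add: comp_def)

lemma inc_closed: "r : carrier R ==> inc r : carrier R'" by (rule ring_hom_closed[OF inc_hom])

lemma x'_length: "length (snd (gabber_step p T)) = n" by (simp add: gabber_step_def)

lemma x'_cls: "j < n ==> x' j = cls (pvar j)" by (simp add: gabber_step_def)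

lemma x'_closed: "j < n ==> x' j : carrier R'"
 using x'_cls ring_hom_closed[OF cls_hom var_closed] by simp

lemma x'_pow: assumes j: "j < n" shows "x' j [^]\<^bsub>R'\<^esub> p = inc (x j)"
proof -
 interpret c: ring_hom_cring P R' cls
  by (intro ring_hom_cring.intro ring_hom_cring_axioms.intro cls_hom P.is_cring R'.is_cring)
 note v = var_closed[OF j] and k = const_closed[OF xc(1)[OF j]]
 have "cls (pvar j [^]\<^bsub>P\<^esub> p \<ominus>\<^bsub>P\<^esub> pconst (x j)) = \<zero>\<^bsub>R'\<^esub>" using cls_J[OF rel_J[OF j]] by (simp add: rel_def)
 then have "cls (pvar j) [^]\<^bsub>R'\<^esub> p \<ominus>\<^bsub>R'\<^esub> inc (x j) = \<zero>\<^bsub>R'\<^esub>" using v k by (simp add: P.minus_eq R'.minus_eq)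
 then show ?thesis using v k x'_cls[OF j] by simp
qed

lemma R'_induct [consumes 1, case_names const add var]:
 assumes v: "v : carrier R'" and 1: "!!r. r : carrier R ==> Q (inc r)"
  and 2: "!!a b. a : carrier R' ==> b : carrier R' ==> Q a ==> Q b ==> Q (a \<oplus>\<^bsub>R'\<^esub> b)"
  and 3: "!!a j. a : carrier R' ==> j < n ==> Q a ==> Q (a \<otimes>\<^bsub>R'\<^esub> x' j)"
 shows "Q v"
proof -
 obtain f where f: "f : carrier (mpoly_ring R {..<n})" "v = cls f" using v by (auto simp: cls_surj P_def)
 have "Q (cls f)" using f(1)
 proof (induct rule: R.mpoly_induct)
  case (const r) then show ?case by (rule 1)
 next
  case (add f g)
  then show ?case using 2[of "cls f" "cls g"] ring_hom_add[OF cls_hom] ring_hom_closed[OF cls_hom] by (simp add: P_def)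
 next
  case (var f j)
  then have "j < n" "f : carrier P" by (simp_all add: P_def)
  then show ?case
   using 3[of "cls f" j] ring_hom_mult[OF cls_hom _ var_closed] ring_hom_closed[OF cls_hom] var(3) by (simp add: x'_cls P_def)
 qed
 then show ?thesis using f by simp
qed

lemma hom_eqI:
 assumes S: "cring S" and gh: "g : ring_hom R' S" "h : ring_hom R' S"
  and e: "!!r. r : carrier R ==> g (inc r) = h (inc r)" "!!j. j < n ==> g (x' j) = h (x' j)"
  and v: "v : carrier R'"
 shows "g v = h v"
 using v
proof (induct rule: R'_induct)
 case (add a b) then show ?case using ring_hom_add[OF gh(1)] ring_hom_add[OF gh(2)] by simp
next
 case (var a j)
 then show ?case using ring_hom_mult[OF gh(1) _ x'_closed] ring_hom_mult[OF gh(2) _ x'_closed] e(2) by simp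
qed (rule e(1))

text \<open>The universal property of \<open>R'\<close>: evaluation annihilates the relations, so its value on a class does
 not depend on the representative.\<close>

lemma lift:
 assumes S: "cring S" and h: "h : ring_hom R S" and y: "y : {..<n} \<rightarrow> carrier S"
  and yp: "!!j. j < n ==> y j [^]\<^bsub>S\<^esub> p = h (x j)"
 defines "e \<equiv> %v. mpoly_eval R S h y (un_MPoly v)"
 shows lift_hom: "e : ring_hom R' S" and lift_inc: "r : carrier R ==> e (inc r) = h r"
  and lift_x': "j < n ==> e (x' j) = y j"
proof -
 interpret S: cring S by (rule S)
 interpret h: ring_hom_cring R S h
  by (intro ring_hom_cring.intro ring_hom_cring_axioms.intro h R.is_cring S)
 let ?E = "mpoly_eval R S h y"
 have E: "?E : ring_hom P S" unfolding P_def by (rule h.mpoly_eval_hom[OF y])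
 interpret E: ring_hom_cring P S ?E
  by (intro ring_hom_cring.intro ring_hom_cring_axioms.intro E P.is_cring S)
 have "J <= a_kernel P S ?E"
 proof (rule J_least[OF ring_hom_ring.kernel_is_ideal[OF ring_hom_ringI2[OF P.ring_axioms S.ring_axioms E]]])
  fix j assume j: "j < n"
  have "?E (rel j) = \<zero>\<^bsub>S\<^esub>"
   unfolding rel_def using var_closed[OF j] const_closed[OF xc(1)[OF j]] yp[OF j] j funcset_mem[OF y] h.mpoly_eval_var[OF y, of j] h.mpoly_eval_const[OF y xc(1)[OF j]]
    ring_hom_closed[OF h xc(1)[OF j]]
   by (simp add: P.minus_eq S.r_neg)
  then show "rel j : a_kernel P S ?E" using rel_closed[OF j] unfolding a_kernel_def' by blast
 qed
 then have zero: "?E f = \<zero>\<^bsub>S\<^esub>" if "f : J" for f using that unfolding a_kernel_def' by blast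
 have ecls: "e (cls f) = ?E f" if f: "f : carrier P" for f
 proof -
  obtain g where g: "g : J" "un_MPoly (cls f) = g \<oplus>\<^bsub>P\<^esub> f" by (rule cls_rep[OF f])
  show ?thesis using zero[OF g(1)] J.Icarr[OF g(1)] f by (simp add: e_def g(2))
 qed
 show "e : ring_hom R' S"
 proof (rule ring_hom_memI)
  fix u v assume "u : carrier R'" "v : carrier R'"
  then obtain f g where fg: "f : carrier P" "g : carrier P" "u = cls f" "v = cls g" by (auto simp: cls_surj)
  show "e u : carrier S" using fg ecls by simp
  have "u \<otimes>\<^bsub>R'\<^esub> v = cls (f \<otimes>\<^bsub>P\<^esub> g)" using fg ring_hom_mult[OF cls_hom] by simp
  then show "e (u \<otimes>\<^bsub>R'\<^esub> v) = e u \<otimes>\<^bsub>S\<^esub> e v" using fg ecls by simp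
  have "u \<oplus>\<^bsub>R'\<^esub> v = cls (f \<oplus>\<^bsub>P\<^esub> g)" using fg ring_hom_add[OF cls_hom] by simp
  then show "e (u \<oplus>\<^bsub>R'\<^esub> v) = e u \<oplus>\<^bsub>S\<^esub> e v" using fg ecls by simp
 next
  have "\<one>\<^bsub>R'\<^esub> = cls \<one>\<^bsub>P\<^esub>" using ring_hom_one[OF cls_hom] by simp
  then show "e \<one>\<^bsub>R'\<^esub> = \<one>\<^bsub>S\<^esub>" using ecls[OF P.one_closed] by simp
 qed
 show "e (inc r) = h r" if "r : carrier R" using ecls[OF const_closed[OF that]] h.mpoly_eval_const[OF y that] by simp
 show "e (x' j) = y j" if "j < n" using ecls[OF var_closed[OF that]] h.mpoly_eval_var[OF y, of j] that by (simp add: x'_cls)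
qed

lemma phi_def: "phi = (%v. mpoly_eval R R (%r. r [^]\<^bsub>R\<^esub> p) x (un_MPoly v))"
 by (simp add: gabber_phi_def fun_eq_iff)

lemma phi_hom: "phi : ring_hom R' R"
 and phi_inc: "r : carrier R ==> phi (inc r) = r [^]\<^bsub>R\<^esub> p"
 and phi_x': "j < n ==> phi (x' j) = x j"
 unfolding phi_def
 by (rule lift[OF R.is_cring R.frob_hom xc(2)], simp, (assumption)?)+

lemma R'_charp: "charp R' p"
proof (intro charp.intro R'_cring charp_axioms.intro R.prime_p)
 interpret i: ring_hom_cring R R' inc
  by (intro ring_hom_cring.intro ring_hom_cring_axioms.intro inc_hom R.is_cring R'.is_cring)
 have "inc ([k] \<cdot>\<^bsub>R\<^esub> \<one>\<^bsub>R\<^esub>) = [k] \<cdot>\<^bsub>R'\<^esub> \<one>\<^bsub>R'\<^esub>" for k :: nat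
  by (induct k) auto
 then show "[p] \<cdot>\<^bsub>R'\<^esub> \<one>\<^bsub>R'\<^esub> = \<zero>\<^bsub>R'\<^esub>" using R.char_p by (metis i.hom_zero)
qed

sublocale R': charp R' p by (rule R'_charp)

text \<open>The image is a subring that contains the \<open>p\<close>-th powers and the \<open>p\<close>-generators.\<close>

lemma phi_surj: "phi ` carrier R' = carrier R"
proof
 interpret f: ring_hom_ring R' R phi
  by (intro ring_hom_ringI2 R'.ring_axioms R.ring_axioms phi_hom)
 show "phi ` carrier R' <= carrier R" by auto
 have "generate_ring R (frob_image p R \<union> set (snd T)) <= phi ` carrier R'"
 proof (rule R.generate_ring_min_subring1[OF _ f.img_is_subring[OF R'.carrier_is_subring]])
  show "frob_image p R \<union> set (snd T) <= phi ` carrier R'"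
  proof
   fix a assume "a : frob_image p R \<union> set (snd T)"
   then show "a : phi ` carrier R'"
   proof
    assume "a : frob_image p R"
    then obtain r where "r : carrier R" "a = r [^]\<^bsub>R\<^esub> p" by (auto simp: frob_image_def)
    then show ?thesis using phi_inc inc_closed by (intro image_eqI[of _ _ "inc r"]) auto
   next
    assume "a : set (snd T)"
    then obtain j where "j < n" "a = x j" by (auto simp: in_set_conv_nth)
    then show ?thesis using phi_x' x'_closed by (intro image_eqI[of _ _ "x' j"]) auto
   qed
  qed
 qed (use R.Kp_carrier xc(3) in auto)
 then show "carrier R <= phi ` carrier R'" using pg by (simp add: p_generators_def)
qed

text \<open>Both sides are ring homomorphisms that agree on constants and variables.\<close>

lemma inc_phi: "v : carrier R' ==> inc (phi v) = v [^]\<^bsub>R'\<^esub> p"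
proof (rule hom_eqI[OF R'_cring _ R'.frob_hom])
 show "(%v. inc (phi v)) : ring_hom R' R'" using ring_hom_trans[OF phi_hom inc_hom] by (simp add: comp_def)
 interpret i: ring_hom_cring R R' inc
  by (intro ring_hom_cring.intro ring_hom_cring_axioms.intro inc_hom R.is_cring R'.is_cring)
 show "inc (phi (inc r)) = inc r [^]\<^bsub>R'\<^esub> p" if "r : carrier R" for r using that phi_inc by simp
 show "inc (phi (x' j)) = x' j [^]\<^bsub>R'\<^esub> p" if "j < n" for j using that phi_x' x'_pow by simp
qed

lemma Kp_R': "frob_image p R' = inc ` carrier R"
proof -
 have "frob_image p R' = inc ` phi ` carrier R'" using inc_phi by (force simp: frob_image_def)
 then show ?thesis by (simp add: phi_surj)
qed

lemma x'_funcset: "x' : {..<n} \<rightarrow> carrier R'" using x'_closed by auto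

lemma x'_pgens: "p_generators p R' (snd (gabber_step p T))"
 unfolding p_generators_def
proof
 show s: "set (snd (gabber_step p T)) <= carrier R'" using x'_closed by (auto simp: in_set_conv_nth x'_length)
 let ?G = "generate_ring R' (frob_image p R' \<union> set (snd (gabber_step p T)))"
 have sub: "frob_image p R' \<union> set (snd (gabber_step p T)) <= carrier R'" using s R'.Kp_carrier by auto
 note G = R'.generate_ring_is_subring[OF sub]
 have "v : ?G" if "v : carrier R'" for v
  using that
 proof (induct rule: R'_induct)
  case (const r)
  have "inc r : frob_image p R'" using const Kp_R' by auto
  then show ?case by (intro generate_ring.incl) simp
 next
  case (add a b) then show ?case using subringE(7)[OF G] by blast
 next
  case (var a j)
  have "x' j : ?G" by (intro generate_ring.incl) (use var in "auto simp: x'_length")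
  then show ?case using subringE(6)[OF G] var by blast
 qed
 then show "?G = carrier R'" using subringE(1)[OF G] by blast
qed

lemma step_gens: "gens (gabber_step p T) p"
 by (intro gens.intro gens_axioms.intro R'_charp x'_pgens)

lemma R'_noetherian:
 assumes N: "noetherian_ring R" shows "noetherian_ring R'"
proof -
 have "R'.pspan x' n = carrier R'" using R'.p_generators_iff x'_pgens x'_length by simp
 then obtain gs where gs: "set gs <= carrier R'" "R'.adjs (frob_image p R') {\<zero>\<^bsub>R'\<^esub>} gs = carrier R'"
  by (rule R'.gens_of_pspan[OF x'_funcset])
 have "noeth_cring R'"
  by (rule finite_module_noetherian[OF _ R'_cring inc_hom gs(1)]) (use gs(2) N R.is_cring in "simp_all add: Kp_R' noeth_cring.intro")
 then show ?thesis by (rule noeth_cring.axioms(2))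
qed

text \<open>The functional on polynomials that reads off, after the reduction \<open>X\<^sub>j\<^sup>p = x\<^sub>j\<close>, the
 coefficient of \<open>X\<^sup>b\<close>. It vanishes on the defining ideal, which makes the monomials independent.\<close>

definition wt :: "(nat => nat) => nat multiset => 'k runiv" where
 "wt b m = (if \<forall>j<n. count m j mod p = b j then \<Otimes>\<^bsub>R\<^esub>j\<in>{..<n}. x j [^]\<^bsub>R\<^esub> (count m j div p) else \<zero>\<^bsub>R\<^esub>)"

lemma wt_closed: "wt b m : carrier R"
 unfolding wt_def using xc by (auto intro!: R.finprod_closed)

lemma wt_shift:
 assumes j: "j < n" shows "wt b (m + replicate_mset p j) = x j \<otimes>\<^bsub>R\<^esub> wt b m"
proof -
 have cm: "(\<forall>k<n. count (m + replicate_mset p j) k mod p = b k) \<longleftrightarrow> (\<forall>k<n. count m k mod p = b k)"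
  by auto
 let ?d = "%k. if j = k then x k else \<one>\<^bsub>R\<^esub>"
 have "(\<Otimes>\<^bsub>R\<^esub>k\<in>{..<n}. x k [^]\<^bsub>R\<^esub> (count (m + replicate_mset p j) k div p))
   = (\<Otimes>\<^bsub>R\<^esub>k\<in>{..<n}. ?d k \<otimes>\<^bsub>R\<^esub> x k [^]\<^bsub>R\<^esub> (count m k div p))"
 proof (rule R.finprod_cong')
  fix k assume k: "k : {..<n}"
  show "x k [^]\<^bsub>R\<^esub> (count (m + replicate_mset p j) k div p) = ?d k \<otimes>\<^bsub>R\<^esub> x k [^]\<^bsub>R\<^esub> (count m k div p)"
   using xc(1)[of k] k R.p_pos R.nat_pow_Suc2[of "x k"] by (auto simp: div_add_self2)
 qed (use xc in auto)
 also have "\<dots> = (\<Otimes>\<^bsub>R\<^esub>k\<in>{..<n}. ?d k) \<otimes>\<^bsub>R\<^esub> (\<Otimes>\<^bsub>R\<^esub>k\<in>{..<n}. x k [^]\<^bsub>R\<^esub> (count m k div p))"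
  by (rule R.finprod_multf) (use xc in auto)
 also have "(\<Otimes>\<^bsub>R\<^esub>k\<in>{..<n}. ?d k) = x j"
  by (rule R.finprod_singleton) (use j xc in auto)
 finally have e: "(\<Otimes>\<^bsub>R\<^esub>k\<in>{..<n}. x k [^]\<^bsub>R\<^esub> (count (m + replicate_mset p j) k div p))
   = x j \<otimes>\<^bsub>R\<^esub> (\<Otimes>\<^bsub>R\<^esub>k\<in>{..<n}. x k [^]\<^bsub>R\<^esub> (count m k div p))" .
 show ?thesis
 proof (cases "\<forall>k<n. count m k mod p = b k")
  case True show ?thesis unfolding wt_def cm if_P[OF True] by (rule e)
 next
  case False show ?thesis unfolding wt_def cm if_not_P[OF False] using xc(1)[OF j] by simp
 qed
qed

lemma id_hom: "ring_hom_cring R R (%r. r)"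
 by (intro ring_hom_cring.intro ring_hom_cring_axioms.intro R.is_cring) (auto simp: ring_hom_def)

definition L :: "(nat => nat) => _ => 'k runiv" where "L b = mlin R R (%r. r) (wt b)"

lemma L_closed: "f : carrier P ==> L b f : carrier R"
 unfolding L_def P_def by (rule ring_hom_cring.mlin_closed'[OF id_hom _ wt_closed])

lemma L_add: "f : carrier P ==> g : carrier P ==> L b (f \<oplus>\<^bsub>P\<^esub> g) = L b f \<oplus>\<^bsub>R\<^esub> L b g"
 unfolding L_def P_def by (rule ring_hom_cring.mlin_add[OF id_hom _ _ wt_closed])

lemma L_scale: "f : carrier P ==> r : carrier R ==> L b (pconst r \<otimes>\<^bsub>P\<^esub> f) = r \<otimes>\<^bsub>R\<^esub> L b f"
 unfolding L_def P_def by (rule ring_hom_cring.mlin_scale[OF id_hom _ _ wt_closed])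

lemma L_zero: "L b \<zero>\<^bsub>P\<^esub> = \<zero>\<^bsub>R\<^esub>"
 using L_add[of "\<zero>\<^bsub>P\<^esub>" "\<zero>\<^bsub>P\<^esub>" b] L_closed[OF P.zero_closed, of b] by simp

lemma L_diff:
 assumes "f : carrier P" "g : carrier P" shows "L b (f \<ominus>\<^bsub>P\<^esub> g) = L b f \<ominus>\<^bsub>R\<^esub> L b g"
proof -
 have "(f \<ominus>\<^bsub>P\<^esub> g) \<oplus>\<^bsub>P\<^esub> g = f" using assms by algebra
 then have e: "L b f = L b (f \<ominus>\<^bsub>P\<^esub> g) \<oplus>\<^bsub>R\<^esub> L b g" using L_add[of "f \<ominus>\<^bsub>P\<^esub> g" g b] assms by simp
 have c: "L b (f \<ominus>\<^bsub>P\<^esub> g) : carrier R" "L b g : carrier R" using L_closed assms by simp_all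
 show ?thesis unfolding e using c by algebra
qed

lemma L_sum:
 "finite A ==> f : A \<rightarrow> carrier P ==> L b (\<Oplus>\<^bsub>P\<^esub>a\<in>A. f a) = (\<Oplus>\<^bsub>R\<^esub>a\<in>A. L b (f a))"
proof (induct A rule: finite_induct)
 case (insert a A)
 then have "f a : carrier P" "f : A \<rightarrow> carrier P" by auto
 moreover from this have "(%a. L b (f a)) : A \<rightarrow> carrier R" using L_closed funcset_mem[of f A] by auto
 ultimately show ?case using insert L_add[of "f a"] L_closed[of "f a"] by (simp add: P.finsum_insert R.finsum_insert P.finsum_closed)
qed (simp add: L_zero)

lemma L_J:
 assumes f: "f : J" shows "L b f = \<zero>\<^bsub>R\<^esub>"
proof -
 let ?H = "{f : carrier P. ALL g:carrier P. L b (f \<otimes>\<^bsub>P\<^esub> g) = \<zero>\<^bsub>R\<^esub>}"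
 have sH: "P.submod (carrier P) ?H"
  unfolding P.submod_def
 proof (intro conjI ballI)
  show "\<zero>\<^bsub>P\<^esub> : ?H" using L_zero by simp
  fix f assume f: "f : ?H"
  { fix g assume "g : ?H"
   then show "f \<oplus>\<^bsub>P\<^esub> g : ?H" using f L_add by (simp add: P.l_distr) }
  fix k assume k: "k : carrier P"
  have "L b (k \<otimes>\<^bsub>P\<^esub> f \<otimes>\<^bsub>P\<^esub> g) = \<zero>\<^bsub>R\<^esub>" if g: "g : carrier P" for g
  proof -
   have "k \<otimes>\<^bsub>P\<^esub> f \<otimes>\<^bsub>P\<^esub> g = f \<otimes>\<^bsub>P\<^esub> (k \<otimes>\<^bsub>P\<^esub> g)" using k g f by (simp add: P.m_ac)
   then show ?thesis using f k g by simp
  qed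
  then show "k \<otimes>\<^bsub>P\<^esub> f : ?H" using k f by simp
 qed auto
 have "J <= ?H"
 proof (rule J_least[OF P.ideal_submod[OF sH]])
  fix j assume j: "j < n"
  have "L b (rel j \<otimes>\<^bsub>P\<^esub> g) = \<zero>\<^bsub>R\<^esub>" if g: "g : carrier P" for g
  proof -
   note v = var_closed[OF j] and k = const_closed[OF xc(1)[OF j]]
   have vp: "pvar j [^]\<^bsub>P\<^esub> p : carrier P" using v by simp
   have "rel j \<otimes>\<^bsub>P\<^esub> g = g \<otimes>\<^bsub>P\<^esub> pvar j [^]\<^bsub>P\<^esub> p \<ominus>\<^bsub>P\<^esub> pconst (x j) \<otimes>\<^bsub>P\<^esub> g"
    unfolding rel_def using vp k g by algebra
   then have e: "L b (rel j \<otimes>\<^bsub>P\<^esub> g) = L b (g \<otimes>\<^bsub>P\<^esub> pvar j [^]\<^bsub>P\<^esub> p) \<ominus>\<^bsub>R\<^esub> x j \<otimes>\<^bsub>R\<^esub> L b g"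
    using L_diff L_scale[OF g xc(1)[OF j]] vp k g by simp
   have "L b (g \<otimes>\<^bsub>P\<^esub> pvar j [^]\<^bsub>P\<^esub> p) = mlin R R (%r. r) (%m. wt b (m + replicate_mset p j)) g"
    unfolding L_def P_def by (rule ring_hom_cring.mlin_var_pow[OF id_hom _ _ wt_closed]) (use j g P_def in auto)
   also have "\<dots> = x j \<otimes>\<^bsub>R\<^esub> L b g"
    unfolding wt_shift[OF j] L_def
    by (rule ring_hom_cring.mlin_wscale[OF id_hom _ xc(1)[OF j] wt_closed]) (use g P_def in auto)
   finally show ?thesis using e L_closed[OF g] xc(1)[OF j] by (simp add: R.minus_eq R.r_neg)
  qed
  then show "rel j : ?H" using rel_closed[OF j] by simp
 qed
 then have "L b (f \<otimes>\<^bsub>P\<^esub> \<one>\<^bsub>P\<^esub>) = \<zero>\<^bsub>R\<^esub>" using f P.one_closed by blast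
 then show ?thesis using J.Icarr[OF f] by simp
qed

lemma mlin_monom:
 assumes w: "!!m. w m : carrier R"
 shows "k <= n ==> f : carrier P ==> mlin R R (%r. r) w (f \<otimes>\<^bsub>P\<^esub> (\<Otimes>\<^bsub>P\<^esub>j\<in>{..<k}. pvar j [^]\<^bsub>P\<^esub> (b j :: nat)))
  = mlin R R (%r. r) (%m. w (m + (\<Sum>j<k. replicate_mset (b j) j))) f"
 using w
proof (induct k arbitrary: f w)
 case 0 then show ?case by simp
next
 case (Suc k)
 have kn: "k < n" using Suc by simp
 have vc: "(%j. pvar j [^]\<^bsub>P\<^esub> b j) : {..<k} \<rightarrow> carrier P" "pvar k [^]\<^bsub>P\<^esub> b k : carrier P"
  using var_closed kn by auto
 note m = P.finprod_closed[OF vc(1)]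
 have "(\<Otimes>\<^bsub>P\<^esub>j\<in>{..<Suc k}. pvar j [^]\<^bsub>P\<^esub> b j) = pvar k [^]\<^bsub>P\<^esub> b k \<otimes>\<^bsub>P\<^esub> (\<Otimes>\<^bsub>P\<^esub>j\<in>{..<k}. pvar j [^]\<^bsub>P\<^esub> b j)"
  unfolding lessThan_Suc by (rule P.finprod_insert) (use vc in auto)
 then have "f \<otimes>\<^bsub>P\<^esub> (\<Otimes>\<^bsub>P\<^esub>j\<in>{..<Suc k}. pvar j [^]\<^bsub>P\<^esub> b j)
   = (f \<otimes>\<^bsub>P\<^esub> pvar k [^]\<^bsub>P\<^esub> b k) \<otimes>\<^bsub>P\<^esub> (\<Otimes>\<^bsub>P\<^esub>j\<in>{..<k}. pvar j [^]\<^bsub>P\<^esub> b j)"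
  using Suc(3) vc(2) m by (simp add: P.m_assoc)
 then have "mlin R R (%r. r) w (f \<otimes>\<^bsub>P\<^esub> (\<Otimes>\<^bsub>P\<^esub>j\<in>{..<Suc k}. pvar j [^]\<^bsub>P\<^esub> b j))
  = mlin R R (%r. r) (%m. w (m + (\<Sum>j<k. replicate_mset (b j) j))) (f \<otimes>\<^bsub>P\<^esub> pvar k [^]\<^bsub>P\<^esub> b k)"
  using Suc(1)[of "f \<otimes>\<^bsub>P\<^esub> pvar k [^]\<^bsub>P\<^esub> b k" w] kn Suc(3,4) vc(2) by simp
 also have "\<dots> = mlin R R (%r. r) (%m. w (m + replicate_mset (b k) k + (\<Sum>j<k. replicate_mset (b j) j))) f"
  unfolding P_def by (rule ring_hom_cring.mlin_var_pow[OF id_hom]) (use kn Suc P_def in auto)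
 also have "\<dots> = mlin R R (%r. r) (%m. w (m + (\<Sum>j<Suc k. replicate_mset (b j) j))) f"
  by (simp add: ac_simps)
 finally show ?case .
qed

lemma L_monom:
 assumes b: "b : R.E n" "b' : R.E n"
 shows "L b' (\<Otimes>\<^bsub>P\<^esub>j\<in>{..<n}. pvar j [^]\<^bsub>P\<^esub> b j) = (if b = b' then \<one>\<^bsub>R\<^esub> else \<zero>\<^bsub>R\<^esub>)"
proof -
 let ?M = "\<Sum>j<n. replicate_mset (b j) j"
 have vc: "(%j. pvar j [^]\<^bsub>P\<^esub> b j) : {..<n} \<rightarrow> carrier P" using var_closed by auto
 note m = P.finprod_closed[OF vc]
 have one: "\<one>\<^bsub>P\<^esub> = pconst \<one>\<^bsub>R\<^esub>" by (simp add: P_def R.mpoly_simps)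
 have "L b' (\<Otimes>\<^bsub>P\<^esub>j\<in>{..<n}. pvar j [^]\<^bsub>P\<^esub> b j) = mlin R R (%r. r) (%m. wt b' (m + ?M)) (pconst \<one>\<^bsub>R\<^esub>)"
  using mlin_monom[of "wt b'" n "\<one>\<^bsub>P\<^esub>" b, OF wt_closed order_refl P.one_closed] m unfolding L_def by (simp add: one[symmetric])
 also have "\<dots> = \<one>\<^bsub>R\<^esub> \<otimes>\<^bsub>R\<^esub> wt b' ({#} + ?M)"
  by (rule ring_hom_cring.mlin_const[OF id_hom]) (use wt_closed in auto)
 also have "\<dots> = wt b' ?M" using wt_closed by simp
 also have "\<dots> = (if b = b' then \<one>\<^bsub>R\<^esub> else \<zero>\<^bsub>R\<^esub>)"
 proof -
  have cM: "count ?M k = b k" if "k < n" for k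
  proof -
   have "count ?M k = (\<Sum>j<n. if j = k then b j else 0)" by (auto simp: count_sum intro!: sum.cong)
   also have "\<dots> = b k" using that by simp
   finally show ?thesis .
  qed
  have lt: "b k < p" if "k < n" for k using R.E_le[OF b(1) that] .
  have "(\<forall>k<n. b k = b' k) \<longleftrightarrow> b = b'"
   using b PiE_ext[of b "{..<n}" "%_. {..<p}" b'] unfolding R.E_def by auto
  then have "(\<forall>k<n. count ?M k mod p = b' k) \<longleftrightarrow> b = b'" using cM lt by simp
  moreover have "(\<Otimes>\<^bsub>R\<^esub>j\<in>{..<n}. x j [^]\<^bsub>R\<^esub> (count ?M j div p)) = \<one>\<^bsub>R\<^esub>"
   by (rule R.finprod_one_eqI) (use cM lt in auto)
  ultimately show ?thesis unfolding wt_def by (simp only:)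
 qed
 finally show ?thesis .
qed

lemma R'_indep:
 assumes c: "c : R.E n \<rightarrow> carrier R'" and z: "R'.pcomb x' n c = \<zero>\<^bsub>R'\<^esub>" and b': "b' : R.E n"
 shows "phi (c b') = \<zero>\<^bsub>R\<^esub>"
proof -
 interpret cls: ring_hom_cring P R' cls
  by (intro ring_hom_cring.intro ring_hom_cring_axioms.intro cls_hom P.is_cring R'.is_cring)
 let ?M = "%b. \<Otimes>\<^bsub>P\<^esub>j\<in>{..<n}. pvar j [^]\<^bsub>P\<^esub> (b j :: nat)"
 have Mc: "?M b : carrier P" for b by (rule P.finprod_closed) (use var_closed in auto)
 have r: "phi (c b) : carrier R" if "b : R.E n" for b using ring_hom_closed[OF phi_hom] funcset_mem[OF c that] by simp
 let ?t = "%b. pconst (phi (c b)) \<otimes>\<^bsub>P\<^esub> ?M b"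
 have tc: "?t : R.E n \<rightarrow> carrier P" using const_closed[OF r] Mc by auto
 let ?f = "\<Oplus>\<^bsub>P\<^esub>b\<in>R.E n. ?t b"
 have clsM: "cls (?M b) = R'.mon x' n b" for b
 proof -
  have "cls (?M b) = (\<Otimes>\<^bsub>R'\<^esub>j\<in>{..<n}. (cls \<circ> (%j. pvar j [^]\<^bsub>P\<^esub> b j)) j)"
   by (subst cls.hom_finprod) (use var_closed in "auto simp: comp_def")
  also have "\<dots> = R'.mon x' n b" unfolding R'.mon_def
   by (rule R'.finprod_cong') (use var_closed x'_cls x'_closed in auto)
  finally show ?thesis .
 qed
 have "cls ?f = (\<Oplus>\<^bsub>R'\<^esub>b\<in>R.E n. (cls \<circ> ?t) b)"
  by (subst cls.hom_finsum[OF tc]) (simp add: comp_def)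
 also have "\<dots> = R'.pcomb x' n c" unfolding R'.pcomb_def
 proof (rule R'.finsum_cong')
  fix b assume b: "b : R.E n"
  show "(cls \<circ> ?t) b = c b [^]\<^bsub>R'\<^esub> p \<otimes>\<^bsub>R'\<^esub> R'.mon x' n b"
   using const_closed[OF r[OF b]] Mc clsM inc_phi[OF funcset_mem[OF c b]] by simp
 qed (use R'.pcomb_term_closed[OF x'_funcset c] in auto)
 finally have "?f : J" using z cls_kernel[OF P.finsum_closed[OF tc]] by simp
 then have "\<zero>\<^bsub>R\<^esub> = L b' ?f" using L_J by simp
 also have "\<dots> = (\<Oplus>\<^bsub>R\<^esub>b\<in>R.E n. L b' (?t b))" by (rule L_sum[OF R.finite_E tc])
 also have "\<dots> = (\<Oplus>\<^bsub>R\<^esub>b\<in>R.E n. if b' = b then phi (c b) else \<zero>\<^bsub>R\<^esub>)"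
  by (rule R.finsum_cong') (use L_scale[OF Mc r] L_monom[OF _ b'] r in auto)
 also have "\<dots> = phi (c b')" by (rule R.add.finprod_singleton[OF b' R.finite_E]) (use r in auto)
 finally show ?thesis by simp
qed

lemma R'_span: "v : carrier R' ==> EX c:R.E n \<rightarrow> carrier R'. v = R'.pcomb x' n c"
 using R'.p_generators_iff x'_pgens x'_length unfolding R'.pspan_def by auto

end

section \<open>The limit of a tower\<close>

lemma adjs_hom_image:
 assumes A: "cring A" and B: "cring B" and h: "h : ring_hom A B" and s: "h ` carrier A = carrier B"
 shows "set us <= carrier A ==> U <= carrier A ==>
  h ` cring.adjs A (carrier A) U us = cring.adjs B (carrier B) (h ` U) (map h us)"
proof -
 interpret A: cring A by (rule A)
 interpret B: cring B by (rule B)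
 show "set us <= carrier A ==> U <= carrier A ==>
  h ` cring.adjs A (carrier A) U us = cring.adjs B (carrier B) (h ` U) (map h us)"
 proof (induct us arbitrary: U)
  case (Cons u us)
  have uc: "u : carrier A" using Cons by simp
  have hu: "h (v \<oplus>\<^bsub>A\<^esub> k \<otimes>\<^bsub>A\<^esub> u) = h v \<oplus>\<^bsub>B\<^esub> h k \<otimes>\<^bsub>B\<^esub> h u" if "v : carrier A" "k : carrier A" for v k
   using that uc ring_hom_add[OF h] ring_hom_mult[OF h] by simp
  have "h ` A.adj (carrier A) U u = B.adj (carrier B) (h ` U) (h u)"
  proof
   show "h ` A.adj (carrier A) U u <= B.adj (carrier B) (h ` U) (h u)"
   proof (rule image_subsetI)
    fix w assume "w : A.adj (carrier A) U u"
    then obtain v k where "v : U" "k : carrier A" "w = v \<oplus>\<^bsub>A\<^esub> k \<otimes>\<^bsub>A\<^esub> u" by (rule A.adjE)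
    then show "h w : B.adj (carrier B) (h ` U) (h u)"
     using hu Cons(3) B.adjI[of "h v" "h ` U" "h k" "carrier B" "h u"] ring_hom_closed[OF h] by auto
   qed
   show "B.adj (carrier B) (h ` U) (h u) <= h ` A.adj (carrier A) U u"
   proof
    fix w assume "w : B.adj (carrier B) (h ` U) (h u)"
    then obtain v' k' where v': "v' : h ` U" "k' : carrier B" "w = v' \<oplus>\<^bsub>B\<^esub> k' \<otimes>\<^bsub>B\<^esub> h u" by (rule B.adjE)
    have "k' : h ` carrier A" using v'(2) s by simp
    then obtain v k where vk: "v : U" "v' = h v" "k : carrier A" "k' = h k" using v'(1) by blast
    have "w = h (v \<oplus>\<^bsub>A\<^esub> k \<otimes>\<^bsub>A\<^esub> u)" using v'(3) vk hu Cons(3) by auto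
    then show "w : h ` A.adj (carrier A) U u" using A.adjI[OF vk(1,3)] by blast
   qed
  qed
  moreover have "A.adj (carrier A) U u <= carrier A"
  proof
   fix w assume "w : A.adj (carrier A) U u"
   then obtain v k where "v : U" "k : carrier A" "w = v \<oplus>\<^bsub>A\<^esub> k \<otimes>\<^bsub>A\<^esub> u" by (rule A.adjE)
   then show "w : carrier A" using Cons(3) uc by auto
  qed
  ultimately show ?case using Cons by simp
 qed simp
qed

lemma (in cring) adjs_split:
 assumes U: "submod (carrier R) U"
 shows "set us <= carrier R ==> w : adjs (carrier R) U us ==> EX u:U. EX v:adjs (carrier R) {\<zero>} us. w = u \<oplus> v"
proof (induct us arbitrary: w rule: rev_induct)
 case Nil then show ?case using submodD(5)[OF U] by auto
next
 case (snoc u us)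
 let ?A = "adjs (carrier R) {\<zero>} us"
 have uc: "u : carrier R" "set us <= carrier R" using snoc(2) by auto
 have Ac: "?A <= carrier R" by (rule submodD(1)[OF submod_adjs[OF carrier_is_subring zero_submod[OF subset_refl] uc(2)]])
 have "w : adj (carrier R) (adjs (carrier R) U us) u" using snoc(3) by (simp add: adjs_append)
 then obtain w' k where w': "w' : adjs (carrier R) U us" "k : carrier R" "w = w' \<oplus> k \<otimes> u" by (rule adjE)
 obtain a v where av: "a : U" "v : ?A" "w' = a \<oplus> v" using snoc(1)[OF uc(2) w'(1)] by auto
 have "w = a \<oplus> (v \<oplus> k \<otimes> u)" unfolding w'(3) av(3) using submodD(5)[OF U av(1)] av(2) Ac uc w'(2) by (simp add: a_assoc subsetD)
 moreover have "v \<oplus> k \<otimes> u : adjs (carrier R) {\<zero>} (us @ [u])" using adjI[OF av(2) w'(2)] by (simp add: adjs_append)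
 ultimately show ?case using av(1) by blast
qed

text \<open>A tower of rings of characteristic \<open>p\<close> in which Frobenius factors as \<open>phi\<close> followed by \<open>inc\<close>,
 together with a limit cone \<open>pr\<close> over the maps \<open>phi\<close>.\<close>

locale tower_limit = G: cring G for G :: "('g, 'r) ring_scheme" (structure) +
 fixes A :: "nat => ('a, 's) ring_scheme" and xs :: "nat => nat => 'a" and n p :: nat
  and inc phi :: "nat => 'a => 'a" and pr :: "nat => 'g => 'a" and y :: "nat => 'g"
 assumes A_charp: "charp (A i) p"
  and xs_closed: "j < n ==> xs i j : carrier (A i)"
  and inc_hom: "inc i : ring_hom (A i) (A (Suc i))"
  and phi_hom: "phi i : ring_hom (A (Suc i)) (A i)"
  and phi_xs: "j < n ==> phi i (xs (Suc i) j) = xs i j"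
  and phi_surj: "phi i ` carrier (A (Suc i)) = carrier (A i)"
  and inc_phi: "v : carrier (A (Suc i)) ==> inc i (phi i v) = v [^]\<^bsub>A (Suc i)\<^esub> p"
  and A_span: "v : carrier (A (Suc i)) ==> EX c:charp.E p n \<rightarrow> carrier (A (Suc i)). v = charp.pcomb (A (Suc i)) p (xs (Suc i)) n c"
  and A_indep: "[|c : charp.E p n \<rightarrow> carrier (A (Suc i)); charp.pcomb (A (Suc i)) p (xs (Suc i)) n c = \<zero>\<^bsub>A (Suc i)\<^esub>; b : charp.E p n|]
   ==> phi i (c b) = \<zero>\<^bsub>A i\<^esub>"
  and pr_hom: "pr i : ring_hom G (A i)"
  and phi_pr: "s : carrier G ==> phi i (pr (Suc i) s) = pr i s"
  and pr_joint_inj: "s : carrier G ==> t : carrier G ==> (!!i. pr i s = pr i t) ==> s = t"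
  and pr_joint_surj: "(!!i. a i : carrier (A i)) ==> (!!i. phi i (a (Suc i)) = a i) ==> EX s:carrier G. ALL i. pr i s = a i"
  and y_closed: "j < n ==> y j : carrier G"
  and pr_y: "j < n ==> pr i (y j) = xs i j"
begin

lemma A_cring: "cring (A i)" using A_charp by (rule charp.axioms)

lemma xs_funcset: "xs i : {..<n} \<rightarrow> carrier (A i)" using xs_closed by auto

lemma y_funcset: "y : {..<n} \<rightarrow> carrier G" using y_closed by auto

lemma pr_cring: "ring_hom_cring G (A i) (pr i)"
 by (intro ring_hom_cring.intro ring_hom_cring_axioms.intro G.is_cring A_cring pr_hom)

lemma phi_cring: "ring_hom_cring (A (Suc i)) (A i) (phi i)"
 by (intro ring_hom_cring.intro ring_hom_cring_axioms.intro A_cring phi_hom)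

lemma inc_cring: "ring_hom_cring (A i) (A (Suc i)) (inc i)"
 by (intro ring_hom_cring.intro ring_hom_cring_axioms.intro A_cring inc_hom)

lemma pr_closed: "s : carrier G ==> pr i s : carrier (A i)" by (rule ring_hom_closed[OF pr_hom])

lemma phi_closed: "v : carrier (A (Suc i)) ==> phi i v : carrier (A i)" by (rule ring_hom_closed[OF phi_hom])

lemma p_prime: "Factorial_Ring.prime p" using charp.prime_p[OF A_charp] .

lemma G_charp: "charp G p"
proof (intro charp.intro G.is_cring charp_axioms.intro p_prime)
 show "[p] \<cdot> \<one> = \<zero>"
 proof (rule pr_joint_inj)
  fix i
  interpret pr: ring_hom_cring G "A i" "pr i" by (rule pr_cring)
  have "pr i ([k] \<cdot> \<one>) = [k] \<cdot>\<^bsub>A i\<^esub> \<one>\<^bsub>A i\<^esub>" for k :: nat by (induct k) auto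
  then show "pr i ([p] \<cdot> \<one>) = pr i \<zero>" using charp.char_p[OF A_charp] by simp
 qed auto
qed

sublocale G: charp G p by (rule G_charp)

lemma pr_pcomb:
 assumes "c : G.E n \<rightarrow> carrier G"
 shows "pr i (G.pcomb y n c) = charp.pcomb (A i) p (xs i) n (%b. pr i (c b))"
 by (rule hom_pcomb[OF G_charp A_charp pr_hom y_funcset assms]) (rule pr_y)

lemma frob_zero_iff:
 assumes v: "v : carrier (A (Suc i))" and z: "phi i v = \<zero>\<^bsub>A i\<^esub>"
 shows "v [^]\<^bsub>A (Suc i)\<^esub> p = \<zero>\<^bsub>A (Suc i)\<^esub>"
 using inc_phi[OF v] z ring_hom_cring.hom_zero[OF inc_cring] by simp

lemma pcomb_phi_zero:
 assumes c: "c : G.E n \<rightarrow> carrier (A (Suc i))" and z: "!!b. b : G.E n ==> phi i (c b) = \<zero>\<^bsub>A i\<^esub>"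
 shows "charp.pcomb (A (Suc i)) p (xs (Suc i)) n c = \<zero>\<^bsub>A (Suc i)\<^esub>"
proof -
 interpret B: charp "A (Suc i)" p by (rule A_charp)
 show ?thesis unfolding B.pcomb_def
  by (rule B.add.finprod_one_eqI) (use frob_zero_iff[OF funcset_mem[OF c] z] B.mon_closed[OF xs_funcset] in auto)
qed

text \<open>An element of \<open>A k\<close> is lifted step by step to the higher levels, and mapped down to the lower ones.\<close>

lemma pr_surj:
 assumes a: "a : carrier (A k)"
 shows "EX s:carrier G. pr k s = a"
proof -
 have "EX f. ALL m. (f m : carrier (A (k + m)) & (m = 0 --> f m = a)) & phi (k + m) (f (Suc m)) = f m"
 proof (rule dependent_nat_choice)
  show "EX v. v : carrier (A (k + 0)) & ((0::nat) = 0 --> v = a)" using a by auto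
  fix v m assume "v : carrier (A (k + m)) & (m = 0 --> v = a)"
  then have "v : phi (k + m) ` carrier (A (Suc (k + m)))" using phi_surj by simp
  then show "EX w. (w : carrier (A (k + Suc m)) & (Suc m = 0 --> w = a)) & phi (k + m) w = v" by auto
 qed
 then obtain f where f: "!!m. f m : carrier (A (k + m))" "f 0 = a" "!!m. phi (k + m) (f (Suc m)) = f m" by blast
 define g where "g = rec_nat a (%d w. phi (k - Suc d) w)"
 have g0: "g 0 = a" and gS: "g (Suc d) = phi (k - Suc d) (g d)" for d by (simp_all add: g_def)
 have gc: "d <= k ==> g d : carrier (A (k - d))" for d
 proof (induct d)
  case (Suc d)
  then have "k - d = Suc (k - Suc d)" by simp
  then show ?case using Suc phi_closed[of "g d" "k - Suc d"] gS by simp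
 qed (use a g0 in simp)
 define h where "h i = (if i < k then g (k - i) else f (i - k))" for i
 have "EX s:carrier G. ALL i. pr i s = h i"
 proof (rule pr_joint_surj)
  fix i
  show "h i : carrier (A i)" using gc[of "k - i"] f(1)[of "i - k"] by (cases "i < k") (auto simp: h_def)
  show "phi i (h (Suc i)) = h i"
  proof (cases "i < k")
   case True
   have e: "h (Suc i) = g (k - Suc i)"
   proof (cases "Suc i < k")
    case False
    then have "Suc i = k" using True by simp
    then show ?thesis using f(2) g0 by (simp add: h_def)
   qed (simp add: h_def)
   have "k - i = Suc (k - Suc i)" "k - Suc (k - Suc i) = i" using True by simp_all
   then have "g (k - i) = phi i (g (k - Suc i))" using gS by simp
   then show ?thesis using e True by (simp add: h_def)
  next
   case False
   then show ?thesis using f(3)[of "i - k"] by (simp add: h_def Suc_diff_le)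
  qed
 qed
 moreover have "h k = a" using f(2) by (simp add: h_def)
 ultimately show ?thesis by metis
qed

text \<open>Coordinates at level \<open>i + 1\<close> are determined after applying \<open>phi\<close>; hence the coordinates of a
 compatible sequence are again compatible sequences.\<close>

lemma G_pbasis: "pbasis G p y n"
proof (intro pbasis.intro G_charp pbasis_axioms.intro y_funcset)
 have "s : G.pspan y n" if s: "s : carrier G" for s
 proof -
  have "ALL i. EX c. c : G.E n \<rightarrow> carrier (A (Suc i)) & pr (Suc i) s = charp.pcomb (A (Suc i)) p (xs (Suc i)) n c"
   using A_span[OF pr_closed[OF s]] by blast
  then obtain c where c: "!!i. c i : G.E n \<rightarrow> carrier (A (Suc i))"
   "!!i. pr (Suc i) s = charp.pcomb (A (Suc i)) p (xs (Suc i)) n (c i)" by metis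
  define d where "d i b = phi i (c i b)" for i b
  have dc: "d i b : carrier (A i)" if "b : G.E n" for i b using phi_closed[OF funcset_mem[OF c(1) that]] by (simp add: d_def)
  have dF: "d i : G.E n \<rightarrow> carrier (A i)" for i using dc by auto
  have e: "pr i s = charp.pcomb (A i) p (xs i) n (d i)" for i
  proof -
   have "phi i (pr (Suc i) s) = charp.pcomb (A i) p (xs i) n (%b. phi i (c i b))"
    unfolding c(2) by (rule hom_pcomb[OF A_charp A_charp phi_hom xs_funcset c(1)]) (rule phi_xs)
   moreover have "d i = (%b. phi i (c i b))" by (simp add: d_def fun_eq_iff)
   ultimately show ?thesis using phi_pr[OF s] by simp
  qed
  have dphi: "phi i (d (Suc i) b) = d i b" if b: "b : G.E n" for i b
  proof -
   interpret B: charp "A (Suc i)" p by (rule A_charp)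
   interpret Ai: cring "A i" by (rule A_cring)
   interpret phi: ring_hom_cring "A (Suc i)" "A i" "phi i" by (rule phi_cring)
   let ?e = "%b. \<ominus>\<^bsub>A (Suc i)\<^esub> \<one>\<^bsub>A (Suc i)\<^esub> \<otimes>\<^bsub>A (Suc i)\<^esub> c i b"
   have ec: "?e : G.E n \<rightarrow> carrier (A (Suc i))" using funcset_mem[OF c(1)] by auto
   have m1: "(\<ominus>\<^bsub>A (Suc i)\<^esub> \<one>\<^bsub>A (Suc i)\<^esub>) [^]\<^bsub>A (Suc i)\<^esub> p = \<ominus>\<^bsub>A (Suc i)\<^esub> \<one>\<^bsub>A (Suc i)\<^esub>" by (simp add: B.frob_neg)
   have "B.pcomb (xs (Suc i)) n (%b. d (Suc i) b \<oplus>\<^bsub>A (Suc i)\<^esub> ?e b) = B.pcomb (xs (Suc i)) n (d (Suc i)) \<oplus>\<^bsub>A (Suc i)\<^esub> B.pcomb (xs (Suc i)) n ?e"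
    by (rule B.pcomb_add[OF xs_funcset dF ec])
   also have "B.pcomb (xs (Suc i)) n ?e = \<ominus>\<^bsub>A (Suc i)\<^esub> \<one>\<^bsub>A (Suc i)\<^esub> \<otimes>\<^bsub>A (Suc i)\<^esub> B.pcomb (xs (Suc i)) n (c i)"
    using B.pcomb_smult[OF xs_funcset c(1)[of i], of "\<ominus>\<^bsub>A (Suc i)\<^esub> \<one>\<^bsub>A (Suc i)\<^esub>"] m1 by simp
   also have "B.pcomb (xs (Suc i)) n (d (Suc i)) \<oplus>\<^bsub>A (Suc i)\<^esub> \<dots> = \<zero>\<^bsub>A (Suc i)\<^esub>"
    unfolding e[symmetric] c(2)[symmetric] using pr_closed[OF s, of "Suc i"] by (simp add: B.l_minus B.r_neg)
   finally have z: "B.pcomb (xs (Suc i)) n (%b. d (Suc i) b \<oplus>\<^bsub>A (Suc i)\<^esub> ?e b) = \<zero>\<^bsub>A (Suc i)\<^esub>" .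
   have F: "(%b. d (Suc i) b \<oplus>\<^bsub>A (Suc i)\<^esub> ?e b) : G.E n \<rightarrow> carrier (A (Suc i))" using dc funcset_mem[OF ec] by auto
   have "phi i (d (Suc i) b \<oplus>\<^bsub>A (Suc i)\<^esub> ?e b) = \<zero>\<^bsub>A i\<^esub>" by (rule A_indep[OF F z b])
   then have "phi i (d (Suc i) b) \<oplus>\<^bsub>A i\<^esub> \<ominus>\<^bsub>A i\<^esub> (d i b) = \<zero>\<^bsub>A i\<^esub>"
    using dc[OF b, of "Suc i"] funcset_mem[OF c(1) b, of i] dc[OF b, of i]
    by (simp add: d_def B.l_minus)
   then have "phi i (d (Suc i) b) \<ominus>\<^bsub>A i\<^esub> d i b = \<zero>\<^bsub>A i\<^esub>" unfolding Ai.minus_eq .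
   then show ?thesis using Ai.r_right_minus_eq[OF phi_closed[OF dc[OF b]] dc[OF b]] by simp
  qed
  have "ALL b. EX t. b : G.E n --> t : carrier G & (ALL i. pr i t = d i b)"
  proof
   fix b
   show "EX t. b : G.E n --> t : carrier G & (ALL i. pr i t = d i b)"
   proof (cases "b : G.E n")
    case True
    show ?thesis using pr_joint_surj[of "%i. d i b", OF dc[OF True] dphi[OF True]] by blast
   qed simp
  qed
  then obtain t where t: "!!b. b : G.E n ==> t b : carrier G" "!!b i. b : G.E n ==> pr i (t b) = d i b" by metis
  have tF: "t : G.E n \<rightarrow> carrier G" using t(1) by auto
  have "s = G.pcomb y n t"
  proof (rule pr_joint_inj[OF s G.pcomb_closed[OF y_funcset tF]])
   fix i
   have "charp.pcomb (A i) p (xs i) n (%b. pr i (t b)) = charp.pcomb (A i) p (xs i) n (d i)"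
    by (rule charp.pcomb_cong[OF A_charp xs_funcset dF t(2)])
   then show "pr i s = pr i (G.pcomb y n t)" unfolding pr_pcomb[OF tF] e by simp
  qed
  then show ?thesis unfolding G.pspan_def using tF by blast
 qed
 moreover have "G.pspan y n <= carrier G" unfolding G.pspan_def using G.pcomb_closed[OF y_funcset] by blast
 ultimately show "G.pspan y n = carrier G" by blast
 show "G.pindep y n" unfolding G.pindep_def
 proof (intro ballI impI)
  fix c b assume c: "c : G.E n \<rightarrow> carrier G" and z: "G.pcomb y n c = \<zero>" and b: "b : G.E n"
  show "c b = \<zero>"
  proof (rule pr_joint_inj[OF funcset_mem[OF c b] G.zero_closed])
   fix i
   have zi: "charp.pcomb (A (Suc i)) p (xs (Suc i)) n (%b. pr (Suc i) (c b)) = \<zero>\<^bsub>A (Suc i)\<^esub>"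
    using pr_pcomb[OF c] z ring_hom_cring.hom_zero[OF pr_cring] by metis
   have "phi i (pr (Suc i) (c b)) = \<zero>\<^bsub>A i\<^esub>"
    by (rule A_indep[OF _ zi b]) (use pr_closed funcset_mem[OF c] in auto)
   then show "pr i (c b) = pr i \<zero>"
    using phi_pr[OF funcset_mem[OF c b]] ring_hom_cring.hom_zero[OF pr_cring] by metis
  qed
 qed
qed

sublocale G: pbasis G p y n by (rule G_pbasis)

definition V :: "nat => 'g set" where "V i = {s : carrier G. pr i s = \<zero>\<^bsub>A i\<^esub>}"

lemma V_ideal: "ideal (V i) G"
proof -
 have "V i = a_kernel G (A i) (pr i)" unfolding V_def a_kernel_def' ..
 moreover have "ring_hom_ring G (A i) (pr i)"
  by (rule ring_hom_ringI2[OF G.ring_axioms _ pr_hom]) (rule cring.axioms(1)[OF A_cring])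
 ultimately show ?thesis using ring_hom_ring.kernel_is_ideal by simp
qed

lemma pr_diff: "s : carrier G ==> t : carrier G ==> s \<ominus> t : V i \<longleftrightarrow> pr i s = pr i t"
proof -
 assume st: "s : carrier G" "t : carrier G"
 interpret pr: ring_hom_cring G "A i" "pr i" by (rule pr_cring)
 have "pr i (s \<ominus> t) = pr i s \<ominus>\<^bsub>A i\<^esub> pr i t" using st by (simp add: G.minus_eq pr.S.minus_eq)
 then show ?thesis using st by (simp add: V_def)
qed

sublocale F: complete_filtered G V
proof (intro complete_filtered.intro complete_filtered_axioms.intro G.is_cring)
 show "ideal (V i) G" for i by (rule V_ideal)
 fix S assume S: "!!i. S i : carrier G" "!!i. S (Suc i) \<ominus> S i : V i"
 have "EX s:carrier G. ALL i. pr i s = pr i (S i)"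
 proof (rule pr_joint_surj)
  show "pr i (S i) : carrier (A i)" for i by (rule pr_closed[OF S(1)])
  show "phi i (pr (Suc i) (S (Suc i))) = pr i (S i)" for i
   using phi_pr[OF S(1)] S(2) pr_diff[OF S(1) S(1)] by metis
 qed
 then obtain s where s: "s : carrier G" "!!i. pr i s = pr i (S i)" by blast
 then have "ALL i. s \<ominus> S i : V i" using pr_diff S(1) by simp
 then show "EX s:carrier G. ALL i. s \<ominus> S i : V i" using s(1) by blast
next
 fix a assume a: "a : carrier G" "!!i. a : V i"
 show "a = \<zero>"
  by (rule pr_joint_inj[OF a(1) G.zero_closed]) (use a ring_hom_cring.hom_zero[OF pr_cring] in "simp add: V_def")
qed

lemma V_cf:
 assumes g: "g : V (Suc i)" and b: "b : G.E n" shows "G.cf g b : V i"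
proof -
 have gc: "g : carrier G" "pr (Suc i) g = \<zero>\<^bsub>A (Suc i)\<^esub>" using g by (auto simp: V_def)
 note c = G.cf_spec[OF gc(1)]
 have "charp.pcomb (A (Suc i)) p (xs (Suc i)) n (%b. pr (Suc i) (G.cf g b)) = \<zero>\<^bsub>A (Suc i)\<^esub>"
  using pr_pcomb[OF conjunct1[OF c], of "Suc i"] c gc(2) by simp
 then have "phi i (pr (Suc i) (G.cf g b)) = \<zero>\<^bsub>A i\<^esub>"
  by (intro A_indep[OF _ _ b]) (use pr_closed G.cf_closed[OF gc(1)] in auto)
 then show ?thesis using phi_pr[OF G.cf_closed[OF gc(1) b]] G.cf_closed[OF gc(1) b] by (simp add: V_def)
qed

lemma V_frob:
 assumes g: "g : V i" shows "g [^] p : V (Suc i)"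
proof -
 interpret pr: ring_hom_cring G "A (Suc i)" "pr (Suc i)" by (rule pr_cring)
 have gc: "g : carrier G" "pr i g = \<zero>\<^bsub>A i\<^esub>" using g by (auto simp: V_def)
 have "pr (Suc i) g [^]\<^bsub>A (Suc i)\<^esub> p = \<zero>\<^bsub>A (Suc i)\<^esub>"
  using frob_zero_iff[OF pr_closed[OF gc(1)]] phi_pr[OF gc(1)] gc(2) by simp
 then show ?thesis using gc by (simp add: V_def)
qed

lemma V_pow: "g : V 0 ==> g [^] (p ^ i) : V i"
proof (induct i)
 case 0 then show ?case by (simp add: V_def)
next
 case (Suc i)
 have "g : carrier G" using Suc by (simp add: V_def)
 then have "g [^] (p ^ Suc i) = (g [^] (p ^ i)) [^] p" by (simp add: G.nat_pow_pow mult.commute)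
 then show ?case using V_frob[OF Suc(1)[OF Suc(2)]] by simp
qed

definition powers :: "'g list => nat => 'g list" where "powers fs N = map (%f. f [^] (p ^ N)) fs"

text \<open>By \<open>V_cf\<close> the coordinates of an element of \<open>V (N + 1)\<close> lie in \<open>V N\<close>; the inductive description of
 these, raised to the \<open>p\<close>-th power, describes the element.\<close>

lemma V_step:
 assumes fs: "set fs <= carrier G" and base: "V 0 <= G.adjs (carrier G) (V (Suc 0)) fs"
 shows "V N <= G.adjs (carrier G) (V (Suc N)) (powers fs N)"
proof (induct N)
 case 0
 have "powers fs 0 = fs" using fs unfolding powers_def by (induct fs) auto
 then show ?case using base by simp
next
 case (Suc N)
 let ?H = "%N. G.adjs (carrier G) (V (Suc N)) (powers fs N)"
 have pc: "set (powers fs N) <= carrier G" for N using fs by (auto simp: powers_def)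
 note sV = G.submod_ideal[OF V_ideal subset_refl]
 have sH: "G.submod (carrier G) (?H N)" for N by (rule G.submod_adjs[OF G.carrier_is_subring sV pc])
 note Hm = G.submodD[OF sH]
 have up: "V (Suc N) <= ?H N" "set (powers fs N) <= ?H N" for N
  using G.adjs_upper[OF G.carrier_is_subring sV pc] G.adjs_mem[OF G.carrier_is_subring sV pc] by auto
 have "?H N <= {u : carrier G. u [^] p : ?H (Suc N)}"
 proof (rule G.adjs_least)
  show "G.submod (carrier G) {u : carrier G. u [^] p : ?H (Suc N)}"
   unfolding G.submod_def
  proof (intro conjI ballI)
   show "\<zero> : {u : carrier G. u [^] p : ?H (Suc N)}" using Hm(2) by (simp add: G.frob_zero)
   fix u assume u: "u : {u : carrier G. u [^] p : ?H (Suc N)}"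
   show "u \<oplus> v : {u : carrier G. u [^] p : ?H (Suc N)}" if "v : {u : carrier G. u [^] p : ?H (Suc N)}" for v
    using u that Hm(3) by (simp add: G.frob_add)
   show "k \<otimes> u : {u : carrier G. u [^] p : ?H (Suc N)}" if "k : carrier G" for k
    using u that Hm(4) by (simp add: G.frob_mult)
  qed auto
  show "V (Suc N) <= {u : carrier G. u [^] p : ?H (Suc N)}"
   using V_frob up(1)[of "Suc N"] by (auto simp: V_def)
  show "set (powers fs N) <= {u : carrier G. u [^] p : ?H (Suc N)}"
  proof
   fix u assume "u : set (powers fs N)"
   then obtain f where f: "f : set fs" "u = f [^] (p ^ N)" by (auto simp: powers_def)
   have fc: "f : carrier G" using f fs by auto
   have "u [^] p = f [^] (p ^ Suc N)" using fc f by (simp add: G.nat_pow_pow mult.commute)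
   moreover have "f [^] (p ^ Suc N) : set (powers fs (Suc N))" using f(1) unfolding powers_def by auto
   ultimately show "u : {u : carrier G. u [^] p : ?H (Suc N)}" using up(2)[of "Suc N"] fc f(2) by auto
  qed
 qed
 then have frob: "u [^] p : ?H (Suc N)" if "u : ?H N" for u using that by blast
 show ?case
 proof
  fix g assume g: "g : V (Suc N)"
  have gc: "g : carrier G" using g by (simp add: V_def)
  show "g : ?H (Suc N)"
  proof (rule G.cf_in_submod[OF Hm(1,2,3) gc])
   fix b assume b: "b : G.E n"
   have "G.cf g b [^] p : ?H (Suc N)" using frob Suc V_cf[OF g b] by blast
   then have "G.mon y n b \<otimes> G.cf g b [^] p : ?H (Suc N)" by (rule Hm(4)[OF G.mon_closed[OF y_funcset]])
   then show "G.cf g b [^] p \<otimes> G.mon y n b : ?H (Suc N)"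
    using G.m_comm[OF G.mon_closed[OF y_funcset], of "G.cf g b [^] p" b] G.cf_closed[OF gc b] by simp
  qed
 qed
qed

text \<open>\<open>f\<^sup>q = f\<^sup>q\<^sup>-\<^sup>1 f\<close> for \<open>q = p\<^sup>k\<^sup>+\<^sup>1\<close>, and \<open>f\<^sup>q\<^sup>-\<^sup>1 \<in> V k\<close> because \<open>q - 1 \<ge> p\<^sup>k\<close>.\<close>

lemma powers_coeff:
 assumes fs: "set fs <= V 0"
 shows "u : G.adjs (carrier G) {\<zero>} (powers fs (Suc k)) ==> u : G.adjs (V k) {\<zero>} fs"
 using fs
proof (induct fs arbitrary: u rule: rev_induct)
 case (snoc f fs)
 have f: "f : V 0" "f : carrier G" using snoc(3) by (auto simp: V_def)
 have "u : G.adj (carrier G) (G.adjs (carrier G) {\<zero>} (powers fs (Suc k))) (f [^] (p ^ Suc k))"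
  using snoc(2) unfolding powers_def by (simp add: G.adjs_append)
 then obtain w c where w: "w : G.adjs (carrier G) {\<zero>} (powers fs (Suc k))" "c : carrier G"
  "u = w \<oplus> c \<otimes> f [^] (p ^ Suc k)" by (rule G.adjE)
 define m where "m = p ^ Suc k - 1"
 have pk: "0 < p ^ k" "2 * p ^ k <= p ^ Suc k" using G.p_pos by simp_all
 have le: "p ^ k <= m" "p ^ Suc k = Suc m" using pk unfolding m_def by linarith+
 have fm: "f [^] m : V k" by (rule F.pow_V[OF f(2) V_pow[OF f(1)] le(1)])
 have "c \<otimes> f [^] (p ^ Suc k) = (c \<otimes> f [^] m) \<otimes> f"
  unfolding le(2) using w(2) f(2) by (simp add: G.m_assoc)
 moreover have "c \<otimes> f [^] m : V k" by (rule ideal.I_l_closed[OF V_ideal fm w(2)])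
 ultimately have "u : G.adj (V k) (G.adjs (V k) {\<zero>} fs) f"
  unfolding w(3) using G.adjI[OF snoc(1)[OF w(1)]] snoc(3) by simp
 then show ?case by (simp add: G.adjs_append)
qed (simp add: powers_def)

lemma V_span:
 assumes fs: "set fs <= V 0" and base: "V 0 <= G.adjs (carrier G) (V (Suc 0)) fs"
 shows "V 0 <= G.adjs (carrier G) {\<zero>} fs"
proof
 fix g assume g: "g : V 0"
 have fc: "set fs <= carrier G" using fs by (auto simp: V_def)
 note sV = G.submod_ideal[OF V_ideal subset_refl]
 have pc: "set (powers fs N) <= carrier G" for N using fc by (auto simp: powers_def)
 let ?M = "%N. G.adjs (carrier G) {\<zero>} (powers fs N)"
 have ex: "EX w. w : V (Suc N) & (EX u:?M N. v = w \<oplus> u)" if v: "v : V N" for v N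
  using G.adjs_split[OF sV pc subsetD[OF V_step[OF fc base] v]] by blast
 note sfs = G.submod_adjs[OF G.carrier_is_subring G.zero_submod[OF subset_refl] fc]
 have "powers fs 0 = fs" using fc unfolding powers_def by (induct fs) auto
 then obtain w u where w: "w : V (Suc 0)" "u : G.adjs (carrier G) {\<zero>} fs" "g = w \<oplus> u" using ex[OF g] by auto
 have "V (Suc 0) <= G.adjs (carrier G) {\<zero>} fs"
 proof (rule F.approx_span[OF fc, of "%k. V (Suc k)"])
  show "V (Suc k) <= V k" for k
   using phi_pr ring_hom_cring.hom_zero[OF phi_cring] unfolding V_def by (auto, metis)
  show "EX w:V (Suc (Suc k)). EX u:G.adjs (V k) {\<zero>} fs. v = w \<oplus> u" if "v : V (Suc k)" for k v
   using ex[OF that] powers_coeff[OF fs] by blast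
 qed
 then show "g : G.adjs (carrier G) {\<zero>} fs" unfolding w(3) using G.submodD(3)[OF sfs] w(1,2) by blast
qed

lemma pr_image: "pr i ` carrier G = carrier (A i)"
 using pr_surj pr_closed by blast

text \<open>An ideal of \<open>G\<close> is determined by its image in \<open>A i\<close> up to \<open>V i\<close>.\<close>

lemma lift_generators:
 assumes N: "noetherian_ring (A i)" and J: "ideal J G" "V i <= J"
 obtains ws where "set ws <= J" "J = G.adjs (carrier G) (V i) ws"
proof -
 interpret A: noeth_cring "A i" by (intro noeth_cring.intro A_cring N)
 note sJ = G.submod_ideal[OF J(1) subset_refl]
 note Jm = G.submodD[OF sJ]
 note hz = ring_hom_cring.hom_zero[OF pr_cring]
 have "A.submod (carrier (A i)) (pr i ` J)"
  unfolding A.submod_def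
 proof (intro conjI ballI)
  show "pr i ` J <= carrier (A i)" using Jm(5) pr_closed by blast
  show "\<zero>\<^bsub>A i\<^esub> : pr i ` J" using Jm(2) hz by (metis imageI)
  fix a assume "a : pr i ` J"
  then obtain s where s: "s : J" "a = pr i s" by blast
  { fix b assume "b : pr i ` J"
   then obtain t where t: "t : J" "b = pr i t" by blast
   have "a \<oplus>\<^bsub>A i\<^esub> b = pr i (s \<oplus> t)" using s t ring_hom_add[OF pr_hom Jm(5) Jm(5)] by simp
   then show "a \<oplus>\<^bsub>A i\<^esub> b : pr i ` J" using Jm(3)[OF s(1) t(1)] by blast }
  fix k assume "k : carrier (A i)"
  then obtain t where t: "t : carrier G" "k = pr i t" using pr_image by blast
  have "k \<otimes>\<^bsub>A i\<^esub> a = pr i (t \<otimes> s)" using s t ring_hom_mult[OF pr_hom t(1) Jm(5)] by simp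
  then show "k \<otimes>\<^bsub>A i\<^esub> a : pr i ` J" using Jm(4)[OF t(1) s(1)] by blast
 qed
 then have "ideal (pr i ` J) (A i)" by (rule A.ideal_submod)
 then obtain us where us: "set us <= carrier (A i)" "pr i ` J = A.adjs (carrier (A i)) {\<zero>\<^bsub>A i\<^esub>} us"
  by (rule A.ideal_list)
 have "set us <= pr i ` J"
  using A.adjs_mem[OF A.carrier_is_subring A.zero_submod[OF subset_refl] us(1)] us(2) by simp
 then have "us : lists (pr i ` J)" by blast
 then have "us : map (pr i) ` lists J" by (simp add: lists_image)
 then obtain ws where "ws : lists J" "us = map (pr i) ws" by blast
 then have ws: "set ws <= J" "us = map (pr i) ws" by auto
 have wc: "set ws <= carrier G" using ws Jm(1) by blast
 note sV = G.submod_ideal[OF V_ideal subset_refl]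
 note sW = G.submod_adjs[OF G.carrier_is_subring sV wc]
 have "J <= G.adjs (carrier G) (V i) ws"
 proof
  fix g assume g: "g : J"
  have "pr i g : A.adjs (carrier (A i)) (pr i ` {\<zero>}) (map (pr i) ws)" using us(2) g ws hz by auto
  then have "pr i g : pr i ` G.adjs (carrier G) {\<zero>} ws"
   using adjs_hom_image[OF G.is_cring A_cring pr_hom pr_image wc, of "{\<zero>}"] by simp
  then obtain w where w: "w : G.adjs (carrier G) {\<zero>} ws" "pr i g = pr i w" by blast
  have w': "w : G.adjs (carrier G) (V i) ws" using G.adjs_mono[of "{\<zero>}" "V i"] w(1) G.submodD(2)[OF sV] by blast
  have wcc: "w : carrier G" using G.submodD(5)[OF sW w'] .
  have "g \<ominus> w : V i" using pr_diff[OF Jm(5)[OF g] wcc] w(2) by simp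
  then have "(g \<ominus> w) \<oplus> w : G.adjs (carrier G) (V i) ws"
   using G.submodD(3)[OF sW _ w'] G.adjs_upper[OF G.carrier_is_subring sV wc] by blast
  moreover have "(g \<ominus> w) \<oplus> w = g" using Jm(5)[OF g] wcc by algebra
  ultimately show "g : G.adjs (carrier G) (V i) ws" by simp
 qed
 moreover have "G.adjs (carrier G) (V i) ws <= J" by (rule G.adjs_least[OF sJ J(2) ws(1)])
 ultimately show thesis using that ws(1) by blast
qed

theorem G_noetherian:
 assumes N0: "noetherian_ring (A 0)" and N1: "noetherian_ring (A (Suc 0))"
 shows "noetherian_ring G"
proof -
 have sub: "V (Suc 0) <= V 0"
 proof
  fix v assume v: "v : V (Suc 0)"
  then have vc: "v : carrier G" "pr (Suc 0) v = \<zero>\<^bsub>A (Suc 0)\<^esub>" by (auto simp: V_def)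
  then show "v : V 0" using phi_pr[OF vc(1), of 0] ring_hom_cring.hom_zero[OF phi_cring, of 0] by (simp add: V_def)
 qed
 obtain fs where fs: "set fs <= V 0" "V 0 = G.adjs (carrier G) (V (Suc 0)) fs"
  by (rule lift_generators[OF N1 V_ideal sub])
 have V0: "V 0 <= G.adjs (carrier G) {\<zero>} fs" by (rule V_span[OF fs(1)]) (use fs(2) in simp)
 have fc: "set fs <= carrier G" using fs(1) by (auto simp: V_def)
 show ?thesis
 proof (rule F.noetherianI[OF fc])
  show "F.tnil f" if "f : set fs" for f
   unfolding F.tnil_def using V_pow subsetD[OF fs(1) that] by blast
  fix J assume J: "ideal J G" "set fs <= J"
  note sJ = G.submod_ideal[OF J(1) subset_refl]
  have "G.adjs (carrier G) {\<zero>} fs <= J" by (rule G.adjs_least[OF sJ _ J(2)]) (use G.submodD(2)[OF sJ] in simp)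
  then have VJ: "V 0 <= J" using V0 by blast
  obtain ws where ws: "set ws <= J" "J = G.adjs (carrier G) (V 0) ws" by (rule lift_generators[OF N0 J(1) VJ])
  have "J = G.adjs (carrier G) {\<zero>} (fs @ ws)"
  proof
   show "J <= G.adjs (carrier G) {\<zero>} (fs @ ws)"
    using G.adjs_mono[OF V0] ws(2) unfolding G.adjs_append by blast
   show "G.adjs (carrier G) {\<zero>} (fs @ ws) <= J"
    by (rule G.adjs_least[OF sJ]) (use G.submodD(2)[OF sJ] J(2) ws(1) in auto)
  qed
  moreover have "set (fs @ ws) <= carrier G" using fc ws(1) G.submodD(1)[OF sJ] by auto
  ultimately show "G.fg J" unfolding G.fg_def by blast
 qed
qed

end

section \<open>Maps into the limit\<close>

context tower_limit begin

text \<open>Frobenius is determined one level below, so a map into the limit is determined by level \<open>0\<close> and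
 by its values on \<open>p\<close>-generators.\<close>

lemma hom_unique:
 assumes S: "charp S p" and x: "x : {..<m} \<rightarrow> carrier S" and gen: "charp.pspan S p x m = carrier S"
  and g: "g : ring_hom S G" and h: "h : ring_hom S G"
  and e0: "!!v. v : carrier S ==> pr 0 (g v) = pr 0 (h v)" and ex: "!!j. j < m ==> g (x j) = h (x j)"
  and v: "v : carrier S"
 shows "g v = h v"
proof -
 interpret S: charp S p by (rule S)
 have gc: "g u : carrier G" "h u : carrier G" if "u : carrier S" for u
  using ring_hom_closed[OF g that] ring_hom_closed[OF h that] by simp_all
 have "ALL v:carrier S. pr i (g v) = pr i (h v)" for i
 proof (induct i)
  case (Suc i)
  show ?case
  proof
   fix v assume v: "v : carrier S"
   interpret B: charp "A (Suc i)" p by (rule A_charp)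
   obtain c where c: "c : S.E m \<rightarrow> carrier S" "v = S.pcomb x m c" using v gen unfolding S.pspan_def by blast
   let ?z = "%j. pr (Suc i) (g (x j))"
   have zc: "?z : {..<m} \<rightarrow> carrier (A (Suc i))" using pr_closed gc funcset_mem[OF x] by auto
   have hg: "(%v. pr (Suc i) (g v)) : ring_hom S (A (Suc i))" "(%v. pr (Suc i) (h v)) : ring_hom S (A (Suc i))"
    using ring_hom_trans[OF g pr_hom] ring_hom_trans[OF h pr_hom] by (simp_all add: comp_def)
   have 1: "pr (Suc i) (g v) = B.pcomb ?z m (%b. pr (Suc i) (g (c b)))"
    unfolding c(2) by (rule hom_pcomb[OF S B.charp_axioms hg(1) x c(1)]) simp
   have 2: "pr (Suc i) (h v) = B.pcomb ?z m (%b. pr (Suc i) (h (c b)))"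
    unfolding c(2) by (rule hom_pcomb[OF S B.charp_axioms hg(2) x c(1)]) (simp add: ex)
   have pw: "pr (Suc i) u [^]\<^bsub>A (Suc i)\<^esub> p = inc i (pr i u)" if "u : carrier G" for u
    using inc_phi[OF pr_closed[OF that]] phi_pr[OF that] by simp
   have "B.pcomb ?z m (%b. pr (Suc i) (g (c b))) = B.pcomb ?z m (%b. pr (Suc i) (h (c b)))"
    unfolding B.pcomb_def
   proof (rule B.finsum_cong')
    fix b assume "b : S.E m"
    then have cb: "c b : carrier S" using funcset_mem[OF c(1)] by simp
    show "pr (Suc i) (g (c b)) [^]\<^bsub>A (Suc i)\<^esub> p \<otimes>\<^bsub>A (Suc i)\<^esub> B.mon ?z m b
     = pr (Suc i) (h (c b)) [^]\<^bsub>A (Suc i)\<^esub> p \<otimes>\<^bsub>A (Suc i)\<^esub> B.mon ?z m b"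
     using pw gc[OF cb] Suc cb by simp
   qed (use pr_closed gc funcset_mem[OF c(1)] B.mon_closed[OF zc] in auto)
   then show "pr (Suc i) (g v) = pr (Suc i) (h v)" using 1 2 by simp
  qed
 qed (use e0 in simp)
 then show ?thesis by (intro pr_joint_inj) (use gc v in auto)
qed

text \<open>If level \<open>i\<close> has a \<open>p\<close>-basis and \<open>phi i v = 0\<close>, then \<open>phi i\<close> kills the coordinates of \<open>v\<close>, so their
 \<open>p\<close>-th powers vanish. By induction, all maps of a tower that starts with a \<open>p\<close>-basis are
 isomorphisms.\<close>

lemma phi_inj:
 assumes P: "pbasis (A i) p (xs i) n" and v: "v : carrier (A (Suc i))" and z: "phi i v = \<zero>\<^bsub>A i\<^esub>"
 shows "v = \<zero>\<^bsub>A (Suc i)\<^esub>"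
proof -
 interpret P: pbasis "A i" p "xs i" n by (rule P)
 obtain c where c: "c : G.E n \<rightarrow> carrier (A (Suc i))" "v = charp.pcomb (A (Suc i)) p (xs (Suc i)) n c"
  using A_span[OF v] by blast
 have "P.pcomb (xs i) n (%b. phi i (c b)) = \<zero>\<^bsub>A i\<^esub>"
  using hom_pcomb[OF A_charp A_charp phi_hom xs_funcset c(1), of "xs i"] phi_xs z c(2) by simp
 moreover have "(%b. phi i (c b)) : G.E n \<rightarrow> carrier (A i)" using phi_closed funcset_mem[OF c(1)] by auto
 ultimately have "phi i (c b) = \<zero>\<^bsub>A i\<^esub>" if "b : G.E n" for b using P.indep that unfolding P.pindep_def by blast
 then show ?thesis unfolding c(2) by (rule pcomb_phi_zero[OF c(1)])
qed

lemma A_pbasis: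
 assumes P: "pbasis (A 0) p (xs 0) n" shows "pbasis (A i) p (xs i) n"
proof (induct i)
 case (Suc i)
 interpret B: charp "A (Suc i)" p by (rule A_charp)
 have "B.pspan (xs (Suc i)) n = carrier (A (Suc i))"
  unfolding B.pspan_def using B.pcomb_closed[OF xs_funcset] A_span by blast
 moreover have "B.pindep (xs (Suc i)) n" unfolding B.pindep_def
  using A_indep phi_inj[OF Suc] funcset_mem by metis
 ultimately show ?case by (intro pbasis.intro B.charp_axioms pbasis_axioms.intro xs_funcset)
qed (rule P)

lemma pr_0_inj:
 assumes P: "pbasis (A 0) p (xs 0) n" shows "inj_on (pr 0) (carrier G)"
proof (rule inj_onI)
 fix s t assume st: "s : carrier G" "t : carrier G" "pr 0 s = pr 0 t"
 have d: "s \<ominus> t : carrier G" using st by simp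
 have "pr i (s \<ominus> t) = \<zero>\<^bsub>A i\<^esub>" for i
 proof (induct i)
  case 0 show ?case using pr_diff[OF st(1,2), of 0] st(3) by (simp add: V_def)
 next
  case (Suc i)
  show ?case by (rule phi_inj[OF A_pbasis[OF P] pr_closed[OF d]]) (use Suc phi_pr[OF d] in simp)
 qed
 then have "s \<ominus> t : V i" for i using d by (simp add: V_def)
 then show "s = t" by (intro pr_joint_inj st(1,2)) (use pr_diff[OF st(1,2)] in blast)
qed

end

section \<open>Gabber's limit as an object\<close>

lemma restrict_hom:
 assumes A: "cring A" and f: "f : ring_hom A B"
 shows "restrict f (carrier A) : ring_hom A B"
proof -
 interpret A: cring A by (rule A)
 show ?thesis
  by (rule ring_hom_memI) (use ring_hom_closed[OF f] ring_hom_mult[OF f] ring_hom_add[OF f] ring_hom_one[OF f] in simp_all)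
qed

lemma inverse_limit_cring:
 assumes A: "!!i. cring (A i)" and h: "!!i. \<phi> i : ring_hom (A (Suc i)) (A i)"
 shows "cring (inverse_limit A \<phi>)"
proof -
 interpret A: cring "A i" for i by (rule A)
 let ?IL = "inverse_limit A \<phi>"
 have sc: "s i : carrier (A i)" if "s : carrier ?IL" for s i using that by (simp add: inverse_limit_def)
 have s\<phi>: "\<phi> i (s (Suc i)) = s i" if "s : carrier ?IL" for s i using that by (simp add: inverse_limit_def)
 have mem: "s : carrier ?IL" if "!!i. s i : carrier (A i)" "!!i. \<phi> i (s (Suc i)) = s i" for s
  using that by (simp add: inverse_limit_def)
 have ops: "s \<otimes>\<^bsub>?IL\<^esub> t = (%i. s i \<otimes>\<^bsub>A i\<^esub> t i)" "s \<oplus>\<^bsub>?IL\<^esub> t = (%i. s i \<oplus>\<^bsub>A i\<^esub> t i)"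
  "\<one>\<^bsub>?IL\<^esub> = (%i. \<one>\<^bsub>A i\<^esub>)" "\<zero>\<^bsub>?IL\<^esub> = (%i. \<zero>\<^bsub>A i\<^esub>)" for s t by (simp_all add: inverse_limit_def)
 have hc: "ring_hom_cring (A (Suc i)) (A i) (\<phi> i)" for i
  by (intro ring_hom_cring.intro ring_hom_cring_axioms.intro A h)
 show ?thesis
 proof (rule cringI)
  show "abelian_group ?IL"
  proof (rule abelian_groupI)
   fix s t assume st: "s : carrier ?IL" "t : carrier ?IL"
   show "s \<oplus>\<^bsub>?IL\<^esub> t : carrier ?IL"
    by (rule mem) (use sc st s\<phi> ring_hom_add[OF h] in "simp_all add: ops")
   show "s \<oplus>\<^bsub>?IL\<^esub> t = t \<oplus>\<^bsub>?IL\<^esub> s" using sc st by (simp add: ops A.a_comm)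
   fix r assume r: "r : carrier ?IL"
   show "s \<oplus>\<^bsub>?IL\<^esub> t \<oplus>\<^bsub>?IL\<^esub> r = s \<oplus>\<^bsub>?IL\<^esub> (t \<oplus>\<^bsub>?IL\<^esub> r)" using sc st r by (simp add: ops A.a_assoc)
  next
   show "\<zero>\<^bsub>?IL\<^esub> : carrier ?IL" by (rule mem) (simp_all add: ops ring_hom_cring.hom_zero[OF hc])
   fix s assume s: "s : carrier ?IL"
   show "\<zero>\<^bsub>?IL\<^esub> \<oplus>\<^bsub>?IL\<^esub> s = s" using sc[OF s] by (simp add: ops)
   have "(%i. \<ominus>\<^bsub>A i\<^esub> s i) : carrier ?IL"
    by (rule mem) (use sc[OF s] s\<phi>[OF s] ring_hom_cring.hom_a_inv[OF hc] in simp_all)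
   moreover have "(%i. \<ominus>\<^bsub>A i\<^esub> s i) \<oplus>\<^bsub>?IL\<^esub> s = \<zero>\<^bsub>?IL\<^esub>" using sc[OF s] by (simp add: ops A.l_neg)
   ultimately show "EX t:carrier ?IL. t \<oplus>\<^bsub>?IL\<^esub> s = \<zero>\<^bsub>?IL\<^esub>" by blast
  qed
  show "comm_monoid ?IL"
  proof (rule comm_monoidI)
   fix s t assume st: "s : carrier ?IL" "t : carrier ?IL"
   show "s \<otimes>\<^bsub>?IL\<^esub> t : carrier ?IL"
    by (rule mem) (use sc st s\<phi> ring_hom_mult[OF h] in "simp_all add: ops")
   show "s \<otimes>\<^bsub>?IL\<^esub> t = t \<otimes>\<^bsub>?IL\<^esub> s" using sc st by (simp add: ops A.m_comm)
   fix r assume r: "r : carrier ?IL"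
   show "s \<otimes>\<^bsub>?IL\<^esub> t \<otimes>\<^bsub>?IL\<^esub> r = s \<otimes>\<^bsub>?IL\<^esub> (t \<otimes>\<^bsub>?IL\<^esub> r)" using sc st r by (simp add: ops A.m_assoc)
  next
   show "\<one>\<^bsub>?IL\<^esub> : carrier ?IL" by (rule mem) (simp_all add: ops ring_hom_one[OF h])
   fix s assume s: "s : carrier ?IL"
   show "\<one>\<^bsub>?IL\<^esub> \<otimes>\<^bsub>?IL\<^esub> s = s" using sc[OF s] by (simp add: ops)
  qed
  fix r s t assume "r : carrier ?IL" "s : carrier ?IL" "t : carrier ?IL"
  then show "(r \<oplus>\<^bsub>?IL\<^esub> s) \<otimes>\<^bsub>?IL\<^esub> t = r \<otimes>\<^bsub>?IL\<^esub> t \<oplus>\<^bsub>?IL\<^esub> s \<otimes>\<^bsub>?IL\<^esub> t" using sc by (simp add: ops A.l_distr)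
 qed
qed

lemma gabber_tower_simps:
 "gabber_tower p T 0 = T" "gabber_tower p T (Suc i) = gabber_step p (gabber_tower p T i)"
 by (simp_all add: gabber_tower_def)

context gens begin

lemma tower_gens: "gens (gabber_tower p T i) p"
 by (induct i) (auto simp: gabber_tower_simps gens_axioms gens.step_gens)

lemma tower_length: "length (snd (gabber_tower p T i)) = n"
 by (induct i) (auto simp: gabber_tower_simps gabber_step_def)

abbreviation "lev i \<equiv> fst (gabber_tower p T i)"
abbreviation "G \<equiv> fst (gabber_obj p T)"
abbreviation "IL \<equiv> inverse_limit lev (%i. gabber_phi p (gabber_tower p T i))"

lemma lev_cring: "cring (lev i)"
 using tower_gens[of i] by (meson charp.axioms(1) gens.axioms(1))

lemma lev_phi: "gabber_phi p (gabber_tower p T i) : ring_hom (lev (Suc i)) (lev i)"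
 using gens.phi_hom[OF tower_gens[of i]] by (simp add: gabber_tower_simps)

lemma L_cring: "cring IL" by (rule inverse_limit_cring) (rule lev_cring, rule lev_phi)

lemma G_def: "G = image_ring Seq IL" by (simp add: gabber_obj_def)

lemma Seq_inj: "inj_on Seq (carrier IL)" by (simp add: inj_on_def)

lemma G_cring: "cring G" unfolding G_def by (rule image_ring_cring[OF L_cring Seq_inj])

lemma Seq_hom: "Seq : ring_hom IL G" unfolding G_def using inj_imp_image_ring_iso[OF Seq_inj] by (simp add: ring_iso_def)

lemma G_carrier: "carrier G = {Seq s | s. ALL i. s i : carrier (lev i) & gabber_phi p (gabber_tower p T i) (s (Suc i)) = s i}"
 unfolding G_def image_ring_carrier by (auto simp: inverse_limit_def)

lemma obj_length: "length (snd (gabber_obj p T)) = n" by (simp add: gabber_obj_def)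

lemma obj_nth: "j < n ==> snd (gabber_obj p T) ! j = Seq (%i. snd (gabber_tower p T i) ! j)"
 by (simp add: gabber_obj_def)

lemma proj_hom: "(%v. un_Seq v i) : ring_hom G (lev i)"
proof (rule ring_hom_memI)
 have car: "carrier G = Seq ` carrier IL" unfolding G_def image_ring_carrier ..
 fix u v assume "u : carrier G" "v : carrier G"
 then obtain s t where st: "s : carrier IL" "t : carrier IL" "u = Seq s" "v = Seq t" unfolding car by blast
 show "un_Seq u i : carrier (lev i)" using st by (simp add: inverse_limit_def)
 have "u \<otimes>\<^bsub>G\<^esub> v = Seq (s \<otimes>\<^bsub>IL\<^esub> t)" "u \<oplus>\<^bsub>G\<^esub> v = Seq (s \<oplus>\<^bsub>IL\<^esub> t)"
  using st ring_hom_mult[OF Seq_hom] ring_hom_add[OF Seq_hom] by simp_all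
 then show "un_Seq (u \<otimes>\<^bsub>G\<^esub> v) i = un_Seq u i \<otimes>\<^bsub>lev i\<^esub> un_Seq v i" "un_Seq (u \<oplus>\<^bsub>G\<^esub> v) i = un_Seq u i \<oplus>\<^bsub>lev i\<^esub> un_Seq v i"
  using st by (simp_all add: inverse_limit_def)
next
 have "\<one>\<^bsub>G\<^esub> = Seq \<one>\<^bsub>IL\<^esub>" using ring_hom_one[OF Seq_hom] by simp
 then show "un_Seq \<one>\<^bsub>G\<^esub> i = \<one>\<^bsub>lev i\<^esub>" by (simp add: inverse_limit_def)
qed

lemma limit:
 "tower_limit G lev (%i. (!) (snd (gabber_tower p T i))) n p
  (%i r. gabber_class p (gabber_tower p T i) (ring.indexed_const (lev i) r))
  (%i. gabber_phi p (gabber_tower p T i)) (%i v. un_Seq v i) ((!) (snd (gabber_obj p T)))"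
proof (intro tower_limit.intro tower_limit_axioms.intro G_cring proj_hom lev_phi)
 fix i
 note g = tower_gens[of i] and g' = tower_gens[of "Suc i"]
 show "charp (lev i) p" using g by (rule gens.axioms(1))
 show "snd (gabber_tower p T i) ! j : carrier (lev i)" if "j < n" for j
  using gens.xc(1)[OF g] that by (simp add: tower_length)
 show "(%r. gabber_class p (gabber_tower p T i) (ring.indexed_const (lev i) r)) : ring_hom (lev i) (lev (Suc i))"
  using gens.inc_hom[OF g] by (simp add: gabber_tower_simps)
 show "gabber_phi p (gabber_tower p T i) (snd (gabber_tower p T (Suc i)) ! j) = snd (gabber_tower p T i) ! j" if "j < n" for j
  using gens.phi_x'[OF g] that by (simp add: gabber_tower_simps tower_length)
 show "gabber_phi p (gabber_tower p T i) ` carrier (lev (Suc i)) = carrier (lev i)"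
  using gens.phi_surj[OF g] by (simp add: gabber_tower_simps)
 show "gabber_class p (gabber_tower p T i) (ring.indexed_const (lev i) (gabber_phi p (gabber_tower p T i) v)) = v [^]\<^bsub>lev (Suc i)\<^esub> p"
  if "v : carrier (lev (Suc i))" for v
  using gens.inc_phi[OF g] that by (simp add: gabber_tower_simps)
 show "EX c:charp.E p n \<rightarrow> carrier (lev (Suc i)). v = charp.pcomb (lev (Suc i)) p ((!) (snd (gabber_tower p T (Suc i)))) n c"
  if "v : carrier (lev (Suc i))" for v
  using gens.R'_span[OF g] that unfolding gabber_tower_simps tower_length by blast
 show "gabber_phi p (gabber_tower p T i) (c b) = \<zero>\<^bsub>lev i\<^esub>"
  if "c : charp.E p n \<rightarrow> carrier (lev (Suc i))" "charp.pcomb (lev (Suc i)) p ((!) (snd (gabber_tower p T (Suc i)))) n c = \<zero>\<^bsub>lev (Suc i)\<^esub>" "b : charp.E p n" for c b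
  using gens.R'_indep[OF g] that unfolding gabber_tower_simps tower_length by blast
 show "gabber_phi p (gabber_tower p T i) (un_Seq s (Suc i)) = un_Seq s i" if "s : carrier G" for s
  using that by (auto simp: G_carrier)
next
 fix s t assume "s : carrier G" "t : carrier G" "!!i. un_Seq s i = un_Seq t i"
 then show "s = t" by (auto simp: G_carrier)
next
 fix a assume "!!i. a i : carrier (lev i)" "!!i. gabber_phi p (gabber_tower p T i) (a (Suc i)) = a i"
 then show "EX s:carrier G. ALL i. un_Seq s i = a i" by (intro bexI[of _ "Seq a"]) (auto simp: G_carrier)
next
 fix j i assume j: "j < n"
 show "snd (gabber_obj p T) ! j : carrier G"
  using j gens.phi_x'[OF tower_gens] gens.xc(1)[OF tower_gens] by (auto simp: obj_nth G_carrier tower_length gabber_tower_simps)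
 show "un_Seq (snd (gabber_obj p T) ! j) i = snd (gabber_tower p T i) ! j" using j by (simp add: obj_nth)
qed

end

text \<open>The monomials are distinct unless the ring is trivial.\<close>

lemma (in pbasis) F_finite: "F_finite p R"
proof (cases "\<one> = \<zero>")
 case True
 then have "carrier R = {\<zero>}" using l_one by (metis carrier_one_zero)
 then show ?thesis unfolding F_finite_def by (intro exI[of _ "{}"]) auto
next
 case False
 have inj: "inj_on (mon x n) (E n)"
  by (rule inj_onI) (metis False cf_mon)
 have "EX a:mon x n ` E n \<rightarrow> carrier R. r = (\<Oplus>b\<in>mon x n ` E n. a b [^] p \<otimes> b)" if r: "r : carrier R" for r
 proof
  let ?a = "%m. cf r (inv_into (E n) (mon x n) m)"
  show a: "?a : mon x n ` E n \<rightarrow> carrier R" using cf_closed[OF r] inj by auto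
  have "(\<Oplus>b\<in>mon x n ` E n. ?a b [^] p \<otimes> b) = (\<Oplus>b\<in>E n. ?a (mon x n b) [^] p \<otimes> mon x n b)"
   by (rule finsum_reindex[OF _ inj]) (use a mon_closed[OF x] in auto)
  also have "\<dots> = pcomb x n (cf r)" unfolding pcomb_def
   by (rule finsum_cong') (use inj cf_closed[OF r] mon_closed[OF x] in auto)
  finally show "r = (\<Oplus>b\<in>mon x n ` E n. ?a b [^] p \<otimes> b)" using cf_spec[OF r] by simp
 qed
 moreover have "mon x n ` E n <= carrier R" "finite (mon x n ` E n)" using mon_closed[OF x] finite_E by auto
 ultimately show ?thesis unfolding F_finite_def by blast
qed

lemma (in charp) p_basis_iff:
 assumes xs: "set xs <= carrier R"
 shows "p_basis p R xs \<longleftrightarrow> pspan ((!) xs) (length xs) = carrier R \<and>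
  (ALL c:E (length xs) \<rightarrow> carrier R. pcomb ((!) xs) (length xs) c = \<zero> --> (ALL b:E (length xs). c b [^] p = \<zero>))"
proof -
 let ?n = "length xs"
 have xf: "(!) xs : {..<?n} \<rightarrow> carrier R" using xs by auto
 have "(ALL c:E ?n \<rightarrow> Kp. (\<Oplus>b\<in>E ?n. c b \<otimes> mon ((!) xs) ?n b) = \<zero> --> (ALL b:E ?n. c b = \<zero>)) \<longleftrightarrow>
  (ALL c:E ?n \<rightarrow> carrier R. pcomb ((!) xs) ?n c = \<zero> --> (ALL b:E ?n. c b [^] p = \<zero>))" (is "?l \<longleftrightarrow> ?r")
 proof
  assume l: ?l
  show ?r
  proof (intro ballI impI)
   fix c b assume c: "c : E ?n \<rightarrow> carrier R" "pcomb ((!) xs) ?n c = \<zero>" "b : E ?n"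
   have "(%b. c b [^] p) : E ?n \<rightarrow> Kp" using funcset_mem[OF c(1)] KpI by auto
   then show "c b [^] p = \<zero>" using bspec[OF l, of "%b. c b [^] p"] c(2,3) unfolding pcomb_def by blast
  qed
 next
  assume r: ?r
  show ?l
  proof (intro ballI impI)
   fix c b assume c: "c : E ?n \<rightarrow> Kp" "(\<Oplus>b\<in>E ?n. c b \<otimes> mon ((!) xs) ?n b) = \<zero>" "b : E ?n"
   have "ALL b. EX d. b : E ?n --> d : carrier R & c b = d [^] p" using funcset_mem[OF c(1)] by (metis KpE)
   then obtain d where d: "!!b. b : E ?n ==> d b : carrier R & c b = d b [^] p" by metis
   have dF: "d : E ?n \<rightarrow> carrier R" using d by auto
   have "pcomb ((!) xs) ?n d = (\<Oplus>b\<in>E ?n. c b \<otimes> mon ((!) xs) ?n b)"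
    unfolding pcomb_def by (rule finsum_cong') (use d mon_closed[OF xf] Kp_carrier funcset_mem[OF c(1)] in auto)
   then show "c b = \<zero>" using r dF c d by auto
  qed
 qed
 then show ?thesis unfolding p_basis_def p_generators_iff Let_def using xs by (simp add: E_def mon_def)
qed

lemma obj_gens:
 assumes p: "Factorial_Ring.prime p" and T: "T : Obj (Ring_pgens p)"
 shows "gens T p" and "noetherian_ring (fst T)" and "F_finite p (fst T)"
 using T p by (auto simp: Ring_pgens_def char_p_ring_def intro!: gens.intro gens_axioms.intro charp.intro charp_axioms.intro)

context gens begin

lemma gabber_obj_regular:
 assumes p: "Factorial_Ring.prime p" and N: "noetherian_ring R"
 shows "gabber_obj p T : Obj (RegRing_pbasis p)"
proof -
 interpret t: tower_limit G lev "%i. (!) (snd (gabber_tower p T i))" n p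
  "%i r. gabber_class p (gabber_tower p T i) (ring.indexed_const (lev i) r)"
  "%i. gabber_phi p (gabber_tower p T i)" "%i v. un_Seq v i" "(!) (snd (gabber_obj p T))" by (rule limit)
 have N1: "noetherian_ring (lev (Suc 0))" using R'_noetherian[OF N] by (simp add: gabber_tower_simps)
 have NG: "noetherian_ring G" by (rule t.G_noetherian) (use N N1 in "simp_all add: gabber_tower_simps")
 have s: "set (snd (gabber_obj p T)) <= carrier G" using t.y_closed by (auto simp: in_set_conv_nth obj_length)
 have "p_basis p G (snd (gabber_obj p T))"
  unfolding t.G.p_basis_iff[OF s] obj_length
  using t.G.gen t.G.indep unfolding t.G.pindep_def by (auto simp: t.G.frob_zero)
 moreover have "p_generators p G (snd (gabber_obj p T))"
  unfolding t.G.p_generators_iff obj_length using t.G.gen s by simp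
 moreover have "regular_ring G" by (rule t.G.imp_regular_ring[OF NG])
 moreover have "F_finite p G" by (rule t.G.F_finite)
 moreover have "char_p_ring p G" using t.G.char_p t.G.is_cring by (simp add: char_p_ring_def)
 ultimately show ?thesis using NG
  by (cases "gabber_obj p T") (simp add: RegRing_pbasis_def full_subcat_def Ring_pgens_def)
qed

text \<open>Induction on the level: \<open>lift\<close> provides the next map, and it is compatible with \<open>phi\<close> because both
 composites agree on constants and variables.\<close>

lemma level_mor:
 assumes U: "gens U p" and F: "F : tuple_hom T U"
 defines "f \<equiv> gabber_level_mor p T U F"
 shows level_hom: "f i : ring_hom (lev i) (fst (gabber_tower p U i))"
  and level_x: "j < n ==> f i (snd (gabber_tower p T i) ! j) = snd (gabber_tower p U i) ! snd F j"
  and level_phi: "v : carrier (lev (Suc i)) ==>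
   gabber_phi p (gabber_tower p U i) (f (Suc i) v) = f i (gabber_phi p (gabber_tower p T i) v)"
proof -
 have F0: "fst F : ring_hom R (fst U)" "!!j. j < n ==> fst F (x j) = snd U ! snd F j"
  "!!j. j < n ==> snd F j < length (snd U)"
  using F by (auto simp: tuple_hom_def)
 note gT = tower_gens and gU = gens.tower_gens[OF U] and lU = gens.tower_length[OF U]
 have step: "f (Suc i) : ring_hom (lev (Suc i)) (fst (gabber_tower p U (Suc i))) \<and>
   (\<forall>j<n. f (Suc i) (snd (gabber_tower p T (Suc i)) ! j) = snd (gabber_tower p U (Suc i)) ! snd F j) \<and>
   (ALL v:carrier (lev (Suc i)). gabber_phi p (gabber_tower p U i) (f (Suc i) v) = f i (gabber_phi p (gabber_tower p T i) v))"
  if h: "f i : ring_hom (lev i) (fst (gabber_tower p U i))"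
   and hx: "!!j. j < n ==> f i (snd (gabber_tower p T i) ! j) = snd (gabber_tower p U i) ! snd F j" for i
 proof -
  interpret t: gens "gabber_tower p T i" p by (rule gT)
  interpret u: gens "gabber_tower p U i" p by (rule gU)
  let ?h = "%r. u.inc (f i r)"
  let ?y = "%j. u.x' (snd F j)"
  have hh: "?h : ring_hom t.R u.R'" using ring_hom_trans[OF h u.inc_hom] by (simp add: comp_def)
  have sj: "snd F j < u.n" if "j < n" for j using F0(3)[OF that] lU by simp
  have yc: "?y : {..<t.n} \<rightarrow> carrier u.R'" using sj u.x'_closed by (auto simp: tower_length)
  have yp: "?y j [^]\<^bsub>u.R'\<^esub> p = ?h (t.x j)" if "j < t.n" for j
   using that u.x'_pow[OF sj] hx by (simp add: tower_length)
  have fe: "f (Suc i) = (%v. mpoly_eval t.R u.R' ?h ?y (un_MPoly v))"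
   by (simp add: f_def gabber_tower_simps fun_eq_iff)
  note hom = t.lift_hom[OF u.R'_cring hh yc yp, folded fe]
  note finc = t.lift_inc[OF u.R'_cring hh yc yp] and fx = t.lift_x'[OF u.R'_cring hh yc yp]
  have finc': "f (Suc i) (t.inc r) = ?h r" if "r : carrier t.R" for r using finc that unfolding fe by simp
  have fx': "f (Suc i) (t.x' j) = ?y j" if "j < n" for j using fx that unfolding fe by (simp add: tower_length)
  have "u.phi (f (Suc i) v) = f i (t.phi v)" if v: "v : carrier t.R'" for v
  proof (rule t.hom_eqI[OF u.R.is_cring _ _ _ _ v])
   show "(%v. u.phi (f (Suc i) v)) : ring_hom t.R' u.R" using ring_hom_trans[OF hom u.phi_hom] by (simp add: comp_def)
   show "(%v. f i (t.phi v)) : ring_hom t.R' u.R" using ring_hom_trans[OF t.phi_hom h] by (simp add: comp_def)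
   interpret h: ring_hom_cring t.R u.R "f i"
    by (intro ring_hom_cring.intro ring_hom_cring_axioms.intro h t.R.is_cring u.R.is_cring)
   show "u.phi (f (Suc i) (t.inc r)) = f i (t.phi (t.inc r))" if r: "r : carrier t.R" for r
    unfolding finc'[OF r] t.phi_inc[OF r] u.phi_inc[OF ring_hom_closed[OF h r]] using r by simp
   show "u.phi (f (Suc i) (t.x' j)) = f i (t.phi (t.x' j))" if j: "j < t.n" for j
    unfolding fx'[OF j[unfolded tower_length]] t.phi_x'[OF j] u.phi_x'[OF sj[OF j[unfolded tower_length]]]
    using hx[OF j[unfolded tower_length]] by simp
  qed
  then show ?thesis unfolding gabber_tower_simps using hom fx' by simp
 qed
 have all: "f i : ring_hom (lev i) (fst (gabber_tower p U i)) \<and>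
   (\<forall>j<n. f i (snd (gabber_tower p T i) ! j) = snd (gabber_tower p U i) ! snd F j)" for i
 proof (induct i)
  case 0 show ?case using F0 by (simp add: f_def gabber_tower_simps)
 next
  case (Suc i) then show ?case using step by blast
 qed
 show "f i : ring_hom (lev i) (fst (gabber_tower p U i))" using all by blast
 show "f i (snd (gabber_tower p T i) ! j) = snd (gabber_tower p U i) ! snd F j" if "j < n" using all that by blast
 show "gabber_phi p (gabber_tower p U i) (f (Suc i) v) = f i (gabber_phi p (gabber_tower p T i) v)"
  if "v : carrier (lev (Suc i))" using step all that by blast
qed

lemma gabber_mor_app:
 "v : carrier G ==> fst (gabber_mor p T U F) v = Seq (%i. gabber_level_mor p T U F i (un_Seq v i))"
 by (simp add: gabber_mor_def)

lemma gabber_mor_hom: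
 assumes U: "gens U p" and F: "F : tuple_hom T U"
 shows "gabber_mor p T U F : tuple_hom (gabber_obj p T) (gabber_obj p U)"
proof -
 note lh = level_hom[OF U F] and lx = level_x[OF U F] and lp = level_phi[OF U F]
 let ?f = "fst (gabber_mor p T U F)" and ?GU = "fst (gabber_obj p U)"
 interpret u: gens U p by (rule U)
 have pc: "un_Seq v i : carrier (lev i)" if "v : carrier G" for v i by (rule ring_hom_closed[OF proj_hom that])
 have c: "?f v : carrier ?GU" if v: "v : carrier G" for v
 proof -
  have "gabber_phi p (gabber_tower p T i) (un_Seq v (Suc i)) = un_Seq v i" for i using v by (auto simp: G_carrier)
  then show ?thesis unfolding gabber_mor_app[OF v] u.G_carrier
   using ring_hom_closed[OF lh pc[OF v]] lp[OF pc[OF v]] by auto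
 qed
 have proj: "un_Seq (?f v) i = gabber_level_mor p T U F i (un_Seq v i)" if "v : carrier G" for v i
  using gabber_mor_app[OF that] by simp
 have inj: "u = v" if "u : carrier ?GU" "v : carrier ?GU" "!!i. un_Seq u i = un_Seq v i" for u v
  using that by (auto simp: u.G_carrier)
 interpret G: cring G by (rule G_cring)
 interpret GU: cring ?GU by (rule u.G_cring)
 have hom: "?f : ring_hom G ?GU"
 proof (rule ring_hom_memI)
  fix v w assume v: "v : carrier G" and w: "w : carrier G"
  show "?f v : carrier ?GU" by (rule c[OF v])
  show "?f (v \<otimes>\<^bsub>G\<^esub> w) = ?f v \<otimes>\<^bsub>?GU\<^esub> ?f w"
  proof (rule inj)
   fix i show "un_Seq (?f (v \<otimes>\<^bsub>G\<^esub> w)) i = un_Seq (?f v \<otimes>\<^bsub>?GU\<^esub> ?f w) i"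
    unfolding proj[OF G.m_closed[OF v w]] ring_hom_mult[OF proj_hom v w] ring_hom_mult[OF u.proj_hom c[OF v] c[OF w]]
     proj[OF v] proj[OF w] by (rule ring_hom_mult[OF lh pc[OF v] pc[OF w]])
  qed (use v w c in simp_all)
  show "?f (v \<oplus>\<^bsub>G\<^esub> w) = ?f v \<oplus>\<^bsub>?GU\<^esub> ?f w"
  proof (rule inj)
   fix i show "un_Seq (?f (v \<oplus>\<^bsub>G\<^esub> w)) i = un_Seq (?f v \<oplus>\<^bsub>?GU\<^esub> ?f w) i"
    unfolding proj[OF G.a_closed[OF v w]] ring_hom_add[OF proj_hom v w] ring_hom_add[OF u.proj_hom c[OF v] c[OF w]]
     proj[OF v] proj[OF w] by (rule ring_hom_add[OF lh pc[OF v] pc[OF w]])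
  qed (use v w c in simp_all)
 next
  show "?f \<one>\<^bsub>G\<^esub> = \<one>\<^bsub>?GU\<^esub>"
  proof (rule inj)
   fix i show "un_Seq (?f \<one>\<^bsub>G\<^esub>) i = un_Seq \<one>\<^bsub>?GU\<^esub> i"
    unfolding proj[OF G.one_closed] ring_hom_one[OF proj_hom] ring_hom_one[OF u.proj_hom] by (rule ring_hom_one[OF lh])
  qed (use c in simp_all)
 qed
 have F': "snd F : {..<n} \<rightarrow>\<^sub>E {..<u.n}" using F by (simp add: tuple_hom_def split_beta)
 have yv: "?f (snd (gabber_obj p T) ! j) = snd (gabber_obj p U) ! snd F j" if j: "j < n" for j
 proof -
  have yc: "snd (gabber_obj p T) ! j : carrier G" by (rule tower_limit.y_closed[OF limit j])
  have sj: "snd F j < u.n" using F' j by auto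
  show ?thesis unfolding gabber_mor_app[OF yc] unfolding obj_nth[OF j] u.obj_nth[OF sj] using lx[OF j] by simp
 qed
 have m: "gabber_mor p T U F = (?f, snd F)" "?f : extensional (carrier G)" by (simp_all add: gabber_mor_def)
 show ?thesis unfolding tuple_hom_def using hom m F' yv by (auto simp: obj_length u.obj_length)
qed

lemma counit_hom: "gabber_counit p T : tuple_hom (gabber_obj p T) T"
proof -
 have "restrict (%v. un_Seq v 0) (carrier G) : ring_hom G R"
  by (rule restrict_hom[OF G_cring proj_hom[of 0, unfolded gabber_tower_simps]])
 moreover have "snd (gabber_obj p T) ! j : carrier G" "un_Seq (snd (gabber_obj p T) ! j) 0 = x j" if "j < n" for j
  using tower_limit.y_closed[OF limit that] tower_limit.pr_y[OF limit that, of 0] by (simp_all add: gabber_tower_simps)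
 ultimately show ?thesis by (auto simp: tuple_hom_def gabber_counit_def obj_length)
qed

lemma counit_surj: "fst (gabber_counit p T) ` carrier G = carrier R"
 using tower_limit.pr_image[OF limit, of 0] by (simp add: gabber_counit_def gabber_tower_simps)

text \<open>By \<open>hom_unique\<close>, because the tuple of the source generates it over its \<open>p\<close>-th powers.\<close>

lemma mor_eqI:
 assumes S: "gens S p" and F: "F : tuple_hom S (gabber_obj p T)" and H: "H : tuple_hom S (gabber_obj p T)"
  and s: "snd F = snd H" and e: "!!v. v : carrier (fst S) ==> un_Seq (fst F v) 0 = un_Seq (fst H v) 0"
 shows "F = H"
proof -
 interpret s: gens S p by (rule S)
 have F': "fst F : ring_hom s.R G" "fst F : extensional (carrier s.R)" "!!j. j < s.n ==> fst F (s.x j) = snd (gabber_obj p T) ! snd F j"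
  using F by (auto simp: tuple_hom_def)
 have H': "fst H : ring_hom s.R G" "fst H : extensional (carrier s.R)" "!!j. j < s.n ==> fst H (s.x j) = snd (gabber_obj p T) ! snd H j"
  using H by (auto simp: tuple_hom_def)
 have gen: "s.R.pspan s.x s.n = carrier s.R" using s.R.p_generators_iff s.pg by blast
 have "fst F v = fst H v" if "v : carrier s.R" for v
  by (rule tower_limit.hom_unique[OF limit s.R.charp_axioms s.xc(2) gen F'(1) H'(1) e _ that])
   (use F'(3) H'(3) s in simp_all)
 then have "fst F = fst H" by (rule extensionalityI[OF F'(2) H'(2)])
 then show ?thesis using s by (simp add: prod_eq_iff)
qed

end

section \<open>The adjunction\<close>

lemma tuple_homD:
 assumes "F : tuple_hom T U"
 shows "fst F : ring_hom (fst T) (fst U)" "fst F : extensional (carrier (fst T))"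
  "snd F : {..<length (snd T)} \<rightarrow>\<^sub>E {..<length (snd U)}"
  "j < length (snd T) ==> fst F (snd T ! j) = snd U ! snd F j"
  "v : carrier (fst T) ==> fst F v : carrier (fst U)"
 using assms ring_hom_closed[of "fst F" "fst T" "fst U"] by (auto simp: tuple_hom_def split_beta)

lemma tuple_homI:
 assumes "f : ring_hom (fst T) (fst U)" "f : extensional (carrier (fst T))"
  "\<sigma> : {..<length (snd T)} \<rightarrow>\<^sub>E {..<length (snd U)}" "!!j. j < length (snd T) ==> f (snd T ! j) = snd U ! \<sigma> j"
 shows "(f, \<sigma>) : tuple_hom T U"
 using assms by (simp add: tuple_hom_def)

lemma pgens_sel:
 "Hom (Ring_pgens p) = tuple_hom"
 "Ident (Ring_pgens p) T = (restrict (%r. r) (carrier (fst T)), restrict (%j. j) {..<length (snd T)})"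
 "Comp (Ring_pgens p) T U W g f = (compose (carrier (fst T)) (fst g) (fst f), compose {..<length (snd T)} (snd g) (snd f))"
 "Hom (RegRing_pbasis p) = tuple_hom"
 "Ident (RegRing_pbasis p) T = (restrict (%r. r) (carrier (fst T)), restrict (%j. j) {..<length (snd T)})"
 "Comp (RegRing_pbasis p) T U W g f = (compose (carrier (fst T)) (fst g) (fst f), compose {..<length (snd T)} (snd g) (snd f))"
 by (simp_all add: Ring_pgens_def RegRing_pbasis_def full_subcat_def)

lemma reg_obj: "T : Obj (RegRing_pbasis p) ==> T : Obj (Ring_pgens p)"
 by (simp add: RegRing_pbasis_def full_subcat_def)

lemma reg_objD: "T : Obj (RegRing_pbasis p) ==> regular_ring (fst T) & p_basis p (fst T) (snd T)"
 by (auto simp: RegRing_pbasis_def full_subcat_def)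

lemma compose_hom:
 assumes "f : ring_hom A B" "g : ring_hom B D" "cring A"
 shows "compose (carrier A) g f : ring_hom A D"
 unfolding compose_def using restrict_hom[OF assms(3) ring_hom_trans[OF assms(1,2)]] by (simp add: comp_def)

lemma compose_tuple_hom:
 assumes A: "cring (fst T)" "set (snd T) <= carrier (fst T)" and f: "f : tuple_hom T U" and g: "g : tuple_hom U W"
 shows "(compose (carrier (fst T)) (fst g) (fst f), compose {..<length (snd T)} (snd g) (snd f)) : tuple_hom T W"
proof (rule tuple_homI)
 show "compose (carrier (fst T)) (fst g) (fst f) : ring_hom (fst T) (fst W)"
  by (rule compose_hom[OF tuple_homD(1)[OF f] tuple_homD(1)[OF g] A(1)])
 note s = PiE_mem[OF tuple_homD(3)[OF f]] PiE_mem[OF tuple_homD(3)[OF g]]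
 show "compose {..<length (snd T)} (snd g) (snd f) : {..<length (snd T)} \<rightarrow>\<^sub>E {..<length (snd W)}"
  using s by (auto simp: compose_def)
 show "compose (carrier (fst T)) (fst g) (fst f) (snd T ! j) = snd W ! compose {..<length (snd T)} (snd g) (snd f) j"
  if "j < length (snd T)" for j
  using that A(2) tuple_homD(4)[OF f that] tuple_homD(4)[OF g, of "snd f j"] s(1)[of j] by (simp add: compose_eq subset_iff)
qed (simp add: compose_def)

lemma ident_tuple_hom:
 assumes "cring (fst T)" "set (snd T) <= carrier (fst T)"
 shows "(restrict (%r. r) (carrier (fst T)), restrict (%j. j) {..<length (snd T)}) : tuple_hom T T"
proof (rule tuple_homI)
 show "restrict (%r. r) (carrier (fst T)) : ring_hom (fst T) (fst T)"
  by (rule restrict_hom[OF assms(1)]) (simp add: ring_hom_def)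
qed (use assms(2) in "auto simp: subset_iff")

lemma pgens_obj:
 assumes "T : Obj (Ring_pgens p)"
 shows "cring (fst T)" "set (snd T) <= carrier (fst T)"
 using assms by (auto simp: Ring_pgens_def char_p_ring_def p_generators_def)

text \<open>Both categories have the same morphisms and composition, so the axioms are checked once for any class
 of objects.\<close>

lemma category_of_pairs:
 assumes O: "Obj C <= Obj (Ring_pgens p)"
  and C: "Hom C = tuple_hom"
   "!!T. Ident C T = (restrict (%r. r) (carrier (fst T)), restrict (%j. j) {..<length (snd T)})"
   "!!T U W g f. Comp C T U W g f = (compose (carrier (fst T)) (fst g) (fst f), compose {..<length (snd T)} (snd g) (snd f))"
 shows "category C"
proof (rule category.intro; unfold C)
 fix T assume "T : Obj C"
 then have T: "T : Obj (Ring_pgens p)" using O by blast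
 note t = pgens_obj[OF T]
 show "(restrict (%r. r) (carrier (fst T)), restrict (%j. j) {..<length (snd T)}) : tuple_hom T T"
  by (rule ident_tuple_hom[OF t])
 fix U f assume f: "f : tuple_hom T U"
 show "(compose (carrier (fst T)) (fst f) (fst (restrict (%r. r) (carrier (fst T)), restrict (%j. j) {..<length (snd T)})),
   compose {..<length (snd T)} (snd f) (snd (restrict (%r. r) (carrier (fst T)), restrict (%j. j) {..<length (snd T)}))) = f"
  using tuple_homD[OF f]
  by (auto simp: prod_eq_iff compose_def PiE_iff intro!: extensionalityI[of _ "carrier (fst T)"] extensionalityI[of _ "{..<length (snd T)}"])
 show "(compose (carrier (fst T)) (fst (restrict (%r. r) (carrier (fst U)), restrict (%j. j) {..<length (snd U)})) (fst f),
   compose {..<length (snd T)} (snd (restrict (%r. r) (carrier (fst U)), restrict (%j. j) {..<length (snd U)})) (snd f)) = f"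
  using tuple_homD[OF f]
  by (auto simp: prod_eq_iff compose_def PiE_iff intro!: extensionalityI[of _ "carrier (fst T)"] extensionalityI[of _ "{..<length (snd T)}"])
 fix W g assume g: "g : tuple_hom U W"
 show "(compose (carrier (fst T)) (fst g) (fst f), compose {..<length (snd T)} (snd g) (snd f)) : tuple_hom T W"
  by (rule compose_tuple_hom[OF t f g])
 fix Z h assume "h : tuple_hom W Z"
 show "(compose (carrier (fst T)) (fst (compose (carrier (fst U)) (fst h) (fst g), compose {..<length (snd U)} (snd h) (snd g))) (fst f),
   compose {..<length (snd T)} (snd (compose (carrier (fst U)) (fst h) (fst g), compose {..<length (snd U)} (snd h) (snd g))) (snd f))
  = (compose (carrier (fst T)) (fst h) (fst (compose (carrier (fst T)) (fst g) (fst f), compose {..<length (snd T)} (snd g) (snd f))),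
   compose {..<length (snd T)} (snd h) (snd (compose (carrier (fst T)) (fst g) (fst f), compose {..<length (snd T)} (snd g) (snd f))))"
  using tuple_homD(5)[OF f] PiE_mem[OF tuple_homD(3)[OF f]] by (auto simp: compose_def restrict_def fun_eq_iff)
qed

lemma functor_comp:
 assumes F: "cat_functor C D F" and G: "cat_functor D E G"
 shows "cat_functor C E (comp_functor G F)"
proof -
 interpret F: cat_functor C D F by (rule F)
 interpret G: cat_functor D E G by (rule G)
 show ?thesis
  by unfold_locales (simp_all add: comp_functor_def F.fobj_obj G.fobj_obj F.fmor_hom G.fmor_hom F.fmor_ident G.fmor_ident F.fmor_comp G.fmor_comp)
qed

lemma functor_id: "category C ==> cat_functor C C id_functor"
 by (intro cat_functor.intro cat_functor_axioms.intro) (simp_all add: id_functor_def)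

lemma category_pgens: "category (Ring_pgens p :: ('k tring, 'k tmor) cat)"
 by (rule category_of_pairs[of _ p]) (simp_all add: pgens_sel)

lemma category_reg: "category (RegRing_pbasis p :: ('k tring, 'k tmor) cat)"
 by (rule category_of_pairs[of _ p]) (use reg_obj in "auto simp: pgens_sel")

context
 fixes p :: nat
 assumes p: "Factorial_Ring.prime p"
begin

lemma gabber_obj_reg: "T : Obj (Ring_pgens p) ==> gabber_obj p T : Obj (RegRing_pbasis p)"
 using gens.gabber_obj_regular[OF obj_gens(1)[OF p] p obj_gens(2)[OF p]] by blast

lemma gabber_obj_obj: "T : Obj (Ring_pgens p) ==> gabber_obj p T : Obj (Ring_pgens p)"
 by (rule reg_obj[OF gabber_obj_reg])

lemma obj_mor_eqI:
 assumes "S : Obj (Ring_pgens p)" "T : Obj (Ring_pgens p)"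
  and "F : tuple_hom S (gabber_obj p T)" "H : tuple_hom S (gabber_obj p T)" "snd F = snd H"
  and "!!v. v : carrier (fst S) ==> un_Seq (fst F v) 0 = un_Seq (fst H v) 0"
 shows "F = H"
 by (rule gens.mor_eqI[OF obj_gens(1)[OF p assms(2)] obj_gens(1)[OF p assms(1)] assms(3-)])

lemma obj_gabber_mor:
 assumes "T : Obj (Ring_pgens p)" "U : Obj (Ring_pgens p)" "F : tuple_hom T U"
 shows "gabber_mor p T U F : tuple_hom (gabber_obj p T) (gabber_obj p U)"
  and "snd (gabber_mor p T U F) = snd F"
  and "v : carrier (fst (gabber_obj p T)) ==> un_Seq (fst (gabber_mor p T U F) v) 0 = fst F (un_Seq v 0)"
 using gens.gabber_mor_hom[OF obj_gens(1)[OF p assms(1)] obj_gens(1)[OF p assms(2)] assms(3)]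
  gens.gabber_mor_app[OF obj_gens(1)[OF p assms(1)], of v U F] by (auto simp: gabber_mor_def)

lemma gabber_len: "length (snd (gabber_obj p T)) = length (snd T)" by (simp add: gabber_obj_def)

lemma un_Seq_0:
 assumes "T : Obj (Ring_pgens p)" "v : carrier (fst (gabber_obj p T))"
 shows "un_Seq v 0 : carrier (fst T)"
 using ring_hom_closed[OF gens.proj_hom[OF obj_gens(1)[OF p assms(1)], of 0] assms(2)] by (simp add: gabber_tower_simps)

lemma counit_tuple_hom: "T : Obj (Ring_pgens p) ==> gabber_counit p T : tuple_hom (gabber_obj p T) T"
 by (rule gens.counit_hom[OF obj_gens(1)[OF p]])

text \<open>The functor laws are equalities of morphisms into a limit, so \<open>obj_mor_eqI\<close> reduces them to level \<open>0\<close>,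
 where the functor acts by the given ring map.\<close>

lemma gabber_functor_right: "cat_functor (Ring_pgens p :: ('k tring, 'k tmor) cat) (RegRing_pbasis p) (gabber_functor p)"
proof (intro cat_functor.intro category_pgens category_reg cat_functor_axioms.intro, unfold pgens_sel)
 fix T :: "'k tring" assume T: "T : Obj (Ring_pgens p)"
 note t = pgens_obj[OF T] and gt = pgens_obj[OF gabber_obj_obj[OF T]]
 show "fobj (gabber_functor p) T : Obj (RegRing_pbasis p)" using gabber_obj_reg[OF T] by (simp add: gabber_functor_def)
 show "fmor (gabber_functor p) T T (restrict (%r. r) (carrier (fst T)), restrict (%j. j) {..<length (snd T)}) =
  (restrict (%r. r) (carrier (fst (fobj (gabber_functor p) T))), restrict (%j. j) {..<length (snd (fobj (gabber_functor p) T))})"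
  (is "fmor _ _ _ ?I = ?J")
 proof -
  have J: "?J = (restrict (%r. r) (carrier (fst (gabber_obj p T))), restrict (%j. j) {..<length (snd (gabber_obj p T))})"
   by (simp add: gabber_functor_def)
  have "gabber_mor p T T ?I = ?J"
   unfolding J
   by (rule obj_mor_eqI[OF gabber_obj_obj[OF T] T obj_gabber_mor(1)[OF T T ident_tuple_hom[OF t]] ident_tuple_hom[OF gt]])
    (use obj_gabber_mor(2,3)[OF T T ident_tuple_hom[OF t]] un_Seq_0[OF T] in "simp_all add: gabber_len")
  then show ?thesis by (simp add: gabber_functor_def)
 qed
 fix U f assume U: "U : Obj (Ring_pgens p)" and f: "f : tuple_hom T U"
 show "fmor (gabber_functor p) T U f : tuple_hom (fobj (gabber_functor p) T) (fobj (gabber_functor p) U)"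
  using obj_gabber_mor(1)[OF T U f] by (simp add: gabber_functor_def)
 fix W g assume W: "W : Obj (Ring_pgens p)" and g: "g : tuple_hom U W"
 note c = compose_tuple_hom[OF t f g]
 note mf = obj_gabber_mor[OF T U f] and mg = obj_gabber_mor[OF U W g] and mc = obj_gabber_mor[OF T W c]
 have "gabber_mor p T W (compose (carrier (fst T)) (fst g) (fst f), compose {..<length (snd T)} (snd g) (snd f))
  = (compose (carrier (fst (gabber_obj p T))) (fst (gabber_mor p U W g)) (fst (gabber_mor p T U f)),
   compose {..<length (snd (gabber_obj p T))} (snd (gabber_mor p U W g)) (snd (gabber_mor p T U f)))"
  by (rule obj_mor_eqI[OF gabber_obj_obj[OF T] W mc(1) compose_tuple_hom[OF gt mf(1) mg(1)]])
   (use mf mg(2) mg(3)[OF tuple_homD(5)[OF mf(1)]] mc(2,3) un_Seq_0[OF T] in "simp_all add: gabber_len compose_eq")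
 then show "fmor (gabber_functor p) T W (compose (carrier (fst T)) (fst g) (fst f), compose {..<length (snd T)} (snd g) (snd f))
  = (compose (carrier (fst (fobj (gabber_functor p) T))) (fst (fmor (gabber_functor p) U W g)) (fst (fmor (gabber_functor p) T U f)),
   compose {..<length (snd (fobj (gabber_functor p) T))} (snd (fmor (gabber_functor p) U W g)) (snd (fmor (gabber_functor p) T U f)))"
  by (simp add: gabber_functor_def)
qed

lemma inclusion_functor_left: "cat_functor (RegRing_pbasis p :: ('k tring, 'k tmor) cat) (Ring_pgens p) inclusion_functor"
 by (intro cat_functor.intro category_pgens category_reg cat_functor_axioms.intro)
  (simp_all add: inclusion_functor_def id_functor_def pgens_sel reg_obj)

text \<open>A regular ring is reduced, so a \<open>p\<close>-basis of it is also linearly independent with respect to the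
 module structure given by Frobenius; then the tower is constant and the counit bijective.\<close>

lemma reg_pbasis:
 assumes S: "S : Obj (RegRing_pbasis p)"
 shows "pbasis (fst S) p ((!) (snd S)) (length (snd S))"
proof -
 interpret s: gens S p by (rule obj_gens(1)[OF p reg_obj[OF S]])
 note r = conjunct1[OF reg_objD[OF S]] and b = conjunct2[OF reg_objD[OF S]]
 have b': "s.R.pspan s.x s.n = carrier s.R"
  "!!c b. c : s.R.E s.n \<rightarrow> carrier s.R ==> s.R.pcomb s.x s.n c = \<zero>\<^bsub>s.R\<^esub> ==> b : s.R.E s.n ==> c b [^]\<^bsub>s.R\<^esub> p = \<zero>\<^bsub>s.R\<^esub>"
  using b unfolding s.R.p_basis_iff[OF s.xc(3)] by blast+
 have "s.R.pindep s.x s.n" unfolding s.R.pindep_def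
  using s.R.regular_ring_reduced[OF r s.xc(2) b'(1) _ b'(2)] funcset_mem by metis
 then show ?thesis by (intro pbasis.intro s.R.charp_axioms pbasis_axioms.intro s.xc(2) b'(1))
qed

text \<open>The inverse of the counit.\<close>

definition gabber_unit :: "'k tring => 'k tmor" where
 "gabber_unit S = (restrict (inv_into (carrier (fst (gabber_obj p S))) (%v. un_Seq v 0)) (carrier (fst S)),
  restrict (%j. j) {..<length (snd S)})"

lemma unit_props:
 assumes S: "S : Obj (RegRing_pbasis p)"
 shows unit_hom: "gabber_unit S : tuple_hom S (gabber_obj p S)"
  and unit_counit: "v : carrier (fst S) ==> un_Seq (fst (gabber_unit S) v) 0 = v"
  and counit_unit: "w : carrier (fst (gabber_obj p S)) ==> fst (gabber_unit S) (un_Seq w 0) = w"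
proof -
 note So = reg_obj[OF S]
 interpret s: gens S p by (rule obj_gens(1)[OF p So])
 let ?c = "%v. un_Seq v 0"
 have inj: "inj_on ?c (carrier s.G)"
  by (rule tower_limit.pr_0_inj[OF s.limit]) (use reg_pbasis[OF S] in "simp add: gabber_tower_simps")
 have surj: "?c ` carrier s.G = carrier s.R"
  using tower_limit.pr_image[OF s.limit, of 0] by (simp add: gabber_tower_simps)
 have hom: "?c : ring_hom s.G s.R" using s.proj_hom[of 0] by (simp add: gabber_tower_simps)
 have iso: "?c : ring_iso s.G s.R" using hom inj surj by (simp add: ring_iso_def bij_betw_def)
 have inv: "inv_into (carrier s.G) ?c : ring_hom s.R s.G"
  using ring_iso_set_sym[OF cring.axioms(1)[OF s.G_cring] iso] by (simp add: ring_iso_def)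
 show cu: "fst (gabber_unit S) (?c w) = w" if "w : carrier s.G" for w
  using inv_into_f_f[OF inj that] un_Seq_0[OF So that] by (simp add: gabber_unit_def)
 show "?c (fst (gabber_unit S) v) = v" if "v : carrier s.R"
  using f_inv_into_f[of v ?c "carrier s.G"] surj that by (simp add: gabber_unit_def)
 show "gabber_unit S : tuple_hom S (gabber_obj p S)"
  unfolding gabber_unit_def
 proof (rule tuple_homI)
  show "restrict (inv_into (carrier s.G) ?c) (carrier s.R) : ring_hom s.R s.G"
   by (rule restrict_hom[OF s.R.is_cring inv])
  show "restrict (inv_into (carrier s.G) ?c) (carrier s.R) (snd S ! j) = snd (gabber_obj p S) ! restrict (%j. j) {..<length (snd S)} j"
   if j: "j < length (snd S)" for j
   using cu[OF tower_limit.y_closed[OF s.limit j]] tower_limit.pr_y[OF s.limit j, of 0] j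
   by (simp add: gabber_unit_def gabber_tower_simps)
 qed (auto simp: gabber_len)
qed

lemma unit_iso_inverses:
 assumes S: "S : Obj (RegRing_pbasis p)"
 shows "Comp (RegRing_pbasis p) S (gabber_obj p S) S (gabber_counit p S) (gabber_unit S) = Ident (RegRing_pbasis p) S"
  and "Comp (RegRing_pbasis p) (gabber_obj p S) S (gabber_obj p S) (gabber_unit S) (gabber_counit p S) = Ident (RegRing_pbasis p) (gabber_obj p S)"
 unfolding pgens_sel
 using unit_counit[OF S] counit_unit[OF S] tuple_homD(5)[OF unit_hom[OF S]] un_Seq_0[OF reg_obj[OF S]]
 by (auto simp: gabber_counit_def compose_def restrict_def fun_eq_iff gabber_len, simp_all add: gabber_unit_def)

lemma gabber_adjunction:
 "adjunction (RegRing_pbasis p :: ('k tring, 'k tmor) cat) (Ring_pgens p) inclusion_functor (gabber_functor p) gabber_unit (gabber_counit p)"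
proof -
 note sel = inclusion_functor_def id_functor_def comp_functor_def gabber_functor_def
 have unit: "nat_trans (RegRing_pbasis p :: ('k tring, 'k tmor) cat) (RegRing_pbasis p) id_functor (comp_functor (gabber_functor p) inclusion_functor) gabber_unit"
 proof (intro nat_trans.intro nat_trans_axioms.intro functor_id category_reg category_pgens
   functor_comp[OF inclusion_functor_left gabber_functor_right] functor_comp[OF gabber_functor_right inclusion_functor_left])
  fix a :: "'k tring" assume a: "a : Obj (RegRing_pbasis p)"
  show "gabber_unit a : Hom (RegRing_pbasis p) (fobj id_functor a) (fobj (comp_functor (gabber_functor p) inclusion_functor) a)"
   using unit_hom[OF a] by (simp add: pgens_sel sel)
  fix b f assume b: "b : Obj (RegRing_pbasis p)" and f: "f : Hom (RegRing_pbasis p) a b"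
  note ao = reg_obj[OF a] and bo = reg_obj[OF b] and f' = f[unfolded pgens_sel]
  note m = obj_gabber_mor[OF ao bo f']
  have "(compose (carrier (fst a)) (fst (gabber_unit b)) (fst f), compose {..<length (snd a)} (snd (gabber_unit b)) (snd f))
   = (compose (carrier (fst a)) (fst (gabber_mor p a b f)) (fst (gabber_unit a)), compose {..<length (snd a)} (snd (gabber_mor p a b f)) (snd (gabber_unit a)))"
  proof (rule obj_mor_eqI[OF ao bo compose_tuple_hom[OF pgens_obj[OF ao] f' unit_hom[OF b]] compose_tuple_hom[OF pgens_obj[OF ao] unit_hom[OF a] m(1)]])
   fix v assume v: "v : carrier (fst a)"
   show "un_Seq (fst (compose (carrier (fst a)) (fst (gabber_unit b)) (fst f), compose {..<length (snd a)} (snd (gabber_unit b)) (snd f)) v) 0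
    = un_Seq (fst (compose (carrier (fst a)) (fst (gabber_mor p a b f)) (fst (gabber_unit a)), compose {..<length (snd a)} (snd (gabber_mor p a b f)) (snd (gabber_unit a))) v) 0"
    using v unit_counit[OF b tuple_homD(5)[OF f' v]] m(3)[OF tuple_homD(5)[OF unit_hom[OF a] v]] unit_counit[OF a v] by (simp add: compose_eq)
  next
   show "snd (compose (carrier (fst a)) (fst (gabber_unit b)) (fst f), compose {..<length (snd a)} (snd (gabber_unit b)) (snd f))
    = snd (compose (carrier (fst a)) (fst (gabber_mor p a b f)) (fst (gabber_unit a)), compose {..<length (snd a)} (snd (gabber_mor p a b f)) (snd (gabber_unit a)))"
    using PiE_mem[OF tuple_homD(3)[OF f']] m(2) by (auto simp: gabber_unit_def compose_def restrict_def fun_eq_iff)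
  qed
  then show "Comp (RegRing_pbasis p) (fobj id_functor a) (fobj id_functor b) (fobj (comp_functor (gabber_functor p) inclusion_functor) b) (gabber_unit b) (fmor id_functor a b f)
   = Comp (RegRing_pbasis p) (fobj id_functor a) (fobj (comp_functor (gabber_functor p) inclusion_functor) a) (fobj (comp_functor (gabber_functor p) inclusion_functor) b)
    (fmor (comp_functor (gabber_functor p) inclusion_functor) a b f) (gabber_unit a)"
   by (simp add: pgens_sel sel)
 qed
 have counit: "nat_trans (Ring_pgens p :: ('k tring, 'k tmor) cat) (Ring_pgens p) (comp_functor inclusion_functor (gabber_functor p)) id_functor (gabber_counit p)"
 proof (intro nat_trans.intro nat_trans_axioms.intro functor_id category_reg category_pgens
   functor_comp[OF inclusion_functor_left gabber_functor_right] functor_comp[OF gabber_functor_right inclusion_functor_left])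
  fix a :: "'k tring" assume a: "a : Obj (Ring_pgens p)"
  note ca = counit_tuple_hom[OF a]
  show "gabber_counit p a : Hom (Ring_pgens p) (fobj (comp_functor inclusion_functor (gabber_functor p)) a) (fobj id_functor a)"
   using ca by (simp add: pgens_sel sel)
  fix b f assume b: "b : Obj (Ring_pgens p)" and f: "f : Hom (Ring_pgens p) a b"
  note f' = f[unfolded pgens_sel]
  note m = obj_gabber_mor[OF a b f']
  have "compose (carrier (fst (gabber_obj p a))) (fst (gabber_counit p b)) (fst (gabber_mor p a b f))
    = compose (carrier (fst (gabber_obj p a))) (fst f) (fst (gabber_counit p a))"
   using m(3) tuple_homD(5)[OF m(1)] by (auto simp: compose_def gabber_counit_def restrict_def fun_eq_iff)
  moreover have "compose {..<length (snd (gabber_obj p a))} (snd (gabber_counit p b)) (snd (gabber_mor p a b f))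
    = compose {..<length (snd (gabber_obj p a))} (snd f) (snd (gabber_counit p a))"
   using m(2) PiE_mem[OF tuple_homD(3)[OF f']] by (auto simp: compose_def gabber_counit_def restrict_def fun_eq_iff gabber_len)
  ultimately show "Comp (Ring_pgens p) (fobj (comp_functor inclusion_functor (gabber_functor p)) a) (fobj (comp_functor inclusion_functor (gabber_functor p)) b) (fobj id_functor b)
    (gabber_counit p b) (fmor (comp_functor inclusion_functor (gabber_functor p)) a b f)
   = Comp (Ring_pgens p) (fobj (comp_functor inclusion_functor (gabber_functor p)) a) (fobj id_functor a) (fobj id_functor b) (fmor id_functor a b f) (gabber_counit p a)"
   by (simp add: pgens_sel sel)
 qed
 show ?thesis
 proof (intro adjunction.intro adjunction_axioms.intro unit counit inclusion_functor_left gabber_functor_right)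
  fix c :: "'k tring" assume c: "c : Obj (RegRing_pbasis p)"
  show "Comp (Ring_pgens p) (fobj inclusion_functor c) (fobj inclusion_functor (fobj (gabber_functor p) (fobj inclusion_functor c))) (fobj inclusion_functor c)
    (gabber_counit p (fobj inclusion_functor c)) (fmor inclusion_functor c (fobj (gabber_functor p) (fobj inclusion_functor c)) (gabber_unit c))
   = Ident (Ring_pgens p) (fobj inclusion_functor c)"
   using unit_iso_inverses(1)[OF c] by (simp add: pgens_sel sel)
 next
  fix d :: "'k tring" assume d: "d : Obj (Ring_pgens p)"
  let ?g = "gabber_obj p d"
  note gd = gabber_obj_reg[OF d] and go = gabber_obj_obj[OF d]
  note m = obj_gabber_mor[OF go d counit_tuple_hom[OF d]] and u = unit_hom[OF gd]
  have "(compose (carrier (fst ?g)) (fst (gabber_mor p ?g d (gabber_counit p d))) (fst (gabber_unit ?g)),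
    compose {..<length (snd ?g)} (snd (gabber_mor p ?g d (gabber_counit p d))) (snd (gabber_unit ?g)))
   = (restrict (%r. r) (carrier (fst ?g)), restrict (%j. j) {..<length (snd ?g)})" (is "?l = ?r")
  proof (rule obj_mor_eqI[OF go d compose_tuple_hom[OF pgens_obj[OF go] u m(1)] ident_tuple_hom[OF pgens_obj[OF go]]])
   show "snd ?l = snd ?r" using m(2) by (auto simp: gabber_unit_def gabber_counit_def compose_def restrict_def fun_eq_iff gabber_len)
   fix v assume v: "v : carrier (fst ?g)"
   show "un_Seq (fst ?l v) 0 = un_Seq (fst ?r v) 0"
    using v m(3)[OF tuple_homD(5)[OF u v]] unit_counit[OF gd v] by (simp add: compose_eq gabber_counit_def)
  qed
  then show "Comp (RegRing_pbasis p) (fobj (gabber_functor p) d) (fobj (gabber_functor p) (fobj inclusion_functor (fobj (gabber_functor p) d))) (fobj (gabber_functor p) d)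
    (fmor (gabber_functor p) (fobj inclusion_functor (fobj (gabber_functor p) d)) d (gabber_counit p d)) (gabber_unit (fobj (gabber_functor p) d))
   = Ident (RegRing_pbasis p) (fobj (gabber_functor p) d)"
   by (simp add: pgens_sel sel)
 qed
qed

lemma unit_iso:
 assumes S: "S : Obj (RegRing_pbasis p)"
 shows "cat_iso (RegRing_pbasis p) S (gabber_obj p S) (gabber_unit S)"
  and "cat_iso (RegRing_pbasis p) (gabber_obj p S) S (gabber_counit p S)"
 unfolding cat_iso_def using unit_hom[OF S] counit_tuple_hom[OF reg_obj[OF S]] unit_iso_inverses[OF S]
 by (auto simp: pgens_sel(4))

end

theorem proposition3p2p2:
  fixes p :: nat
  assumes "Factorial_Ring.prime p"
  shows "cat_functor (Ring_pgens p :: ('k tring, 'k tmor) cat) (RegRing_pbasis p) (gabber_functor p)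
    \<and> (\<exists>\<epsilon>. adjunction (RegRing_pbasis p :: ('k tring, 'k tmor) cat) (Ring_pgens p)
               inclusion_functor (gabber_functor p) \<epsilon> (gabber_counit p)
         \<and> (\<forall>S \<in> Obj (RegRing_pbasis p :: ('k tring, 'k tmor) cat).
               cat_iso (RegRing_pbasis p) S
                 (fobj (comp_functor (gabber_functor p) inclusion_functor) S) (\<epsilon> S)))
    \<and> (\<forall>T \<in> Obj (Ring_pgens p :: ('k tring, 'k tmor) cat).
          fst (gabber_counit p T) ` carrier (fst (gabber_obj p T)) = carrier (fst T))
    \<and> essentially_surjective (Ring_pgens p :: ('k tring, 'k tmor) cat) (RegRing_pbasis p)
         (gabber_functor p)"
proof (intro conjI)
 note p = assms
 show "cat_functor (Ring_pgens p :: ('k tring, 'k tmor) cat) (RegRing_pbasis p) (gabber_functor p)"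
  by (rule gabber_functor_right[OF p])
 have e: "fobj (comp_functor (gabber_functor p) inclusion_functor) S = gabber_obj p S" for S :: "'k tring"
  by (simp add: comp_functor_def gabber_functor_def inclusion_functor_def id_functor_def)
 then show "\<exists>\<epsilon>. adjunction (RegRing_pbasis p :: ('k tring, 'k tmor) cat) (Ring_pgens p)
       inclusion_functor (gabber_functor p) \<epsilon> (gabber_counit p)
    & (ALL S:Obj (RegRing_pbasis p :: ('k tring, 'k tmor) cat).
       cat_iso (RegRing_pbasis p) S
        (fobj (comp_functor (gabber_functor p) inclusion_functor) S) (\<epsilon> S))"
  using unit_iso(1)[OF p] by (intro exI[of _ "gabber_unit p"] conjI ballI gabber_adjunction[OF p]) (simp only:)
 show "ALL T:Obj (Ring_pgens p :: ('k tring, 'k tmor) cat).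
     fst (gabber_counit p T) ` carrier (fst (gabber_obj p T)) = carrier (fst T)"
  using gens.counit_surj[OF obj_gens(1)[OF p]] by blast
 show "essentially_surjective (Ring_pgens p :: ('k tring, 'k tmor) cat) (RegRing_pbasis p) (gabber_functor p)"
  unfolding essentially_surjective_def
 proof
  fix S :: "'k tring" assume S: "S : Obj (RegRing_pbasis p)"
  have "cat_iso (RegRing_pbasis p) (fobj (gabber_functor p) S) S (gabber_counit p S)"
   using unit_iso(2)[OF p S] by (simp add: gabber_functor_def)
  then show "EX T:Obj (Ring_pgens p). EX f. cat_iso (RegRing_pbasis p) (fobj (gabber_functor p) T) S f"
   using reg_obj[OF S] by blast
 qed
qed

end
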